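(* Let $n\ge1$. (i) $\mathrm{grFrob}(\widetilde A(U_{n,n})_{\mathbb C},t)=\widetilde Q_n(\mathbf x,t)$. (ii) If $n\ge2$, $\mathrm{grFrob}(\widetilde A(U_{n-1,n})_{\mathbb C},t)=Q_n(\mathbf x,t)$.
   Context: For $1\le r\le n$, the uniform matroid $U_{r,n}$ is the matroid on $[n]=\{1,\dots,n\}$ with flats $\{S\subseteq[n]:|S|\le r-1\}\cup\{[n]\}$. For a loopless matroid $M$ on $E$ with lattice of flats $\mathcal L(M)$, the augmented Chow ring is the graded $\mathbb{Q}$-algebra (all variables in degree 1) $$\widetilde A(M)=\mathbb{Q}\big[\{x_F\}_{F\in\mathcal L(M)\setminus\{E\}}\cup\{y_i\}_{i\in E}\big]/(\widetilde I_1+\widetilde I_2+\widetilde J),$$ where $\widetilde I_1$ is generated by $x_Fx_{F'}$ for incomparable proper flats $F,F'$; $\widetilde I_2$ by $y_ix_F$ for $i\in E$ and proper flats $F$ with $i\notin F$; $\widetilde J$ by $y_i-\sum_{F\in\mathcal L(M)\setminus\{E\}:\, i\notin F}x_F$ for $i\in E$. Put $\widetilde A(M)_{\mathbb C}=\mathbb C\otimes_{\mathbb Q}\widetilde A(M)$. $\mathfrak S_n$ acts on $\widetilde A(U_{r,n})_{\mathbb C}$ by $\sigma x_F=x_{\sigma(F)}$, $\sigma y_i=y_{\sigma(i)}$. For a graded $\mathbb C[\mathfrak S_n]$-module $V=\bigoplus_iV^i$, $\mathrm{grFrob}(V,t)=\sum_i\mathrm{ch}(V^i)t^i$, where $\mathrm{ch}$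 is the Frobenius characteristic (irreducible $\chi^\lambda\mapsto$ Schur function $s_\lambda$, trivial character $\mapsto h_n$). $h_n$ is the complete homogeneous symmetric function in $\mathbf x=(x_1,x_2,\dots)$, $h_0=1$. For $\sigma=\sigma_1\cdots\sigma_n\in\mathfrak S_n$: $\mathrm{EXC}(\sigma)=\{i\in[n-1]:\sigma_i>i\}$, $\mathrm{exc}(\sigma)=|\mathrm{EXC}(\sigma)|$. Let $\overline\sigma$ be the word over $\{\overline1<\cdots<\overline n<1<\cdots<n\}$ obtained from $\sigma$ by replacing $\sigma_i$ by $\overline{\sigma_i}$ for each $i\in\mathrm{EXC}(\sigma)$; $\mathrm{DEX}(\sigma)=\{i\in[n-1]:\overline\sigma_i>\overline\sigma_{i+1}\}$. For $S\subseteq[n-1]$, $F_{S,n}(\mathbf x)=\sum x_{i_1}\cdots x_{i_n}$ over $i_1\ge\cdots\ge i_n\geq 1$ with $i_j>i_{j+1}$ for $j\in S$. $Q_n(\mathbf x,t)=\sum_{\sigma\in\mathfrak S_n}F_{\mathrm{DEX}(\sigma),n}t^{\mathrm{exc}(\sigma)}$ and $\widetilde Q_n(\mathbf x,t)=h_n+t\sum_{k=1}^nh_{n-k}Q_k(\mathbf x,t)$. *)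

theory Defs
  imports
    Complex_Main
    "HOL-Library.Multiset"
    "HOL-Library.FuncSet"
    "HOL-Library.Poly_Mapping"
    "HOL-Combinatorics.Permutations"
    "HOL-Combinatorics.Orbits"
    "HOL-Computational_Algebra.Formal_Power_Series"
    "HOL-Algebra.QuotRing"
    "HOL-Algebra.Module"
begin

section \<open>Matroids given by their flats\<close>

locale loopless_matroid_flats =
  fixes E :: "'e set" and L :: "'e set set"
  assumes finite_ground: "finite E"
    and flats_subset: "F \<in> L \<Longrightarrow> F \<subseteq> E"
    and ground_flat: "E \<in> L"
    and inter_flat: "F \<in> L \<Longrightarrow> G \<in> L \<Longrightarrow> F \<inter> G \<in> L"
    and unique_cover: "F \<in> L \<Longrightarrow> i \<in> E - F \<Longrightarrow>
          \<exists>!G. G \<in> L \<and> i \<in> G \<and> F \<subset> G \<and> (\<forall>H\<in>L. \<not> (F \<subset> H \<and> H \<subset> G))"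
    and loopless: "{} \<in> L"

definition uniform_flats :: "nat \<Rightarrow> nat \<Rightarrow> nat set set" where
  "uniform_flats r n = {S. S \<subseteq> {1..n} \<and> card S \<le> r - 1} \<union> {{1..n}}"

lemma uniform_matroid:
  assumes "1 \<le> r" "r \<le> n"
  shows "loopless_matroid_flats {1..n} (uniform_flats r n)"
proof
  show "finite {1..n}" "{1..n} \<in> uniform_flats r n" "{} \<in> uniform_flats r n"
    by (auto simp: uniform_flats_def)
  show "F \<subseteq> {1..n}" if "F \<in> uniform_flats r n" for F
    using that by (auto simp: uniform_flats_def)
  show "F \<inter> G \<in> uniform_flats r n" if "F \<in> uniform_flats r n" "G \<in> uniform_flats r n" for F G
  proof -
    have "card (F \<inter> G) \<le> r - 1" if "F \<subseteq> {1..n}" "G \<subseteq> {1..n}" "card F \<le> r - 1 \<or> card G \<le> r - 1"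
    proof -
      have "finite F" "finite G"
        using that finite_subset by blast+
      then have "card (F \<inter> G) \<le> card F" "card (F \<inter> G) \<le> card G"
        by (auto intro: card_mono)
      with that show ?thesis by linarith
    qed
    moreover have "F \<inter> G = {1..n} \<or> card F \<le> r - 1 \<or> card G \<le> r - 1"
      using that by (auto simp: uniform_flats_def)
    moreover have "F \<subseteq> {1..n}" "G \<subseteq> {1..n}"
      using that by (auto simp: uniform_flats_def)
    ultimately show ?thesis
      by (auto simp: uniform_flats_def)
  qed
  show "\<exists>!G. G \<in> uniform_flats r n \<and> i \<in> G \<and> F \<subset> G \<and>
          (\<forall>H\<in>uniform_flats r n. \<not> (F \<subset> H \<and> H \<subset> G))"
    if F: "F \<in> uniform_flats r n" and i: "i \<in> {1..n} - F" for F i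
  proof -
    have F1: "F \<subseteq> {1..n}" "card F \<le> r - 1" and fin: "finite F"
      using F i finite_subset[of F "{1..n}"] by (auto simp: uniform_flats_def)
    show ?thesis
    proof (cases "card F < r - 1")
      case True
      have ins: "insert i F \<in> uniform_flats r n"
        using F1 True i fin by (auto simp: uniform_flats_def)
      show ?thesis
      proof (rule ex1I[of _ "insert i F"], intro conjI)
        show "F \<subset> insert i F" using i by auto
        show "\<forall>H\<in>uniform_flats r n. \<not> (F \<subset> H \<and> H \<subset> insert i F)" by blast
        show "G = insert i F" if "G \<in> uniform_flats r n \<and> i \<in> G \<and> F \<subset> G \<and>
          (\<forall>H\<in>uniform_flats r n. \<not> (F \<subset> H \<and> H \<subset> G))" for G
          using that ins i by blast
      qed (use ins in auto)
    next
      case False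
      have no: "H = {1..n}" if "H \<in> uniform_flats r n" "F \<subset> H" for H
      proof (rule ccontr)
        assume "H \<noteq> {1..n}"
        then have "H \<subseteq> {1..n}" "card H \<le> r - 1"
          using that by (auto simp: uniform_flats_def)
        moreover have "card F < card H"
          using that calculation finite_subset[of H "{1..n}"] by (intro psubset_card_mono) auto
        ultimately show False using False by simp
      qed
      show ?thesis
      proof (rule ex1I[of _ "{1..n}"], intro conjI)
        show "{1..n} \<in> uniform_flats r n" by (simp add: uniform_flats_def)
        show "i \<in> {1..n}" "F \<subset> {1..n}" using i F1 by auto
        show "\<forall>H\<in>uniform_flats r n. \<not> (F \<subset> H \<and> H \<subset> {1..n})" using no by blast
      qed (use no in blast)
    qed
  qed
qed


section \<open>The augmented Chow ring\<close>

text \<open>Polynomials are finitely supported functions on monomials, and a monomial is the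
  multiset of its variables, so that multiplication of monomials is multiset union.\<close>

type_synonym ('v, 'k) mpoly = "'v multiset \<Rightarrow>\<^sub>0 'k"

definition pconst :: "'k \<Rightarrow> ('v, 'k::comm_ring_1) mpoly" where
  "pconst c = Poly_Mapping.single {#} c"

definition pvar :: "'v \<Rightarrow> ('v, 'k::comm_ring_1) mpoly" where
  "pvar v = Poly_Mapping.single {#v#} 1"

definition poly_ring :: "'v set \<Rightarrow> ('v, 'k::comm_ring_1) mpoly ring" where
  "poly_ring V =
     \<lparr>carrier = {p. \<forall>m\<in>Poly_Mapping.keys p. set_mset m \<subseteq> V},
      mult = (*), one = 1, zero = 0, add = (+)\<rparr>"

definition homogeneous :: "nat \<Rightarrow> ('v, 'k::comm_ring_1) mpoly \<Rightarrow> bool" where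
  "homogeneous d p \<longleftrightarrow> (\<forall>m\<in>Poly_Mapping.keys p. size m = d)"

text \<open>The algebra endomorphism sending the variable \<open>v\<close> to the variable \<open>\<rho> v\<close>.\<close>

definition rename :: "('v \<Rightarrow> 'v) \<Rightarrow> ('v, 'k::comm_ring_1) mpoly \<Rightarrow> ('v, 'k) mpoly" where
  "rename \<rho> p =
     (\<Sum>m\<in>Poly_Mapping.keys p. Poly_Mapping.single (image_mset \<rho> m) (Poly_Mapping.lookup p m))"

datatype 'e chow_var = X "'e set" | Y 'e

definition chow_vars :: "'e set \<Rightarrow> 'e set set \<Rightarrow> 'e chow_var set" where
  "chow_vars E L = X ` (L - {E}) \<union> Y ` E"

definition chow_poly_ring :: "'e set \<Rightarrow> 'e set set \<Rightarrow> ('e chow_var, rat) mpoly ring" where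
  "chow_poly_ring E L = poly_ring (chow_vars E L)"

definition chow_I1 :: "'e set \<Rightarrow> 'e set set \<Rightarrow> ('e chow_var, rat) mpoly set" where
  "chow_I1 E L = Idl\<^bsub>chow_poly_ring E L\<^esub>
     {pvar (X F) * pvar (X G) | F G. F \<in> L - {E} \<and> G \<in> L - {E} \<and> \<not> F \<subseteq> G \<and> \<not> G \<subseteq> F}"

definition chow_I2 :: "'e set \<Rightarrow> 'e set set \<Rightarrow> ('e chow_var, rat) mpoly set" where
  "chow_I2 E L = Idl\<^bsub>chow_poly_ring E L\<^esub>
     {pvar (Y i) * pvar (X F) | i F. i \<in> E \<and> F \<in> L - {E} \<and> i \<notin> F}"

definition chow_J :: "'e set \<Rightarrow> 'e set set \<Rightarrow> ('e chow_var, rat) mpoly set" where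
  "chow_J E L = Idl\<^bsub>chow_poly_ring E L\<^esub>
     {pvar (Y i) - (\<Sum>F | F \<in> L - {E} \<and> i \<notin> F. pvar (X F)) | i. i \<in> E}"

definition chow_ideal :: "'e set \<Rightarrow> 'e set set \<Rightarrow> ('e chow_var, rat) mpoly set" where
  "chow_ideal E L =
     chow_I1 E L <+>\<^bsub>chow_poly_ring E L\<^esub> chow_I2 E L <+>\<^bsub>chow_poly_ring E L\<^esub> chow_J E L"

definition aug_chow_ring :: "'e set \<Rightarrow> 'e set set \<Rightarrow> ('e chow_var, rat) mpoly set ring" where
  "aug_chow_ring E L = chow_poly_ring E L Quot chow_ideal E L"

text \<open>The degree \<open>d\<close> component of the augmented Chow ring, as a rational vector space.\<close>

definition aug_chow_piece ::
    "'e set \<Rightarrow> 'e set set \<Rightarrow> nat \<Rightarrow> (rat, ('e chow_var, rat) mpoly set) module" where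
  "aug_chow_piece E L d =
     \<lparr>carrier = {chow_ideal E L +>\<^bsub>chow_poly_ring E L\<^esub> p | p.
                   p \<in> carrier (chow_poly_ring E L) \<and> homogeneous d p},
      mult = mult (aug_chow_ring E L), one = one (aug_chow_ring E L),
      zero = zero (aug_chow_ring E L), add = add (aug_chow_ring E L),
      smult = (\<lambda>q a. (chow_ideal E L +>\<^bsub>chow_poly_ring E L\<^esub> pconst q)
                       \<otimes>\<^bsub>aug_chow_ring E L\<^esub> a)\<rparr>"

fun chow_var_act :: "('e \<Rightarrow> 'e) \<Rightarrow> 'e chow_var \<Rightarrow> 'e chow_var" where
  "chow_var_act \<sigma> (X F) = X (\<sigma> ` F)"
| "chow_var_act \<sigma> (Y i) = Y (\<sigma> i)"

text \<open>The induced map on residue classes: the class of \<open>p\<close> goes to the class of \<open>\<sigma> p\<close>.  For an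
  automorphism of the matroid the union below is over equal sets.\<close>

definition aug_chow_act ::
    "'e set \<Rightarrow> 'e set set \<Rightarrow> ('e \<Rightarrow> 'e) \<Rightarrow>
      ('e chow_var, rat) mpoly set \<Rightarrow> ('e chow_var, rat) mpoly set" where
  "aug_chow_act E L \<sigma> a =
     (\<Union>p\<in>a. chow_ideal E L +>\<^bsub>chow_poly_ring E L\<^esub> rename (chow_var_act \<sigma>) p)"


section \<open>Extension of scalars from the rationals to the complex numbers\<close>

definition field_ring :: "'k::field ring" where
  "field_ring = \<lparr>carrier = UNIV, mult = (*), one = 1, zero = 0, add = (+)\<rparr>"

definition free_module :: "'v set \<Rightarrow> ('k::field, 'v \<Rightarrow>\<^sub>0 'k) module" where
  "free_module S =
     \<lparr>carrier = {f. Poly_Mapping.keys f \<subseteq> S}, mult = undefined, one = undefined,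
      zero = 0, add = (+), smult = (\<lambda>c. Poly_Mapping.map ((*) c))\<rparr>"

definition submodule_gen :: "('k, 'a) ring_scheme \<Rightarrow> ('k, 'v, 'b) module_scheme \<Rightarrow> 'v set \<Rightarrow> 'v set" where
  "submodule_gen K M S = \<Inter>{N. submodule N K M \<and> S \<subseteq> N}"

definition quot_module :: "('k, 'v, 'b) module_scheme \<Rightarrow> 'v set \<Rightarrow> ('k, 'v set) module" where
  "quot_module M N =
     \<lparr>carrier = a_rcosets\<^bsub>M\<^esub> N, mult = undefined, one = undefined,
      zero = N, add = set_add M, smult = (\<lambda>c A. \<Union>x\<in>A. N +>\<^bsub>M\<^esub> (c \<odot>\<^bsub>M\<^esub> x))\<rparr>"

text \<open>The complex vector space \<open>\<complex> \<otimes> V\<close> for a rational vector space \<open>V\<close>: the free complex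
  vector space on the symbols \<open>1 \<otimes> v\<close>, modulo additivity and rational homogeneity in \<open>v\<close>.\<close>

definition cplx_free :: "(rat, 'v, 'b) module_scheme \<Rightarrow> (complex, 'v \<Rightarrow>\<^sub>0 complex) module" where
  "cplx_free V = free_module (carrier V)"

definition cplx_rel :: "(rat, 'v, 'b) module_scheme \<Rightarrow> ('v \<Rightarrow>\<^sub>0 complex) set" where
  "cplx_rel V = submodule_gen field_ring (cplx_free V)
     ({Poly_Mapping.single (v \<oplus>\<^bsub>V\<^esub> w) 1 - Poly_Mapping.single v 1 - Poly_Mapping.single w 1 | v w.
         v \<in> carrier V \<and> w \<in> carrier V} \<union>
      {Poly_Mapping.single (q \<odot>\<^bsub>V\<^esub> v) 1 - Poly_Mapping.single v (of_rat q) | q v.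
         v \<in> carrier V})"

definition complexify ::
    "(rat, 'v, 'b) module_scheme \<Rightarrow> (complex, ('v \<Rightarrow>\<^sub>0 complex) set) module" where
  "complexify V = quot_module (cplx_free V) (cplx_rel V)"

text \<open>The map \<open>1 \<otimes> f\<close> induced by a linear endomorphism \<open>f\<close> of \<open>V\<close>.\<close>

definition complexify_map ::
    "(rat, 'v, 'b) module_scheme \<Rightarrow> ('v \<Rightarrow> 'v) \<Rightarrow> ('v \<Rightarrow>\<^sub>0 complex) set \<Rightarrow> ('v \<Rightarrow>\<^sub>0 complex) set" where
  "complexify_map V f A =
     (\<Union>g\<in>A. cplx_rel V +>\<^bsub>cplx_free V\<^esub>
        (\<Sum>v\<in>Poly_Mapping.keys g. Poly_Mapping.single (f v) (Poly_Mapping.lookup g v)))"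


section \<open>Trace of an endomorphism of a finite-dimensional complex vector space\<close>

definition is_basis :: "(complex, 'v, 'b) module_scheme \<Rightarrow> 'v set \<Rightarrow> bool" where
  "is_basis M B \<longleftrightarrow> finite B \<and> B \<subseteq> carrier M \<and>
     (\<forall>v\<in>carrier M. \<exists>!c. c \<in> extensional B \<and> v = (\<Oplus>\<^bsub>M\<^esub>b\<in>B. c b \<odot>\<^bsub>M\<^esub> b))"

definition coords :: "(complex, 'v, 'b) module_scheme \<Rightarrow> 'v set \<Rightarrow> 'v \<Rightarrow> 'v \<Rightarrow> complex" where
  "coords M B v = (THE c. c \<in> extensional B \<and> v = (\<Oplus>\<^bsub>M\<^esub>b\<in>B. c b \<odot>\<^bsub>M\<^esub> b))"

definition module_trace :: "(complex, 'v, 'b) module_scheme \<Rightarrow> ('v \<Rightarrow> 'v) \<Rightarrow> complex" where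
  "module_trace M f = (let B = (SOME B. is_basis M B) in \<Sum>b\<in>B. coords M B (f b) b)"


section \<open>Formal power series in countably many variables\<close>

text \<open>An exponent vector is a multiset of indices; the index \<open>i\<close> stands for the variable
  \<open>x\<close> with subscript \<open>i + 1\<close>.\<close>

typedef 'a mfps = "UNIV :: (nat multiset \<Rightarrow> 'a) set"
  morphisms mfps_nth Abs_mfps ..

setup_lifting type_definition_mfps

lemma mfps_eqI: "(\<And>m. mfps_nth f m = mfps_nth g m) \<Longrightarrow> f = g"
  by transfer auto

definition splits :: "'b multiset \<Rightarrow> ('b multiset \<times> 'b multiset) set" where
  "splits m = {(a, b). a + b = m}"

lemma finite_splits [simp, intro]: "finite (splits m)"
proof -
  have fin: "finite {A. A \<subseteq># m}"
  proof (induction m)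
    case (add x m)
    have "{A. A \<subseteq># add_mset x m} \<subseteq> {A. A \<subseteq># m} \<union> add_mset x ` {A. A \<subseteq># m}"
    proof
      fix A assume A: "A \<in> {A. A \<subseteq># add_mset x m}"
      show "A \<in> {A. A \<subseteq># m} \<union> add_mset x ` {A. A \<subseteq># m}"
      proof (cases "x \<in># A")
        case True
        then obtain B where "A = add_mset x B" by (meson multi_member_split)
        then show ?thesis using A by auto
      next
        case False
        then have "A \<subseteq># m"
          using A by (metis add_mset_remove_trivial diff_subset_eq_self mem_Collect_eq
              minus_add_mset_if_not_in_lhs subset_eq_diff_conv add_mset_add_single
              diff_single_trivial)
        then show ?thesis by simp
      qed
    qed
    then show ?case using add finite_subset by blast
  qed simp
  have "splits m \<subseteq> {A. A \<subseteq># m} \<times> {A. A \<subseteq># m}"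
    by (auto simp: splits_def)
  then show ?thesis
    using fin finite_subset by blast
qed

instantiation mfps :: (comm_ring_1) comm_ring_1
begin

lift_definition zero_mfps :: "'a mfps" is "\<lambda>_. 0" .
lift_definition one_mfps :: "'a mfps" is "\<lambda>m. if m = {#} then 1 else 0" .
lift_definition plus_mfps :: "'a mfps \<Rightarrow> 'a mfps \<Rightarrow> 'a mfps" is "\<lambda>f g m. f m + g m" .
lift_definition minus_mfps :: "'a mfps \<Rightarrow> 'a mfps \<Rightarrow> 'a mfps" is "\<lambda>f g m. f m - g m" .
lift_definition uminus_mfps :: "'a mfps \<Rightarrow> 'a mfps" is "\<lambda>f m. - f m" .
lift_definition times_mfps :: "'a mfps \<Rightarrow> 'a mfps \<Rightarrow> 'a mfps"
  is "\<lambda>f g m. \<Sum>(a, b)\<in>splits m. f a * g b" .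

instance
proof
  fix f g h :: "'a mfps"
  show "f + g + h = f + (g + h)" "f + g = g + f" "0 + f = f" "- f + f = 0" "f - g = f + - g"
    by (transfer, simp add: fun_eq_iff algebra_simps)+
  show "(0::'a mfps) \<noteq> 1"
    by transfer (auto simp: fun_eq_iff)
  show "(f + g) * h = f * h + g * h"
    by transfer (simp add: fun_eq_iff algebra_simps sum.distrib case_prod_unfold)
  show "f * g = g * f"
  proof (transfer, rule ext)
    fix f g :: "nat multiset \<Rightarrow> 'a" and m
    show "(\<Sum>(a, b)\<in>splits m. f a * g b) = (\<Sum>(a, b)\<in>splits m. g a * f b)"
      by (rule sum.reindex_bij_witness[of _ prod.swap prod.swap])
         (auto simp: splits_def add.commute mult.commute)
  qed
  show "1 * f = f"
  proof (transfer, rule ext)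
    fix f :: "nat multiset \<Rightarrow> 'a" and m
    have "(\<Sum>(a, b)\<in>splits m. (if a = {#} then 1 else 0) * f b)
        = (\<Sum>(a, b)\<in>{({#} :: nat multiset, m)}. (if a = {#} then 1 else 0) * f b)"
      by (rule sum.mono_neutral_right, rule finite_splits)
         (auto simp: splits_def split: if_splits)
    then show "(\<Sum>(a, b)\<in>splits m. (if a = {#} then 1 else 0) * f b) = f m"
      by simp
  qed
  show "f * g * h = f * (g * h)"
  proof (transfer, rule ext)
    fix f g h :: "nat multiset \<Rightarrow> 'a" and m
    have "(\<Sum>(d, c)\<in>splits m. (\<Sum>(a, b)\<in>splits d. f a * g b) * h c)
        = (\<Sum>(x, y)\<in>(SIGMA x:splits m. splits (fst x)). f (fst y) * g (snd y) * h (snd x))"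
      by (subst sum.Sigma [symmetric]) (auto simp: sum_distrib_right case_prod_unfold)
    also have "\<dots> = (\<Sum>(x, y)\<in>(SIGMA x:splits m. splits (snd x)). f (fst x) * (g (fst y) * h (snd y)))"
      by (rule sum.reindex_bij_witness
            [of _ "\<lambda>((a, e), (b, c)). ((a + b, c), (a, b))" "\<lambda>((d, c), (a, b)). ((a, b + c), (b, c))"])
         (auto simp: splits_def algebra_simps)
    also have "\<dots> = (\<Sum>(a, e)\<in>splits m. f a * (\<Sum>(b, c)\<in>splits e. g b * h c))"
      by (subst sum.Sigma [symmetric]) (auto simp: sum_distrib_left case_prod_unfold)
    finally show "(\<Sum>(d, c)\<in>splits m. (\<Sum>(a, b)\<in>splits d. f a * g b) * h c)
        = (\<Sum>(a, e)\<in>splits m. f a * (\<Sum>(b, c)\<in>splits e. g b * h c))" .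
  qed
qed

end

lift_definition mfps_const :: "'a::comm_ring_1 \<Rightarrow> 'a mfps" is "\<lambda>c m. if m = {#} then c else 0" .

text \<open>The formal sum of the monomials \<open>x\<^sub>w = x\<^sub>w\<^sub>1 \<cdots> x\<^sub>w\<^sub>n\<close> over all words \<open>w \<in> W\<close>.\<close>

lift_definition word_sum :: "nat list set \<Rightarrow> 'a::comm_ring_1 mfps"
  is "\<lambda>W m. of_nat (card {w \<in> W. mset w = m})" .

definition hom_sym :: "nat \<Rightarrow> 'a::comm_ring_1 mfps" where
  "hom_sym n = word_sum {w. length w = n \<and> sorted w}"

definition power_sum :: "nat \<Rightarrow> 'a::comm_ring_1 mfps" where
  "power_sum k = word_sum {replicate k i | i. True}"

text \<open>Positions in a word are counted from \<open>1\<close>, hence the shift in the list indices.\<close>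

definition fund_quasisym :: "nat set \<Rightarrow> nat \<Rightarrow> 'a::comm_ring_1 mfps" where
  "fund_quasisym S n = word_sum {w. length w = n \<and>
     (\<forall>j\<in>{1..<n}. w ! (j - 1) \<ge> w ! j \<and> (j \<in> S \<longrightarrow> w ! (j - 1) > w ! j))}"


section \<open>Graded Frobenius series\<close>

text \<open>The Frobenius characteristic of a class function \<open>\<chi>\<close>, in its usual power sum form
  \<open>ch \<chi> = (1 / n!) \<Sum>\<^sub>\<sigma> \<chi>(\<sigma>) p\<^sub>\<sigma>\<close>, where \<open>p\<^sub>\<sigma>\<close> is the product of the power sums of the cycle
  lengths of \<open>\<sigma>\<close>.  This is the normalisation for which irreducible characters go to Schur
  functions without the transposition of partitions; see \<open>frobenius_ch_trivial\<close>.\<close>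

definition cycle_power_sum :: "nat \<Rightarrow> (nat \<Rightarrow> nat) \<Rightarrow> 'a::comm_ring_1 mfps" where
  "cycle_power_sum n \<sigma> = (\<Prod>C\<in>orbit \<sigma> ` {1..n}. power_sum (card C))"

definition frobenius_ch :: "nat \<Rightarrow> ((nat \<Rightarrow> nat) \<Rightarrow> complex) \<Rightarrow> complex mfps" where
  "frobenius_ch n \<chi> =
     (\<Sum>\<sigma> | \<sigma> permutes {1..n}. mfps_const (\<chi> \<sigma> / fact n) * cycle_power_sum n \<sigma>)"

text \<open>\<open>V d\<close> is the degree \<open>d\<close> component of a graded representation, on which a permutation
  \<open>\<sigma>\<close> acts by \<open>\<rho> d \<sigma>\<close>.\<close>

definition gr_frob ::
    "nat \<Rightarrow> (nat \<Rightarrow> (complex, 'v) module) \<Rightarrow> (nat \<Rightarrow> (nat \<Rightarrow> nat) \<Rightarrow> 'v \<Rightarrow> 'v) \<Rightarrow> complex mfps fps" where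
  "gr_frob n V \<rho> = Abs_fps (\<lambda>d. frobenius_ch n (\<lambda>\<sigma>. module_trace (V d) (\<rho> d \<sigma>)))"

definition aug_chow_frob :: "nat \<Rightarrow> nat \<Rightarrow> complex mfps fps" where
  "aug_chow_frob r n =
     gr_frob n
       (\<lambda>d. complexify (aug_chow_piece {1..n} (uniform_flats r n) d))
       (\<lambda>d \<sigma>. complexify_map (aug_chow_piece {1..n} (uniform_flats r n) d)
                 (aug_chow_act {1..n} (uniform_flats r n) \<sigma>))"


section \<open>Eulerian quasisymmetric functions\<close>

definition EXC :: "nat \<Rightarrow> (nat \<Rightarrow> nat) \<Rightarrow> nat set" where
  "EXC n \<sigma> = {i \<in> {1..<n}. \<sigma> i > i}"

datatype letter = Barred nat | Plain nat

fun letter_less :: "letter \<Rightarrow> letter \<Rightarrow> bool" where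
  "letter_less (Barred i) (Barred j) \<longleftrightarrow> i < j"
| "letter_less (Barred i) (Plain j) \<longleftrightarrow> True"
| "letter_less (Plain i) (Barred j) \<longleftrightarrow> False"
| "letter_less (Plain i) (Plain j) \<longleftrightarrow> i < j"

definition barred_word :: "nat \<Rightarrow> (nat \<Rightarrow> nat) \<Rightarrow> nat \<Rightarrow> letter" where
  "barred_word n \<sigma> i = (if i \<in> EXC n \<sigma> then Barred (\<sigma> i) else Plain (\<sigma> i))"

definition DEX :: "nat \<Rightarrow> (nat \<Rightarrow> nat) \<Rightarrow> nat set" where
  "DEX n \<sigma> = {i \<in> {1..<n}. letter_less (barred_word n \<sigma> (i + 1)) (barred_word n \<sigma> i)}"

definition eulerian_Q :: "nat \<Rightarrow> 'a::comm_ring_1 mfps fps" where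
  "eulerian_Q n = (\<Sum>\<sigma> | \<sigma> permutes {1..n}.
     fps_const (fund_quasisym (DEX n \<sigma>) n) * fps_X ^ card (EXC n \<sigma>))"

definition eulerian_Q_tilde :: "nat \<Rightarrow> 'a::comm_ring_1 mfps fps" where
  "eulerian_Q_tilde n = fps_const (hom_sym n) +
     fps_X * (\<Sum>k=1..n. fps_const (hom_sym (n - k)) * eulerian_Q k)"


section \<open>Normalisation of the Frobenius characteristic: the trivial character\<close>

definition block_maps :: "'b set set \<Rightarrow> nat multiset \<Rightarrow> ('b set \<Rightarrow> nat) set" where
  "block_maps A m = {g \<in> A \<rightarrow>\<^sub>E UNIV. (\<Sum>C\<in>A. replicate_mset (card C) (g C)) = m}"

lemma finite_block_maps:
  assumes "finite A" "\<And>C. C \<in> A \<Longrightarrow> card C \<ge> 1"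
  shows "finite (block_maps A m)"
proof (rule finite_subset)
  show "block_maps A m \<subseteq> A \<rightarrow>\<^sub>E set_mset m"
  proof
    fix g assume g: "g \<in> block_maps A m"
    have "g C \<in># (\<Sum>C\<in>A. replicate_mset (card C) (g C))" if "C \<in> A" for C
    proof -
      have "(\<Sum>C\<in>A. replicate_mset (card C) (g C))
          = replicate_mset (card C) (g C) + (\<Sum>C\<in>A-{C}. replicate_mset (card C) (g C))"
        using assms(1) that by (rule sum.remove)
      then show ?thesis using assms(2)[OF that] by (auto simp: Suc_le_eq)
    qed
    then show "g \<in> A \<rightarrow>\<^sub>E set_mset m"
      using g by (auto simp: block_maps_def PiE_iff)
  qed
  show "finite (A \<rightarrow>\<^sub>E set_mset m)" using assms(1) by (intro finite_PiE) auto
qed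

lemma nth_power_sum:
  assumes "k \<ge> 1"
  shows "mfps_nth (power_sum k :: 'a::comm_ring_1 mfps) m = of_nat (card {i. replicate_mset k i = m})"
proof -
  have inj: "inj_on (replicate k) (I :: nat set)" for I
  proof (rule inj_onI)
    fix i j :: nat
    assume "replicate k i = replicate k j"
    then have "hd (replicate k i) = hd (replicate k j)" by (rule arg_cong)
    then show "i = j" using assms by (simp only: hd_replicate One_nat_def Suc_le_eq neq0_conv not_gr0)
  qed
  have "{w \<in> {replicate k i | i. True}. mset w = m} = replicate k ` {i. replicate_mset k i = m}"
    by (intro equalityI subsetI) (auto simp only: mem_Collect_eq mset_replicate image_iff)
  then have "card {w \<in> {replicate k i | i. True}. mset w = m} = card {i. replicate_mset k i = m}"
    by (simp only: card_image[OF inj])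
  then show ?thesis
    unfolding power_sum_def word_sum.rep_eq by (simp only:)
qed

lemma nth_prod_power_sum:
  fixes A :: "'b set set"
  assumes "finite A" "\<And>C. C \<in> A \<Longrightarrow> card C \<ge> 1"
  shows "mfps_nth (\<Prod>C\<in>A. power_sum (card C) :: 'a::comm_ring_1 mfps) m = of_nat (card (block_maps A m))"
  using assms
proof (induction A arbitrary: m rule: finite_induct)
  case empty
  have "block_maps ({} :: 'b set set) m = (if m = {#} then {\<lambda>_. undefined} else {})" for m :: "nat multiset"
    by (auto simp: block_maps_def)
  then show ?case by (simp add: one_mfps.rep_eq)
next
  case (insert D A)
  define Q :: "nat multiset \<times> nat multiset \<Rightarrow> (nat \<times> ('b set \<Rightarrow> nat)) set"
    where "Q = (\<lambda>(a, b). {i. replicate_mset (card D) i = a} \<times> block_maps A b)"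
  have finA: "finite (block_maps A b)" for b
    using insert.prems by (intro finite_block_maps insert.hyps) auto
  have D1: "card D \<ge> 1" using insert.prems by auto
  have finD: "finite {i. replicate_mset (card D) i = a}" for a :: "nat multiset"
  proof (rule finite_subset)
    show "{i. replicate_mset (card D) i = a} \<subseteq> set_mset a" using D1 by auto
  qed auto
  have "card (block_maps (insert D A) m) = card (\<Union>s\<in>splits m. Q s)"
  proof (rule bij_betw_same_card)
    show "bij_betw (\<lambda>g. (g D, restrict g A)) (block_maps (insert D A) m) (\<Union>s\<in>splits m. Q s)"
    proof (rule bij_betw_byWitness[where f' = "\<lambda>(i, g). g(D := i)"])
      show "\<forall>g\<in>block_maps (insert D A) m. (\<lambda>(i, g). g(D := i)) (g D, restrict g A) = g"
      proof
        fix g assume "g \<in> block_maps (insert D A) m"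
        then have "g \<in> extensional (insert D A)" by (auto simp: block_maps_def PiE_def)
        then have "(restrict g A)(D := g D) = g"
          by (intro ext) (auto simp: extensional_def)
        then show "(\<lambda>(i, g). g(D := i)) (g D, restrict g A) = g" by simp
      qed
      show "\<forall>s\<in>\<Union> (Q ` splits m). (\<lambda>g. (g D, restrict g A)) ((\<lambda>(i, g). g(D := i)) s) = s"
        using insert.hyps(2)
        by (auto simp: Q_def block_maps_def fun_eq_iff PiE_iff extensional_def)
      show "(\<lambda>g. (g D, restrict g A)) ` block_maps (insert D A) m \<subseteq> \<Union> (Q ` splits m)"
        using insert.hyps
        by (auto simp: Q_def block_maps_def splits_def)
      show "(\<lambda>(i, g). g(D := i)) ` \<Union> (Q ` splits m) \<subseteq> block_maps (insert D A) m"
      proof clarify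
        fix i g a b assume s: "(a, b) \<in> splits m" and q: "(i, g) \<in> Q (a, b)"
        have "(\<Sum>C\<in>A. replicate_mset (card C) ((g(D := i)) C)) = (\<Sum>C\<in>A. replicate_mset (card C) (g C))"
          using insert.hyps(2) by (intro sum.cong) auto
        then show "g(D := i) \<in> block_maps (insert D A) m"
          using s q insert.hyps
          by (auto simp: Q_def block_maps_def splits_def PiE_iff extensional_def)
      qed
    qed
  qed
  also have "\<dots> = (\<Sum>s\<in>splits m. card (Q s))"
    using finA finD by (intro card_UN_disjoint) (auto simp: Q_def block_maps_def)
  finally have "card (block_maps (insert D A) m)
      = (\<Sum>(a, b)\<in>splits m. card {i. replicate_mset (card D) i = a} * card (block_maps A b))"
    by (simp add: Q_def case_prod_unfold card_cartesian_product)
  then show ?case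
    using insert
    by (simp add: times_mfps.rep_eq nth_power_sum[OF D1] case_prod_unfold)
qed

lemma nth_cycle_power_sum:
  assumes \<sigma>: "\<sigma> permutes {1..n}"
  shows "mfps_nth (cycle_power_sum n \<sigma> :: 'a::comm_ring_1 mfps) m =
    of_nat (card {f \<in> {1..n} \<rightarrow>\<^sub>E UNIV. image_mset f (mset_set {1..n}) = m \<and> (\<forall>x\<in>{1..n}. f (\<sigma> x) = f x)})"
proof -
  let ?S = "{1..n}" and ?A = "orbit \<sigma> ` {1..n}"
  have perm: "permutation \<sigma>" using \<sigma> permutation_permutes by blast
  have self: "x \<in> orbit \<sigma> x" for x using perm by (rule permutation_self_in_orbit)
  have sub: "orbit \<sigma> x \<subseteq> ?S" if "x \<in> ?S" for x
    using permutes_orbit_subset[OF \<sigma> that] .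
  have eq: "orbit \<sigma> y = orbit \<sigma> x" if "y \<in> orbit \<sigma> x" for x y
  proof -
    have "cyclic_on \<sigma> (orbit \<sigma> x)" using self by (auto simp: cyclic_on_def)
    then show ?thesis using that by (metis orbit_cyclic_eq3)
  qed
  have card1: "card C \<ge> 1" if "C \<in> ?A" for C
  proof -
    have "finite C" "C \<noteq> {}" using that sub self finite_subset[of _ ?S] by auto blast+
    then show ?thesis by (simp add: Suc_le_eq card_gt_0_iff)
  qed
  have union: "(\<Union>C\<in>?A. C) = ?S" using sub self by blast
  have mset_eq: "(\<Sum>C\<in>?A. replicate_mset (card C) (g C)) = image_mset (\<lambda>x. g (orbit \<sigma> x)) (mset_set ?S)" for g :: "nat set \<Rightarrow> nat"
  proof -
    have "(\<Sum>x\<in>?S. {#g (orbit \<sigma> x)#}) = (\<Sum>x\<in>(\<Union>C\<in>?A. C). {#g (orbit \<sigma> x)#})"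
      using union by simp
    also have "\<dots> = (\<Sum>C\<in>?A. \<Sum>x\<in>C. {#g (orbit \<sigma> x)#})"
    proof (rule sum.UNION_disjoint)
      show "\<forall>C\<in>?A. finite C" using sub finite_subset by blast
      show "\<forall>C\<in>?A. \<forall>D\<in>?A. C \<noteq> D \<longrightarrow> C \<inter> D = {}" using eq by blast
    qed auto
    also have "\<dots> = (\<Sum>C\<in>?A. replicate_mset (card C) (g C))"
    proof (rule sum.cong)
      fix C assume C: "C \<in> ?A"
      then have "(\<Sum>x\<in>C. {#g (orbit \<sigma> x)#}) = (\<Sum>x\<in>C. {#g C#})"
        using eq by (intro sum.cong) auto
      also have "\<dots> = replicate_mset (card C) (g C)"
      proof -
        have "(\<Sum>x\<in>X. {#c#}) = replicate_mset (card X) c" if "finite X" for X :: "nat set" and c :: nat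
          using that by (induction X) auto
        moreover have "finite C" using C sub finite_subset by blast
        ultimately show ?thesis by simp
      qed
      finally show "(\<Sum>x\<in>C. {#g (orbit \<sigma> x)#}) = replicate_mset (card C) (g C)" .
    qed simp
    finally have "(\<Sum>x\<in>?S. {#g (orbit \<sigma> x)#}) = (\<Sum>C\<in>?A. replicate_mset (card C) (g C))" .
    moreover have "(\<Sum>x\<in>X. {#h x#}) = image_mset h (mset_set X)" if "finite X" for X and h :: "nat \<Rightarrow> nat"
      using that by (induction X) auto
    ultimately show ?thesis by simp
  qed
  let ?F = "{f \<in> ?S \<rightarrow>\<^sub>E UNIV. image_mset f (mset_set ?S) = m \<and> (\<forall>x\<in>?S. f (\<sigma> x) = f x)}"
  have "card (block_maps ?A m) = card ?F"
  proof (rule bij_betw_same_card)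
    have const: "f y = f x" if "f \<in> ?F" "x \<in> ?S" "y \<in> orbit \<sigma> x" for f :: "nat \<Rightarrow> nat" and x y
      using that(3)
    proof induction
      case base then show ?case using that by auto
    next
      case (step y)
      then have "y \<in> ?S" using sub that by blast
      then show ?case using step that by auto
    qed
    have some: "(SOME y. y \<in> orbit \<sigma> x) \<in> orbit \<sigma> x" for x
      using self by (rule someI)
    show "bij_betw (\<lambda>g. \<lambda>x\<in>?S. g (orbit \<sigma> x)) (block_maps ?A m) ?F"
    proof (rule bij_betw_byWitness[where f' = "\<lambda>f. \<lambda>C\<in>?A. f (SOME y. y \<in> C)"])
      show "\<forall>g\<in>block_maps ?A m. (\<lambda>C\<in>?A. (\<lambda>x\<in>?S. g (orbit \<sigma> x)) (SOME y. y \<in> C)) = g"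
      proof
        fix g assume g: "g \<in> block_maps ?A m"
        show "(\<lambda>C\<in>?A. (\<lambda>x\<in>?S. g (orbit \<sigma> x)) (SOME y. y \<in> C)) = g"
        proof
          fix C
          show "(\<lambda>C\<in>?A. (\<lambda>x\<in>?S. g (orbit \<sigma> x)) (SOME y. y \<in> C)) C = g C"
          proof (cases "C \<in> ?A")
            case True
            then obtain x where x: "x \<in> ?S" "C = orbit \<sigma> x" by blast
            have "(SOME y. y \<in> C) \<in> ?S" "orbit \<sigma> (SOME y. y \<in> C) = C"
              using some[of x] sub[OF x(1)] eq x by blast+
            then show ?thesis using True by simp
          next
            case False
            then have "g C = undefined" using g by (auto simp: block_maps_def PiE_def extensional_def)
            then show ?thesis using False by simp
          qed
        qed
      qed
      show "\<forall>f\<in>?F. (\<lambda>x\<in>?S. (\<lambda>C\<in>?A. f (SOME y. y \<in> C)) (orbit \<sigma> x)) = f"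
      proof
        fix f assume f: "f \<in> ?F"
        show "(\<lambda>x\<in>?S. (\<lambda>C\<in>?A. f (SOME y. y \<in> C)) (orbit \<sigma> x)) = f"
        proof
          fix x
          show "(\<lambda>x\<in>?S. (\<lambda>C\<in>?A. f (SOME y. y \<in> C)) (orbit \<sigma> x)) x = f x"
            using f const[OF f _ some] by (cases "x \<in> ?S") (auto simp: PiE_def extensional_def)
        qed
      qed
      show "(\<lambda>g. \<lambda>x\<in>?S. g (orbit \<sigma> x)) ` block_maps ?A m \<subseteq> ?F"
      proof clarify
        fix g assume g: "g \<in> block_maps ?A m"
        have "image_mset (\<lambda>x\<in>?S. g (orbit \<sigma> x)) (mset_set ?S) = image_mset (\<lambda>x. g (orbit \<sigma> x)) (mset_set ?S)"
          by (intro image_mset_cong) auto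
        moreover have "orbit \<sigma> (\<sigma> x) = orbit \<sigma> x" for x
          using eq[OF orbit.base] .
        moreover have "\<sigma> x \<in> ?S" if "x \<in> ?S" for x
          using permutes_in_image[OF \<sigma>] that by blast
        ultimately show "(\<lambda>x\<in>?S. g (orbit \<sigma> x)) \<in> ?S \<rightarrow>\<^sub>E UNIV \<and>
            image_mset (\<lambda>x\<in>?S. g (orbit \<sigma> x)) (mset_set ?S) = m \<and>
            (\<forall>x\<in>?S. (\<lambda>x\<in>?S. g (orbit \<sigma> x)) (\<sigma> x) = (\<lambda>x\<in>?S. g (orbit \<sigma> x)) x)"
          using g mset_eq by (simp add: block_maps_def)
      qed
      show "(\<lambda>f. \<lambda>C\<in>?A. f (SOME y. y \<in> C)) ` ?F \<subseteq> block_maps ?A m"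
      proof
        fix g assume "g \<in> (\<lambda>f. \<lambda>C\<in>?A. f (SOME y. y \<in> C)) ` ?F"
        then obtain f where f: "f \<in> ?F" and g: "g = (\<lambda>C\<in>?A. f (SOME y. y \<in> C))" by blast
        have "image_mset (\<lambda>x. g (orbit \<sigma> x)) (mset_set ?S) = image_mset f (mset_set ?S)"
          using const[OF f _ some] g by (intro image_mset_cong) auto
        then have "(\<Sum>C\<in>?A. replicate_mset (card C) (g C)) = m"
          using f mset_eq by simp
        then show "g \<in> block_maps ?A m" using g by (simp add: block_maps_def)
      qed
    qed
  qed
  then show ?thesis
    unfolding cycle_power_sum_def using card1 by (subst nth_prod_power_sum) auto
qed

lemma nth_hom_sym: "mfps_nth (hom_sym n :: 'a::comm_ring_1 mfps) m = (if size m = n then 1 else 0)"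
proof -
  have uniq: "w = sorted_list_of_multiset m" if "sorted w" "mset w = m" for w
    using that by (metis sorted_list_of_multiset_mset sorted_sort_id)
  have ms: "mset (sorted_list_of_multiset m) = m" "sorted (sorted_list_of_multiset m)"
    by (simp_all add: sorted_sorted_list_of_multiset)
  have len: "length (sorted_list_of_multiset m) = size m"
    using ms(1) by (metis size_mset)
  have "{w \<in> {w. length w = n \<and> sorted w}. mset w = m} =
      (if size m = n then {sorted_list_of_multiset m} else {})"
  proof (rule Set.set_eqI)
    fix w
    show "w \<in> {w \<in> {w. length w = n \<and> sorted w}. mset w = m} \<longleftrightarrow>
        w \<in> (if size m = n then {sorted_list_of_multiset m} else {})"
    proof (cases "w = sorted_list_of_multiset m")
      case True
      then show ?thesis using ms len by simp
    next
      case False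
      then show ?thesis using uniq[of w] by auto
    qed
  qed
  then show ?thesis unfolding hom_sym_def word_sum.rep_eq by (simp only:) simp
qed

lemma nth_const_mult: "mfps_nth (mfps_const c * f) m = c * mfps_nth f m"
proof -
  have "(\<Sum>(a, b)\<in>splits m. mfps_nth (mfps_const c) a * mfps_nth f b)
      = (\<Sum>(a, b)\<in>{({#} :: nat multiset, m)}. mfps_nth (mfps_const c) a * mfps_nth f b)"
    by (rule sum.mono_neutral_right, rule finite_splits)
       (auto simp: splits_def mfps_const.rep_eq split: if_splits)
  then show ?thesis by (simp add: times_mfps.rep_eq mfps_const.rep_eq)
qed

lemma frobenius_ch_trivial: "frobenius_ch n (\<lambda>_. 1) = hom_sym n"
proof (rule mfps_eqI)
  fix m :: "nat multiset"
  let ?S = "{1..n}"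
  define P where "P = {\<sigma>. \<sigma> permutes ?S}"
  define F where "F = {f \<in> ?S \<rightarrow>\<^sub>E (UNIV :: nat set). image_mset f (mset_set ?S) = m}"
  have finP: "finite P" and cardP: "card P = fact n"
    unfolding P_def using finite_permutations[of ?S] card_permutations[of ?S n] by auto
  have finF: "finite F"
  proof (rule finite_subset)
    show "F \<subseteq> ?S \<rightarrow>\<^sub>E set_mset m" by (auto simp: F_def PiE_def)
    show "finite (?S \<rightarrow>\<^sub>E set_mset m)" by (intro finite_PiE) auto
  qed
  have swap: "(\<Sum>\<sigma>\<in>P. card {f \<in> F. R \<sigma> f}) = (\<Sum>f\<in>F. card {\<sigma> \<in> P. R \<sigma> f})" for R
    using finP finF by (intro sum_multicount_gen) simp_all
  have nth_sum: "mfps_nth (sum g A) m = (\<Sum>x\<in>A. mfps_nth (g x) m)" if "finite A"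
    for g :: "(nat \<Rightarrow> nat) \<Rightarrow> complex mfps" and A
    using that by (induction A) (auto simp: zero_mfps.rep_eq plus_mfps.rep_eq)
  have summand: "mfps_nth (mfps_const (1 / fact n) * cycle_power_sum n \<sigma>) m
      = (1 / fact n * of_nat (card {f \<in> F. \<forall>x\<in>?S. f (\<sigma> x) = f x}) :: complex)"
    if "\<sigma> \<in> P" for \<sigma>
  proof -
    have perm: "\<sigma> permutes ?S" using that unfolding P_def by blast
    have "{f \<in> ?S \<rightarrow>\<^sub>E UNIV. image_mset f (mset_set ?S) = m \<and> (\<forall>x\<in>?S. f (\<sigma> x) = f x)}
        = {f \<in> F. \<forall>x\<in>?S. f (\<sigma> x) = f x}"
      unfolding F_def by blast
    then show ?thesis
      unfolding nth_const_mult nth_cycle_power_sum[OF perm] by (simp only:)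
  qed
  have "mfps_nth (frobenius_ch n (\<lambda>_. 1)) m
      = (\<Sum>\<sigma>\<in>P. 1 / fact n * of_nat (card {f \<in> F. \<forall>x\<in>?S. f (\<sigma> x) = f x}))"
    unfolding frobenius_ch_def P_def[symmetric] nth_sum[OF finP]
    by (rule sum.cong) (rule refl, rule summand)
  also have "\<dots> = of_nat (\<Sum>\<sigma>\<in>P. card {f \<in> F. \<forall>x\<in>?S. f (\<sigma> x) = f x}) / fact n"
    by (subst of_nat_sum, subst sum_divide_distrib, rule sum.cong) (rule refl, simp)
  finally have coeff: "mfps_nth (frobenius_ch n (\<lambda>_. 1)) m
      = of_nat (\<Sum>\<sigma>\<in>P. card {f \<in> F. \<forall>x\<in>?S. f (\<sigma> x) = f x}) / fact n" .
  have "(\<Sum>\<sigma>\<in>P. card {f \<in> F. \<forall>x\<in>?S. f (\<sigma> x) = f x})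
      = (\<Sum>f\<in>F. card {\<sigma> \<in> P. \<forall>x\<in>?S. f (\<sigma> x) = f x})"
    by (rule swap)
  also have "\<dots> = (if size m = n then fact n else 0)"
  proof (cases "F = {}")
    case True
    have "size m \<noteq> n"
    proof
      assume s: "size m = n"
      obtain w where w: "mset w = m" using ex_mset by blast
      have "image_mset (\<lambda>x\<in>?S. w ! (x - 1)) (mset_set ?S) = image_mset (\<lambda>x. w ! (x - 1)) (mset_set ?S)"
        by (intro image_mset_cong) auto
      also have "\<dots> = image_mset (\<lambda>x. w ! (x - 1)) (mset [1..<Suc n])"
        by (simp only: mset_upt atLeastLessThanSuc_atLeastAtMost)
      also have "\<dots> = mset (map (\<lambda>x. w ! (x - 1)) [1..<Suc n])"
        by (simp only: mset_map)
      also have "map (\<lambda>x. w ! (x - 1)) [1..<Suc n] = w"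
        using s w by (intro nth_equalityI) (auto simp del: upt_Suc)
      finally have "image_mset (\<lambda>x\<in>?S. w ! (x - 1)) (mset_set ?S) = m"
        by (simp only: w)
      moreover have "(\<lambda>x\<in>?S. w ! (x - 1)) \<in> ?S \<rightarrow>\<^sub>E UNIV"
        by (intro restrict_PiE_iff[THEN iffD2] ballI UNIV_I)
      ultimately have "(\<lambda>x\<in>?S. w ! (x - 1)) \<in> F"
        unfolding F_def by blast
      then show False using True by blast
    qed
    then show ?thesis using True by simp
  next
    case False
    then obtain f0 where f0: "f0 \<in> F" by blast
    then have sz: "size m = n" by (auto simp: F_def)
    have "\<exists>\<tau>. \<tau> permutes ?S \<and> (\<forall>x\<in>?S. f0 x = f (\<tau> x))" if "f \<in> F" for f
    proof -
      have "image_mset f0 (mset_set ?S) = image_mset f (mset_set ?S)"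
        using f0 that by (simp add: F_def)
      from image_mset_eq_implies_permutes[OF _ this] show ?thesis by auto
    qed
    then obtain \<tau> where \<tau>: "\<And>f. f \<in> F \<Longrightarrow> \<tau> f permutes ?S"
        "\<And>f x. f \<in> F \<Longrightarrow> x \<in> ?S \<Longrightarrow> f0 x = f (\<tau> f x)"
      using bchoice[of F "\<lambda>f \<tau>. \<tau> permutes ?S \<and> (\<forall>x\<in>?S. f0 x = f (\<tau> x))"] by blast
    have "card {\<sigma> \<in> P. \<forall>x\<in>?S. f (\<sigma> x) = f x} = card {\<sigma> \<in> P. \<forall>x\<in>?S. f (\<sigma> x) = f0 x}"
      if f: "f \<in> F" for f
    proof (rule bij_betw_same_card)
      note t = \<tau>(1)[OF f]
      have inS: "inv_into UNIV (\<tau> f) x \<in> ?S" "\<tau> f x \<in> ?S" if "x \<in> ?S" for x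
        using that by (simp_all only: permutes_in_image[OF t] permutes_in_image[OF permutes_inv[OF t]])
      show "bij_betw (\<lambda>\<sigma>. \<sigma> \<circ> \<tau> f) {\<sigma> \<in> P. \<forall>x\<in>?S. f (\<sigma> x) = f x} {\<sigma> \<in> P. \<forall>x\<in>?S. f (\<sigma> x) = f0 x}"
      proof (rule bij_betw_byWitness[where f' = "\<lambda>\<sigma>. \<sigma> \<circ> inv_into UNIV (\<tau> f)"])
        show "(\<lambda>\<sigma>. \<sigma> \<circ> \<tau> f) ` {\<sigma> \<in> P. \<forall>x\<in>?S. f (\<sigma> x) = f x} \<subseteq> {\<sigma> \<in> P. \<forall>x\<in>?S. f (\<sigma> x) = f0 x}"
        proof clarify
          fix \<sigma> assume s: "\<sigma> \<in> P" "\<forall>x\<in>?S. f (\<sigma> x) = f x"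
          have "f ((\<sigma> \<circ> \<tau> f) x) = f0 x" if "x \<in> ?S" for x
            using bspec[OF s(2) inS(2)[OF that]] \<tau>(2)[OF f that] by simp
          moreover have "\<sigma> \<circ> \<tau> f \<in> P"
            using permutes_compose[OF t] s(1) by (simp add: P_def)
          ultimately show "\<sigma> \<circ> \<tau> f \<in> P \<and> (\<forall>x\<in>?S. f ((\<sigma> \<circ> \<tau> f) x) = f0 x)" by blast
        qed
        show "(\<lambda>\<sigma>. \<sigma> \<circ> inv_into UNIV (\<tau> f)) ` {\<sigma> \<in> P. \<forall>x\<in>?S. f (\<sigma> x) = f0 x} \<subseteq> {\<sigma> \<in> P. \<forall>x\<in>?S. f (\<sigma> x) = f x}"
        proof clarify
          fix \<sigma> assume s: "\<sigma> \<in> P" "\<forall>x\<in>?S. f (\<sigma> x) = f0 x"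
          have "f ((\<sigma> \<circ> inv_into UNIV (\<tau> f)) x) = f x" if "x \<in> ?S" for x
            using s(2) inS(1)[OF that] \<tau>(2)[OF f inS(1)[OF that]] permutes_inverses(1)[OF t] by simp
          moreover have "\<sigma> \<circ> inv_into UNIV (\<tau> f) \<in> P"
            using permutes_compose[OF permutes_inv[OF t]] s(1) by (simp add: P_def)
          ultimately show "\<sigma> \<circ> inv_into UNIV (\<tau> f) \<in> P \<and> (\<forall>x\<in>?S. f ((\<sigma> \<circ> inv_into UNIV (\<tau> f)) x) = f x)" by blast
        qed
      qed (simp_all add: fun_eq_iff permutes_inverses[OF t])
    qed
    then have "(\<Sum>f\<in>F. card {\<sigma> \<in> P. \<forall>x\<in>?S. f (\<sigma> x) = f x})
        = (\<Sum>f\<in>F. card {\<sigma> \<in> P. \<forall>x\<in>?S. f (\<sigma> x) = f0 x})"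
      by simp
    also have "\<dots> = (\<Sum>\<sigma>\<in>P. card {f \<in> F. \<forall>x\<in>?S. f (\<sigma> x) = f0 x})"
      by (rule swap[symmetric])
    also have "\<dots> = (\<Sum>\<sigma>\<in>P. 1)"
    proof (rule sum.cong)
      fix \<sigma> assume "\<sigma> \<in> P"
      then have s: "\<sigma> permutes ?S" by (simp add: P_def)
      have inS: "inv_into UNIV \<sigma> x \<in> ?S" "\<sigma> x \<in> ?S" if "x \<in> ?S" for x
        using that by (simp_all only: permutes_in_image[OF s] permutes_in_image[OF permutes_inv[OF s]])
      have "{f \<in> F. \<forall>x\<in>?S. f (\<sigma> x) = f0 x} = {\<lambda>x\<in>?S. f0 (inv_into UNIV \<sigma> x)}"
      proof (rule Set.set_eqI)
        fix f
        have "image_mset (\<lambda>x\<in>?S. f0 (inv_into UNIV \<sigma> x)) (mset_set ?S) = image_mset (f0 \<circ> inv_into UNIV \<sigma>) (mset_set ?S)"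
          by (intro image_mset_cong) auto
        also have "\<dots> = image_mset f0 (image_mset (inv_into UNIV \<sigma>) (mset_set ?S))"
          by (simp add: multiset.map_comp)
        also have "\<dots> = image_mset f0 (mset_set ?S)"
          using image_mset_mset_set[OF permutes_inj_on[OF permutes_inv[OF s]], of ?S]
            permutes_image[OF permutes_inv[OF s]] by (simp only:)
        also have "\<dots> = m"
          using f0 unfolding F_def by blast
        finally have "image_mset (\<lambda>x\<in>?S. f0 (inv_into UNIV \<sigma> x)) (mset_set ?S) = m" .
        moreover have "(\<lambda>x\<in>?S. f0 (inv_into UNIV \<sigma> x)) \<in> ?S \<rightarrow>\<^sub>E UNIV"
          by (intro restrict_PiE_iff[THEN iffD2] ballI UNIV_I)
        ultimately have "(\<lambda>x\<in>?S. f0 (inv_into UNIV \<sigma> x)) \<in> F"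
          unfolding F_def by blast
        moreover have "f = (\<lambda>x\<in>?S. f0 (inv_into UNIV \<sigma> x))" if "f \<in> F" "\<forall>x\<in>?S. f (\<sigma> x) = f0 x"
        proof
          fix x
          show "f x = (\<lambda>x\<in>?S. f0 (inv_into UNIV \<sigma> x)) x"
          proof (cases "x \<in> ?S")
            case True
            then have "f (\<sigma> (inv_into UNIV \<sigma> x)) = f0 (inv_into UNIV \<sigma> x)" using that(2) inS(1) by blast
            then show ?thesis using True permutes_inverses(1)[OF s] by simp
          next
            case False
            moreover have "f \<in> extensional ?S" using that(1) by (simp add: F_def PiE_def)
            ultimately show ?thesis
              using extensional_arb[of f ?S x] by auto
          qed
        qed
        moreover have "\<forall>y\<in>?S. (\<lambda>x\<in>?S. f0 (inv_into UNIV \<sigma> x)) (\<sigma> y) = f0 y"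
        proof
          fix y assume "y \<in> ?S"
          then show "(\<lambda>x\<in>?S. f0 (inv_into UNIV \<sigma> x)) (\<sigma> y) = f0 y"
            using inS(2) by (simp only: restrict_apply if_True permutes_inverses(2)[OF s])
        qed
        ultimately show "f \<in> {f \<in> F. \<forall>x\<in>?S. f (\<sigma> x) = f0 x} \<longleftrightarrow> f \<in> {\<lambda>x\<in>?S. f0 (inv_into UNIV \<sigma> x)}"
          by blast
      qed
      then show "card {f \<in> F. \<forall>x\<in>?S. f (\<sigma> x) = f0 x} = 1" by simp
    qed simp
    finally have "(\<Sum>f\<in>F. card {\<sigma> \<in> P. \<forall>x\<in>?S. f (\<sigma> x) = f x}) = card P"
      by (simp only: card_eq_sum)
    then show ?thesis by (simp only: sz cardP if_True simp_thms)
  qed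
  finally have total: "(\<Sum>\<sigma>\<in>P. card {f \<in> F. \<forall>x\<in>?S. f (\<sigma> x) = f x})
      = (if size m = n then fact n else 0)" .
  show "mfps_nth (frobenius_ch n (\<lambda>_. 1)) m = mfps_nth (hom_sym n) m"
    unfolding coeff total nth_hom_sym by simp
qed

end

theory Submission
  imports Defs "HOL-Computational_Algebra.Polynomial" "HOL-Combinatorics.Multiset_Permutations"
    "HOL-Library.Nat_Bijection"
begin

text \<open>Both identities are proved coefficient by coefficient. In degree \<open>d\<close>, at a monomial given by a
  multiset \<open>m\<close> of colours, both sides count the multisets of pairs (colour, level) with the
  colours \<open>m\<close> whose levels satisfy the condition \<open>fy_levels 1\<close> and have the maximum \<open>d\<close>; for the
  uniform matroid of rank \<open>n - 1\<close>, all levels have to be positive and the maximum is \<open>Suc d\<close>.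

  On the side of the ring, put \<open>x E = - (\<Sum>F. x F)\<close> for the ground set \<open>E\<close>, with the sum over
  all proper flats. The monomials in the \<open>x F\<close>, \<open>F\<close> any flat, that are supported on chains and
  satisfy the bounds \<open>fy\<close> on exponents form a basis in each degree. They span, because suitable
  powers of \<open>above F\<close>, the sum of the \<open>x G\<close> over all flats \<open>G \<supseteq> F\<close>, vanish and allow the other
  monomials to be straightened towards larger flats (\<open>x_above_power\<close>, \<open>above_power\<close>,
  \<open>homogeneous_spanned\<close>). For the Boolean matroid they are independent, because the linear
  relations can be deformed by constants so that the relations acquire one rational point for every
  list of distinct elements of \<open>E\<close>. Straightening modulo lower degree shows that the monomials span
  all functions on these points, and there are as many monomials as points (\<open>FY_independent\<close>). The
  ring of the truncation is related to that of the Boolean matroid by multiplication with \<open>x E\<close>,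
  which sends its monomials to those divisible by \<open>x E\<close> (\<open>C_FY_independent\<close>).

  The symmetric group permutes the basis. A basis monomial is encoded by its level function, which
  maps \<open>i\<close> to the number of factors whose flat contains \<open>i\<close> (\<open>Lev_bij\<close>), and so the character
  of each degree is a permutation character on level functions (\<open>trace_act\<close>, \<open>card_fixed_FY\<close>,
  \<open>C_card_fixed_FY\<close>). An orbit count then gives the coefficients of its Frobenius characteristic
  (\<open>nth_frobenius_ch_levels\<close>).

  On the side of \<open>eulerian_Q\<close>, the coefficient at \<open>m\<close> counts by \<open>exc\<close> the permutations whose
  \<open>DEX\<close> is contained in the set of descents of the decreasing word of \<open>m\<close>. Recording for every
  value the letter at its position, and whether it is an excedance value, encodes them by labelings
  in which the label of each value can be chosen independently (\<open>perm_labels_bij\<close>). Their generating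
  polynomial is thus a coefficient of a product of linear forms. A telescoping argument for such
  products (\<open>block_coeff_identity\<close>) shows that it satisfies the recursion for level multisets that
  removes the highest level, \<open>level_gf_rec\<close>. Hence both count the same (\<open>block_coeff_eq_level_gf\<close>),
  and in \<open>eulerian_Q_tilde\<close> the factors \<open>hom_sym\<close> correspond to the elements of level \<open>0\<close>, the
  factor \<open>t\<close> to the weaker bound at the highest level (\<open>level_gf_1\<close>, \<open>pos_gf_1\<close>).\<close>

section \<open>Power series in several variables\<close>

lemma mfps_nth_zero [simp]: "mfps_nth 0 m = 0"
  by (simp add: zero_mfps.rep_eq)

lemma mfps_nth_add [simp]: "mfps_nth (f + g) m = mfps_nth f m + mfps_nth g m"
  by (simp add: plus_mfps.rep_eq)

lemma mfps_nth_diff [simp]: "mfps_nth (f - g) m = mfps_nth f m - mfps_nth g m"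
  by (simp add: minus_mfps.rep_eq)

lemma mfps_nth_sum [simp]: "mfps_nth (sum f A) m = (\<Sum>x\<in>A. mfps_nth (f x) m)"
  by (induction A rule: infinite_finite_induct) simp_all

lemma mfps_nth_mult: "mfps_nth (f * g) m = (\<Sum>(a, b)\<in>splits m. mfps_nth f a * mfps_nth g b)"
  by (simp add: times_mfps.rep_eq)

lift_definition xmon :: "nat multiset \<Rightarrow> 'a::comm_ring_1 mfps"
  is "\<lambda>M k. if k = M then 1 else 0" .

lemma mfps_nth_xmon: "mfps_nth (xmon M) k = (if k = M then 1 else 0)"
  by (simp add: xmon.rep_eq)

lemma mfps_nth_xmon_mult:
  "mfps_nth (xmon M * p) k = (if M \<subseteq># k then mfps_nth p (k - M) else 0)"
proof -
  have "mfps_nth (xmon M * p) k = (\<Sum>(a, b)\<in>splits k. if a = M then mfps_nth p b else 0)"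
    unfolding mfps_nth_mult by (intro sum.cong) (auto simp: mfps_nth_xmon)
  also have "\<dots> = (\<Sum>(a, b)\<in>(if M \<subseteq># k then {(M, k - M)} else {}). mfps_nth p b)"
    by (intro sum.mono_neutral_cong_right finite_splits) (auto simp: splits_def split: if_splits)
  finally show ?thesis by simp
qed

lemma xmon_empty [simp]: "xmon {#} = 1"
  by (rule mfps_eqI) (simp add: mfps_nth_xmon one_mfps.rep_eq)

lemma xmon_add: "xmon (M + N) = xmon M * xmon N"
proof (rule mfps_eqI)
  fix k
  show "mfps_nth (xmon (M + N) :: 'a mfps) k = mfps_nth (xmon M * xmon N) k"
    unfolding mfps_nth_xmon_mult mfps_nth_xmon
    by (metis add_diff_cancel_left' mset_subset_eq_add_left subset_mset.add_diff_inverse)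
qed

lemma xmon_repeat: "xmon M ^ j = xmon (repeat_mset j M)"
  by (induction j) (simp_all add: xmon_add)

text \<open>These are the series without a term dividing the monomial \<open>m\<close>, the ideal generated by the
  monomials that do not divide \<open>m\<close>. The coefficient at \<open>m\<close> depends only on the residue class
  modulo this ideal.\<close>

definition vanishes_below :: "nat multiset \<Rightarrow> 'a::comm_ring_1 mfps \<Rightarrow> bool" where
  "vanishes_below m p \<longleftrightarrow> (\<forall>k. k \<subseteq># m \<longrightarrow> mfps_nth p k = 0)"

lemma vanishes_below_mult:
  assumes "vanishes_below m p"
  shows "vanishes_below m (p * q)" "vanishes_below m (q * p)"
proof -
  show "vanishes_below m (p * q)"
    unfolding vanishes_below_def
  proof (intro allI impI)
    fix k assume k: "k \<subseteq># m"
    have "mfps_nth p a = 0" if "(a, b) \<in> splits k" for a b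
      using that k assms unfolding vanishes_below_def splits_def
      by (metis (mono_tags, lifting) case_prodD mem_Collect_eq mset_subset_eq_add_left subset_mset.order_trans)
    then show "mfps_nth (p * q) k = 0"
      unfolding mfps_nth_mult by (intro sum.neutral) auto
  qed
  then show "vanishes_below m (q * p)" by (simp add: mult.commute)
qed

lemma vanishes_below_add:
  "vanishes_below m p \<Longrightarrow> vanishes_below m q \<Longrightarrow> vanishes_below m (p + q)"
  by (simp add: vanishes_below_def)

lemma vanishes_below_diff:
  "vanishes_below m p \<Longrightarrow> vanishes_below m q \<Longrightarrow> vanishes_below m (p - q)"
  by (simp add: vanishes_below_def)

lemma vanishes_below_sum:
  "(\<And>x. x \<in> A \<Longrightarrow> vanishes_below m (p x)) \<Longrightarrow> vanishes_below m (sum p A)"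
  by (simp add: vanishes_below_def)

lemma vanishes_below_xmon: "\<not> M \<subseteq># m \<Longrightarrow> vanishes_below m (xmon M)"
  by (auto simp: vanishes_below_def mfps_nth_xmon)

definition degree_less :: "nat \<Rightarrow> 'a::comm_ring_1 mfps \<Rightarrow> bool" where
  "degree_less d p \<longleftrightarrow> (\<forall>k. size k \<ge> d \<longrightarrow> mfps_nth p k = 0)"

lemma degree_less_mult:
  assumes "degree_less (Suc a) p" "degree_less d q"
  shows "degree_less (a + d) (p * q)"
  unfolding degree_less_def
proof (intro allI impI)
  fix k :: "nat multiset" assume k: "a + d \<le> size k"
  have "mfps_nth p x * mfps_nth q y = 0" if "(x, y) \<in> splits k" for x y
  proof -
    have "size x + size y = size k" using that by (auto simp: splits_def)
    then have "size x \<ge> Suc a \<or> size y \<ge> d" using k by linarith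
    then show ?thesis using assms by (auto simp: degree_less_def)
  qed
  then show "mfps_nth (p * q) k = 0"
    unfolding mfps_nth_mult by (intro sum.neutral) auto
qed

lemma degree_less_add: "degree_less d p \<Longrightarrow> degree_less d q \<Longrightarrow> degree_less d (p + q)"
  by (simp add: degree_less_def)

lemma degree_less_sum: "(\<And>x. x \<in> A \<Longrightarrow> degree_less d (p x)) \<Longrightarrow> degree_less d (sum p A)"
  by (simp add: degree_less_def)

lemma degree_less_const_mult: "degree_less d p \<Longrightarrow> degree_less d (mfps_const c * p)"
  by (simp add: degree_less_def nth_const_mult)

lemma degree_less_power:
  assumes "degree_less 2 p" shows "degree_less (Suc j) (p ^ j)"
proof (induction j)
  case 0
  then show ?case by (auto simp: degree_less_def one_mfps.rep_eq)
next
  case (Suc j)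
  from degree_less_mult[of 1 p, OF _ this] assms show ?case by (simp add: numeral_2_eq_2)
qed

text \<open>The product of the \<open>F b\<close> turns into the product of the \<open>g b\<close> by exchanging one factor at a
  time, from the last to the first. The multiplier \<open>U (Suc b)\<close> becomes \<open>U b\<close> in the exchange of the
  factor \<open>b\<close>, which leaves the error term \<open>c * z b\<close>.\<close>

lemma nested_telescope:
  fixes U F g z :: "nat \<Rightarrow> 'a::comm_ring_1"
  assumes "\<And>b. b < K \<Longrightarrow> U b * g b = U (Suc b) * F b - c * z b"
  shows "U K * (\<Prod>b<K. F b) - U 0 * (\<Prod>b<K. g b) =
    c * (\<Sum>j<K. z j * (\<Prod>b<j. F b) * (\<Prod>b\<in>{Suc j..<K}. g b))"
  using assms
proof (induction K)
  case (Suc K)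
  have "(\<Sum>j<K. z j * (\<Prod>b<j. F b) * (\<Prod>b\<in>{Suc j..<Suc K}. g b)) =
      (\<Sum>j<K. z j * (\<Prod>b<j. F b) * (\<Prod>b\<in>{Suc j..<K}. g b)) * g K"
    unfolding sum_distrib_right by (intro sum.cong) (auto simp: mult.assoc)
  then have "c * (\<Sum>j<Suc K. z j * (\<Prod>b<j. F b) * (\<Prod>b\<in>{Suc j..<Suc K}. g b)) =
      (U K * (\<Prod>b<K. F b) - U 0 * (\<Prod>b<K. g b)) * g K + c * z K * (\<Prod>b<K. F b)"
    using Suc by (simp add: algebra_simps)
  also have "\<dots> = U K * g K * (\<Prod>b<K. F b) - U 0 * (\<Prod>b<K. g b) * g K + c * z K * (\<Prod>b<K. F b)"
    by (simp add: algebra_simps)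
  also have "\<dots> = U (Suc K) * (\<Prod>b<Suc K. F b) - U 0 * (\<Prod>b<Suc K. g b)"
  proof -
    have "U (Suc K) * F K = U K * g K + c * z K" using Suc.prems[of K] by simp
    then have "U (Suc K) * F K * (\<Prod>b<K. F b) = (U K * g K + c * z K) * (\<Prod>b<K. F b)" by simp
    then show ?thesis by (simp add: algebra_simps)
  qed
  finally show ?case by simp
qed simp

lemma count_sum_replicate:
  "count (\<Sum>b<K. replicate_mset (g b) b) a = (if a < K then g a else 0)" for a K :: nat
  by (induction K) auto

text \<open>A submultiset of \<open>m\<close> is an independent choice of a multiplicity for every letter.\<close>

lemma sum_subset_mset_prod:
  fixes h :: "nat \<Rightarrow> nat \<Rightarrow> 'a::comm_ring_1"
  assumes "set_mset m \<subseteq> {..<K}"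
  shows "(\<Sum>M | M \<subseteq># m. \<Prod>b<K. h b (count M b)) = (\<Prod>b<K. \<Sum>j\<le>count m b. h b j)"
proof -
  have "(\<Prod>b<K. \<Sum>j\<le>count m b. h b j) =
      (\<Sum>g\<in>PiE {..<K} (\<lambda>b. {..count m b}). \<Prod>b<K. h b (g b))"
    by (rule prod_sum_PiE) auto
  also have "\<dots> = (\<Sum>M | M \<subseteq># m. \<Prod>b<K. h b (count M b))"
  proof (rule sum.reindex_bij_witness[where j = "\<lambda>g. \<Sum>b<K. replicate_mset (g b) b"
        and i = "\<lambda>M. restrict (count M) {..<K}"])
    fix g assume g: "g \<in> PiE {..<K} (\<lambda>b. {..count m b})"
    note c = count_sum_replicate
    show "restrict (count (\<Sum>b<K. replicate_mset (g b) b)) {..<K} = g"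
      using g by (auto simp: c fun_eq_iff PiE_def extensional_def)
    show "(\<Sum>b<K. replicate_mset (g b) b) \<in> {M. M \<subseteq># m}"
      using g by (auto simp: c subseteq_mset_def PiE_def)
    show "(\<Prod>b<K. h b (count (\<Sum>b<K. replicate_mset (g b) b) b)) = (\<Prod>b<K. h b (g b))"
      by (intro prod.cong) (auto simp: c)
  next
    fix M assume M: "M \<in> {M. M \<subseteq># m}"
    then have 0: "a \<ge> K \<Longrightarrow> count M a = 0" for a
      using assms by (metis (no_types, lifting) lessThan_iff linorder_not_less mem_Collect_eq
          mset_subset_eqD not_in_iff subsetD)
    show "(\<Sum>b<K. replicate_mset (restrict (count M) {..<K} b) b) = M"
      by (rule multiset_eqI) (use 0 in \<open>auto simp: count_sum_replicate\<close>)
    show "restrict (count M) {..<K} \<in> PiE {..<K} (\<lambda>b. {..count m b})"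
      using M by (auto simp: subseteq_mset_def)
  qed
  finally show ?thesis by simp
qed

lemma mfps_const_mult_const: "mfps_const (a * b) = mfps_const a * mfps_const b"
  by (rule mfps_eqI) (simp add: nth_const_mult mfps_const.rep_eq)

lemma mfps_const_1 [simp]: "mfps_const 1 = 1"
  by (rule mfps_eqI) (simp add: mfps_const.rep_eq one_mfps.rep_eq)

text \<open>The polynomials below are homogeneous, so the variable of the colour \<open>0\<close> can be set to \<open>1\<close>
  without loss of information. This makes the sum of all variables invertible modulo
  \<open>vanishes_below\<close>.\<close>

definition positive_part :: "nat multiset \<Rightarrow> nat multiset" where
  "positive_part m = filter_mset (\<lambda>a. 0 < a) m"

definition yv :: "nat \<Rightarrow> 'a::comm_ring_1 mfps" where
  "yv a = xmon (positive_part {#a#})"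

text \<open>For the values whose own letter is \<open>b\<close>, the form \<open>lin_part t K (Suc b)\<close> counts the labels of the
  least value and \<open>lin_full t K b\<close> those of every other one; \<open>t\<close> marks excedances.\<close>

definition lin_part :: "'a::comm_ring_1 \<Rightarrow> nat \<Rightarrow> nat \<Rightarrow> 'a mfps" where
  "lin_part t K j = mfps_const t * (\<Sum>a\<in>{j..<K}. yv a) + (\<Sum>a<j. yv a)"

definition lin_full :: "'a::comm_ring_1 \<Rightarrow> nat \<Rightarrow> nat \<Rightarrow> 'a mfps" where
  "lin_full t K b = lin_part t K (Suc b) + mfps_const t * yv b"

text \<open>The generating function of the labels of \<open>c\<close> values with the same letter \<open>b\<close>: the least of
  them has one admissible label fewer than the others, see the definition of \<open>allowed\<close> below.\<close>

definition block_factor :: "'a::comm_ring_1 \<Rightarrow> nat \<Rightarrow> nat \<Rightarrow> nat \<Rightarrow> 'a mfps" where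
  "block_factor t K b c = (if c = 0 then 1 else lin_part t K (Suc b) * lin_full t K b ^ (c - 1))"

text \<open>The generating polynomial, in the number of labels of weight \<open>t\<close>, of the admissible labelings
  of content \<open>m\<close>.\<close>

definition block_coeff :: "'a::comm_ring_1 \<Rightarrow> nat \<Rightarrow> nat multiset \<Rightarrow> 'a" where
  "block_coeff t K m = mfps_nth (\<Prod>b<K. block_factor t K b (count m b)) (positive_part m)"

lemma prod_yv_powers:
  assumes "set_mset M \<subseteq> {..<K}"
  shows "(\<Prod>b<K. (mfps_const s * yv b) ^ count M b) =
    mfps_const (s ^ size M) * xmon (positive_part M)"
proof -
  have "(\<Prod>b<K. (mfps_const s * yv b) ^ count M b) = (\<Prod>b\<in>set_mset M. (mfps_const s * yv b) ^ count M b)"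
    using assms by (intro prod.mono_neutral_right) (auto simp: not_in_iff)
  also have "\<dots> = (\<Prod>b\<in>#M. mfps_const s * yv b)"
    by (simp add: image_prod_mset_multiplicity)
  also have "\<dots> = mfps_const (s ^ size M) * xmon (positive_part M)"
  proof (induction M)
    case empty
    then show ?case by (simp add: positive_part_def)
  next
    case (add a M)
    have "positive_part (add_mset a M) = positive_part {#a#} + positive_part M"
      by (simp add: positive_part_def)
    then show ?case
      using add by (simp add: yv_def xmon_add mfps_const_mult_const ac_simps)
  qed
  finally show ?thesis .
qed

text \<open>Splitting off a submultiset \<open>M\<close> of \<open>m\<close> multiplies the product of the block factors by the
  monomial of \<open>M\<close>; the sum over all \<open>M\<close> then factors over the letters.\<close>

lemma weighted_block_coeff_sum:
  fixes s t :: "'a::comm_ring_1"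
  assumes m: "set_mset m \<subseteq> {..<K}"
  shows "(\<Sum>M | M \<subseteq># m. s ^ size M * block_coeff t K (m - M)) =
    mfps_nth (\<Prod>b<K. \<Sum>j\<le>count m b. (mfps_const s * yv b) ^ j * block_factor t K b (count m b - j))
      (positive_part m)"
proof -
  have "mfps_nth (\<Prod>b<K. (mfps_const s * yv b) ^ count M b * block_factor t K b (count m b - count M b))
          (positive_part m) = s ^ size M * block_coeff t K (m - M)" if "M \<subseteq># m" for M
  proof -
    have M: "set_mset M \<subseteq> {..<K}" using that m by (meson mset_subset_eqD subset_iff)
    have "positive_part M \<subseteq># positive_part m" "positive_part m - positive_part M = positive_part (m - M)"
      using that unfolding positive_part_def by (auto simp: multiset_filter_mono)
    then show ?thesis
      by (simp add: prod.distrib prod_yv_powers[OF M] mult.assoc nth_const_mult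
          mfps_nth_xmon_mult block_coeff_def)
  qed
  then show ?thesis
    unfolding sum_subset_mset_prod[OF m, symmetric] mfps_nth_sum by (intro sum.cong) auto
qed

lemma lin_part_Suc:
  assumes "b < K"
  shows "lin_part t K (Suc b) = lin_part t K b + (1 - mfps_const t) * yv b"
proof -
  have "{b..<K} = insert b {Suc b..<K}" using assms by auto
  then show ?thesis by (simp add: lin_part_def algebra_simps)
qed

lemma geometric_sum_times:
  fixes p q :: "'a::comm_ring_1"
  shows "(q - p) * (\<Sum>j<n. p ^ j * q ^ (n - Suc j)) = q ^ n - p ^ n"
proof -
  have "(p - q) * (\<Sum>j<n. p ^ j * q ^ (n - Suc j)) = p ^ n - q ^ n"
    using power_diff_sumr2[of p n q] by (simp add: mult.commute)
  then have "- ((p - q) * (\<Sum>j<n. p ^ j * q ^ (n - Suc j))) = - (p ^ n - q ^ n)" by simp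
  then show ?thesis by (simp add: algebra_simps)
qed

lemma block_sum_split:
  "(\<Sum>j\<le>c. p ^ j * block_factor t K b (c - j)) =
     lin_part t K (Suc b) * (\<Sum>j<c. p ^ j * lin_full t K b ^ (c - Suc j)) + p ^ c"
proof -
  have "(\<Sum>j\<le>c. p ^ j * block_factor t K b (c - j)) = (\<Sum>j<c. p ^ j * block_factor t K b (c - j)) + p ^ c"
    by (simp add: lessThan_Suc_atMost[symmetric] block_factor_def)
  also have "(\<Sum>j<c. p ^ j * block_factor t K b (c - j)) =
      lin_part t K (Suc b) * (\<Sum>j<c. p ^ j * lin_full t K b ^ (c - Suc j))"
    unfolding sum_distrib_left by (intro sum.cong) (auto simp: block_factor_def algebra_simps)
  finally show ?thesis .
qed

text \<open>Geometric sum, because \<open>lin_full t K b\<close> and \<open>t * yv b\<close> differ by exactly the linear form that is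
  the first factor of \<open>block_factor\<close>.\<close>

lemma block_sum_t:
  "(\<Sum>j\<le>c. (mfps_const t * yv b) ^ j * block_factor t K b (c - j)) = lin_full t K b ^ c"
  using geometric_sum_times[of "lin_full t K b" "mfps_const t * yv b" c]
  by (simp add: block_sum_split lin_full_def)

text \<open>Here the two bases of the geometric sum differ by \<open>lin_part t K b\<close> instead, while the first
  factor of \<open>block_factor\<close> is \<open>lin_part t K (Suc b)\<close>. Passing from one to the other is what makes
  the products over all letters telescope.\<close>

lemma block_sum_1:
  assumes "b < K"
  shows "lin_part t K b * (\<Sum>j\<le>c. yv b ^ j * block_factor t K b (c - j)) =
    lin_part t K (Suc b) * lin_full t K b ^ c - (1 - mfps_const t) * yv b ^ Suc c"
proof -
  have 1: "lin_full t K b - yv b = lin_part t K b"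
    by (simp add: lin_full_def lin_part_Suc[OF assms] algebra_simps)
  define Q where "Q = (\<Sum>j<c. yv b ^ j * lin_full t K b ^ (c - Suc j))"
  have 2: "lin_part t K b * Q = lin_full t K b ^ c - yv b ^ c"
    using geometric_sum_times[of "lin_full t K b" "yv b" c] unfolding 1 Q_def .
  have "lin_part t K b * (lin_part t K (Suc b) * Q + yv b ^ c) =
      lin_part t K (Suc b) * (lin_part t K b * Q) + lin_part t K b * yv b ^ c"
    by (simp add: algebra_simps)
  also have "\<dots> = lin_part t K (Suc b) * lin_full t K b ^ c - (1 - mfps_const t) * yv b ^ Suc c"
    unfolding 2 lin_part_Suc[OF assms] by (simp add: algebra_simps)
  finally show ?thesis unfolding block_sum_split Q_def .
qed

lemma degree_less_yv: "degree_less 2 (yv a)"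
  by (auto simp: degree_less_def yv_def positive_part_def mfps_nth_xmon)

lemma degree_less_lin_part: "degree_less 2 (lin_part t K j)"
  unfolding lin_part_def
  by (intro degree_less_add degree_less_const_mult degree_less_sum degree_less_yv)

lemma degree_less_lin_full: "degree_less 2 (lin_full t K j)"
  unfolding lin_full_def
  by (intro degree_less_add degree_less_const_mult degree_less_lin_part degree_less_yv)

lemma degree_less_quotient: "degree_less c (\<Sum>j<c. yv b ^ j * lin_full t K b ^ (c - Suc j))"
proof (intro degree_less_sum)
  fix j assume j: "j \<in> {..<c}"
  have "degree_less (j + Suc (c - Suc j)) (yv b ^ j * lin_full t K b ^ (c - Suc j))"
    by (rule degree_less_mult[OF degree_less_power[OF degree_less_yv] degree_less_power[OF degree_less_lin_full]])
  then show "degree_less c (yv b ^ j * lin_full t K b ^ (c - Suc j))"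
    using j by simp
qed

lemma degree_less_block_sum:
  "degree_less (Suc c) (\<Sum>j\<le>c. yv b ^ j * block_factor t K b (c - j))"
  unfolding block_sum_split
proof (rule degree_less_add[OF _ degree_less_power[OF degree_less_yv]])
  show "degree_less (Suc c) (lin_part t K (Suc b) * (\<Sum>j<c. yv b ^ j * lin_full t K b ^ (c - Suc j)))"
    using degree_less_mult[OF _ degree_less_quotient, of 1 "lin_part t K (Suc b)" c b t K]
      degree_less_lin_part[of t K "Suc b"] by (simp add: numeral_2_eq_2)
qed

lemma yv_power_not_below:
  assumes "b > 0"
  shows "vanishes_below (positive_part m) (yv b ^ Suc (count m b))"
proof -
  have "count (repeat_mset (Suc (count m b)) (positive_part {#b#})) b = Suc (count m b)"
    using assms by (simp add: positive_part_def)
  moreover have "count (positive_part m) b = count m b"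
    using assms by (simp add: positive_part_def)
  ultimately have "\<not> repeat_mset (Suc (count m b)) (positive_part {#b#}) \<subseteq># positive_part m"
    by (metis Suc_n_not_le_n mset_subset_eq_count)
  then show ?thesis
    unfolding yv_def xmon_repeat by (rule vanishes_below_xmon)
qed

text \<open>Modulo the monomials that do not divide that of \<open>m\<close>, the power \<open>yv b ^ Suc (count m b)\<close>
  vanishes. Multiplied by the powers \<open>yv b ^ count m b\<close> of the later letters, the form \<open>lin_part\<close>
  therefore becomes the sum of all variables, and each factor contributes a multiple of it besides a
  pure power. The
  bound on the degree of the cofactor \<open>X\<close> keeps it away from the coefficient at \<open>m\<close>.\<close>

lemma block_sums_mod:
  fixes t :: "'a::comm_ring_1"
  assumes m: "set_mset m \<subseteq> {..<K}" and K: "1 \<le> K"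
  defines "g \<equiv> \<lambda>b. (\<Sum>j\<le>count m b. yv b ^ j * block_factor t K b (count m b - j))"
  shows "\<exists>X. degree_less (\<Sum>b\<in>{1..<K}. count m b) X \<and>
    vanishes_below (positive_part m) ((\<Prod>b\<in>{1..<K}. g b) - lin_part t K K * X - (\<Prod>b\<in>{1..<K}. yv b ^ count m b))"
proof -
  have "\<exists>X. degree_less (\<Sum>b\<in>{j..<K}. count m b) X \<and>
    vanishes_below (positive_part m) ((\<Prod>b\<in>{j..<K}. g b) - lin_part t K K * X - (\<Prod>b\<in>{j..<K}. yv b ^ count m b))"
    if "1 \<le> j" "j \<le> K" for j
    using that(2,1)
  proof (induction rule: inc_induct)
    case base
    show ?case by (rule exI[of _ 0]) (simp add: degree_less_def vanishes_below_def)
  next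
    case (step j)
    define Y where "Y = (\<Prod>b\<in>{Suc j..<K}. yv b ^ count m b :: 'a mfps)"
    define G where "G = (\<Prod>b\<in>{Suc j..<K}. g b)"
    define c where "c = count m j"
    define Q where "Q = (\<Sum>i<c. yv j ^ i * lin_full t K j ^ (c - Suc i))"
    define U where "U = lin_part t K K"
    define R where "R = (\<Sum>b\<in>{Suc j..<K}. yv b :: 'a mfps)"
    from step obtain X where X: "degree_less (\<Sum>b\<in>{Suc j..<K}. count m b) X"
        "vanishes_below (positive_part m) (G - U * X - Y)"
      unfolding Y_def G_def U_def by auto
    have gj: "g j = lin_part t K (Suc j) * Q + yv j ^ c"
      unfolding g_def Q_def c_def by (rule block_sum_split)
    have U: "lin_part t K (Suc j) = U - (1 - mfps_const t) * R"
    proof -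
      have *: "{..<K} = {..<Suc j} \<union> {Suc j..<K}" using step.hyps by auto
      have "(\<Sum>a<K. yv a :: 'a mfps) = (\<Sum>a<Suc j. yv a) + (\<Sum>a\<in>{Suc j..<K}. yv a)"
        unfolding * by (rule sum.union_disjoint) auto
      then show ?thesis by (simp add: U_def lin_part_def R_def algebra_simps)
    qed
    have RY: "vanishes_below (positive_part m) (R * Y)"
      unfolding R_def sum_distrib_right
    proof (intro vanishes_below_sum)
      fix b assume b: "b \<in> {Suc j..<K}"
      have "Y = yv b ^ count m b * (\<Prod>b\<in>{Suc j..<K} - {b}. yv b ^ count m b)"
        unfolding Y_def using b by (intro prod.remove) auto
      then have "yv b * Y = yv b ^ Suc (count m b) * (\<Prod>b\<in>{Suc j..<K} - {b}. yv b ^ count m b)"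
        by (simp add: mult.assoc)
      then show "vanishes_below (positive_part m) (yv b * Y)"
        using vanishes_below_mult(1)[OF yv_power_not_below[of b m]] b by simp
    qed
    have split: "{j..<K} = insert j {Suc j..<K}" using step.hyps by auto
    have "g j * G - U * (g j * X + Q * Y) - yv j ^ c * Y =
        g j * (G - U * X - Y) - (1 - mfps_const t) * Q * (R * Y)"
      unfolding gj U by (simp add: algebra_simps)
    moreover have "vanishes_below (positive_part m) (g j * (G - U * X - Y) - (1 - mfps_const t) * Q * (R * Y))"
      by (intro vanishes_below_diff vanishes_below_mult(2) X(2) RY)
    ultimately have "vanishes_below (positive_part m)
        ((\<Prod>b\<in>{j..<K}. g b) - U * (g j * X + Q * Y) - (\<Prod>b\<in>{j..<K}. yv b ^ count m b))"
      by (simp add: split G_def Y_def c_def)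
    moreover have "degree_less (\<Sum>b\<in>{j..<K}. count m b) (g j * X + Q * Y)"
    proof (rule degree_less_add)
      show "degree_less (\<Sum>b\<in>{j..<K}. count m b) (g j * X)"
        unfolding split using degree_less_mult[OF degree_less_block_sum X(1)] by (simp add: g_def)
      have "degree_less (Suc (\<Sum>b\<in>{Suc j..<K}. count m b)) Y"
        unfolding Y_def
      proof (induction rule: finite_induct[OF finite_atLeastLessThan[of "Suc j" K]])
        case 1
        then show ?case by (auto simp: degree_less_def one_mfps.rep_eq)
      next
        case (2 b F)
        from degree_less_mult[OF degree_less_power[OF degree_less_yv] this(3), of "count m b" b] 2(1,2)
        show ?case by simp
      qed
      from degree_less_mult[OF this degree_less_quotient, of c j t K]
      show "degree_less (\<Sum>b\<in>{j..<K}. count m b) (Q * Y)"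
        by (simp add: split Q_def c_def ac_simps)
    qed
    ultimately show ?case unfolding U_def by blast
  qed
  from this[of 1] K show ?thesis by simp
qed

text \<open>A series with constant term \<open>1\<close> can be cancelled, coefficient by coefficient from the lowest
  degree upwards.\<close>

lemma vanishes_below_unit:
  fixes Q :: "'a::comm_ring_1 mfps"
  assumes "vanishes_below m ((1 + (\<Sum>a\<in>A. xmon {#a#})) * Q)"
  shows "vanishes_below m Q"
  unfolding vanishes_below_def
proof (intro allI)
  fix k
  show "k \<subseteq># m \<longrightarrow> mfps_nth Q k = 0"
  proof (induction "size k" arbitrary: k rule: less_induct)
    case less
    show ?case
    proof
      assume k: "k \<subseteq># m"
      have "mfps_nth (xmon {#a#} * Q) k = 0" for a
      proof (cases "a \<in># k")
        case True
        have "size (k - {#a#}) < size k" using True by (rule size_Diff1_less)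
        moreover have "k - {#a#} \<subseteq># m"
          using k by (meson diff_subset_eq_self subset_mset.order_trans)
        ultimately have "mfps_nth Q (k - {#a#}) = 0" using less by blast
        then show ?thesis by (simp add: mfps_nth_xmon_mult)
      qed (simp add: mfps_nth_xmon_mult)
      then have "mfps_nth ((1 + (\<Sum>a\<in>A. xmon {#a#})) * Q) k = mfps_nth Q k"
        by (simp add: distrib_right sum_distrib_right)
      then show "mfps_nth Q k = 0" using assms k by (simp add: vanishes_below_def)
    qed
  qed
qed

text \<open>Both sums are coefficients of products over the letters, by \<open>weighted_block_coeff_sum\<close>; the
  products are related by \<open>nested_telescope\<close> after multiplication by the sum of all variables. As
  the variable of the colour \<open>0\<close> is \<open>1\<close>, that sum is a unit, and its cancellation leaves
  \<open>1 - t\<close> times the monomial of \<open>m\<close>.\<close>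

theorem block_coeff_identity:
  fixes t :: "'a::comm_ring_1"
  assumes m: "set_mset m \<subseteq> {..<K}" and K: "1 \<le> K"
  shows "(\<Sum>M | M \<subseteq># m. t ^ size M * block_coeff t K (m - M)) -
    t * (\<Sum>M | M \<subseteq># m. block_coeff t K (m - M)) = 1 - t"
proof -
  define F where "F b = lin_full t K b ^ count m b" for b
  define g where "g b = (\<Sum>j\<le>count m b. yv b ^ j * block_factor t K b (count m b - j))" for b
  define c where "c = 1 - mfps_const t"
  define U where "U = lin_part t K K"
  define P where "P = (\<Prod>b<K. F b) - mfps_const t * (\<Prod>b<K. g b)"
  define Y where "Y = (\<Prod>b\<in>{1..<K}. yv b ^ count m b :: 'a mfps)"
  let ?m = "positive_part m"
  have lhs: "(\<Sum>M | M \<subseteq># m. t ^ size M * block_coeff t K (m - M)) -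
    t * (\<Sum>M | M \<subseteq># m. block_coeff t K (m - M)) = mfps_nth P ?m"
    using weighted_block_coeff_sum[OF m, of t t] weighted_block_coeff_sum[OF m, of 1 t]
    by (simp add: P_def F_def g_def block_sum_t nth_const_mult)
  have yv0: "yv 0 = (1 :: 'a mfps)" by (simp add: yv_def positive_part_def)
  have yvp: "yv a = (xmon {#a#} :: 'a mfps)" if "a > 0" for a
    using that by (simp add: yv_def positive_part_def)
  have split: "{..<K} = insert 0 {1..<K}" using K by auto
  \<comment> \<open>The variable of the colour 0 provides the constant term.\<close>
  have U: "U = 1 + (\<Sum>a\<in>{1..<K}. xmon {#a#})"
    unfolding U_def lin_part_def split by (simp add: yv0 yvp)
  have U0: "lin_part t K 0 = mfps_const t * U"
    by (simp add: U_def lin_part_def atLeast0LessThan)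
  obtain X where X: "degree_less (\<Sum>b\<in>{1..<K}. count m b) X"
      "vanishes_below ?m ((\<Prod>b\<in>{1..<K}. g b) - U * X - Y)"
    using block_sums_mod[OF m K, of t] unfolding g_def U_def Y_def by blast
  have tele: "U * (\<Prod>b<K. F b) - lin_part t K 0 * (\<Prod>b<K. g b) =
      c * (\<Sum>j<K. yv j ^ Suc (count m j) * (\<Prod>b<j. F b) * (\<Prod>b\<in>{Suc j..<K}. g b))"
    unfolding U_def
    by (rule nested_telescope) (simp add: F_def g_def c_def block_sum_1)
  define S where "S = (\<Sum>j\<in>{1..<K}. yv j ^ Suc (count m j) * (\<Prod>b<j. F b) * (\<Prod>b\<in>{Suc j..<K}. g b))"
  have S: "vanishes_below ?m S"
    unfolding S_def
    by (intro vanishes_below_sum vanishes_below_mult(1) yv_power_not_below) auto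
  have UP: "U * P = c * (\<Prod>b\<in>{1..<K}. g b) + c * S"
    using tele unfolding P_def U0 split S_def by (simp add: yv0 algebra_simps)
  \<comment> \<open>Multiplying the full monomial by any further variable leaves the divisors of the monomial of m.\<close>
  have R: "vanishes_below ?m ((U - 1) * Y)"
    unfolding U add_diff_cancel_left' sum_distrib_right
  proof (intro vanishes_below_sum)
    fix b assume b: "b \<in> {1..<K}"
    have "Y = yv b ^ count m b * (\<Prod>b\<in>{1..<K} - {b}. yv b ^ count m b)"
      unfolding Y_def using b by (intro prod.remove) auto
    then have "xmon {#b#} * Y = yv b ^ Suc (count m b) * (\<Prod>b\<in>{1..<K} - {b}. yv b ^ count m b)"
      using b by (simp add: mult.assoc yvp)
    then show "vanishes_below ?m (xmon {#b#} * Y)"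
      using vanishes_below_mult(1)[OF yv_power_not_below[of b m]] b by simp
  qed
  have "U * (P - c * X - c * Y) = c * ((\<Prod>b\<in>{1..<K}. g b) - U * X - Y) + c * S - c * ((U - 1) * Y)"
  proof -
    have "U * (P - c * X - c * Y) = U * P - c * (U * X) - c * (U * Y)"
      by (simp only: right_diff_distrib mult.left_commute)
    then show ?thesis unfolding UP by (simp add: algebra_simps)
  qed
  also have "vanishes_below ?m \<dots>"
    by (intro vanishes_below_diff vanishes_below_add vanishes_below_mult(2)[OF X(2)]
        vanishes_below_mult(2)[OF S] vanishes_below_mult(2)[OF R])
  finally have "vanishes_below ?m (P - c * X - c * Y)"
    unfolding U by (rule vanishes_below_unit)
  then have "mfps_nth P ?m = mfps_nth (c * X) ?m + mfps_nth (c * Y) ?m"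
    by (simp add: vanishes_below_def algebra_simps)
  moreover have "mfps_nth (c * Z) k = (1 - t) * mfps_nth Z k" for Z k
    by (simp add: c_def left_diff_distrib nth_const_mult)
  moreover have "mfps_nth Y ?m = 1"
  proof -
    have "(\<Prod>b<K. (mfps_const 1 * yv b) ^ count m b) = (Y :: 'a mfps)"
      unfolding Y_def split by (simp add: yv0)
    then show ?thesis
      using prod_yv_powers[OF m, of "1::'a"] by (simp add: mfps_nth_xmon)
  qed
  moreover have "mfps_nth X ?m = 0"
  proof -
    have "size ?m = (\<Sum>b\<in>set_mset ?m. count ?m b)" by (simp add: size_multiset_overloaded_eq)
    also have "\<dots> = (\<Sum>b\<in>{1..<K}. count m b)"
      using m by (intro sum.mono_neutral_cong_left) (auto simp: positive_part_def Suc_le_eq not_in_iff)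
    finally show ?thesis using X(1) by (simp add: degree_less_def)
  qed
  ultimately show ?thesis unfolding lhs by simp
qed

section \<open>Level multisets and their generating polynomials\<close>

definition top :: "nat multiset \<Rightarrow> nat" where
  "top h = Max (insert 0 (set_mset h))"

text \<open>Inserting \<open>0\<close> makes the ground level count even if no element lies on it.\<close>

definition below :: "nat multiset \<Rightarrow> nat \<Rightarrow> nat" where
  "below h v = Max (insert 0 {w \<in> set_mset h. w < v})"

text \<open>The Feichtner--Yuzvinsky condition on exponents, read off from the number of factors that
  contain a given element: the gap below a level is the exponent of a flat of the chain, and the
  multiplicity of the level is the number of elements by which that flat exceeds the next smaller
  one. With \<open>e = 1\<close> the bound at the highest level, hence for the smallest flat of the chain, is
  weak.\<close>

definition fy_levels :: "nat \<Rightarrow> nat multiset \<Rightarrow> bool" where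
  "fy_levels e h \<longleftrightarrow>
     (\<forall>v\<in>#h. 0 < v \<longrightarrow> v - below h v < count h v + (if v = top h then e else 0))"

definition labelled :: "nat \<Rightarrow> nat multiset \<Rightarrow> (nat \<times> nat) multiset set" where
  "labelled e m = {M. image_mset fst M = m \<and> fy_levels e (image_mset snd M)}"

abbreviation height :: "(nat \<times> nat) multiset \<Rightarrow> nat" where
  "height M \<equiv> top (image_mset snd M)"

definition tvar :: "int poly" where "tvar = monom 1 1"

definition level_gf :: "nat \<Rightarrow> nat multiset \<Rightarrow> int poly" where
  "level_gf e m = (\<Sum>M\<in>labelled e m. tvar ^ height M)"

lemma top_ge: "v \<in># h \<Longrightarrow> v \<le> top h"
  by (simp add: top_def)

lemma top_mem: "0 < top h \<Longrightarrow> top h \<in># h"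
  using Max_in[of "insert 0 (set_mset h)"] by (auto simp: top_def)

lemma top_le: "(\<And>v. v \<in># h \<Longrightarrow> v \<le> c) \<Longrightarrow> top h \<le> c"
  by (simp add: top_def)

lemma top_empty [simp]: "top {#} = 0"
  by (simp add: top_def)

text \<open>The condition at a level involves only its multiplicity and the next smaller level. Hence the
  highest level can be taken off without changing the conditions at the others.\<close>

lemma fy_levels_peel:
  assumes h': "\<And>w. w \<in># h' \<Longrightarrow> w < v" and c: "0 < c" and v: "0 < v"
  shows "top (h' + replicate_mset c v) = v"
    and "fy_levels e (h' + replicate_mset c v) \<longleftrightarrow> v - top h' < c + e \<and> fy_levels 0 h'"
proof -
  let ?h = "h' + replicate_mset c v"
  have set: "set_mset ?h = insert v (set_mset h')" using c by auto
  show top: "top ?h = v"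
    unfolding top_def set by (intro Max_eqI) (use h' in \<open>auto simp: less_imp_le\<close>)
  have nv: "v \<notin># h'" using h' by blast
  have bv: "below ?h v = top h'"
  proof -
    have "{w \<in> set_mset ?h. w < v} = set_mset h'" using set h' by auto
    then show ?thesis by (simp add: below_def top_def)
  qed
  have bw: "below ?h w = below h' w" if "w \<in># h'" for w
  proof -
    have "{u \<in> set_mset ?h. u < w} = {u \<in> set_mset h'. u < w}" using set h'[OF that] by auto
    then show ?thesis by (simp add: below_def)
  qed
  have cw: "count ?h w = count h' w" "w \<noteq> v" if "w \<in># h'" for w
    using h'[OF that] by auto
  have "fy_levels e ?h \<longleftrightarrow> v - top h' < count ?h v + e \<and>
      (\<forall>w\<in>#h'. 0 < w \<longrightarrow> w - below ?h w < count ?h w + (if w = v then e else 0))"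
    unfolding fy_levels_def top set by (simp add: bv v)
  also have "\<dots> \<longleftrightarrow> v - top h' < c + e \<and> fy_levels 0 h'"
    using nv bw cw by (auto simp: fy_levels_def not_in_iff)
  finally show "fy_levels e ?h \<longleftrightarrow> v - top h' < c + e \<and> fy_levels 0 h'" .
qed

text \<open>The colours in \<open>B\<close> are put on a new highest level, at distance \<open>a\<close> above \<open>M\<close>.\<close>

definition stack :: "nat multiset \<times> nat \<times> (nat \<times> nat) multiset \<Rightarrow> (nat \<times> nat) multiset" where
  "stack = (\<lambda>(B, a, M). M + image_mset (\<lambda>x. (x, height M + a)) B)"

definition stack_data :: "nat \<Rightarrow> nat multiset \<Rightarrow> (nat multiset \<times> nat \<times> (nat \<times> nat) multiset) set" where
  "stack_data e m = (SIGMA B:{B. B \<subseteq># m \<and> B \<noteq> {#}}. {1..<size B + e} \<times> labelled 0 (m - B))"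

lemma image_snd_const: "image_mset (\<lambda>x. v) B = replicate_mset (size B) v"
  by (induction B) auto

lemma stack_levels:
  "image_mset snd (stack (B, a, M)) = image_mset snd M + replicate_mset (size B) (height M + a)"
  by (simp add: stack_def multiset.map_comp comp_def image_snd_const)

lemma stack_bij:
  "bij_betw stack (stack_data e m) {M \<in> labelled e m. 0 < height M}"
proof (rule bij_betw_byWitness[where f' = "\<lambda>M. (image_mset fst (filter_mset (\<lambda>p. snd p = height M) M),
    height M - height (filter_mset (\<lambda>p. snd p \<noteq> height M) M), filter_mset (\<lambda>p. snd p \<noteq> height M) M)"])
  let ?inv = "\<lambda>M. (image_mset fst (filter_mset (\<lambda>p. snd p = height M) M),
    height M - height (filter_mset (\<lambda>p. snd p \<noteq> height M) M), filter_mset (\<lambda>p. snd p \<noteq> height M) M)"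
  have top: "height (stack (B, a, M)) = height M + a"
       "fy_levels e (image_mset snd (stack (B, a, M))) \<longleftrightarrow> a < size B + e \<and> fy_levels 0 (image_mset snd M)"
    if "B \<noteq> {#}" "1 \<le> a" for B a M e
  proof -
    have lt: "w < height M + a" if "w \<in># image_mset snd M" for w
      using top_ge[OF that] \<open>1 \<le> a\<close> by simp
    show "height (stack (B, a, M)) = height M + a"
       "fy_levels e (image_mset snd (stack (B, a, M))) \<longleftrightarrow> a < size B + e \<and> fy_levels 0 (image_mset snd M)"
      unfolding stack_levels
      using that fy_levels_peel[of "image_mset snd M" "height M + a" "size B", OF lt]
      by (simp_all add: nonempty_has_size)
  qed
  have gt: "snd p < height M + a" if "p \<in># M" "1 \<le> a" for p and M :: "(nat \<times> nat) multiset" and a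
    using top_ge[of "snd p" "image_mset snd M"] that by simp
  show "\<forall>x\<in>stack_data e m. ?inv (stack x) = x"
  proof
    fix x assume "x \<in> stack_data e m"
    then obtain B a M where x: "x = (B, a, M)" "B \<noteq> {#}" "1 \<le> a" by (auto simp: stack_data_def)
    have "filter_mset (\<lambda>p. snd p \<noteq> height M + a) M = M"
      "filter_mset (\<lambda>p. snd p = height M + a) M = {#}"
      using gt[OF _ x(3), of _ M] by (force simp: filter_mset_eq_conv)+
    then show "?inv (stack x) = x"
      unfolding x(1) top(1)[OF x(2,3)]
      by (simp add: stack_def filter_mset_image_mset comp_def multiset.map_comp)
  qed
  show "stack ` stack_data e m \<subseteq> {M \<in> labelled e m. 0 < height M}"
  proof
    fix N assume "N \<in> stack ` stack_data e m"
    then obtain B a M where x: "N = stack (B, a, M)" "B \<noteq> {#}" "1 \<le> a" "a < size B + e" "B \<subseteq># m"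
      "M \<in> labelled 0 (m - B)" by (auto simp: stack_data_def)
    have "image_mset fst N = m"
      using x by (simp add: stack_def labelled_def multiset.map_comp comp_def)
    then show "N \<in> {M \<in> labelled e m. 0 < height M}"
      using x top[OF x(2,3)] by (simp add: labelled_def)
  qed
  have back_inv: "stack (?inv N) = N" if "0 < height N" for N
  proof -
    let ?v = "height N" and ?M = "filter_mset (\<lambda>p. snd p \<noteq> height N) N"
    have "height ?M \<le> ?v" by (intro top_le top_ge) auto
    then have "height ?M + (?v - height ?M) = ?v" by simp
    moreover have "image_mset (\<lambda>x. (x, ?v)) (image_mset fst (filter_mset (\<lambda>p. snd p = ?v) N)) =
        image_mset id (filter_mset (\<lambda>p. snd p = ?v) N)"
      unfolding multiset.map_comp by (intro image_mset_cong) auto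
    ultimately show ?thesis
      unfolding stack_def by simp
  qed
  then show "\<forall>N\<in>{M \<in> labelled e m. 0 < height M}. stack (?inv N) = N" by simp
  show "?inv ` {M \<in> labelled e m. 0 < height M} \<subseteq> stack_data e m"
  proof
    fix y assume "y \<in> ?inv ` {M \<in> labelled e m. 0 < height M}"
    then obtain N where N: "N \<in> labelled e m" "0 < height N" "y = ?inv N" by blast
    obtain B a M where y: "y = (B, a, M)" by (metis prod_cases3)
    have BaM: "(B, a, M) = ?inv N" using N(3) unfolding y .
    have stack: "stack (B, a, M) = N" unfolding BaM by (rule back_inv[OF N(2)])
    have "height N \<in># image_mset snd N" using top_mem[OF N(2)] .
    then have B: "B \<noteq> {#}" using BaM by (auto simp: filter_mset_eq_mempty_iff)
    have "height M < height N"
    proof (cases "height M = 0")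
      case False
      then have "height M \<in># image_mset snd M" by (intro top_mem) simp
      then have "height M \<in># image_mset snd N" "height M \<noteq> height N" using BaM by auto
      then show ?thesis by (intro le_neq_implies_less top_ge)
    qed (use N(2) in simp)
    moreover have "a = height N - height M" using BaM by simp
    ultimately have a: "1 \<le> a" by simp
    have "image_mset fst M + B = m"
      using N(1) stack by (auto simp: labelled_def stack_def multiset.map_comp comp_def)
    then have "B \<subseteq># m" "image_mset fst M = m - B" by auto
    moreover have "a < size B + e \<and> fy_levels 0 (image_mset snd M)"
      using N(1) stack top(2)[OF B a] by (auto simp: labelled_def)
    ultimately show "y \<in> stack_data e m"
      unfolding y stack_data_def using B a by (auto simp: labelled_def)
  qed
qed

lemma labelled_height_0:
  "{M \<in> labelled e m. height M = 0} = {image_mset (\<lambda>x. (x, 0)) m}"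
proof -
  have "M = image_mset (\<lambda>x. (x, 0)) (image_mset fst M)" if "height M = 0" for M
  proof -
    have "snd p = 0" if "p \<in># M" for p
      using top_ge[of "snd p" "image_mset snd M"] that \<open>height M = 0\<close> by simp
    then have "image_mset (\<lambda>x. (x, 0)) (image_mset fst M) = image_mset id M"
      unfolding multiset.map_comp by (intro image_mset_cong) auto
    then show ?thesis by simp
  qed
  moreover have "image_mset (\<lambda>x. (x, 0)) m \<in> labelled e m"
    by (auto simp: labelled_def fy_levels_def multiset.map_comp comp_def)
  moreover have "height (image_mset (\<lambda>x. (x, 0)) m) = 0"
  proof -
    have "height (image_mset (\<lambda>x. (x, 0)) m) \<le> 0" by (rule top_le) auto
    then show ?thesis by simp
  qed
  ultimately show ?thesis by (auto simp: labelled_def)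
qed

lemma labelled_split:
  "labelled e m = insert (image_mset (\<lambda>x. (x, 0)) m) {M \<in> labelled e m. 0 < height M}"
proof -
  have "labelled e m = {M \<in> labelled e m. height M = 0} \<union> {M \<in> labelled e m. 0 < height M}"
    by auto
  then show ?thesis unfolding labelled_height_0 by simp
qed

lemma finite_subset_mset [simp, intro]: "finite {B. B \<subseteq># m \<and> P B}"
proof -
  have "{B. B \<subseteq># m} \<subseteq> fst ` splits m"
    by (force simp: splits_def subset_mset.le_iff_add image_iff)
  then have "finite {B. B \<subseteq># m}" using finite_splits finite_subset by blast
  then show ?thesis by (rule rev_finite_subset) auto
qed

lemma finite_subset_mset' [simp, intro]: "finite {B. B \<subseteq># m}"
  using finite_subset_mset[of m "\<lambda>_. True"] by simp

lemma finite_labelled [simp, intro]: "finite (labelled e m)"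
proof (induction "size m" arbitrary: m e rule: less_induct)
  case less
  have "finite (labelled 0 (m - B))" if "B \<subseteq># m" "B \<noteq> {#}" for B
  proof (rule less)
    have "0 < size B" "size B \<le> size m"
      using that by (simp_all add: nonempty_has_size size_mset_mono)
    then show "size (m - B) < size m" using that(1) by (simp add: size_Diff_submset)
  qed
  then have "finite (stack_data e m)"
    unfolding stack_data_def by (intro finite_SigmaI finite_cartesian_product) auto
  then have "finite {M \<in> labelled e m. 0 < height M}"
    using bij_betw_finite[OF stack_bij] by blast
  then have "finite (insert (image_mset (\<lambda>x. (x, 0)) m) {M \<in> labelled e m. 0 < height M})"
    by simp
  then show ?case by (simp only: labelled_split[of e m, symmetric])
qed

definition tsum :: "nat \<Rightarrow> int poly" where
  "tsum c = (\<Sum>a\<in>{1..<c}. tvar ^ a)"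

text \<open>Classification by the multiset of colours on the highest level and by its distance to the level
  below.\<close>

lemma level_gf_rec:
  "level_gf e m = 1 + (\<Sum>B | B \<subseteq># m \<and> B \<noteq> {#}. tsum (size B + e) * level_gf 0 (m - B))"
proof -
  have "level_gf e m = 1 + (\<Sum>M | M \<in> labelled e m \<and> 0 < height M. tvar ^ height M)"
  proof -
    have "image_mset (\<lambda>x. (x, 0)) m \<in> {M \<in> labelled e m. height M = 0}"
      unfolding labelled_height_0 by simp
    then have "height (image_mset (\<lambda>x. (x, 0)) m) = 0" by simp
    moreover have "finite {M \<in> labelled e m. 0 < height M}" by simp
    ultimately have *: "(\<Sum>M\<in>insert (image_mset (\<lambda>x. (x, 0)) m) {M \<in> labelled e m. 0 < height M}. tvar ^ height M) =
        1 + (\<Sum>M | M \<in> labelled e m \<and> 0 < height M. tvar ^ height M)"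
      by (subst sum.insert) simp_all
    show ?thesis
      unfolding level_gf_def by (subst labelled_split[of e m]) (rule *)
  qed
  also have "(\<Sum>M | M \<in> labelled e m \<and> 0 < height M. tvar ^ height M) =
      (\<Sum>x\<in>stack_data e m. tvar ^ height (stack x))"
    by (rule sum.reindex_bij_betw[OF stack_bij, symmetric])
  also have "\<dots> = (\<Sum>x\<in>stack_data e m. tvar ^ fst (snd x) * tvar ^ height (snd (snd x)))"
  proof (intro sum.cong refl)
    fix x assume "x \<in> stack_data e m"
    then obtain B a M where x: "x = (B, a, M)" "B \<noteq> {#}" "1 \<le> a" by (auto simp: stack_data_def)
    have lt: "w < height M + a" if "w \<in># image_mset snd M" for w
      using top_ge[OF that] x(3) by simp
    have "height (stack x) = height M + a"
      unfolding x(1) stack_levels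
      using x fy_levels_peel(1)[of "image_mset snd M" "height M + a" "size B", OF lt]
      by (simp add: nonempty_has_size)
    then show "tvar ^ height (stack x) = tvar ^ fst (snd x) * tvar ^ height (snd (snd x))"
      by (simp add: x(1) power_add mult.commute)
  qed
  also have "\<dots> = (\<Sum>B | B \<subseteq># m \<and> B \<noteq> {#}. tsum (size B + e) * level_gf 0 (m - B))"
  proof -
    have "(\<Sum>x\<in>stack_data e m. tvar ^ fst (snd x) * tvar ^ height (snd (snd x))) =
        (\<Sum>B | B \<subseteq># m \<and> B \<noteq> {#}. \<Sum>y\<in>{1..<size B + e} \<times> labelled 0 (m - B). tvar ^ fst y * tvar ^ height (snd y))"
      unfolding stack_data_def by (subst sum.Sigma) (simp_all add: case_prod_unfold)
    also have "\<dots> = (\<Sum>B | B \<subseteq># m \<and> B \<noteq> {#}. tsum (size B + e) * level_gf 0 (m - B))"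
    proof (intro sum.cong refl)
      fix B
      show "(\<Sum>y\<in>{1..<size B + e} \<times> labelled 0 (m - B). tvar ^ fst y * tvar ^ height (snd y)) =
          tsum (size B + e) * level_gf 0 (m - B)"
        unfolding tsum_def level_gf_def sum_product sum.cartesian_product case_prod_unfold ..
    qed
    finally show ?thesis .
  qed
  finally show ?thesis .
qed

definition labelled_pos :: "nat \<Rightarrow> nat multiset \<Rightarrow> (nat \<times> nat) multiset set" where
  "labelled_pos e m = {M \<in> labelled e m. 0 \<notin># image_mset snd M}"

lemma finite_labelled_pos: "finite (labelled_pos e m)"
  unfolding labelled_pos_def by (rule finite_subset[OF _ finite_labelled[of e m]]) blast

definition pos_gf :: "nat \<Rightarrow> nat multiset \<Rightarrow> int poly" where
  "pos_gf e m = (\<Sum>M\<in>labelled_pos e m. tvar ^ height M)"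

lemma zero_level:
  fixes M :: "(nat \<times> nat) multiset" and B :: "nat multiset"
  defines "N \<equiv> M + image_mset (\<lambda>x. (x, 0)) B"
  shows "height N = height M" "fy_levels e (image_mset snd N) \<longleftrightarrow> fy_levels e (image_mset snd M)"
proof -
  have snd: "image_mset snd N = image_mset snd M + replicate_mset (size B) 0"
    by (simp add: N_def multiset.map_comp comp_def image_snd_const)
  have set: "insert 0 (set_mset (image_mset snd N)) = insert 0 (set_mset (image_mset snd M))"
    unfolding snd by auto
  show top: "height N = height M" unfolding top_def set ..
  have below: "below (image_mset snd N) v = below (image_mset snd M) v" for v
  proof -
    have *: "insert 0 {w \<in> A. w < v} = insert 0 {w \<in> insert 0 A. w < v}" for A
      by auto
    have "insert 0 {w \<in> set_mset (image_mset snd N). w < v} = insert 0 {w \<in> set_mset (image_mset snd M). w < v}"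
      by (subst (1 2) *) (simp only: set)
    then show ?thesis unfolding below_def by simp
  qed
  have cnt: "count (image_mset snd N) v = count (image_mset snd M) v" if "0 < v" for v
    unfolding snd using that by simp
  have mem: "v \<in># image_mset snd N \<longleftrightarrow> v \<in># image_mset snd M" if "0 < v" for v
    using cnt[OF that] by (metis count_eq_zero_iff)
  show "fy_levels e (image_mset snd N) \<longleftrightarrow> fy_levels e (image_mset snd M)"
    unfolding fy_levels_def top below using cnt mem by metis
qed

text \<open>Nothing is required of the elements of level \<open>0\<close>, so they can be split off freely.\<close>

lemma level_gf_zero_block:
  "level_gf e m = (\<Sum>B | B \<subseteq># m. pos_gf e (m - B))"
proof -
  have "level_gf e m = (\<Sum>x\<in>(SIGMA B:{B. B \<subseteq># m}. labelled_pos e (m - B)). tvar ^ height (snd x))"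
    unfolding level_gf_def
  proof (rule sum.reindex_bij_witness[where i = "\<lambda>(B, M). M + image_mset (\<lambda>x. (x, 0)) B"
        and j = "\<lambda>M. (image_mset fst (filter_mset (\<lambda>p. snd p = 0) M), filter_mset (\<lambda>p. snd p \<noteq> 0) M)"])
    fix N assume N: "N \<in> labelled e m"
    let ?j = "(image_mset fst (filter_mset (\<lambda>p. snd p = 0) N), filter_mset (\<lambda>p. snd p \<noteq> 0) N)"
    let ?B = "image_mset fst (filter_mset (\<lambda>p. snd p = 0) N)" and ?M = "filter_mset (\<lambda>p. snd p \<noteq> 0) N"
    have "image_mset (\<lambda>x. (x, 0)) ?B = image_mset id (filter_mset (\<lambda>p. snd p = 0) N)"
      unfolding multiset.map_comp by (intro image_mset_cong) auto
    then have eq: "?M + image_mset (\<lambda>x. (x, 0)) ?B = N"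
      by simp
    then show "(case ?j of (B, M) \<Rightarrow> M + image_mset (\<lambda>x. (x, 0)) B) = N" by simp
    have "image_mset fst ?M + ?B = image_mset fst N"
      by (subst eq[symmetric]) (simp add: multiset.map_comp comp_def)
    then have "image_mset fst ?M + ?B = m"
      using N by (simp add: labelled_def)
    then have "?B \<subseteq># m" "image_mset fst ?M = m - ?B"
      by auto
    moreover have "fy_levels e (image_mset snd ?M)"
      using zero_level(2)[of e ?M ?B] N unfolding eq by (simp add: labelled_def)
    ultimately show "?j \<in> (SIGMA B:{B. B \<subseteq># m}. labelled_pos e (m - B))"
      by (auto simp: labelled_pos_def labelled_def)
    show "tvar ^ height (snd ?j) = tvar ^ height N"
      using zero_level(1)[of ?M ?B] unfolding eq by simp
  next
    fix x assume "x \<in> (SIGMA B:{B. B \<subseteq># m}. labelled_pos e (m - B))"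
    then obtain B M where x: "x = (B, M)" "B \<subseteq># m" "M \<in> labelled_pos e (m - B)" by auto
    have nz: "snd p \<noteq> 0" if "p \<in># M" for p
      using x(3) that unfolding labelled_pos_def by (metis (mono_tags, lifting) image_eqI mem_Collect_eq set_image_mset)
    have "filter_mset (\<lambda>p. snd p = 0) M = {#}" "filter_mset (\<lambda>p. snd p \<noteq> 0) M = M"
      using nz by (auto simp: filter_mset_eq_mempty_iff filter_mset_eq_conv)
    then show "(\<lambda>M. (image_mset fst (filter_mset (\<lambda>p. snd p = 0) M), filter_mset (\<lambda>p. snd p \<noteq> 0) M))
        ((\<lambda>(B, M). M + image_mset (\<lambda>x. (x, 0)) B) x) = x"
      by (simp add: x(1) filter_mset_image_mset multiset.map_comp comp_def)
    show "(case x of (B, M) \<Rightarrow> M + image_mset (\<lambda>x. (x, 0)) B) \<in> labelled e m"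
      using x zero_level(2)[of e M B]
      by (simp add: labelled_pos_def labelled_def multiset.map_comp comp_def)
  qed
  also have "\<dots> = (\<Sum>B | B \<subseteq># m. pos_gf e (m - B))"
    using sum.Sigma[of "{B. B \<subseteq># m}" "\<lambda>B. labelled_pos e (m - B)" "\<lambda>B M. tvar ^ height M"]
      finite_labelled_pos
    unfolding pos_gf_def case_prod_unfold by simp
  finally show ?thesis .
qed

section \<open>Matching the two recursions\<close>

lemma tvar_geometric: "0 < c \<Longrightarrow> (1 - tvar) * tsum c = tvar - tvar ^ c"
proof (induction c rule: nat_induct_non_zero)
  case 1
  then show ?case by (simp add: tsum_def)
next
  case (Suc c)
  then have "tsum (Suc c) = tsum c + tvar ^ c"
    by (simp add: tsum_def atLeastLessThanSuc)
  then have "(1 - tvar) * tsum (Suc c) = (1 - tvar) * tsum c + (1 - tvar) * tvar ^ c"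
    by (simp add: distrib_left)
  then show ?case unfolding Suc.IH by (simp add: algebra_simps)
qed

lemma tvar_not_1: "1 - tvar \<noteq> 0"
proof
  assume "1 - tvar = 0"
  then have "coeff (1 - tvar) 0 = 0" by simp
  then show False by (simp add: tvar_def)
qed

lemma tsum_Suc: "0 < c \<Longrightarrow> tsum (Suc c) = tvar + tvar * tsum c"
proof (induction c rule: nat_induct_non_zero)
  case 1
  then show ?case by (simp add: tsum_def atLeastLessThanSuc)
next
  case (Suc c)
  have step: "tsum (Suc d) = tsum d + tvar ^ d" if "0 < d" for d
    using that by (simp add: tsum_def atLeastLessThanSuc)
  have "tsum (Suc (Suc c)) = tvar + tvar * tsum c + tvar ^ Suc c"
    using step[of "Suc c"] Suc.IH by simp
  also have "\<dots> = tvar + tvar * (tsum c + tvar ^ c)"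
    by (simp add: algebra_simps)
  also have "tsum c + tvar ^ c = tsum (Suc c)" using step[OF Suc.hyps] by simp
  finally show ?case .
qed

lemma sum_subset_mset_nonempty:
  "(\<Sum>B | B \<subseteq># m. f B) = f {#} + (\<Sum>B | B \<subseteq># m \<and> B \<noteq> {#}. f B :: 'a::comm_monoid_add)"
proof -
  have "{B. B \<subseteq># m} = insert {#} {B. B \<subseteq># m \<and> B \<noteq> {#}}" by auto
  then show ?thesis by (simp add: sum.insert)
qed

lemma sum_subset_mset_complement:
  "(\<Sum>B | B \<subseteq># m. f (m - B)) = (\<Sum>B | B \<subseteq># m. f B :: 'a::comm_monoid_add)"
  by (rule sum.reindex_bij_witness[where i = "\<lambda>B. m - B" and j = "\<lambda>B. m - B"])
    (auto simp: multiset_eq_iff subseteq_mset_def)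

text \<open>Dividing the identity for block coefficients by \<open>1 - t\<close> turns it into the recursion that
  \<open>level_gf\<close> satisfies.\<close>

lemma block_coeff_rec:
  assumes m: "set_mset m \<subseteq> {..<K}" and K: "1 \<le> K"
  shows "block_coeff tvar K m = 1 + (\<Sum>B | B \<subseteq># m \<and> B \<noteq> {#}. tsum (size B) * block_coeff tvar K (m - B))"
proof -
  let ?A = "block_coeff tvar K"
  let ?S = "\<Sum>B | B \<subseteq># m \<and> B \<noteq> {#}. tsum (size B) * ?A (m - B)"
  have "(\<Sum>B | B \<subseteq># m. tvar ^ size B * ?A (m - B)) - tvar * (\<Sum>B | B \<subseteq># m. ?A (m - B)) = 1 - tvar"
    by (rule block_coeff_identity[OF m K])
  then have "(1 - tvar) * ?A m + (\<Sum>B | B \<subseteq># m \<and> B \<noteq> {#}. (tvar ^ size B - tvar) * ?A (m - B)) = 1 - tvar"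
    by (simp add: sum_subset_mset_nonempty sum_distrib_left sum_subtractf algebra_simps)
  moreover have "(\<Sum>B | B \<subseteq># m \<and> B \<noteq> {#}. (tvar ^ size B - tvar) * ?A (m - B)) = - ((1 - tvar) * ?S)"
  proof -
    have "(tvar ^ size B - tvar) * ?A (m - B) = - ((1 - tvar) * (tsum (size B) * ?A (m - B)))"
      if "B \<noteq> {#}" for B
      using tvar_geometric[of "size B"] that
      by (simp add: nonempty_has_size mult.assoc[symmetric]) (simp add: algebra_simps)
    then show ?thesis by (simp add: sum_distrib_left sum_negf[symmetric])
  qed
  ultimately have "(1 - tvar) * (?A m - (1 + ?S)) = 0" by (simp add: algebra_simps)
  then show ?thesis using tvar_not_1 by simp
qed

lemma block_coeff_eq_level_gf:
  assumes m: "set_mset m \<subseteq> {..<K}" and K: "1 \<le> K"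
  shows "block_coeff tvar K m = level_gf 0 m"
  using m
proof (induction "size m" arbitrary: m rule: less_induct)
  case less
  have "block_coeff tvar K (m - B) = level_gf 0 (m - B)" if "B \<subseteq># m" "B \<noteq> {#}" for B
  proof (rule less(1))
    have "0 < size B" "size B \<le> size m"
      using that by (simp_all add: nonempty_has_size size_mset_mono)
    then show "size (m - B) < size m" using that(1) by (simp add: size_Diff_submset)
    show "set_mset (m - B) \<subseteq> {..<K}" using less(2) by (meson in_diffD subset_iff)
  qed
  then show ?case
    unfolding block_coeff_rec[OF less(2) K] level_gf_rec[of 0 m] by simp
qed

lemma level_gf_empty: "level_gf e {#} = 1"
proof -
  have *: "{B :: nat multiset. B \<subseteq># {#} \<and> B \<noteq> {#}} = {}" by auto
  show ?thesis unfolding level_gf_rec[of e "{#}"] * by simp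
qed

text \<open>The weaker bound at the top admits one more distance: \<open>tsum (Suc c) = tvar + tvar * tsum c\<close>. The
  second summand reproduces the recursion for \<open>level_gf 0\<close>, the first one the sum over all smaller
  contents. This is the passage from \<open>eulerian_Q\<close> to \<open>eulerian_Q_tilde\<close>.\<close>

lemma level_gf_1:
  "level_gf 1 m = 1 + tvar * (\<Sum>B | B \<subseteq># m \<and> B \<noteq> {#}. level_gf 0 B)"
proof -
  let ?L = "level_gf 0"
  have "level_gf 1 m = 1 + (\<Sum>B | B \<subseteq># m \<and> B \<noteq> {#}. (tvar + tvar * tsum (size B)) * ?L (m - B))"
    by (subst level_gf_rec) (simp add: tsum_Suc nonempty_has_size)
  also have "\<dots> = 1 + tvar * (\<Sum>B | B \<subseteq># m \<and> B \<noteq> {#}. ?L (m - B)) + tvar * (?L m - 1)"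
    by (subst (3) level_gf_rec) (simp add: sum.distrib sum_distrib_left algebra_simps)
  also have "\<dots> = 1 + tvar * ((\<Sum>B | B \<subseteq># m. ?L (m - B)) - 1)"
    by (simp add: sum_subset_mset_nonempty algebra_simps)
  also have "\<dots> = 1 + tvar * (\<Sum>B | B \<subseteq># m \<and> B \<noteq> {#}. ?L B)"
    unfolding sum_subset_mset_complement[of ?L] by (simp add: sum_subset_mset_nonempty level_gf_empty)
  finally show ?thesis .
qed

text \<open>The expansions \<open>level_gf_zero_block\<close> and \<open>level_gf_1\<close> of the same polynomial agree in all terms
  with smaller content, by induction, hence also in the remaining one.\<close>

lemma pos_gf_1:
  assumes "m \<noteq> {#}"
  shows "pos_gf 1 m = tvar * level_gf 0 m"
  using assms
proof (induction "size m" arbitrary: m rule: less_induct)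
  case less
  have split: "(\<Sum>B | B \<subseteq># m \<and> B \<noteq> {#}. f B) = f m + (\<Sum>B | B \<subset># m \<and> B \<noteq> {#}. f B)"
    for f :: "nat multiset \<Rightarrow> int poly"
  proof -
    have "{B. B \<subseteq># m \<and> B \<noteq> {#}} = insert m {B. B \<subset># m \<and> B \<noteq> {#}}"
      using less(2) by (auto simp: subset_mset.le_less)
    moreover have "finite {B. B \<subset># m \<and> B \<noteq> {#}}"
      by (rule finite_subset[OF _ finite_subset_mset[of m "\<lambda>_. True"]]) (auto simp: subset_mset.le_less)
    ultimately show ?thesis by simp
  qed
  have "labelled_pos 1 {#} = {{#}}"
    by (auto simp: labelled_pos_def labelled_def fy_levels_def)
  then have pos0: "pos_gf 1 {#} = 1" unfolding pos_gf_def by (simp only:) simp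
  have "level_gf 1 m = 1 + (\<Sum>B | B \<subseteq># m \<and> B \<noteq> {#}. pos_gf 1 B)"
    unfolding level_gf_zero_block sum_subset_mset_complement[of "pos_gf 1"]
    unfolding sum_subset_mset_nonempty pos0 ..
  moreover have "(\<Sum>B | B \<subset># m \<and> B \<noteq> {#}. pos_gf 1 B) = (\<Sum>B | B \<subset># m \<and> B \<noteq> {#}. tvar * level_gf 0 B)"
    by (intro sum.cong refl less) (auto simp: mset_subset_size)
  ultimately show ?case
    unfolding level_gf_1 split by (simp add: sum_distrib_left algebra_simps)
qed

section \<open>Permutations and labelled values\<close>

text \<open>For a permutation and a weakly decreasing word \<open>W\<close> of colours, the value \<open>v\<close> at position \<open>p\<close> is
  labelled by the pair of \<open>W p\<close> and the truth value of \<open>p < v\<close>. If \<open>p < v\<close>, then \<open>W p\<close> exceeds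
  \<open>W v\<close>, or both positions carry the same colour and \<open>v\<close> is not the first of them; otherwise
  \<open>W p \<le> W v\<close>. These necessary conditions on the label of \<open>v\<close> do not involve the other labels.\<close>

definition allowed :: "nat \<Rightarrow> (nat \<Rightarrow> nat) \<Rightarrow> nat \<Rightarrow> nat \<times> bool \<Rightarrow> bool" where
  "allowed n W v = (\<lambda>(a, s).
     if s then W v < a \<or> (W v = a \<and> (\<exists>u\<in>{1..n}. u < v \<and> W u = W v)) else a \<le> W v)"

definition label_sets :: "nat \<Rightarrow> (nat \<Rightarrow> nat) \<Rightarrow> nat multiset \<Rightarrow> (nat \<Rightarrow> nat \<times> bool) set" where
  "label_sets n W m = {l \<in> {1..n} \<rightarrow>\<^sub>E UNIV. (\<forall>v\<in>{1..n}. allowed n W v (l v)) \<and>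
     image_mset (\<lambda>v. fst (l v)) (mset_set {1..n}) = m}"

text \<open>The order in which the values appear in the word of a permutation without positions of \<open>DEX\<close>
  inside the blocks of equal colours: colours decrease, and in each block the barred letters, that
  is the excedance values, come first, and letters of the same kind increase.\<close>

definition precedes :: "(nat \<Rightarrow> nat \<times> bool) \<Rightarrow> nat \<Rightarrow> nat \<Rightarrow> bool" where
  "precedes l u v \<longleftrightarrow> fst (l v) < fst (l u) \<or>
     fst (l u) = fst (l v) \<and> (snd (l u) \<and> \<not> snd (l v) \<or> snd (l u) = snd (l v) \<and> u < v)"

definition rank_of :: "nat \<Rightarrow> (nat \<Rightarrow> nat \<times> bool) \<Rightarrow> nat \<Rightarrow> nat" where
  "rank_of n l v = Suc (card {u \<in> {1..n}. precedes l u v})"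

text \<open>The compatibility between the descent set \<open>DEX\<close> and the word of a monomial in the fundamental
  quasisymmetric function.\<close>

definition good_perm :: "nat \<Rightarrow> (nat \<Rightarrow> nat) \<Rightarrow> (nat \<Rightarrow> nat) \<Rightarrow> bool" where
  "good_perm n W \<sigma> \<longleftrightarrow> (\<forall>j\<in>{1..<n}. j \<in> DEX n \<sigma> \<longrightarrow> W (Suc j) < W j)"

lemma precedes_trans: "precedes l u v \<Longrightarrow> precedes l v w \<Longrightarrow> precedes l u w"
  unfolding precedes_def by auto

lemma precedes_irrefl: "\<not> precedes l u u"
  by (simp add: precedes_def)

lemma precedes_total: "u \<noteq> v \<Longrightarrow> precedes l u v \<or> precedes l v u"
  unfolding precedes_def by auto

lemma rank_of_less_iff:
  assumes "u \<in> {1..n}" "v \<in> {1..n}"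
  shows "rank_of n l u < rank_of n l v \<longleftrightarrow> precedes l u v"
proof -
  have less: "rank_of n l u < rank_of n l v" if "precedes l u v" "u \<in> {1..n}" for u v
  proof -
    have "{w \<in> {1..n}. precedes l w u} \<subset> {w \<in> {1..n}. precedes l w v}"
      using that precedes_trans precedes_irrefl by blast
    then show ?thesis unfolding rank_of_def by (simp add: psubset_card_mono)
  qed
  show ?thesis
    using less[of u v] less[of v u] precedes_total[of u v l] assms by (metis less_asym less_irrefl)
qed

lemma rank_of_bij: "bij_betw (rank_of n l) {1..n} {1..n}"
proof -
  have inj: "inj_on (rank_of n l) {1..n}"
    by (rule inj_onI) (metis less_irrefl precedes_total rank_of_less_iff)
  have "rank_of n l v \<in> {1..n}" if "v \<in> {1..n}" for v
  proof -
    have "{u \<in> {1..n}. precedes l u v} \<subset> {1..n}"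
      using that precedes_irrefl by blast
    then have "card {u \<in> {1..n}. precedes l u v} < card {1..n}"
      by (intro psubset_card_mono) auto
    then show ?thesis by (simp add: rank_of_def)
  qed
  then have "rank_of n l ` {1..n} \<subseteq> {1..n}" by blast
  then show ?thesis
    using inj endo_inj_surj[of "{1..n}" "rank_of n l"] unfolding bij_betw_def by blast
qed

lemma rank_of_in: "v \<in> {1..n} \<Longrightarrow> rank_of n l v \<in> {1..n}"
  by (rule bspec[OF bij_betwE[OF rank_of_bij[of n l]]])

lemma rank_of_unique:
  assumes "bij_betw pos {1..n} {1..n}"
    and "\<And>u v. u \<in> {1..n} \<Longrightarrow> v \<in> {1..n} \<Longrightarrow> pos u < pos v \<longleftrightarrow> precedes l u v"
    and v: "v \<in> {1..n}"
  shows "rank_of n l v = pos v"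
proof -
  have "pos ` {u \<in> {1..n}. precedes l u v} = {p \<in> {1..n}. p < pos v}"
  proof (intro equalityI subsetI)
    fix p assume "p \<in> pos ` {u \<in> {1..n}. precedes l u v}"
    then obtain u where "u \<in> {1..n}" "precedes l u v" "p = pos u" by blast
    then show "p \<in> {p \<in> {1..n}. p < pos v}"
      using assms(2)[of u v] v bij_betwE[OF assms(1)] by blast
  next
    fix p assume p: "p \<in> {p \<in> {1..n}. p < pos v}"
    then obtain u where "u \<in> {1..n}" "p = pos u"
      using bij_betw_imp_surj_on[OF assms(1)] by blast
    then show "p \<in> pos ` {u \<in> {1..n}. precedes l u v}"
      using assms(2)[of u v] v p by blast
  qed
  moreover have "inj_on pos {u \<in> {1..n}. precedes l u v}"
    using bij_betw_imp_inj_on[OF assms(1)] by (rule inj_on_subset) blast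
  ultimately have "card {u \<in> {1..n}. precedes l u v} = card {p \<in> {1..n}. p < pos v}"
    using card_image by metis
  also have "{p \<in> {1..n}. p < pos v} = {1..<pos v}"
    using bspec[OF bij_betwE[OF assms(1)] v] by auto
  finally show ?thesis
    using bspec[OF bij_betwE[OF assms(1)] v] by (simp add: rank_of_def)
qed

locale decreasing_word =
  fixes n :: nat and W :: "nat \<Rightarrow> nat" and m :: "nat multiset"
  assumes dec: "\<And>i j. 1 \<le> i \<Longrightarrow> i \<le> j \<Longrightarrow> j \<le> n \<Longrightarrow> W j \<le> W i"
    and content: "image_mset W (mset_set {1..n}) = m"
begin

lemma card_above:
  assumes "l \<in> label_sets n W m"
  shows "card {v \<in> {1..n}. P (fst (l v))} = card {p \<in> {1..n}. P (W p)}"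
proof -
  have "size (filter_mset P (image_mset (\<lambda>v. fst (l v)) (mset_set {1..n}))) =
      size (filter_mset P (image_mset W (mset_set {1..n})))"
    using assms content by (simp add: label_sets_def)
  then show ?thesis
    by (simp add: filter_mset_image_mset filter_mset_mset_set comp_def)
qed

text \<open>As \<open>W\<close> decreases, the positions with a colour above \<open>c\<close> form an initial segment.\<close>

lemma above_initial:
  assumes "p \<in> {1..n}"
  shows "c < W p \<longleftrightarrow> p \<le> card {q \<in> {1..n}. c < W q}"
proof
  assume "c < W p"
  then have "{1..p} \<subseteq> {q \<in> {1..n}. c < W q}"
    using dec assms by (force intro: less_le_trans)
  then have "card {1..p} \<le> card {q \<in> {1..n}. c < W q}" by (intro card_mono) auto
  then show "p \<le> card {q \<in> {1..n}. c < W q}" by simp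
next
  assume le: "p \<le> card {q \<in> {1..n}. c < W q}"
  show "c < W p"
  proof (rule ccontr)
    assume "\<not> c < W p"
    have "q < p" if "q \<in> {1..n}" "c < W q" for q
    proof (rule ccontr)
      assume "\<not> q < p"
      then have "W q \<le> W p" using dec that assms by simp
      then show False using that \<open>\<not> c < W p\<close> by simp
    qed
    then have "{q \<in> {1..n}. c < W q} \<subseteq> {1..<p}" by auto
    then have "card {q \<in> {1..n}. c < W q} \<le> card {1..<p}" by (intro card_mono) auto
    moreover have "card {1..<p} < p" using assms by simp
    ultimately show False using le by linarith
  qed
qed

lemma rank_of_le_iff:
  assumes l: "l \<in> label_sets n W m" and v: "v \<in> {1..n}"
  shows "rank_of n l v \<le> card {p \<in> {1..n}. c < W p} \<longleftrightarrow> c < fst (l v)"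
proof
  assume le: "rank_of n l v \<le> card {p \<in> {1..n}. c < W p}"
  show "c < fst (l v)"
  proof (rule ccontr)
    assume "\<not> c < fst (l v)"
    then have "{u \<in> {1..n}. c < fst (l u)} \<subseteq> {u \<in> {1..n}. precedes l u v}"
      by (auto simp: precedes_def)
    then have "card {u \<in> {1..n}. c < fst (l u)} \<le> card {u \<in> {1..n}. precedes l u v}"
      by (intro card_mono) auto
    then show False using le card_above[OF l, of "\<lambda>x. c < x"] by (simp add: rank_of_def)
  qed
next
  assume "c < fst (l v)"
  then have "{u \<in> {1..n}. precedes l u v} \<subset> {u \<in> {1..n}. c < fst (l u)}"
    using v by (auto simp: precedes_def)
  then have "card {u \<in> {1..n}. precedes l u v} < card {u \<in> {1..n}. c < fst (l u)}"
    by (intro psubset_card_mono) auto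
  then show "rank_of n l v \<le> card {p \<in> {1..n}. c < W p}"
    using card_above[OF l, of "\<lambda>x. c < x"] by (simp add: rank_of_def)
qed

lemma W_rank_of:
  assumes l: "l \<in> label_sets n W m" and v: "v \<in> {1..n}"
  shows "W (rank_of n l v) = fst (l v)"
proof -
  have "rank_of n l v \<in> {1..n}" using rank_of_in[OF v] .
  then have "c < W (rank_of n l v) \<longleftrightarrow> c < fst (l v)" for c
    using above_initial rank_of_le_iff[OF l v] by blast
  then show ?thesis by (meson less_irrefl linorder_neqE_nat)
qed

text \<open>A labeling with admissible labels is realised by a permutation because the second component of
  the label of \<open>v\<close> decides whether \<open>v\<close> is an excedance value. Let \<open>a\<close> be the colour of \<open>v\<close> and
  let \<open>N\<close> be the number of positions with colour above \<open>a\<close>. If the label of \<open>v\<close> is marked, then all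
  marked values of colour \<open>a\<close> exceed \<open>Suc N\<close>, and those below \<open>v\<close> are too few to push \<open>v\<close>
  up to position \<open>v\<close>. If it is unmarked, the same argument runs from the other end of the block:
  unmarked values of colour \<open>a\<close> are at most the last position \<open>e\<close> of the block.\<close>

lemma rank_of_less_self_iff:
  assumes l: "l \<in> label_sets n W m" and v: "v \<in> {1..n}"
  shows "rank_of n l v < v \<longleftrightarrow> snd (l v)"
proof -
  define a where "a = fst (l v)"
  define N where "N = card {p \<in> {1..n}. a < W p}"
  define e where "e = card {p \<in> {1..n}. a \<le> W p}"
  have N: "N = card {u \<in> {1..n}. a < fst (l u)}" and e: "e = card {u \<in> {1..n}. a \<le> fst (l u)}"
    using card_above[OF l, of "\<lambda>x. a < x"] card_above[OF l, of "\<lambda>x. a \<le> x"]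
    by (simp_all add: N_def e_def)
  have al: "allowed n W u (l u)" if "u \<in> {1..n}" for u
    using l that by (simp add: label_sets_def)
  show ?thesis
  proof (cases "snd (l v)")
    case True
    let ?C = "{u \<in> {1..n}. fst (l u) = a \<and> snd (l u) \<and> u < v}"
    have eq: "{u \<in> {1..n}. precedes l u v} = {u \<in> {1..n}. a < fst (l u)} \<union> ?C"
      using True by (auto simp: precedes_def a_def)
    have "card {u \<in> {1..n}. precedes l u v} = N + card ?C"
      unfolding eq N by (rule card_Un_disjoint) auto
    then have rank: "rank_of n l v = Suc (N + card ?C)"
      by (simp add: rank_of_def)
    \<comment> \<open>As a position, a marked value lies behind its block or inside it, but not at the first place.\<close>
    have big: "Suc N < u" if u: "u \<in> {1..n}" "fst (l u) = a" "snd (l u)" for u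
    proof -
      consider "W u < a" | u' where "W u = a" "u' \<in> {1..n}" "u' < u" "W u' = W u"
        using al[OF u(1)] u by (auto simp: allowed_def split: prod.splits if_splits)
      then show ?thesis
      proof cases
        case 1
        then have "W u < fst (l u)" using u by simp
        have "u \<noteq> Suc N \<and> \<not> u \<le> N"
        proof
          have "\<not> u \<le> N" unfolding N_def using above_initial[OF u(1), of a] 1 by simp
          then show "\<not> u \<le> N" .
          have r: "rank_of n l u \<in> {1..n}" using rank_of_in[OF u(1)] .
          have "W (rank_of n l u) = a" using W_rank_of[OF l u(1)] u by simp
          then have "\<not> rank_of n l u \<le> N"
            unfolding N_def using above_initial[OF r, of a] by simp
          moreover have "rank_of n l u < u"
          proof (rule ccontr)
            assume "\<not> rank_of n l u < u"
            then have "W (rank_of n l u) \<le> W u" using dec u(1) r by simp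
            then show False using 1 \<open>W (rank_of n l u) = a\<close> by simp
          qed
          ultimately show "u \<noteq> Suc N" by simp
        qed
        then show ?thesis by simp
      next
        case 2
        then have "\<not> u' \<le> N" unfolding N_def using above_initial[of u' a] by simp
        then show ?thesis using 2 by simp
      qed
    qed
    have "?C \<subseteq> {Suc (Suc N)..<v}" using big by (auto simp: Suc_le_eq)
    then have "card ?C \<le> card {Suc (Suc N)..<v}" by (intro card_mono) auto
    then have "rank_of n l v < v" using big[OF v] True rank by (simp add: a_def)
    then show ?thesis using True by simp
  next
    case False
    let ?D = "{u \<in> {1..n}. fst (l u) = a \<and> \<not> snd (l u) \<and> v < u}"
    have eq: "{u \<in> {1..n}. a \<le> fst (l u)} = insert v ({u \<in> {1..n}. precedes l u v} \<union> ?D)"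
      using False v by (auto simp: precedes_def a_def)
    have "e = Suc (card {u \<in> {1..n}. precedes l u v} + card ?D)"
      unfolding e eq by (subst card_insert_disjoint, simp, simp add: precedes_irrefl, subst card_Un_disjoint)
        (auto simp: precedes_def a_def)
    then have rank: "e = rank_of n l v + card ?D"
      by (simp add: rank_of_def)
    have le: "u \<le> e" if u: "u \<in> {1..n}" "fst (l u) = a" "\<not> snd (l u)" for u
    proof -
      have "a \<le> W u" using al[OF u(1)] u by (auto simp: allowed_def split: prod.splits)
      then have "{1..u} \<subseteq> {p \<in> {1..n}. a \<le> W p}"
        using dec u(1) by (force intro: le_trans)
      then have "card {1..u} \<le> e" unfolding e_def by (intro card_mono) auto
      then show ?thesis by simp
    qed
    have "?D \<subseteq> {v<..e}" using le by auto
    then have "card ?D \<le> card {v<..e}" by (intro card_mono) auto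
    then have "v \<le> rank_of n l v" using le[OF v] False rank by (simp add: a_def)
    then show ?thesis using False by simp
  qed
qed

lemma EXC_iff: "\<sigma> permutes {1..n} \<Longrightarrow> j \<in> {1..n} \<Longrightarrow> j \<in> EXC n \<sigma> \<longleftrightarrow> j < \<sigma> j"
  using permutes_in_image[of \<sigma> "{1..n}" j] by (auto simp: EXC_def)

definition perm_labels :: "(nat \<Rightarrow> nat) \<Rightarrow> nat \<Rightarrow> nat \<times> bool" where
  "perm_labels \<sigma> = (\<lambda>v\<in>{1..n}. (W (inv_into UNIV \<sigma> v), inv_into UNIV \<sigma> v < v))"

definition labels_perm :: "(nat \<Rightarrow> nat \<times> bool) \<Rightarrow> nat \<Rightarrow> nat" where
  "labels_perm l = inv_into UNIV (\<lambda>v. if v \<in> {1..n} then rank_of n l v else v)"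

lemma letter_less_trans: "letter_less x y \<Longrightarrow> letter_less y z \<Longrightarrow> letter_less x z"
  by (cases x; cases y; cases z) auto

lemma letter_less_total: "x \<noteq> y \<Longrightarrow> letter_less x y \<or> letter_less y x"
  by (cases x; cases y) auto

lemma letter_less_asym: "letter_less x y \<Longrightarrow> \<not> letter_less y x"
  by (cases x; cases y) auto

text \<open>Inside a block of equal colours there is no position of \<open>DEX\<close>, so the barred word increases
  there.\<close>

lemma barred_less:
  assumes \<sigma>: "\<sigma> permutes {1..n}" and good: "good_perm n W \<sigma>"
    and p: "1 \<le> p" and pq: "Suc p \<le> q" "q \<le> n" "W p = W q"
  shows "letter_less (barred_word n \<sigma> p) (barred_word n \<sigma> q)"
proof -
  have adjacent: "letter_less (barred_word n \<sigma> j) (barred_word n \<sigma> (Suc j))"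
    if j: "1 \<le> j" "Suc j \<le> n" "W j = W (Suc j)" for j
  proof -
    have "j \<notin> DEX n \<sigma>" using good j by (auto simp: good_perm_def)
    then have "\<not> letter_less (barred_word n \<sigma> (Suc j)) (barred_word n \<sigma> j)"
      using j by (auto simp: DEX_def)
    moreover have "\<sigma> j \<noteq> \<sigma> (Suc j)" using permutes_inj[OF \<sigma>] by (metis injD n_not_Suc_n)
    then have "barred_word n \<sigma> j \<noteq> barred_word n \<sigma> (Suc j)"
      by (auto simp: barred_word_def split: if_splits)
    ultimately show ?thesis using letter_less_total by blast
  qed
  show ?thesis
    using pq
  proof (induction q rule: dec_induct)
    case base
    then show ?case using adjacent[OF p] by simp
  next
    case (step q)
    have "W (Suc q) \<le> W q" "W q \<le> W p"
      using dec[of q "Suc q"] dec[of p q] p step.hyps step.prems by linarith+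
    then have "W p = W q" "W q = W (Suc q)" using step.prems by linarith+
    then show ?case
      using step p adjacent[of q] letter_less_trans by (meson Suc_leD le_trans)
  qed
qed

text \<open>Extended by the identity, so that it is a permutation in the sense of \<open>permutes\<close>.\<close>

definition position :: "(nat \<Rightarrow> nat \<times> bool) \<Rightarrow> nat \<Rightarrow> nat" where
  "position l v = (if v \<in> {1..n} then rank_of n l v else v)"

lemma position_permutes: "position l permutes {1..n}"
proof (rule bij_imp_permutes)
  show "bij_betw (position l) {1..n} {1..n}"
    using rank_of_bij[of n l] by (rule bij_betw_cong[THEN iffD1, rotated]) (simp add: position_def)
qed (auto simp: position_def)

lemma labels_perm_permutes: "labels_perm l permutes {1..n}"
proof -
  have "labels_perm l = inv_into UNIV (position l)"
    unfolding labels_perm_def position_def ..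
  then show ?thesis using permutes_inv[OF position_permutes] by simp
qed

lemma inv_labels_perm: "inv_into UNIV (labels_perm l) = position l"
proof -
  have "labels_perm l = inv_into UNIV (position l)"
    unfolding labels_perm_def position_def ..
  then show ?thesis using inv_inv_eq[OF permutes_bij[OF position_permutes]] by simp
qed

lemma perm_labels_precedes:
  assumes \<sigma>: "\<sigma> permutes {1..n}" and good: "good_perm n W \<sigma>"
    and u: "u \<in> {1..n}" and v: "v \<in> {1..n}"
  shows "inv_into UNIV \<sigma> u < inv_into UNIV \<sigma> v \<longleftrightarrow> precedes (perm_labels \<sigma>) u v"
proof -
  let ?p = "inv_into UNIV \<sigma>"
  have in_n: "?p w \<in> {1..n}" if "w \<in> {1..n}" for w
    using permutes_in_image[OF permutes_inv[OF \<sigma>]] that by blast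
  have fwd: "precedes (perm_labels \<sigma>) u v"
    if uv: "?p u < ?p v" and u: "u \<in> {1..n}" and v: "v \<in> {1..n}" for u v
  proof -
    have le: "W (?p v) \<le> W (?p u)" using dec in_n[OF u] in_n[OF v] uv by simp
    have inv: "\<sigma> (?p w) = w" for w using permutes_inverses(1)[OF \<sigma>] .
    show ?thesis
    proof (cases "W (?p u) = W (?p v)")
      case True
      have "letter_less (barred_word n \<sigma> (?p u)) (barred_word n \<sigma> (?p v))"
        using barred_less[OF \<sigma> good _ _ _ True] in_n[OF u] in_n[OF v] uv by simp
      then show ?thesis
        using True u v EXC_iff[OF \<sigma> in_n[OF u]] EXC_iff[OF \<sigma> in_n[OF v]]
        by (auto simp: barred_word_def inv precedes_def perm_labels_def split: if_splits)
    next
      case False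
      then show ?thesis using le u v by (simp add: precedes_def perm_labels_def)
    qed
  qed
  show ?thesis
  proof
    assume pr: "precedes (perm_labels \<sigma>) u v"
    then have "u \<noteq> v" using precedes_irrefl by blast
    then have "?p u \<noteq> ?p v" using permutes_inj[OF permutes_inv[OF \<sigma>]] by (meson injD)
    moreover have "\<not> ?p v < ?p u"
      using fwd[OF _ v u] pr precedes_trans precedes_irrefl by blast
    ultimately show "?p u < ?p v" by simp
  qed (rule fwd[OF _ u v])
qed

lemma perm_labels_in:
  assumes \<sigma>: "\<sigma> permutes {1..n}"
  shows "perm_labels \<sigma> \<in> label_sets n W m"
proof -
  let ?p = "inv_into UNIV \<sigma>"
  have in_n: "?p w \<in> {1..n}" if "w \<in> {1..n}" for w
    using permutes_in_image[OF permutes_inv[OF \<sigma>]] that by blast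
  have "allowed n W v (perm_labels \<sigma> v)" if v: "v \<in> {1..n}" for v
  proof (cases "?p v < v")
    case True
    then have "W v \<le> W (?p v)" using dec in_n[OF v] v by simp
    then show ?thesis using True v in_n[OF v] by (auto simp: allowed_def perm_labels_def)
  next
    case False
    then have "W (?p v) \<le> W v" using dec in_n[OF v] v by simp
    then show ?thesis using False v by (simp add: allowed_def perm_labels_def)
  qed
  moreover have "image_mset (\<lambda>v. fst (perm_labels \<sigma> v)) (mset_set {1..n}) = m"
  proof -
    have "image_mset (\<lambda>v. fst (perm_labels \<sigma> v)) (mset_set {1..n}) = image_mset (W \<circ> ?p) (mset_set {1..n})"
      by (intro image_mset_cong) (simp add: perm_labels_def)
    also have "\<dots> = image_mset W (image_mset ?p (mset_set {1..n}))" by (simp add: multiset.map_comp)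
    also have "image_mset ?p (mset_set {1..n}) = mset_set {1..n}"
      using image_mset_mset_set[OF permutes_inj_on[OF permutes_inv[OF \<sigma>]], of "{1..n}"]
        permutes_image[OF permutes_inv[OF \<sigma>]] by (simp only:)
    finally show ?thesis using content by simp
  qed
  ultimately show ?thesis
    by (auto simp: label_sets_def perm_labels_def)
qed

lemma labels_perm_good:
  assumes l: "l \<in> label_sets n W m"
  shows "good_perm n W (labels_perm l)"
  unfolding good_perm_def
proof (intro ballI impI)
  fix j assume j: "j \<in> {1..<n}" and dex: "j \<in> DEX n (labels_perm l)"
  let ?\<sigma> = "labels_perm l"
  have rank: "rank_of n l (?\<sigma> i) = i \<and> ?\<sigma> i \<in> {1..n}" if i: "i \<in> {1..n}" for i
  proof -
    have "?\<sigma> i \<in> {1..n}" using permutes_in_image[OF labels_perm_permutes] i by blast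
    moreover have "position l (?\<sigma> i) = i"
      using inv_labels_perm permutes_inverses(2)[OF labels_perm_permutes] by metis
    ultimately show ?thesis by (simp add: position_def)
  qed
  have exc: "i \<in> EXC n ?\<sigma> \<longleftrightarrow> snd (l (?\<sigma> i))" if i: "i \<in> {1..n}" for i
    using EXC_iff[OF labels_perm_permutes i] rank_of_less_self_iff[OF l, of "?\<sigma> i"] rank[OF i] by simp
  have j1: "j \<in> {1..n}" "Suc j \<in> {1..n}" using j by auto
  have "W (Suc j) \<noteq> W j"
  proof
    assume eq: "W (Suc j) = W j"
    have fst: "fst (l (?\<sigma> j)) = fst (l (?\<sigma> (Suc j)))"
      using W_rank_of[OF l, of "?\<sigma> j"] W_rank_of[OF l, of "?\<sigma> (Suc j)"] rank j1 eq by simp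
    have "precedes l (?\<sigma> j) (?\<sigma> (Suc j))"
      using rank_of_less_iff[of "?\<sigma> j" n "?\<sigma> (Suc j)" l] rank j1 by simp
    then have "letter_less (barred_word n ?\<sigma> j) (barred_word n ?\<sigma> (Suc j))"
      using fst exc[OF j1(1)] exc[OF j1(2)] by (auto simp: precedes_def barred_word_def)
    then show False using dex letter_less_asym by (auto simp: DEX_def)
  qed
  moreover have "W (Suc j) \<le> W j" using dec j by simp
  ultimately show "W (Suc j) < W j" by simp
qed

text \<open>A permutation is recovered from its labels by sorting the values with respect to \<open>precedes\<close>.\<close>

lemma perm_labels_bij:
  "bij_betw perm_labels {\<sigma>. \<sigma> permutes {1..n} \<and> good_perm n W \<sigma>} (label_sets n W m)"
proof (rule bij_betw_byWitness[where f' = labels_perm])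
  show "\<forall>\<sigma>\<in>{\<sigma>. \<sigma> permutes {1..n} \<and> good_perm n W \<sigma>}. labels_perm (perm_labels \<sigma>) = \<sigma>"
  proof clarify
    fix \<sigma> assume \<sigma>: "\<sigma> permutes {1..n}" "good_perm n W \<sigma>"
    have "position (perm_labels \<sigma>) v = inv_into UNIV \<sigma> v" for v
    proof (cases "v \<in> {1..n}")
      case True
      have "rank_of n (perm_labels \<sigma>) v = inv_into UNIV \<sigma> v"
        by (rule rank_of_unique[OF permutes_imp_bij[OF permutes_inv[OF \<sigma>(1)]] perm_labels_precedes[OF \<sigma>] True])
      then show ?thesis using True by (simp add: position_def)
    next
      case False
      then show ?thesis
        unfolding position_def using permutes_not_in[OF permutes_inv[OF \<sigma>(1)] False]
        by (simp only: if_False)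
    qed
    then have "position (perm_labels \<sigma>) = inv_into UNIV \<sigma>" by blast
    moreover have "labels_perm (perm_labels \<sigma>) = inv_into UNIV (position (perm_labels \<sigma>))"
      unfolding labels_perm_def position_def ..
    ultimately show "labels_perm (perm_labels \<sigma>) = \<sigma>"
      using inv_inv_eq[OF permutes_bij[OF \<sigma>(1)]] by simp
  qed
  show "\<forall>l\<in>label_sets n W m. perm_labels (labels_perm l) = l"
  proof
    fix l assume l: "l \<in> label_sets n W m"
    show "perm_labels (labels_perm l) = l"
    proof
      fix v
      show "perm_labels (labels_perm l) v = l v"
      proof (cases "v \<in> {1..n}")
        case True
        then show ?thesis
          unfolding perm_labels_def inv_labels_perm
          using W_rank_of[OF l True] rank_of_less_self_iff[OF l True] by (simp add: position_def)
      next
        case False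
        then show ?thesis
          using l by (auto simp: perm_labels_def label_sets_def PiE_def extensional_def)
      qed
    qed
  qed
  show "perm_labels ` {\<sigma>. \<sigma> permutes {1..n} \<and> good_perm n W \<sigma>} \<subseteq> label_sets n W m"
    using perm_labels_in by blast
  show "labels_perm ` label_sets n W m \<subseteq> {\<sigma>. \<sigma> permutes {1..n} \<and> good_perm n W \<sigma>}"
    using labels_perm_permutes labels_perm_good by blast
qed

lemma card_EXC_perm_labels:
  assumes \<sigma>: "\<sigma> permutes {1..n}"
  shows "card (EXC n \<sigma>) = card {v \<in> {1..n}. snd (perm_labels \<sigma> v)}"
proof (rule bij_betw_same_card[of \<sigma>], rule bij_betw_byWitness[where f' = "inv_into UNIV \<sigma>"])
  have in_n: "inv_into UNIV \<sigma> v \<in> {1..n}" if "v \<in> {1..n}" for v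
    using permutes_in_image[OF permutes_inv[OF \<sigma>]] that by blast
  show "\<sigma> ` EXC n \<sigma> \<subseteq> {v \<in> {1..n}. snd (perm_labels \<sigma> v)}"
  proof
    fix v assume "v \<in> \<sigma> ` EXC n \<sigma>"
    then obtain j where "j \<in> EXC n \<sigma>" and v: "v = \<sigma> j" by blast
    then have j: "j \<in> {1..n}" "j < \<sigma> j" by (auto simp: EXC_def)
    have "\<sigma> j \<in> {1..n}" using permutes_in_image[OF \<sigma>] j(1) by blast
    then show "v \<in> {v \<in> {1..n}. snd (perm_labels \<sigma> v)}"
      using j v permutes_inverses(2)[OF \<sigma>] by (simp add: perm_labels_def)
  qed
  show "inv_into UNIV \<sigma> ` {v \<in> {1..n}. snd (perm_labels \<sigma> v)} \<subseteq> EXC n \<sigma>"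
  proof
    fix j assume "j \<in> inv_into UNIV \<sigma> ` {v \<in> {1..n}. snd (perm_labels \<sigma> v)}"
    then obtain v where v: "v \<in> {1..n}" "inv_into UNIV \<sigma> v < v" "j = inv_into UNIV \<sigma> v"
      by (auto simp: perm_labels_def)
    then show "j \<in> EXC n \<sigma>"
      using EXC_iff[OF \<sigma> in_n[OF v(1)]] permutes_inverses(1)[OF \<sigma>, of v] by simp
  qed
qed (simp_all add: permutes_inverses[OF \<sigma>])

lemma sum_good_perms:
  "(\<Sum>\<sigma> | \<sigma> permutes {1..n} \<and> good_perm n W \<sigma>. t ^ card (EXC n \<sigma>)) =
   (\<Sum>l\<in>label_sets n W m. t ^ card {v \<in> {1..n}. snd (l v)} :: 'a::comm_ring_1)"
  using sum.reindex_bij_betw[OF perm_labels_bij, of "\<lambda>l. t ^ card {v \<in> {1..n}. snd (l v)}", symmetric]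
  by (simp add: card_EXC_perm_labels)

end

definition label_weight :: "'a::comm_ring_1 \<Rightarrow> nat \<times> bool \<Rightarrow> 'a mfps" where
  "label_weight t x = mfps_const (if snd x then t else 1) * yv (fst x)"

definition first_in_block :: "nat \<Rightarrow> (nat \<Rightarrow> nat) \<Rightarrow> nat \<Rightarrow> bool" where
  "first_in_block n W v \<longleftrightarrow> \<not> (\<exists>u\<in>{1..n}. u < v \<and> W u = W v)"

definition allowed_below :: "nat \<Rightarrow> nat \<Rightarrow> (nat \<Rightarrow> nat) \<Rightarrow> nat \<Rightarrow> (nat \<times> bool) set" where
  "allowed_below K n W v = {x. allowed n W v x \<and> fst x < K}"

text \<open>The admissible labels of a single value are counted by a linear form in the variables of the
  colours.\<close>

lemma sum_label_weights:
  fixes t :: "'a::comm_ring_1"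
  assumes W: "W v < K"
  shows "(\<Sum>x\<in>allowed_below K n W v. label_weight t x) =
    (if first_in_block n W v then lin_part t K (Suc (W v)) else lin_full t K (W v))"
proof -
  define A where "A = (if first_in_block n W v then {Suc (W v)..<K} else {W v..<K})"
  have eq: "allowed_below K n W v = (\<lambda>a. (a, True)) ` A \<union> (\<lambda>a. (a, False)) ` {..<Suc (W v)}"
    using W by (auto simp: allowed_below_def allowed_def A_def first_in_block_def image_iff split: if_splits)
  have "(\<Sum>x\<in>allowed_below K n W v. label_weight t x) =
      mfps_const t * (\<Sum>a\<in>A. yv a) + (\<Sum>a<Suc (W v). yv a)"
    unfolding eq
    by (subst sum.union_disjoint)
      (auto simp: A_def sum.reindex inj_on_def label_weight_def sum_distrib_left simp del: sum.lessThan_Suc)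
  moreover have "(\<Sum>a\<in>{W v..<K}. yv a) = yv (W v) + (\<Sum>a\<in>{Suc (W v)..<K}. yv a :: 'a mfps)"
    using W by (rule sum.atLeast_Suc_lessThan)
  ultimately show ?thesis
    unfolding A_def lin_part_def lin_full_def
    by (cases "first_in_block n W v") (simp_all only: if_True if_False distrib_left ac_simps)
qed

lemma prod_label_blocks:
  fixes t :: "'a::comm_ring_1"
  assumes W: "\<And>v. v \<in> {1..n} \<Longrightarrow> W v < K" and m: "image_mset W (mset_set {1..n}) = m"
  shows "(\<Prod>v\<in>{1..n}. \<Sum>x\<in>allowed_below K n W v. label_weight t x) = (\<Prod>b<K. block_factor t K b (count m b))"
proof -
  let ?L = "\<lambda>v. if first_in_block n W v then lin_part t K (Suc (W v)) else lin_full t K (W v)"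
  have "(\<Prod>v\<in>{1..n}. \<Sum>x\<in>allowed_below K n W v. label_weight t x) = (\<Prod>v\<in>{1..n}. ?L v)"
    using W by (intro prod.cong refl sum_label_weights) auto
  also have "\<dots> = (\<Prod>b<K. \<Prod>v\<in>{v \<in> {1..n}. W v = b}. ?L v)"
    by (rule prod.group[symmetric]) (use W in auto)
  also have "\<dots> = (\<Prod>b<K. block_factor t K b (count m b))"
  proof (intro prod.cong refl)
    fix b
    let ?B = "{v \<in> {1..n}. W v = b}"
    have card: "card ?B = count m b"
    proof -
      have "size (filter_mset (\<lambda>x. x = b) (image_mset W (mset_set {1..n}))) = card ?B"
        by (simp add: filter_mset_image_mset filter_mset_mset_set comp_def)
      then show ?thesis unfolding m by (simp add: filter_eq_replicate_mset)
    qed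
    show "(\<Prod>v\<in>?B. ?L v) = block_factor t K b (count m b)"
    proof (cases "?B = {}")
      case True
      then have "count m b = 0" using card by (metis card.empty)
      then show ?thesis unfolding True by (simp add: block_factor_def)
    next
      case False
      define v0 where "v0 = Min ?B"
      have v0: "v0 \<in> ?B" unfolding v0_def using False by (intro Min_in) auto
      have min: "v0 \<le> u" if "u \<in> ?B" for u unfolding v0_def using that by (intro Min_le) auto
      have first: "first_in_block n W v0"
        using min v0 by (fastforce simp: first_in_block_def)
      have later: "\<not> first_in_block n W v" if "v \<in> ?B - {v0}" for v
      proof -
        have "v0 < v" using min[of v] that by force
        then show ?thesis using v0 that by (auto simp: first_in_block_def)
      qed
      have "(\<Prod>v\<in>?B. ?L v) = ?L v0 * (\<Prod>v\<in>?B - {v0}. ?L v)"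
        using v0 by (intro prod.remove) auto
      also have "(\<Prod>v\<in>?B - {v0}. ?L v) = (\<Prod>v\<in>?B - {v0}. lin_full t K b)"
        using later by (intro prod.cong) auto
      also have "\<dots> = lin_full t K b ^ (count m b - 1)"
        using v0 card by (simp add: card_Diff_singleton)
      finally show ?thesis
        using first v0 card False by (auto simp: block_factor_def card_eq_0_iff)
    qed
  qed
  finally show ?thesis .
qed

text \<open>The labels of different values are chosen independently, so the sum over all labelings is a
  coefficient of a product of linear forms, one for each value.\<close>

lemma label_sum_eq_block_coeff:
  fixes t :: "'a::comm_ring_1"
  assumes W: "\<And>v. v \<in> {1..n} \<Longrightarrow> W v < K" and m: "image_mset W (mset_set {1..n}) = m"
  shows "(\<Sum>l\<in>label_sets n W m. t ^ card {v \<in> {1..n}. snd (l v)}) = block_coeff t K m"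
proof -
  let ?A = "allowed_below K n W"
  let ?P = "{1..n} \<rightarrow>\<^sub>E UNIV :: (nat \<Rightarrow> nat \<times> bool) set"
  have fin: "finite (?A v)" for v
    by (rule finite_subset[of _ "{..<K} \<times> UNIV"]) (auto simp: allowed_below_def)
  have prod: "(\<Prod>v\<in>S. label_weight t (l v)) =
      mfps_const (t ^ card {v \<in> S. snd (l v)}) * xmon (positive_part (image_mset (\<lambda>v. fst (l v)) (mset_set S)))"
    if "finite S" for S and l :: "nat \<Rightarrow> nat \<times> bool"
    using that
  proof (induction S)
    case empty
    then show ?case by (simp add: positive_part_def)
  next
    case (insert v S)
    have pp: "positive_part (add_mset a M) = positive_part {#a#} + positive_part M" for a M
      by (simp add: positive_part_def)
    have set: "{u \<in> insert v S. snd (l u)} = (if snd (l v) then insert v {u \<in> S. snd (l u)} else {u \<in> S. snd (l u)})"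
      by auto
    define c M where "c = card {v \<in> S. snd (l v)}"
      and "M = positive_part (image_mset (\<lambda>v. fst (l v)) (mset_set S))"
    have "label_weight t (l v) * (mfps_const (t ^ c) * xmon M) =
        mfps_const ((if snd (l v) then t else 1) * t ^ c) * xmon (positive_part {#fst (l v)#} + M)"
      by (simp only: label_weight_def yv_def xmon_add mfps_const_mult_const mult.assoc mult.commute mult.left_commute)
    moreover have "(if snd (l v) then t else 1) * t ^ c = t ^ card {u \<in> insert v S. snd (l u)}"
      unfolding set using insert.hyps by (simp add: c_def)
    ultimately show ?case
      using insert
      by (simp add: c_def M_def pp[of "fst (l v)" "image_mset (\<lambda>v. fst (l v)) (mset_set S)"])
  qed
  have coeff: "mfps_nth (\<Prod>v\<in>{1..n}. label_weight t (l v)) (positive_part m) =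
      (if image_mset (\<lambda>v. fst (l v)) (mset_set {1..n}) = m then t ^ card {v \<in> {1..n}. snd (l v)} else 0)"
    for l
  proof -
    let ?M = "image_mset (\<lambda>v. fst (l v)) (mset_set {1..n})"
    have "positive_part m = positive_part ?M \<longleftrightarrow> ?M = m"
    proof
      assume eq: "positive_part m = positive_part ?M"
      have split: "M = positive_part M + replicate_mset (size M - size (positive_part M)) 0" for M
      proof -
        have M: "M = positive_part M + filter_mset (\<lambda>a. a = 0) M"
          unfolding positive_part_def using multiset_partition[of M "\<lambda>a. 0 < a"] by simp
        have "filter_mset (\<lambda>a. a = 0) M = replicate_mset (count M 0) 0"
          by (simp add: filter_eq_replicate_mset)
        moreover have "count M 0 = size M - size (positive_part M)"
          using arg_cong[OF M, of size] unfolding filter_eq_replicate_mset by simp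
        ultimately show ?thesis using M by simp
      qed
      have "size ?M = size m" using m by auto
      then show "?M = m" using split[of ?M] split[of m] eq by simp
    qed simp
    then show ?thesis by (simp add: prod nth_const_mult mfps_nth_xmon)
  qed
  have finP: "finite (PiE {1..n} ?A)" using fin by (intro finite_PiE) auto
  have sets: "label_sets n W m = {l \<in> PiE {1..n} ?A. image_mset (\<lambda>v. fst (l v)) (mset_set {1..n}) = m}"
  proof -
    have "fst (l v) < K" if "image_mset (\<lambda>v. fst (l v)) (mset_set {1..n}) = m" "v \<in> {1..n}" for l v
    proof -
      have "fst (l v) \<in># image_mset W (mset_set {1..n})"
        unfolding m that(1)[symmetric] using that(2) by auto
      then show ?thesis using W by auto
    qed
    then show ?thesis
      by (auto simp: label_sets_def allowed_below_def PiE_iff)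
  qed
  have "block_coeff t K m = mfps_nth (\<Prod>v\<in>{1..n}. \<Sum>x\<in>?A v. label_weight t x) (positive_part m)"
    unfolding block_coeff_def by (subst prod_label_blocks[OF W m]) auto
  also have "(\<Prod>v\<in>{1..n}. \<Sum>x\<in>?A v. label_weight t x) = (\<Sum>l\<in>PiE {1..n} ?A. \<Prod>v\<in>{1..n}. label_weight t (l v))"
    using fin by (intro prod_sum_PiE) auto
  also have "mfps_nth \<dots> (positive_part m) = (\<Sum>l\<in>label_sets n W m. t ^ card {v \<in> {1..n}. snd (l v)})"
    unfolding mfps_nth_sum coeff sets by (rule sum.inter_filter[OF finP, symmetric])
  finally show ?thesis by simp
qed

section \<open>Coefficients of the Eulerian quasisymmetric functions\<close>

definition decreasing_letters :: "nat multiset \<Rightarrow> nat \<Rightarrow> nat" where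
  "decreasing_letters m v = rev (sorted_list_of_multiset m) ! (v - 1)"

lemma decreasing_word_letters: "decreasing_word (size m) (decreasing_letters m) m"
proof
  let ?w = "rev (sorted_list_of_multiset m)"
  have len: "length ?w = size m" by (metis length_rev mset_sorted_list_of_multiset size_mset)
  show "decreasing_letters m j \<le> decreasing_letters m i" if "1 \<le> i" "i \<le> j" "j \<le> size m" for i j
  proof -
    have "sorted (rev ?w)" by simp
    then show ?thesis
      unfolding decreasing_letters_def using that len
      by (intro sorted_rev_nth_mono) auto
  qed
  have "image_mset (decreasing_letters m) (mset_set {1..size m}) =
      mset (map (decreasing_letters m) [1..<Suc (size m)])"
    by (simp only: mset_map mset_upt atLeastLessThanSuc_atLeastAtMost)
  also have "map (decreasing_letters m) [1..<Suc (size m)] = ?w"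
    using len by (intro nth_equalityI) (auto simp: decreasing_letters_def simp del: upt_Suc)
  finally show "image_mset (decreasing_letters m) (mset_set {1..size m}) = m" by simp
qed

text \<open>A monomial occurs at most once, since its only weakly decreasing word is given by
  \<open>decreasing_letters\<close>.\<close>

lemma nth_fund_quasisym:
  "mfps_nth (fund_quasisym S n :: 'a::comm_ring_1 mfps) m =
    (if size m = n \<and> (\<forall>j\<in>{1..<n}. j \<in> S \<longrightarrow> decreasing_letters m (Suc j) < decreasing_letters m j) then 1 else 0)"
proof -
  let ?w = "rev (sorted_list_of_multiset m)"
  let ?Q = "\<lambda>w. length w = n \<and> (\<forall>j\<in>{1..<n}. w ! (j - 1) \<ge> w ! j \<and> (j \<in> S \<longrightarrow> w ! (j - 1) > w ! j))"
  have len: "length ?w = size m" by (metis length_rev mset_sorted_list_of_multiset size_mset)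
  have uniq: "w = ?w" if Q: "?Q w" and w: "mset w = m" for w
  proof -
    have "w ! Suc i \<le> w ! i" if "Suc i < length w" for i
      using Q that by (metis One_nat_def Suc_eq_plus1 add_diff_cancel_right' atLeastLessThan_iff le_add2)
    then have "sorted_wrt (\<ge>) w"
      by (intro sorted_wrt_iff_nth_Suc_transp[THEN iffD2]) (auto intro: transpI)
    then have "sorted (rev w)" by (simp add: sorted_wrt_rev)
    then have "rev w = sorted_list_of_multiset m"
      using w by (metis mset_rev sorted_list_of_multiset_mset sorted_sort_id)
    then show ?thesis by (metis rev_rev_ident)
  qed
  have Qw: "?Q ?w \<longleftrightarrow> size m = n \<and> (\<forall>j\<in>{1..<n}. j \<in> S \<longrightarrow> decreasing_letters m (Suc j) < decreasing_letters m j)"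
  proof -
    have "?w ! (j - 1) \<ge> ?w ! j" if "j \<in> {1..<n}" "size m = n" for j
      using that len by (intro sorted_rev_nth_mono) auto
    then show ?thesis using len by (auto simp: decreasing_letters_def)
  qed
  have "?Q w \<and> mset w = m \<longleftrightarrow> ?Q ?w \<and> w = ?w" for w
  proof
    assume "?Q w \<and> mset w = m"
    then show "?Q ?w \<and> w = ?w" using uniq by metis
  next
    assume w: "?Q ?w \<and> w = ?w"
    have "mset ?w = m" by simp
    then show "?Q w \<and> mset w = m" using w by metis
  qed
  then have sing: "{w \<in> {w. ?Q w}. mset w = m} = {w. ?Q ?w \<and> w = ?w}" by blast
  have cnt: "card {w. q \<and> w = x} = (if q then 1 else 0)" for q and x :: "nat list"
    by simp
  have card: "card {w \<in> {w. ?Q w}. mset w = m} = (if ?Q ?w then 1 else 0)"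
    unfolding sing by (rule cnt)
  show ?thesis
    unfolding fund_quasisym_def word_sum.rep_eq card Qw
    by (simp only: if_distrib[of of_nat] of_nat_1 of_nat_0)
qed

lemma fps_nth_sum_monomials:
  "fps_nth (\<Sum>\<sigma>\<in>A. fps_const (f \<sigma>) * fps_X ^ g \<sigma>) d = (\<Sum>\<sigma>\<in>{\<sigma> \<in> A. g \<sigma> = d}. f \<sigma> :: 'a::comm_ring_1)"
  if "finite A"
proof -
  have "fps_nth (\<Sum>\<sigma>\<in>A. fps_const (f \<sigma>) * fps_X ^ g \<sigma>) d = (\<Sum>\<sigma>\<in>A. if g \<sigma> = d then f \<sigma> else 0)"
    unfolding fps_sum_nth by (intro sum.cong) (auto simp: fps_X_power_nth)
  then show ?thesis using that by (simp add: sum.inter_filter)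
qed

lemma coeff_tvar_power: "coeff (tvar ^ k) d = (if k = d then 1 else 0)"
  by (simp add: tvar_def monom_power)

lemma level_gf_0_perms:
  "level_gf 0 m =
    (\<Sum>\<sigma> | \<sigma> permutes {1..size m} \<and> good_perm (size m) (decreasing_letters m) \<sigma>. tvar ^ card (EXC (size m) \<sigma>))"
proof -
  let ?W = "decreasing_letters m"
  interpret decreasing_word "size m" ?W m by (rule decreasing_word_letters)
  define K where "K = Suc (Max (insert 0 (set_mset m)))"
  have set: "set_mset m \<subseteq> {..<K}" by (auto simp: K_def less_Suc_eq_le)
  have W: "?W v < K" if "v \<in> {1..size m}" for v
  proof -
    have "?W v \<in># image_mset ?W (mset_set {1..size m})" using that by simp
    then have "?W v \<in># m" by (simp only: content)
    then show ?thesis using set by blast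
  qed
  show ?thesis
    using block_coeff_eq_level_gf[OF set] label_sum_eq_block_coeff[OF W content, of tvar]
      sum_good_perms[of tvar] by (simp add: K_def)
qed

lemma nth_eulerian_Q:
  "mfps_nth (fps_nth (eulerian_Q n :: complex mfps fps) d) m =
    (if size m = n then of_int (coeff (level_gf 0 m) d) else 0)"
proof -
  let ?W = "decreasing_letters m"
  let ?P = "{\<sigma>. \<sigma> permutes {1..n}}"
  have fin: "finite ?P" by (simp add: finite_permutations)
  have lhs: "mfps_nth (fps_nth (eulerian_Q n :: complex mfps fps) d) m =
      (\<Sum>\<sigma>\<in>{\<sigma> \<in> ?P. card (EXC n \<sigma>) = d}. if size m = n \<and> good_perm n ?W \<sigma> then 1 else 0)"
    unfolding eulerian_Q_def by (subst fps_nth_sum_monomials[OF fin])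
      (simp add: nth_fund_quasisym good_perm_def)
  show ?thesis
  proof (cases "size m = n")
    case True
    have count: "(\<Sum>x\<in>A. if P x then 1 else 0) = (of_nat (card {x \<in> A. P x}) :: 'b::semiring_1)"
      if "finite A" for A :: "(nat \<Rightarrow> nat) set" and P
      using that by (simp add: sum.inter_filter[symmetric])
    have "level_gf 0 m = (\<Sum>\<sigma> | \<sigma> permutes {1..n} \<and> good_perm n ?W \<sigma>. tvar ^ card (EXC n \<sigma>))"
      using level_gf_0_perms[of m] unfolding True .
    then have "coeff (level_gf 0 m) d =
        (\<Sum>\<sigma> | \<sigma> permutes {1..n} \<and> good_perm n ?W \<sigma>. if card (EXC n \<sigma>) = d then 1 else 0)"
      by (simp only: coeff_sum coeff_tvar_power)
    also have "\<dots> = int (card {\<sigma> \<in> {\<sigma>. \<sigma> permutes {1..n} \<and> good_perm n ?W \<sigma>}. card (EXC n \<sigma>) = d})"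
      by (rule count)  (rule rev_finite_subset[OF fin], blast)
    finally have 1: "(of_int (coeff (level_gf 0 m) d) :: complex) =
        of_nat (card {\<sigma> \<in> {\<sigma>. \<sigma> permutes {1..n} \<and> good_perm n ?W \<sigma>}. card (EXC n \<sigma>) = d})"
      by (simp only: of_int_of_nat_eq)
    have "mfps_nth (fps_nth (eulerian_Q n :: complex mfps fps) d) m =
        (\<Sum>\<sigma>\<in>{\<sigma> \<in> ?P. card (EXC n \<sigma>) = d}. if good_perm n ?W \<sigma> then 1 else 0)"
      unfolding lhs using True by (simp only: simp_thms)
    also have "\<dots> = of_nat (card {\<sigma> \<in> {\<sigma> \<in> ?P. card (EXC n \<sigma>) = d}. good_perm n ?W \<sigma>})"
      by (rule count) (rule rev_finite_subset[OF fin], blast)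
    also have "{\<sigma> \<in> {\<sigma> \<in> ?P. card (EXC n \<sigma>) = d}. good_perm n ?W \<sigma>} =
       {\<sigma> \<in> {\<sigma>. \<sigma> permutes {1..n} \<and> good_perm n ?W \<sigma>}. card (EXC n \<sigma>) = d}" by auto
    finally show ?thesis unfolding 1 using True by (simp only: if_True simp_thms)
  next
    case False
    then show ?thesis unfolding lhs by simp
  qed
qed

lemma sum_splits: "(\<Sum>(a, b)\<in>splits m. f a b) = (\<Sum>B | B \<subseteq># m. f (m - B) B :: 'a::comm_monoid_add)"
  by (rule sum.reindex_bij_witness[where i = "\<lambda>B. (m - B, B)" and j = snd])
    (auto simp: splits_def)

lemma nth_eulerian_Q_tilde:
  "mfps_nth (fps_nth (eulerian_Q_tilde n :: complex mfps fps) d) m =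
    (if size m = n then of_int (coeff (level_gf 1 m) d) else 0)"
proof (cases d)
  case 0
  have "coeff (tvar * p) 0 = 0" for p by (simp add: tvar_def coeff_mult)
  then have "coeff (level_gf 1 m) 0 = 1" unfolding level_gf_1 by simp
  then show ?thesis by (simp add: 0 eulerian_Q_tilde_def nth_hom_sym)
next
  case (Suc d')
  have shift: "coeff (tvar * p) (Suc d') = coeff p d'" for p
    by (simp add: tvar_def coeff_monom_mult)
  have "mfps_nth (hom_sym (n - k) * fps_nth (eulerian_Q k :: complex mfps fps) d') m =
      (\<Sum>B | B \<subseteq># m. if size m = n \<and> size B = k then of_int (coeff (level_gf 0 B) d') else 0)"
    if k: "k \<in> {1..n}" for k
  proof -
    have "size (m - B) = n - k \<and> size B = k \<longleftrightarrow> size m = n \<and> size B = k" if "B \<subseteq># m" for B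
      using that k size_mset_mono[OF that] by (auto simp: size_Diff_submset)
    then show ?thesis
      unfolding mfps_nth_mult sum_splits
      by (intro sum.cong refl) (auto simp: nth_hom_sym nth_eulerian_Q)
  qed
  then have "mfps_nth (fps_nth (eulerian_Q_tilde n :: complex mfps fps) d) m =
      (\<Sum>k=1..n. \<Sum>B | B \<subseteq># m. if size m = n \<and> size B = k then of_int (coeff (level_gf 0 B) d') else 0)"
    unfolding Suc eulerian_Q_tilde_def by (simp add: fps_sum_nth)
  also have "\<dots> = (\<Sum>B | B \<subseteq># m. \<Sum>k=1..n. if size m = n \<and> size B = k then of_int (coeff (level_gf 0 B) d') else 0)"
    by (rule sum.swap)
  also have "\<dots> = (\<Sum>B | B \<subseteq># m. if size m = n \<and> B \<noteq> {#} then of_int (coeff (level_gf 0 B) d') else 0)"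
  proof (intro sum.cong refl)
    fix B assume "B \<in> {B. B \<subseteq># m}"
    then have le: "size B \<le> size m" by (simp add: size_mset_mono)
    show "(\<Sum>k=1..n. if size m = n \<and> size B = k then of_int (coeff (level_gf 0 B) d') else 0) =
        (if size m = n \<and> B \<noteq> {#} then of_int (coeff (level_gf 0 B) d') else (0::complex))"
    proof (cases "size m = n")
      case True
      have "(\<Sum>k=1..n. if size B = k then of_int (coeff (level_gf 0 B) d') else (0::complex)) =
          (if size B \<in> {1..n} then of_int (coeff (level_gf 0 B) d') else 0)"
        by (rule sum.delta') simp
      moreover have "size B \<in> {1..n} \<longleftrightarrow> B \<noteq> {#}"
        using le True by (auto simp: Suc_le_eq nonempty_has_size)
      ultimately show ?thesis using True by (simp only: simp_thms)
    qed simp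
  qed
  also have "\<dots> = (if size m = n then of_int (coeff (level_gf 1 m) d) else 0)"
  proof (cases "size m = n")
    case True
    have fin: "finite {B. B \<subseteq># m}" by simp
    have "(\<Sum>B | B \<subseteq># m. if B \<noteq> {#} then of_int (coeff (level_gf 0 B) d') else (0::complex)) =
        (\<Sum>B\<in>{B \<in> {B. B \<subseteq># m}. B \<noteq> {#}}. of_int (coeff (level_gf 0 B) d'))"
      by (rule sum.inter_filter[OF fin, symmetric])
    also have "\<dots> = of_int (coeff (level_gf 1 m) d)"
      unfolding level_gf_1 Suc by (simp add: shift coeff_sum)
    finally show ?thesis using True by (simp only: simp_thms if_True)
  qed simp
  finally show ?thesis .
qed

lemma coeff_tvar_sum:
  "finite A \<Longrightarrow> coeff (\<Sum>M\<in>A. tvar ^ f M) d = int (card {M \<in> A. f M = d})"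
  unfolding coeff_sum coeff_tvar_power by (simp add: sum.inter_filter[symmetric])

lemma nth_eulerian_Q_tilde_card:
  "mfps_nth (fps_nth (eulerian_Q_tilde n :: complex mfps fps) d) m =
    (if size m = n then of_nat (card {M \<in> labelled 1 m. height M = d}) else 0)"
  unfolding nth_eulerian_Q_tilde level_gf_def coeff_tvar_sum[OF finite_labelled] by simp

lemma nth_eulerian_Q_card:
  assumes "1 \<le> n"
  shows "mfps_nth (fps_nth (eulerian_Q n :: complex mfps fps) d) m =
    (if size m = n then of_nat (card {M \<in> labelled_pos 1 m. height M = Suc d}) else 0)"
proof (cases "size m = n")
  case True
  then have "m \<noteq> {#}" using assms by auto
  then have "coeff (level_gf 0 m) d = coeff (pos_gf 1 m) (Suc d)"
    by (simp add: pos_gf_1[simplified] tvar_def coeff_monom_mult)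
  also have "\<dots> = int (card {M \<in> labelled_pos 1 m. height M = Suc d})"
    unfolding pos_gf_def by (rule coeff_tvar_sum[OF finite_labelled_pos])
  finally show ?thesis unfolding nth_eulerian_Q using True by simp
qed (simp add: nth_eulerian_Q)

section \<open>Counting level functions on a set\<close>

text \<open>If all letters are distinct, then every permutation is good.\<close>

lemma level_gf_0_distinct:
  assumes "finite E"
  shows "poly (level_gf 0 (mset_set E)) 1 = fact (card E)"
proof -
  let ?m = "mset_set E" and ?n = "card E"
  let ?W = "decreasing_letters ?m"
  interpret decreasing_word "size ?m" ?W ?m by (rule decreasing_word_letters)
  have strict: "?W (Suc j) < ?W j" if j: "j \<in> {1..<?n}" for j
  proof -
    let ?w = "rev (sorted_list_of_multiset ?m)"
    have w: "distinct ?w" "length ?w = ?n"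
      by simp_all
    have "?w ! j \<noteq> ?w ! (j - 1)"
    proof -
      have "j < length ?w" "j - 1 < length ?w" "j \<noteq> j - 1" using j unfolding w(2) by auto
      then show ?thesis using nth_eq_iff_index_eq[OF w(1)] by blast
    qed
    then have "?W (Suc j) \<noteq> ?W j" by (simp add: decreasing_letters_def)
    moreover have "?W (Suc j) \<le> ?W j" using dec[of j "Suc j"] j by simp
    ultimately show ?thesis by simp
  qed
  have "level_gf 0 ?m = (\<Sum>\<sigma> | \<sigma> permutes {1..?n}. tvar ^ card (EXC ?n \<sigma>))"
    unfolding level_gf_0_perms using strict by (intro sum.cong) (auto simp: good_perm_def)
  then have "poly (level_gf 0 ?m) 1 = (\<Sum>\<sigma> | \<sigma> permutes {1..?n}. 1)"
    by (simp add: poly_sum tvar_def poly_monom)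
  also have "\<dots> = int (card {\<sigma>. \<sigma> permutes {1..?n}})" by simp
  also have "card {\<sigma>. \<sigma> permutes {1..?n}} = fact ?n" by (rule card_permutations) auto
  finally show ?thesis by simp
qed

text \<open>A list of distinct elements of \<open>E\<close> is an ordering of a subset of \<open>E\<close>. The subsets come from
  \<open>level_gf_1\<close> at \<open>t = 1\<close>, the orderings from \<open>level_gf_0_distinct\<close>.\<close>

lemma card_labelled_distinct:
  assumes "finite E"
  shows "card (labelled 1 (mset_set E)) = card {xs. distinct xs \<and> set xs \<subseteq> E}"
proof -
  have card: "poly (level_gf 1 (mset_set E)) 1 = int (card (labelled 1 (mset_set E)))"
    unfolding level_gf_def by (simp add: poly_sum tvar_def poly_monom)
  have "poly (level_gf 1 (mset_set E)) 1 = (\<Sum>B | B \<subseteq># mset_set E. poly (level_gf 0 B) 1)"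
    unfolding level_gf_1 sum_subset_mset_nonempty
    by (simp add: poly_sum tvar_def poly_monom level_gf_empty[unfolded One_nat_def])
  also have "\<dots> = (\<Sum>S\<in>Pow E. poly (level_gf 0 (mset_set S)) 1)"
  proof (rule sum.reindex_bij_witness[where i = mset_set and j = set_mset])
    fix B assume B: "B \<in> {B. B \<subseteq># mset_set E}"
    then have le: "count B x \<le> count (mset_set E) x" for x by (simp add: mset_subset_eq_count)
    then show "set_mset B \<in> Pow E"
      using assms B by (metis Pow_iff finite_set_mset_mset_set mem_Collect_eq set_mset_mono)
    have "count B x \<le> 1" for x using le[of x] by (simp add: count_mset_set' split: if_splits)
    then show "mset_set (set_mset B) = B"
      by (intro multiset_eqI) (simp add: count_mset_set', metis One_nat_def Suc_leI count_greater_zero_iff le_antisym not_in_iff)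
    then show "poly (level_gf 0 (mset_set (set_mset B))) 1 = poly (level_gf 0 B) 1" by simp
  next
    fix S assume "S \<in> Pow E"
    then have "finite S" using assms finite_subset by blast
    then show "set_mset (mset_set S) = S" by simp
    show "mset_set S \<in> {B. B \<subseteq># mset_set E}"
      using \<open>S \<in> Pow E\<close> assms by (simp add: subset_imp_msubset_mset_set)
  qed
  also have "\<dots> = (\<Sum>S\<in>Pow E. int (card {xs. distinct xs \<and> set xs = S}))"
  proof (intro sum.cong refl)
    fix S assume "S \<in> Pow E"
    then have S: "finite S" using assms finite_subset by blast
    have "{xs. distinct xs \<and> set xs = S} = permutations_of_set S"
      by (auto simp: permutations_of_set_def)
    then show "poly (level_gf 0 (mset_set S)) 1 = int (card {xs. distinct xs \<and> set xs = S})"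
      using level_gf_0_distinct[OF S] card_permutations_of_set[OF S] by simp
  qed
  also have "\<dots> = int (card (\<Union>S\<in>Pow E. {xs. distinct xs \<and> set xs = S}))"
  proof -
    have "finite {xs. distinct xs \<and> set xs = S}" if "S \<in> Pow E" for S
    proof -
      have "{xs. distinct xs \<and> set xs = S} = permutations_of_set S"
        by (auto simp: permutations_of_set_def)
      then show ?thesis by simp
    qed
    then show ?thesis
      using assms by (subst card_UN_disjoint) auto
  qed
  also have "(\<Union>S\<in>Pow E. {xs. distinct xs \<and> set xs = S}) = {xs. distinct xs \<and> set xs \<subseteq> E}"
    by blast
  finally show ?thesis unfolding card by (simp only: of_nat_eq_iff)
qed

section \<open>The Frobenius characteristic of a permutation character on level functions\<close>

definition fixed_maps :: "nat \<Rightarrow> (nat multiset \<Rightarrow> bool) \<Rightarrow> (nat \<Rightarrow> nat) \<Rightarrow> (nat \<Rightarrow> nat) set" where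
  "fixed_maps n P \<sigma> = {D \<in> {1..n} \<rightarrow>\<^sub>E UNIV.
     P (image_mset D (mset_set {1..n})) \<and> (\<forall>x\<in>{1..n}. D (\<sigma> x) = D x)}"

lemma nth_frobenius_ch:
  "mfps_nth (frobenius_ch n \<chi>) m =
    (\<Sum>\<sigma> | \<sigma> permutes {1..n}. \<chi> \<sigma> / fact n * of_nat (card (fixed_maps n (\<lambda>h. h = m) \<sigma>)))"
  unfolding frobenius_ch_def fixed_maps_def mfps_nth_sum nth_const_mult
  by (intro sum.cong refl) (simp add: nth_cycle_power_sum)

text \<open>The permutations act transitively on the functions of a given content. The orbit count is read
  off from the fact that the trivial character has the characteristic \<open>hom_sym n\<close>.\<close>

lemma sum_card_fixed_content:
  assumes "size G = n"
  shows "(\<Sum>\<sigma> | \<sigma> permutes {1..n}. card (fixed_maps n (\<lambda>h. h = G) \<sigma>)) = fact n"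
proof -
  have "mfps_nth (frobenius_ch n (\<lambda>_. 1)) G = 1"
    using assms by (simp add: frobenius_ch_trivial nth_hom_sym)
  then have "(\<Sum>\<sigma> | \<sigma> permutes {1..n}. of_nat (card (fixed_maps n (\<lambda>h. h = G) \<sigma>)) / fact n) = (1::complex)"
    unfolding nth_frobenius_ch by simp
  then have "(\<Sum>\<sigma> | \<sigma> permutes {1..n}. of_nat (card (fixed_maps n (\<lambda>h. h = G) \<sigma>))) = (fact n :: complex)"
    by (simp add: sum_divide_distrib[symmetric])
  then have "of_nat (\<Sum>\<sigma> | \<sigma> permutes {1..n}. card (fixed_maps n (\<lambda>h. h = G) \<sigma>)) = (of_nat (fact n) :: complex)"
    by simp
  then show ?thesis by (simp only: of_nat_eq_iff)
qed

lemma finite_fixed_maps: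
  assumes "\<And>h v. P h \<Longrightarrow> v \<in># h \<Longrightarrow> v \<le> c"
  shows "finite (fixed_maps n P \<sigma>)"
proof (rule finite_subset)
  show "fixed_maps n P \<sigma> \<subseteq> {1..n} \<rightarrow>\<^sub>E {..c}"
  proof
    fix D assume D: "D \<in> fixed_maps n P \<sigma>"
    have "D x \<le> c" if "x \<in> {1..n}" for x
      using assms[of "image_mset D (mset_set {1..n})" "D x"] D that by (simp add: fixed_maps_def)
    then show "D \<in> {1..n} \<rightarrow>\<^sub>E {..c}" using D by (auto simp: fixed_maps_def PiE_iff)
  qed
qed (intro finite_PiE, auto)

text \<open>Two functions fixed by \<open>\<sigma>\<close> are the same as one fixed function with values in pairs. The pairs
  are encoded by natural numbers so that the orbit count for functions into \<open>nat\<close> applies to them.\<close>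

lemma card_fixed_pairs:
  fixes m :: "nat multiset"
  assumes bound: "\<And>h v. P h \<Longrightarrow> v \<in># h \<Longrightarrow> v \<le> c"
    and \<sigma>: "\<sigma> permutes {1..n}"
  defines "Ms \<equiv> {M. image_mset fst M = m \<and> P (image_mset snd M)}"
  assumes fin: "finite Ms"
  shows "card (fixed_maps n (\<lambda>h. h = m) \<sigma>) * card (fixed_maps n P \<sigma>) =
    (\<Sum>M\<in>Ms. card (fixed_maps n (\<lambda>h. h = image_mset prod_encode M) \<sigma>))"
proof -
  let ?S = "{1..n}" and ?G = "\<lambda>M. fixed_maps n (\<lambda>h. h = image_mset prod_encode M) \<sigma>"
  let ?code = "\<lambda>(f, D). \<lambda>x\<in>?S. prod_encode (f x, D x)"
  let ?decode = "\<lambda>g. (\<lambda>x\<in>?S. fst (prod_decode (g x)), \<lambda>x\<in>?S. snd (prod_decode (g x)))"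
  have in_S: "\<sigma> x \<in> ?S" if "x \<in> ?S" for x using permutes_in_image[OF \<sigma>] that by blast
  have mset_restrict: "image_mset (restrict f ?S) (mset_set ?S) = image_mset f (mset_set ?S)"
    for f :: "nat \<Rightarrow> nat"
    by (intro image_mset_cong) simp
  have finG: "finite (?G M)" for M
  proof (rule finite_fixed_maps[where c = "Max (insert 0 (set_mset (image_mset prod_encode M)))"])
    fix h v assume "h = image_mset prod_encode M" "v \<in># h"
    then show "v \<le> Max (insert 0 (set_mset (image_mset prod_encode M)))" by (intro Max_ge) auto
  qed
  have "card (fixed_maps n (\<lambda>h. h = m) \<sigma> \<times> fixed_maps n P \<sigma>) = card (\<Union>M\<in>Ms. ?G M)"
  proof (rule bij_betw_same_card, rule bij_betw_byWitness[where f = ?code and f' = ?decode])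
    show "\<forall>p\<in>fixed_maps n (\<lambda>h. h = m) \<sigma> \<times> fixed_maps n P \<sigma>. ?decode (?code p) = p"
      by (auto simp: fixed_maps_def fun_eq_iff PiE_iff extensional_def)
    show "\<forall>g\<in>\<Union> (?G ` Ms). ?code (?decode g) = g"
      by (auto simp: fixed_maps_def fun_eq_iff PiE_iff extensional_def)
    show "?code ` (fixed_maps n (\<lambda>h. h = m) \<sigma> \<times> fixed_maps n P \<sigma>) \<subseteq> \<Union> (?G ` Ms)"
    proof clarify
      fix f D assume f: "f \<in> fixed_maps n (\<lambda>h. h = m) \<sigma>" and D: "D \<in> fixed_maps n P \<sigma>"
      define M where "M = image_mset (\<lambda>x. (f x, D x)) (mset_set ?S)"
      have "image_mset fst M = image_mset f (mset_set ?S)" "image_mset snd M = image_mset D (mset_set ?S)"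
        unfolding M_def by (simp_all add: multiset.map_comp comp_def)
      then have "M \<in> Ms" using f D by (simp add: Ms_def fixed_maps_def)
      moreover have "image_mset prod_encode M = image_mset (\<lambda>x. prod_encode (f x, D x)) (mset_set ?S)"
        unfolding M_def by (simp add: multiset.map_comp comp_def)
      then have "(\<lambda>x\<in>?S. prod_encode (f x, D x)) \<in> ?G M"
        unfolding fixed_maps_def using f D in_S by (simp add: mset_restrict[unfolded One_nat_def] fixed_maps_def)
      ultimately show "(\<lambda>x\<in>?S. prod_encode (f x, D x)) \<in> \<Union> (?G ` Ms)" by blast
    qed
    show "?decode ` \<Union> (?G ` Ms) \<subseteq> fixed_maps n (\<lambda>h. h = m) \<sigma> \<times> fixed_maps n P \<sigma>"
    proof
      fix p assume "p \<in> ?decode ` \<Union> (?G ` Ms)"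
      then obtain g M where M: "M \<in> Ms" and g: "g \<in> ?G M" and p: "p = ?decode g" by blast
      have eq: "image_mset (h \<circ> prod_decode \<circ> g) (mset_set ?S) = image_mset h M" for h :: "nat \<times> nat \<Rightarrow> nat"
      proof -
        have "image_mset (h \<circ> prod_decode \<circ> g) (mset_set ?S) = image_mset (h \<circ> prod_decode) (image_mset g (mset_set ?S))"
          by (simp add: multiset.map_comp)
        also have "image_mset g (mset_set ?S) = image_mset prod_encode M"
          using g by (simp add: fixed_maps_def)
        finally show ?thesis by (simp add: multiset.map_comp comp_def)
      qed
      have "image_mset (\<lambda>x. fst (prod_decode (g x))) (mset_set ?S) = m"
        "P (image_mset (\<lambda>x. snd (prod_decode (g x))) (mset_set ?S))"
        using eq[of fst] eq[of snd] M by (simp_all add: Ms_def comp_def)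
      then show "p \<in> fixed_maps n (\<lambda>h. h = m) \<sigma> \<times> fixed_maps n P \<sigma>"
        unfolding p fixed_maps_def using g in_S by (simp add: mset_restrict[unfolded One_nat_def] fixed_maps_def)
    qed
  qed
  also have "\<dots> = (\<Sum>M\<in>Ms. card (?G M))"
  proof (rule card_UN_disjoint)
    show "\<forall>M\<in>Ms. \<forall>N\<in>Ms. M \<noteq> N \<longrightarrow> ?G M \<inter> ?G N = {}"
    proof (intro ballI impI)
      fix M N :: "(nat \<times> nat) multiset" assume "M \<noteq> N"
      moreover have "image_mset prod_decode (image_mset prod_encode M) = M" for M
        by (simp add: multiset.map_comp comp_def)
      ultimately have "image_mset prod_encode M \<noteq> image_mset prod_encode N" by metis
      then show "?G M \<inter> ?G N = {}" by (auto simp: fixed_maps_def)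
    qed
  qed (use fin finG in auto)
  finally show ?thesis by (simp add: card_cartesian_product)
qed

text \<open>The coefficient at \<open>m\<close> is the inner product with the permutation character on colourings of
  content \<open>m\<close>. The product of both characters belongs to the pairs of a colouring and a level
  function, whose orbits are classified by multisets of pairs.\<close>

theorem nth_frobenius_ch_levels:
  assumes bound: "\<And>h v. P h \<Longrightarrow> v \<in># h \<Longrightarrow> v \<le> c"
    and fin: "finite {M. image_mset fst M = m \<and> P (image_mset snd M)}"
  shows "mfps_nth (frobenius_ch n (\<lambda>\<sigma>. of_nat (card (fixed_maps n P \<sigma>)))) m =
    (if size m = n then of_nat (card {M. image_mset fst M = m \<and> P (image_mset snd M)}) else 0)"
proof (cases "size m = n")
  case True
  let ?Ms = "{M. image_mset fst M = m \<and> P (image_mset snd M)}"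
  have size: "size (image_mset prod_encode M) = n" if "M \<in> ?Ms" for M
    using that True by (metis (mono_tags, lifting) mem_Collect_eq size_image_mset)
  have "(\<Sum>\<sigma> | \<sigma> permutes {1..n}. card (fixed_maps n (\<lambda>h. h = m) \<sigma>) * card (fixed_maps n P \<sigma>)) =
      (\<Sum>\<sigma> | \<sigma> permutes {1..n}. \<Sum>M\<in>?Ms. card (fixed_maps n (\<lambda>h. h = image_mset prod_encode M) \<sigma>))"
    using card_fixed_pairs[OF bound _ fin] by (intro sum.cong) auto
  also have "\<dots> = (\<Sum>M\<in>?Ms. \<Sum>\<sigma> | \<sigma> permutes {1..n}. card (fixed_maps n (\<lambda>h. h = image_mset prod_encode M) \<sigma>))"
    by (rule sum.swap)
  also have "\<dots> = (\<Sum>M\<in>?Ms. fact n)"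
    by (intro sum.cong refl sum_card_fixed_content size)
  finally have total: "(\<Sum>\<sigma> | \<sigma> permutes {1..n}. card (fixed_maps n (\<lambda>h. h = m) \<sigma>) * card (fixed_maps n P \<sigma>)) =
      card ?Ms * fact n" by simp
  have "mfps_nth (frobenius_ch n (\<lambda>\<sigma>. of_nat (card (fixed_maps n P \<sigma>)))) m =
      of_nat (\<Sum>\<sigma> | \<sigma> permutes {1..n}. card (fixed_maps n (\<lambda>h. h = m) \<sigma>) * card (fixed_maps n P \<sigma>)) / fact n"
    unfolding nth_frobenius_ch by (simp add: sum_divide_distrib mult.commute)
  then show ?thesis using True unfolding total by simp
next
  case False
  have "fixed_maps n (\<lambda>h. h = m) \<sigma> = {}" for \<sigma>
  proof -
    have "size (image_mset D (mset_set {1..n})) = n" for D :: "nat \<Rightarrow> nat" by simp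
    then show ?thesis using False by (force simp: fixed_maps_def)
  qed
  then show ?thesis using False by (simp add: nth_frobenius_ch)
qed

section \<open>Linear extension\<close>

definition lin_ext :: "('a \<Rightarrow> 'b::zero \<Rightarrow> 'c::comm_monoid_add) \<Rightarrow> ('a \<Rightarrow>\<^sub>0 'b) \<Rightarrow> 'c" where
  "lin_ext h p = (\<Sum>k\<in>Poly_Mapping.keys p. h k (Poly_Mapping.lookup p k))"

locale additive_family =
  fixes h :: "'a \<Rightarrow> 'b::monoid_add \<Rightarrow> 'c::comm_monoid_add"
  assumes zero [simp]: "h k 0 = 0" and add: "h k (x + y) = h k x + h k y"
begin

lemma lin_ext_0 [simp]: "lin_ext h 0 = 0"
  by (simp add: lin_ext_def)

lemma lin_ext_single [simp]: "lin_ext h (Poly_Mapping.single k x) = h k x"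
  by (cases "x = 0") (simp_all add: lin_ext_def)

end

lemma lin_ext_add:
  fixes h :: "'a \<Rightarrow> 'b::comm_monoid_add \<Rightarrow> 'c::comm_monoid_add"
  assumes "additive_family h"
  shows "lin_ext h (p + q) = lin_ext h p + lin_ext h q"
proof -
  interpret additive_family h by fact
  show ?thesis
    unfolding lin_ext_def by (rule setsum_keys_plus_distrib) (simp_all add: add lookup_add)
qed

lemma lin_ext_sum:
  fixes h :: "'a \<Rightarrow> 'b::comm_monoid_add \<Rightarrow> 'c::comm_monoid_add"
  assumes "additive_family h"
  shows "lin_ext h (sum p A) = (\<Sum>x\<in>A. lin_ext h (p x))"
proof -
  interpret additive_family h by fact
  show ?thesis
    by (induction A rule: infinite_finite_induct) (simp_all add: lin_ext_add[OF assms])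
qed

lemma poly_mapping_sum_singles:
  "p = (\<Sum>k\<in>Poly_Mapping.keys p. Poly_Mapping.single k (Poly_Mapping.lookup p k))"
proof (rule poly_mapping_eqI)
  fix k
  show "Poly_Mapping.lookup p k = Poly_Mapping.lookup (\<Sum>k\<in>Poly_Mapping.keys p. Poly_Mapping.single k (Poly_Mapping.lookup p k)) k"
    by (cases "k \<in> Poly_Mapping.keys p")
      (simp_all add: lookup_sum lookup_single when_def in_keys_iff)
qed

section \<open>Coordinates and traces\<close>

definition supported :: "'i set \<Rightarrow> ('i \<Rightarrow> 'k::zero) set" where
  "supported B = {c. \<forall>i. i \<notin> B \<longrightarrow> c i = 0}"

text \<open>An isomorphism from \<open>M\<close> to the space of functions supported on the finite set \<open>B\<close>. It
  replaces a basis, and suits modules whose elements are cosets.\<close>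

locale coordinates =
  fixes M :: "('k::field, 'v, 'b) module_scheme" and B :: "'i set" and \<Phi> :: "'v \<Rightarrow> 'i \<Rightarrow> 'k"
  assumes finite_B [simp, intro]: "finite B"
    and bij: "bij_betw \<Phi> (carrier M) (supported B)"
    and add_closed: "\<lbrakk>a \<in> carrier M; b \<in> carrier M\<rbrakk> \<Longrightarrow> a \<oplus>\<^bsub>M\<^esub> b \<in> carrier M"
    and coord_add: "\<lbrakk>a \<in> carrier M; b \<in> carrier M\<rbrakk> \<Longrightarrow> \<Phi> (a \<oplus>\<^bsub>M\<^esub> b) i = \<Phi> a i + \<Phi> b i"
    and zero_closed: "\<zero>\<^bsub>M\<^esub> \<in> carrier M"
    and coord_zero: "\<Phi> \<zero>\<^bsub>M\<^esub> i = 0"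
    and smult_closed: "a \<in> carrier M \<Longrightarrow> c \<odot>\<^bsub>M\<^esub> a \<in> carrier M"
    and coord_smult: "a \<in> carrier M \<Longrightarrow> \<Phi> (c \<odot>\<^bsub>M\<^esub> a) i = c * \<Phi> a i"
begin

lemma eqI: "\<lbrakk>a \<in> carrier M; b \<in> carrier M; \<And>i. \<Phi> a i = \<Phi> b i\<rbrakk> \<Longrightarrow> a = b"
  using bij by (auto simp: bij_betw_def inj_on_def fun_eq_iff)

lemma coord_outside: "a \<in> carrier M \<Longrightarrow> i \<notin> B \<Longrightarrow> \<Phi> a i = 0"
  using bij_betwE[OF bij] by (auto simp: supported_def)

definition vec :: "('i \<Rightarrow> 'k) \<Rightarrow> 'v" where
  "vec c = inv_into (carrier M) \<Phi> c"

lemma vec_closed: "c \<in> supported B \<Longrightarrow> vec c \<in> carrier M"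
  unfolding vec_def using bij by (metis bij_betw_def inv_into_into)

lemma coord_vec: "c \<in> supported B \<Longrightarrow> \<Phi> (vec c) = c"
  unfolding vec_def using bij by (metis bij_betw_def f_inv_into_f)

definition unit :: "'i \<Rightarrow> 'v" where
  "unit j = vec (\<lambda>i. if i = j then 1 else 0)"

lemma unit_closed: "j \<in> B \<Longrightarrow> unit j \<in> carrier M"
  unfolding unit_def by (rule vec_closed) (auto simp: supported_def)

lemma coord_unit: "j \<in> B \<Longrightarrow> \<Phi> (unit j) i = (if i = j then 1 else 0)"
  unfolding unit_def by (subst coord_vec) (auto simp: supported_def)

lemma abelian_monoid: "abelian_monoid M"
  by (rule abelian_monoidI)
    (auto intro!: eqI simp: add_closed zero_closed coord_add coord_zero algebra_simps)

lemma coord_finsum: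
  assumes "finite S" "\<And>s. s \<in> S \<Longrightarrow> g s \<in> carrier M"
  shows "(\<Oplus>\<^bsub>M\<^esub>s\<in>S. g s) \<in> carrier M \<and> \<Phi> (\<Oplus>\<^bsub>M\<^esub>s\<in>S. g s) i = (\<Sum>s\<in>S. \<Phi> (g s) i)"
  using assms
proof (induction S)
  case empty
  then show ?case
    by (simp add: abelian_monoid.finsum_empty[OF abelian_monoid] zero_closed coord_zero)
next
  case (insert s S)
  have "(\<Oplus>\<^bsub>M\<^esub>s\<in>insert s S. g s) = g s \<oplus>\<^bsub>M\<^esub> (\<Oplus>\<^bsub>M\<^esub>s\<in>S. g s)"
    using insert by (intro abelian_monoid.finsum_insert[OF abelian_monoid]) auto
  then show ?case using insert by (simp add: add_closed coord_add)
qed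

end

lemma (in coordinates) expansion:
  assumes "v \<in> carrier M"
  shows "\<Phi> v j = (\<Sum>i\<in>B. \<Phi> v i * \<Phi> (unit i) j)"
proof -
  have "(\<Sum>i\<in>B. \<Phi> v i * \<Phi> (unit i) j) = (\<Sum>i\<in>B. if j = i then \<Phi> v i else 0)"
    by (intro sum.cong) (auto simp: coord_unit)
  then show ?thesis using coord_outside[OF assms] by (simp add: sum.delta)
qed

locale complex_coordinates = coordinates M B \<Phi>
  for M :: "(complex, 'v, 'b) module_scheme" and B :: "'i set" and \<Phi>
begin

lemma is_basis_units: "is_basis M (unit ` B)"
  unfolding is_basis_def
proof (intro conjI ballI)
  show "finite (unit ` B)" "unit ` B \<subseteq> carrier M" using unit_closed by auto
  have inj: "inj_on unit B"
    by (rule inj_onI) (metis coord_unit one_neq_zero)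
  fix v assume v: "v \<in> carrier M"
  have coord: "\<Phi> (\<Oplus>\<^bsub>M\<^esub>b\<in>unit ` B. c b \<odot>\<^bsub>M\<^esub> b) i = (if i \<in> B then c (unit i) else 0)"
    "(\<Oplus>\<^bsub>M\<^esub>b\<in>unit ` B. c b \<odot>\<^bsub>M\<^esub> b) \<in> carrier M" for c i
  proof -
    have "\<Phi> (\<Oplus>\<^bsub>M\<^esub>b\<in>unit ` B. c b \<odot>\<^bsub>M\<^esub> b) i = (\<Sum>b\<in>unit ` B. \<Phi> (c b \<odot>\<^bsub>M\<^esub> b) i)"
      using coord_finsum[of "unit ` B" "\<lambda>b. c b \<odot>\<^bsub>M\<^esub> b" i] unit_closed smult_closed by auto
    also have "\<dots> = (\<Sum>j\<in>B. if i = j then c (unit j) else 0)"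
      unfolding sum.reindex[OF inj] by (intro sum.cong) (auto simp: coord_smult unit_closed coord_unit)
    finally show "\<Phi> (\<Oplus>\<^bsub>M\<^esub>b\<in>unit ` B. c b \<odot>\<^bsub>M\<^esub> b) i = (if i \<in> B then c (unit i) else 0)"
      by (simp add: sum.delta)
    show "(\<Oplus>\<^bsub>M\<^esub>b\<in>unit ` B. c b \<odot>\<^bsub>M\<^esub> b) \<in> carrier M"
      using coord_finsum[of "unit ` B" "\<lambda>b. c b \<odot>\<^bsub>M\<^esub> b" i] unit_closed smult_closed by auto
  qed
  show "\<exists>!c. c \<in> extensional (unit ` B) \<and> v = (\<Oplus>\<^bsub>M\<^esub>b\<in>unit ` B. c b \<odot>\<^bsub>M\<^esub> b)"
  proof (rule ex1I[of _ "\<lambda>b\<in>unit ` B. \<Phi> v (inv_into B unit b)"], intro conjI)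
    show "v = (\<Oplus>\<^bsub>M\<^esub>b\<in>unit ` B. (\<lambda>b\<in>unit ` B. \<Phi> v (inv_into B unit b)) b \<odot>\<^bsub>M\<^esub> b)"
      by (rule eqI[OF v coord(2)]) (auto simp: coord(1) inv_into_f_f[OF inj] coord_outside[OF v])
    fix c assume c: "c \<in> extensional (unit ` B) \<and> v = (\<Oplus>\<^bsub>M\<^esub>b\<in>unit ` B. c b \<odot>\<^bsub>M\<^esub> b)"
    show "c = (\<lambda>b\<in>unit ` B. \<Phi> v (inv_into B unit b))"
    proof
      fix b
      show "c b = (\<lambda>b\<in>unit ` B. \<Phi> v (inv_into B unit b)) b"
      proof (cases "b \<in> unit ` B")
        case True
        then obtain i where i: "i \<in> B" "b = unit i" by blast
        have "\<Phi> v i = c (unit i)" using c coord(1)[of c i] i(1) by metis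
        then show ?thesis using i by (simp add: inv_into_f_f[OF inj])
      next
        case False
        then show ?thesis using c extensional_arb[of c "unit ` B" b] by auto
      qed
    qed
  qed simp
qed

text \<open>The trace is defined through some unspecified basis \<open>C\<close>. The matrices \<open>\<gamma>\<close> and \<open>\<Phi>\<close> of the
  change of coordinates between \<open>B\<close> and \<open>C\<close> are inverse to each other and cancel inside the
  trace.\<close>

theorem module_trace_eq:
  assumes f: "\<And>v. v \<in> carrier M \<Longrightarrow> f v \<in> carrier M"
    and F: "\<And>v i. v \<in> carrier M \<Longrightarrow> i \<in> B \<Longrightarrow> \<Phi> (f v) i = (\<Sum>j\<in>B. F i j * \<Phi> v j)"
  shows "module_trace M f = (\<Sum>i\<in>B. F i i)"
proof -
  define C where "C = (SOME C. is_basis M C)"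
  have C: "is_basis M C" unfolding C_def by (rule someI[of "is_basis M", OF is_basis_units])
  then have fin: "finite C" and sub: "\<And>b. b \<in> C \<Longrightarrow> b \<in> carrier M"
    and ex1: "\<And>v. v \<in> carrier M \<Longrightarrow> \<exists>!c. c \<in> extensional C \<and> v = (\<Oplus>\<^bsub>M\<^esub>b\<in>C. c b \<odot>\<^bsub>M\<^esub> b)"
    by (auto simp: is_basis_def)
  have comb: "\<Phi> (\<Oplus>\<^bsub>M\<^esub>b\<in>C. c b \<odot>\<^bsub>M\<^esub> b) i = (\<Sum>b\<in>C. c b * \<Phi> b i)"
    "(\<Oplus>\<^bsub>M\<^esub>b\<in>C. c b \<odot>\<^bsub>M\<^esub> b) \<in> carrier M" for c i
    using coord_finsum[OF fin, of "\<lambda>b. c b \<odot>\<^bsub>M\<^esub> b" i] sub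
    by (simp_all add: smult_closed coord_smult)
  have co: "coords M C v \<in> extensional C \<and> v = (\<Oplus>\<^bsub>M\<^esub>b\<in>C. coords M C v b \<odot>\<^bsub>M\<^esub> b)"
    if "v \<in> carrier M" for v
    unfolding coords_def by (rule theI'[OF ex1[OF that]])
  have co_sum: "(\<Sum>b\<in>C. coords M C v b * \<Phi> b i) = \<Phi> v i" if "v \<in> carrier M" for v i
    using co[OF that] comb(1)[of "coords M C v" i] by simp
  define \<gamma> where "\<gamma> i = coords M C (unit i)" for i
  have \<gamma>: "(\<Sum>b\<in>C. \<gamma> i b * \<Phi> b j) = (if j = i then 1 else 0)" if "i \<in> B" for i j
    unfolding \<gamma>_def co_sum[OF unit_closed[OF that]] coord_unit[OF that] ..
  have coords: "coords M C v b = (\<Sum>i\<in>B. \<Phi> v i * \<gamma> i b)" if v: "v \<in> carrier M" and b: "b \<in> C" for v b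
  proof -
    define c where "c = (\<lambda>b\<in>C. \<Sum>i\<in>B. \<Phi> v i * \<gamma> i b)"
    have "v = (\<Oplus>\<^bsub>M\<^esub>b\<in>C. c b \<odot>\<^bsub>M\<^esub> b)"
    proof (rule eqI[OF v comb(2)])
      fix j
      have "\<Phi> (\<Oplus>\<^bsub>M\<^esub>b\<in>C. c b \<odot>\<^bsub>M\<^esub> b) j = (\<Sum>b\<in>C. \<Sum>i\<in>B. \<Phi> v i * (\<gamma> i b * \<Phi> b j))"
        unfolding comb(1) by (intro sum.cong) (auto simp: c_def sum_distrib_right mult.assoc)
      also have "\<dots> = (\<Sum>i\<in>B. \<Phi> v i * (\<Sum>b\<in>C. \<gamma> i b * \<Phi> b j))"
        by (subst sum.swap) (simp add: sum_distrib_left)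
      also have "\<dots> = (\<Sum>i\<in>B. \<Phi> v i * \<Phi> (unit i) j)"
        by (intro sum.cong) (simp_all add: \<gamma> coord_unit)
      finally show "\<Phi> v j = \<Phi> (\<Oplus>\<^bsub>M\<^esub>b\<in>C. c b \<odot>\<^bsub>M\<^esub> b) j"
        unfolding expansion[OF v, of j, symmetric] by (rule sym)
    qed
    moreover have "c \<in> extensional C" by (simp add: c_def)
    ultimately have "coords M C v = c" using ex1[OF v] co[OF v] by blast
    then show ?thesis using b by (simp add: c_def)
  qed
  have "module_trace M f = (\<Sum>b\<in>C. coords M C (f b) b)"
    unfolding module_trace_def C_def[symmetric] Let_def ..
  also have "\<dots> = (\<Sum>b\<in>C. \<Sum>i\<in>B. \<Sum>j\<in>B. F i j * (\<gamma> i b * \<Phi> b j))"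
    by (intro sum.cong refl) (simp add: coords f sub F sum_distrib_left sum_distrib_right ac_simps)
  also have "\<dots> = (\<Sum>i\<in>B. \<Sum>j\<in>B. F i j * (\<Sum>b\<in>C. \<gamma> i b * \<Phi> b j))"
    by (subst sum.swap, rule sum.cong[OF refl], subst sum.swap) (simp add: sum_distrib_left)
  also have "\<dots> = (\<Sum>i\<in>B. \<Sum>j\<in>B. if j = i then F i j else 0)"
    by (intro sum.cong refl) (simp add: \<gamma>)
  also have "\<dots> = (\<Sum>i\<in>B. F i i)"
    by (intro sum.cong refl) (simp add: sum.delta')
  finally show ?thesis .
qed

end

lemma lin_ext_superset:
  assumes "additive_family h" "finite A" "Poly_Mapping.keys p \<subseteq> A"
  shows "lin_ext h p = (\<Sum>k\<in>A. h k (Poly_Mapping.lookup p k))"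
proof -
  interpret additive_family h by fact
  show ?thesis
    unfolding lin_ext_def using assms(2,3)
    by (intro sum.mono_neutral_left) (auto simp: in_keys_iff)
qed

lemma lin_ext_diff:
  fixes h :: "'a \<Rightarrow> 'b::ab_group_add \<Rightarrow> 'c::ab_group_add"
  assumes "additive_family h"
  shows "lin_ext h (p - q) = lin_ext h p - lin_ext h q"
  using lin_ext_add[OF assms, of "p - q" q] by simp

lemma lookup_map_times:
  "Poly_Mapping.lookup (Poly_Mapping.map ((*) c) p) k = c * (Poly_Mapping.lookup p k :: 'a::field)"
  by (simp add: Poly_Mapping.map.rep_eq when_def)

section \<open>Coordinates on the complexification\<close>

locale rational_coordinates = coordinates V B \<kappa>
  for V :: "(rat, 'v, 'b) module_scheme" and B :: "'i set" and \<kappa>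
begin

abbreviation "S \<equiv> carrier V"
abbreviation "N \<equiv> cplx_rel V"

definition cplx_coord :: "('v \<Rightarrow>\<^sub>0 complex) \<Rightarrow> 'i \<Rightarrow> complex" where
  "cplx_coord g i = lin_ext (\<lambda>v c. c * of_rat (\<kappa> v i)) g"

lemma additive_coord: "additive_family (\<lambda>v c :: complex. c * of_rat (\<kappa> v i))"
  by unfold_locales (simp_all add: algebra_simps)

lemma cplx_coord_add: "cplx_coord (g + h) i = cplx_coord g i + cplx_coord h i"
  unfolding cplx_coord_def by (rule lin_ext_add[OF additive_coord])

lemma cplx_coord_diff: "cplx_coord (g - h) i = cplx_coord g i - cplx_coord h i"
  unfolding cplx_coord_def by (rule lin_ext_diff[OF additive_coord])

lemma cplx_coord_sum: "cplx_coord (sum g A) i = (\<Sum>x\<in>A. cplx_coord (g x) i)"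
  unfolding cplx_coord_def by (rule lin_ext_sum[OF additive_coord])

lemma cplx_coord_single: "cplx_coord (Poly_Mapping.single v c) i = c * of_rat (\<kappa> v i)"
  unfolding cplx_coord_def by (rule additive_family.lin_ext_single[OF additive_coord])

lemma cplx_coord_zero: "cplx_coord 0 i = 0"
  unfolding cplx_coord_def by (rule additive_family.lin_ext_0[OF additive_coord])

lemma cplx_coord_scale: "cplx_coord (Poly_Mapping.map ((*) c) g) i = c * cplx_coord g i"
proof -
  have "Poly_Mapping.keys (Poly_Mapping.map ((*) c) g) \<subseteq> Poly_Mapping.keys g"
    by (auto simp: in_keys_iff lookup_map_times)
  then have "cplx_coord (Poly_Mapping.map ((*) c) g) i =
      (\<Sum>v\<in>Poly_Mapping.keys g. c * (Poly_Mapping.lookup g v * of_rat (\<kappa> v i)))"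
    unfolding cplx_coord_def
    by (subst lin_ext_superset[OF additive_coord, of "Poly_Mapping.keys g"])
      (simp_all add: lookup_map_times mult.assoc)
  then show ?thesis by (simp add: cplx_coord_def lin_ext_def sum_distrib_left)
qed

lemma cplx_coord_outside: "Poly_Mapping.keys g \<subseteq> S \<Longrightarrow> i \<notin> B \<Longrightarrow> cplx_coord g i = 0"
  unfolding cplx_coord_def lin_ext_def by (intro sum.neutral) (auto simp: coord_outside)

lemma cplx_free_simps:
  "carrier (cplx_free V) = {g. Poly_Mapping.keys g \<subseteq> S}"
  "x \<oplus>\<^bsub>cplx_free V\<^esub> y = x + y" "\<zero>\<^bsub>cplx_free V\<^esub> = 0"
  "c \<odot>\<^bsub>cplx_free V\<^esub> x = Poly_Mapping.map ((*) c) x"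
  by (simp_all add: cplx_free_def free_module_def)

lemma keys_add_S: "Poly_Mapping.keys x \<subseteq> S \<Longrightarrow> Poly_Mapping.keys y \<subseteq> S \<Longrightarrow> Poly_Mapping.keys (x + y) \<subseteq> S"
  using keys_add[of x y] by blast

lemma keys_diff_S:
  fixes x y :: "'v \<Rightarrow>\<^sub>0 complex"
  shows "Poly_Mapping.keys x \<subseteq> S \<Longrightarrow> Poly_Mapping.keys y \<subseteq> S \<Longrightarrow> Poly_Mapping.keys (x - y) \<subseteq> S"
proof
  fix k assume S: "Poly_Mapping.keys x \<subseteq> S" "Poly_Mapping.keys y \<subseteq> S" and "k \<in> Poly_Mapping.keys (x - y)"
  then have "k \<in> Poly_Mapping.keys x \<or> k \<in> Poly_Mapping.keys y"
    by (simp add: in_keys_iff lookup_minus) auto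
  then show "k \<in> S" using S by blast
qed

lemma keys_scale_S:
  fixes x :: "'v \<Rightarrow>\<^sub>0 complex"
  shows "Poly_Mapping.keys x \<subseteq> S \<Longrightarrow> Poly_Mapping.keys (Poly_Mapping.map ((*) c) x) \<subseteq> S"
  by (auto simp: in_keys_iff lookup_map_times)

lemma keys_single_S: "v \<in> S \<Longrightarrow> Poly_Mapping.keys (Poly_Mapping.single v c) \<subseteq> S"
  by simp

lemma keys_sum_S:
  assumes "\<And>x. x \<in> A \<Longrightarrow> Poly_Mapping.keys (g x) \<subseteq> S"
  shows "Poly_Mapping.keys (sum g A) \<subseteq> S"
  using assms by (induction A rule: infinite_finite_induct) (simp_all add: keys_add_S)

text \<open>The kernel of the complex-linear extension of the coordinate map to formal combinations of
  symbols.\<close>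

definition Ker :: "('v \<Rightarrow>\<^sub>0 complex) set" where
  "Ker = {g. Poly_Mapping.keys g \<subseteq> S \<and> (\<forall>i. cplx_coord g i = 0)}"

lemma inv_cplx_free:
  assumes "Poly_Mapping.keys x \<subseteq> S"
  shows "inv\<^bsub>add_monoid (cplx_free V)\<^esub> x = - x"
  unfolding m_inv_def
proof (rule the_equality)
  have "Poly_Mapping.keys (- x) \<subseteq> S" using assms by (auto simp: in_keys_iff)
  then show "- x \<in> carrier (add_monoid (cplx_free V)) \<and>
      x \<otimes>\<^bsub>add_monoid (cplx_free V)\<^esub> - x = \<one>\<^bsub>add_monoid (cplx_free V)\<^esub> \<and>
      - x \<otimes>\<^bsub>add_monoid (cplx_free V)\<^esub> x = \<one>\<^bsub>add_monoid (cplx_free V)\<^esub>"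
    by (simp add: cplx_free_simps)
next
  fix y assume "y \<in> carrier (add_monoid (cplx_free V)) \<and>
      x \<otimes>\<^bsub>add_monoid (cplx_free V)\<^esub> y = \<one>\<^bsub>add_monoid (cplx_free V)\<^esub> \<and>
      y \<otimes>\<^bsub>add_monoid (cplx_free V)\<^esub> x = \<one>\<^bsub>add_monoid (cplx_free V)\<^esub>"
  then have "x + y = 0" by (simp add: cplx_free_simps)
  then show "y = - x" by (simp add: eq_neg_iff_add_eq_0 add.commute)
qed

lemma submodule_Ker: "submodule Ker field_ring (cplx_free V)"
proof (intro submodule.intro subgroup.intro)
  show "Ker \<subseteq> carrier (add_monoid (cplx_free V))" by (auto simp: Ker_def cplx_free_simps)
  show "\<one>\<^bsub>add_monoid (cplx_free V)\<^esub> \<in> Ker" by (simp add: Ker_def cplx_free_simps cplx_coord_zero)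
  show "x \<otimes>\<^bsub>add_monoid (cplx_free V)\<^esub> y \<in> Ker" if "x \<in> Ker" "y \<in> Ker" for x y
    using that by (simp add: Ker_def cplx_free_simps cplx_coord_add keys_add_S)
  show "inv\<^bsub>add_monoid (cplx_free V)\<^esub> x \<in> Ker" if "x \<in> Ker" for x
  proof -
    have "- x = 0 - x" by simp
    then have "- x \<in> Ker"
      using that keys_diff_S[of 0 x] cplx_coord_diff[of 0 x] by (simp add: Ker_def cplx_coord_zero)
    then show ?thesis using inv_cplx_free[of x] that by (simp add: Ker_def)
  qed
  show "submodule_axioms Ker field_ring (cplx_free V)"
    using keys_scale_S by unfold_locales (simp add: Ker_def cplx_free_simps cplx_coord_scale)
qed

definition cplx_gens :: "('v \<Rightarrow>\<^sub>0 complex) set" where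
  "cplx_gens =
     {Poly_Mapping.single (v \<oplus>\<^bsub>V\<^esub> w) 1 - Poly_Mapping.single v 1 - Poly_Mapping.single w 1 | v w.
         v \<in> carrier V \<and> w \<in> carrier V} \<union>
      {Poly_Mapping.single (q \<odot>\<^bsub>V\<^esub> v) 1 - Poly_Mapping.single v (of_rat q) | q v.
         v \<in> carrier V}"

lemma cplx_rel_eq: "N = \<Inter>{N. submodule N field_ring (cplx_free V) \<and> cplx_gens \<subseteq> N}"
  unfolding cplx_rel_def submodule_gen_def cplx_gens_def ..

lemma gens_Ker: "cplx_gens \<subseteq> Ker"
proof
  fix x assume "x \<in> cplx_gens"
  then consider v w where "v \<in> S" "w \<in> S"
      "x = Poly_Mapping.single (v \<oplus>\<^bsub>V\<^esub> w) 1 - Poly_Mapping.single v 1 - Poly_Mapping.single w 1"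
    | q v where "v \<in> S" "x = Poly_Mapping.single (q \<odot>\<^bsub>V\<^esub> v) 1 - Poly_Mapping.single v (of_rat q)"
    by (auto simp: cplx_gens_def)
  then show "x \<in> Ker"
  proof cases
    case 1
    then show ?thesis
      by (simp add: Ker_def cplx_coord_diff cplx_coord_single coord_add of_rat_add
          keys_diff_S add_closed)
  next
    case 2
    then show ?thesis
      by (simp add: Ker_def cplx_coord_diff cplx_coord_single coord_smult of_rat_mult
          keys_diff_S smult_closed)
  qed
qed

text \<open>Subtracting one coordinate vector after the other reduces a symbol to the symbols of the unit
  vectors, modulo any submodule that contains the defining relations of the tensor product.\<close>

lemma reduce_single:
  assumes N': "submodule N' field_ring (cplx_free V)" and gens: "cplx_gens \<subseteq> N'"
    and T: "T \<subseteq> B" and v: "v \<in> S" and supp: "\<And>i. i \<notin> T \<Longrightarrow> \<kappa> v i = 0"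
  shows "Poly_Mapping.single v c - (\<Sum>i\<in>T. Poly_Mapping.single (unit i) (c * of_rat (\<kappa> v i))) \<in> N'"
proof -
  interpret submodule N' field_ring "cplx_free V" by (rule N')
  have nadd: "x + y \<in> N'" if "x \<in> N'" "y \<in> N'" for x y
    using m_closed[OF that] by (simp add: cplx_free_simps)
  have nscale: "Poly_Mapping.map ((*) d) x \<in> N'" if "x \<in> N'" for x d
    using smult_closed[of d x] that by (simp add: cplx_free_simps field_ring_def)
  have gen1: "Poly_Mapping.single (v \<oplus>\<^bsub>V\<^esub> w) c - Poly_Mapping.single v c - Poly_Mapping.single w c \<in> N'"
    if "v \<in> S" "w \<in> S" for v w
  proof -
    have "Poly_Mapping.single (v \<oplus>\<^bsub>V\<^esub> w) 1 - Poly_Mapping.single v 1 - Poly_Mapping.single w 1 \<in> N'"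
      using gens that by (auto simp: cplx_gens_def)
    moreover have "Poly_Mapping.map ((*) c)
        (Poly_Mapping.single (v \<oplus>\<^bsub>V\<^esub> w) 1 - Poly_Mapping.single v 1 - Poly_Mapping.single w 1) =
        Poly_Mapping.single (v \<oplus>\<^bsub>V\<^esub> w) c - Poly_Mapping.single v c - Poly_Mapping.single w c"
      by (rule poly_mapping_eqI) (simp add: lookup_map_times lookup_minus lookup_single when_def)
    ultimately show ?thesis using nscale by metis
  qed
  have gen2: "Poly_Mapping.single (q \<odot>\<^bsub>V\<^esub> v) c - Poly_Mapping.single v (c * of_rat q) \<in> N'"
    if "v \<in> S" for v q
  proof -
    have "Poly_Mapping.single (q \<odot>\<^bsub>V\<^esub> v) 1 - Poly_Mapping.single v (of_rat q) \<in> N'"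
      using gens that by (auto simp: cplx_gens_def)
    moreover have "Poly_Mapping.map ((*) c)
        (Poly_Mapping.single (q \<odot>\<^bsub>V\<^esub> v) 1 - Poly_Mapping.single v (of_rat q)) =
        Poly_Mapping.single (q \<odot>\<^bsub>V\<^esub> v) c - Poly_Mapping.single v (c * of_rat q)"
      by (rule poly_mapping_eqI) (simp add: lookup_map_times lookup_minus lookup_single when_def algebra_simps)
    ultimately show ?thesis using nscale by metis
  qed
  have "finite T" using T finite_B finite_subset by blast
  then show ?thesis
    using T v supp
  proof (induction T arbitrary: v)
    case empty
    have "0 \<odot>\<^bsub>V\<^esub> v = v"
      using empty by (intro eqI coordinates_axioms[THEN coordinates.smult_closed])
        (auto simp: coord_smult)
    then show ?case using gen2[of v 0] empty by simp
  next
    case (insert j T)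
    have j: "j \<in> B" using insert by simp
    define v' where "v' = vec ((\<kappa> v)(j := 0))"
    have supp': "(\<kappa> v)(j := 0) \<in> supported B"
      using coord_outside[of v] insert.prems by (auto simp: supported_def)
    have v': "v' \<in> S" "\<kappa> v' = (\<kappa> v)(j := 0)"
      unfolding v'_def using vec_closed[OF supp'] coord_vec[OF supp'] by auto
    let ?u = "\<kappa> v j \<odot>\<^bsub>V\<^esub> unit j"
    have u: "?u \<in> S" by (rule coordinates.smult_closed[OF coordinates_axioms unit_closed[OF j]])
    have v: "v = v' \<oplus>\<^bsub>V\<^esub> ?u"
      using insert.prems(2) v' u j unit_closed[OF j]
      by (intro eqI add_closed) (auto simp: coord_add coord_smult coord_unit)
    have IH: "Poly_Mapping.single v' c - (\<Sum>i\<in>T. Poly_Mapping.single (unit i) (c * of_rat (\<kappa> v' i))) \<in> N'"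
      using insert by (intro insert.IH) (auto simp: v')
    have same: "(\<Sum>i\<in>T. Poly_Mapping.single (unit i) (c * of_rat (\<kappa> v' i))) =
        (\<Sum>i\<in>T. Poly_Mapping.single (unit i) (c * of_rat (\<kappa> v i)))"
      using insert.hyps(2) by (intro sum.cong) (auto simp: v')
    have "(Poly_Mapping.single (v' \<oplus>\<^bsub>V\<^esub> ?u) c - Poly_Mapping.single v' c - Poly_Mapping.single ?u c) +
        ((Poly_Mapping.single ?u c - Poly_Mapping.single (unit j) (c * of_rat (\<kappa> v j))) +
        (Poly_Mapping.single v' c - (\<Sum>i\<in>T. Poly_Mapping.single (unit i) (c * of_rat (\<kappa> v' i))))) \<in> N'"
      by (intro nadd gen1[OF v'(1) u] gen2[OF unit_closed[OF j]] IH)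
    then show ?case
      unfolding v[symmetric] same using insert.hyps by (simp add: algebra_simps)
  qed
qed

text \<open>By \<open>reduce_single\<close>, every formal combination is congruent modulo the relations to the
  combination of unit vectors with the same coordinates; in the kernel, these coordinates vanish.\<close>

lemma cplx_rel_eq_Ker: "N = Ker"
proof
  show "N \<subseteq> Ker" unfolding cplx_rel_eq using submodule_Ker gens_Ker by blast
  show "Ker \<subseteq> N"
    unfolding cplx_rel_eq
  proof (intro subsetI InterI, clarify)
    fix g N' assume g: "g \<in> Ker" and N': "submodule N' field_ring (cplx_free V)" "cplx_gens \<subseteq> N'"
    interpret submodule N' field_ring "cplx_free V" by (rule N'(1))
    have nsum: "sum h A \<in> N'" if "\<And>x. x \<in> A \<Longrightarrow> h x \<in> N'" for h and A :: "'v set"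
      using that m_closed one_closed
      by (induction A rule: infinite_finite_induct) (simp_all add: cplx_free_simps)
    let ?K = "Poly_Mapping.keys g"
    have "(\<Sum>v\<in>?K. Poly_Mapping.single v (Poly_Mapping.lookup g v) -
        (\<Sum>i\<in>B. Poly_Mapping.single (unit i) (Poly_Mapping.lookup g v * of_rat (\<kappa> v i)))) \<in> N'"
      using g coord_outside by (intro nsum reduce_single[OF N']) (auto simp: Ker_def)
    also have "(\<Sum>v\<in>?K. Poly_Mapping.single v (Poly_Mapping.lookup g v) -
        (\<Sum>i\<in>B. Poly_Mapping.single (unit i) (Poly_Mapping.lookup g v * of_rat (\<kappa> v i)))) =
        g - (\<Sum>i\<in>B. Poly_Mapping.single (unit i) (cplx_coord g i))"
    proof -
      have "(\<Sum>v\<in>?K. \<Sum>i\<in>B. Poly_Mapping.single (unit i) (Poly_Mapping.lookup g v * of_rat (\<kappa> v i))) =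
          (\<Sum>i\<in>B. \<Sum>v\<in>?K. Poly_Mapping.single (unit i) (Poly_Mapping.lookup g v * of_rat (\<kappa> v i)))"
        by (rule sum.swap)
      also have "\<dots> = (\<Sum>i\<in>B. Poly_Mapping.single (unit i) (cplx_coord g i))"
      proof (intro sum.cong refl)
        fix i
        have "(\<Sum>v\<in>K. Poly_Mapping.single (unit i) (h v)) = Poly_Mapping.single (unit i) (\<Sum>v\<in>K. h v)"
          for K and h :: "'v \<Rightarrow> complex"
          by (induction K rule: infinite_finite_induct) (simp_all add: single_add)
        then show "(\<Sum>v\<in>?K. Poly_Mapping.single (unit i) (Poly_Mapping.lookup g v * of_rat (\<kappa> v i))) =
            Poly_Mapping.single (unit i) (cplx_coord g i)"
          by (simp add: cplx_coord_def lin_ext_def)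
      qed
      finally show ?thesis
        using poly_mapping_sum_singles[of g] by (simp add: sum_subtractf)
    qed
    finally show "g \<in> N'" using g by (simp add: Ker_def)
  qed
qed

text \<open>The fibres of the coordinate map; by \<open>coset_eq_fib\<close> they are the elements of the
  complexification.\<close>

definition fib :: "('i \<Rightarrow> complex) \<Rightarrow> ('v \<Rightarrow>\<^sub>0 complex) set" where
  "fib c = {g. Poly_Mapping.keys g \<subseteq> S \<and> cplx_coord g = c}"

lemma coset_eq_fib:
  assumes x: "Poly_Mapping.keys x \<subseteq> S"
  shows "N +>\<^bsub>cplx_free V\<^esub> x = fib (cplx_coord x)"
proof -
  have "N +>\<^bsub>cplx_free V\<^esub> x = {h + x |h. h \<in> Ker}"
    unfolding cplx_rel_eq_Ker a_r_coset_def r_coset_def by (auto simp: cplx_free_simps)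
  also have "\<dots> = fib (cplx_coord x)"
  proof (intro equalityI subsetI)
    fix g assume "g \<in> {h + x |h. h \<in> Ker}"
    then show "g \<in> fib (cplx_coord x)"
      using x keys_add_S by (auto simp: Ker_def fib_def cplx_coord_add)
  next
    fix g assume g: "g \<in> fib (cplx_coord x)"
    then have "g - x \<in> Ker"
      using x keys_diff_S[of g x] by (auto simp: Ker_def fib_def cplx_coord_diff)
    then show "g \<in> {h + x |h. h \<in> Ker}" by (auto intro: exI[of _ "g - x"])
  qed
  finally show ?thesis .
qed

definition lift :: "('i \<Rightarrow> complex) \<Rightarrow> 'v \<Rightarrow>\<^sub>0 complex" where
  "lift c = (\<Sum>i\<in>B. Poly_Mapping.single (unit i) (c i))"

lemma lift_in_fib: "c \<in> supported B \<Longrightarrow> lift c \<in> fib c"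
proof -
  assume c: "c \<in> supported B"
  have "Poly_Mapping.keys (lift c) \<subseteq> S"
    unfolding lift_def by (intro keys_sum_S keys_single_S unit_closed)
  moreover have "cplx_coord (lift c) i = c i" for i
  proof -
    have "cplx_coord (lift c) i = (\<Sum>j\<in>B. if i = j then c j else 0)"
      unfolding lift_def cplx_coord_sum cplx_coord_single
      by (intro sum.cong) (auto simp: coord_unit)
    then show ?thesis using c by (auto simp: supported_def)
  qed
  ultimately show ?thesis by (auto simp: fib_def)
qed

lemma complexify_simps:
  "carrier (complexify V) = fib ` supported B"
  "\<zero>\<^bsub>complexify V\<^esub> = fib (\<lambda>_. 0)"
  "c \<in> supported B \<Longrightarrow> d \<in> supported B \<Longrightarrow> fib c \<oplus>\<^bsub>complexify V\<^esub> fib d = fib (\<lambda>i. c i + d i)"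
  "c \<in> supported B \<Longrightarrow> z \<odot>\<^bsub>complexify V\<^esub> fib c = fib (\<lambda>i. z * c i)"
proof -
  have "carrier (complexify V) = {N +>\<^bsub>cplx_free V\<^esub> x |x. Poly_Mapping.keys x \<subseteq> S}"
    by (auto simp: complexify_def quot_module_def A_RCOSETS_def' cplx_free_simps)
  also have "\<dots> = fib ` supported B"
  proof (intro equalityI subsetI)
    fix A assume "A \<in> {N +>\<^bsub>cplx_free V\<^esub> x |x. Poly_Mapping.keys x \<subseteq> S}"
    then obtain x where x: "Poly_Mapping.keys x \<subseteq> S" "A = fib (cplx_coord x)"
      using coset_eq_fib by blast
    then show "A \<in> fib ` supported B"
      using cplx_coord_outside by (auto simp: supported_def)
  next
    fix A assume "A \<in> fib ` supported B"
    then obtain c where "c \<in> supported B" "A = fib c" by blast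
    then show "A \<in> {N +>\<^bsub>cplx_free V\<^esub> x |x. Poly_Mapping.keys x \<subseteq> S}"
    proof (intro CollectI exI[of _ "lift c"] conjI)
      show "Poly_Mapping.keys (lift c) \<subseteq> S" "A = N +>\<^bsub>cplx_free V\<^esub> lift c"
        using lift_in_fib[of c] coset_eq_fib[of "lift c"] \<open>c \<in> supported B\<close> \<open>A = fib c\<close>
        by (simp_all add: fib_def)
    qed
  qed
  finally show "carrier (complexify V) = fib ` supported B" .
  show "\<zero>\<^bsub>complexify V\<^esub> = fib (\<lambda>_. 0)"
    by (auto simp: complexify_def quot_module_def cplx_rel_eq_Ker Ker_def fib_def fun_eq_iff)
  show "fib c \<oplus>\<^bsub>complexify V\<^esub> fib d = fib (\<lambda>i. c i + d i)" if c: "c \<in> supported B" and d: "d \<in> supported B"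
  proof -
    have "fib c \<oplus>\<^bsub>complexify V\<^esub> fib d = {x + y |x y. x \<in> fib c \<and> y \<in> fib d}"
      by (auto simp: complexify_def quot_module_def set_add_def' cplx_free_simps)
    also have "\<dots> = fib (\<lambda>i. c i + d i)"
    proof (intro equalityI subsetI)
      fix g assume "g \<in> {x + y |x y. x \<in> fib c \<and> y \<in> fib d}"
      then obtain x y where "x \<in> fib c" "y \<in> fib d" "g = x + y" by blast
      then show "g \<in> fib (\<lambda>i. c i + d i)"
        using keys_add_S by (auto simp: fib_def fun_eq_iff cplx_coord_add)
    next
      fix g assume g: "g \<in> fib (\<lambda>i. c i + d i)"
      have l: "lift c \<in> fib c" by (rule lift_in_fib[OF c])
      have "g - lift c \<in> fib d"
        using g l keys_diff_S[of g "lift c"] by (auto simp: fib_def fun_eq_iff cplx_coord_diff)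
      moreover have "g = lift c + (g - lift c)" by simp
      ultimately show "g \<in> {x + y |x y. x \<in> fib c \<and> y \<in> fib d}" using l by blast
    qed
    finally show ?thesis .
  qed
  show "z \<odot>\<^bsub>complexify V\<^esub> fib c = fib (\<lambda>i. z * c i)" if c: "c \<in> supported B"
  proof -
    have "N +>\<^bsub>cplx_free V\<^esub> (z \<odot>\<^bsub>cplx_free V\<^esub> x) = fib (\<lambda>i. z * c i)" if "x \<in> fib c" for x
    proof -
      have x: "Poly_Mapping.keys x \<subseteq> S" "cplx_coord x = c" using that by (auto simp: fib_def)
      have "cplx_coord (Poly_Mapping.map ((*) z) x) = (\<lambda>i. z * c i)"
        using x(2) by (auto simp: fun_eq_iff cplx_coord_scale)
      then show ?thesis
        unfolding cplx_free_simps using coset_eq_fib[OF keys_scale_S[OF x(1)]] by metis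
    qed
    then have "(\<Union>x\<in>fib c. N +>\<^bsub>cplx_free V\<^esub> (z \<odot>\<^bsub>cplx_free V\<^esub> x)) = fib (\<lambda>i. z * c i)"
      using lift_in_fib[OF c] by blast
    then show ?thesis by (simp add: complexify_def quot_module_def)
  qed
qed

definition \<Phi> :: "('v \<Rightarrow>\<^sub>0 complex) set \<Rightarrow> 'i \<Rightarrow> complex" where
  "\<Phi> A = cplx_coord (SOME g. g \<in> A)"

lemma coord_fib: "c \<in> supported B \<Longrightarrow> \<Phi> (fib c) = c"
proof -
  assume "c \<in> supported B"
  then have "(SOME g. g \<in> fib c) \<in> fib c" using lift_in_fib by (intro someI) blast
  then show ?thesis by (simp add: \<Phi>_def fib_def)
qed

lemma complexify_coordinates: "complex_coordinates (complexify V) B \<Phi>"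
proof unfold_locales
  have closed: "(\<lambda>_. 0 :: complex) \<in> supported B"
    "\<And>c d :: 'i \<Rightarrow> complex. c \<in> supported B \<Longrightarrow> d \<in> supported B \<Longrightarrow> (\<lambda>i. c i + d i) \<in> supported B"
    "\<And>(c :: 'i \<Rightarrow> complex) z. c \<in> supported B \<Longrightarrow> (\<lambda>i. z * c i) \<in> supported B" for B :: "'i set"
    by (auto simp: supported_def)
  show "bij_betw \<Phi> (carrier (complexify V)) (supported B)"
    unfolding complexify_simps
    by (rule bij_betw_byWitness[where f' = fib]) (auto simp: coord_fib)
  fix a b :: "('v \<Rightarrow>\<^sub>0 complex) set" and i :: 'i and z :: complex
  show "\<zero>\<^bsub>complexify V\<^esub> \<in> carrier (complexify V)" "\<Phi> \<zero>\<^bsub>complexify V\<^esub> i = 0"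
    unfolding complexify_simps using closed(1) coord_fib by auto
  assume "a \<in> carrier (complexify V)"
  then obtain c where c: "a = fib c" "c \<in> supported B" unfolding complexify_simps by blast
  show "z \<odot>\<^bsub>complexify V\<^esub> a \<in> carrier (complexify V)" "\<Phi> (z \<odot>\<^bsub>complexify V\<^esub> a) i = z * \<Phi> a i"
    unfolding c(1) complexify_simps(4)[OF c(2)] coord_fib[OF c(2)] coord_fib[OF closed(3)[OF c(2)]]
    unfolding complexify_simps using closed(3)[OF c(2)] by auto
  assume "b \<in> carrier (complexify V)"
  then obtain d where d: "b = fib d" "d \<in> supported B" unfolding complexify_simps by blast
  show "a \<oplus>\<^bsub>complexify V\<^esub> b \<in> carrier (complexify V)" "\<Phi> (a \<oplus>\<^bsub>complexify V\<^esub> b) i = \<Phi> a i + \<Phi> b i"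
    unfolding c(1) d(1) complexify_simps(3)[OF c(2) d(2)] coord_fib[OF c(2)] coord_fib[OF d(2)]
      coord_fib[OF closed(2)[OF c(2) d(2)]]
    unfolding complexify_simps using closed(2)[OF c(2) d(2)] by auto
qed simp

text \<open>In the coordinates of the complexification the map is given by the matrix of the permutation
  \<open>\<pi>\<close>.\<close>

theorem trace_complexify_permuted:
  assumes f: "\<And>v. v \<in> S \<Longrightarrow> f v \<in> S"
    and \<pi>: "bij_betw \<pi> B B" and perm: "\<And>v i. v \<in> S \<Longrightarrow> i \<in> B \<Longrightarrow> \<kappa> (f v) (\<pi> i) = \<kappa> v i"
  shows "module_trace (complexify V) (complexify_map V f) = of_nat (card {i \<in> B. \<pi> i = i})"
proof -
  interpret C: complex_coordinates "complexify V" B \<Phi> by (rule complexify_coordinates)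
  let ?inv = "inv_into B \<pi>"
  have inv: "?inv i \<in> B" "\<pi> (?inv i) = i" if "i \<in> B" for i
    using \<pi> that by (auto simp: bij_betw_def inv_into_into f_inv_into_f)
  let ?push = "\<lambda>g. \<Sum>v\<in>Poly_Mapping.keys g. Poly_Mapping.single (f v) (Poly_Mapping.lookup g v)"
  have key: "complexify_map V f (fib c) = fib (\<lambda>i. if i \<in> B then c (?inv i) else 0)"
    if c: "c \<in> supported B" for c
  proof -
    have "N +>\<^bsub>cplx_free V\<^esub> ?push g = fib (\<lambda>i. if i \<in> B then c (?inv i) else 0)" if "g \<in> fib c" for g
    proof -
      have g: "Poly_Mapping.keys g \<subseteq> S" "cplx_coord g = c" using that by (auto simp: fib_def)
      have K: "Poly_Mapping.keys (?push g) \<subseteq> S"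
        using g f by (intro keys_sum_S keys_single_S) auto
      have "cplx_coord (?push g) i = (if i \<in> B then c (?inv i) else 0)" for i
      proof (cases "i \<in> B")
        case True
        have "cplx_coord (?push g) i = (\<Sum>v\<in>Poly_Mapping.keys g. Poly_Mapping.lookup g v * of_rat (\<kappa> (f v) i))"
          by (simp add: cplx_coord_sum cplx_coord_single)
        also have "\<dots> = (\<Sum>v\<in>Poly_Mapping.keys g. Poly_Mapping.lookup g v * of_rat (\<kappa> v (?inv i)))"
        proof (intro sum.cong refl)
          fix v assume "v \<in> Poly_Mapping.keys g"
          then have "\<kappa> (f v) i = \<kappa> v (?inv i)"
            using perm[of v "?inv i"] inv[OF True] g(1) by auto
          then show "Poly_Mapping.lookup g v * of_rat (\<kappa> (f v) i) = Poly_Mapping.lookup g v * of_rat (\<kappa> v (?inv i))"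
            by simp
        qed
        also have "\<dots> = c (?inv i)" using g(2) by (auto simp: cplx_coord_def lin_ext_def)
        finally show ?thesis using True by simp
      qed (simp add: cplx_coord_outside[OF K])
      then have "cplx_coord (?push g) = (\<lambda>i. if i \<in> B then c (?inv i) else 0)" by blast
      then show ?thesis using coset_eq_fib[OF K] by simp
    qed
    then have "(\<Union>g\<in>fib c. N +>\<^bsub>cplx_free V\<^esub> ?push g) = fib (\<lambda>i. if i \<in> B then c (?inv i) else 0)"
      using lift_in_fib[OF c] by blast
    then show ?thesis by (simp add: complexify_map_def)
  qed
  have "module_trace (complexify V) (complexify_map V f) = (\<Sum>i\<in>B. if ?inv i = i then 1 else 0)"
  proof (rule C.module_trace_eq[where F = "\<lambda>i j. if ?inv i = j then 1 else 0"])
    fix A assume "A \<in> carrier (complexify V)"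
    then obtain c where c: "A = fib c" "c \<in> supported B" unfolding complexify_simps by blast
    have s: "(\<lambda>i. if i \<in> B then c (?inv i) else 0) \<in> supported B" by (simp add: supported_def)
    show "complexify_map V f A \<in> carrier (complexify V)"
      unfolding c(1) key[OF c(2)] complexify_simps using s by blast
    fix i assume i: "i \<in> B"
    have "\<Phi> (complexify_map V f A) i = c (?inv i)"
      unfolding c(1) key[OF c(2)] coord_fib[OF s] using i by simp
    also have "\<dots> = (\<Sum>j\<in>B. if j = ?inv i then c j else 0)"
      using inv(1)[OF i] by (simp add: sum.delta)
    also have "\<dots> = (\<Sum>j\<in>B. (if ?inv i = j then 1 else 0) * \<Phi> A j)"
      unfolding c(1) coord_fib[OF c(2)] by (intro sum.cong) auto
    finally show "\<Phi> (complexify_map V f A) i = (\<Sum>j\<in>B. (if ?inv i = j then 1 else 0) * \<Phi> A j)" .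
  qed
  also have "\<dots> = of_nat (card {i \<in> B. ?inv i = i})"
    by (simp add: sum.inter_filter[symmetric])
  also have "{i \<in> B. ?inv i = i} = {i \<in> B. \<pi> i = i}"
    using inv \<pi> by (metis (no_types, lifting) bij_betw_def inv_into_f_f)
  finally show ?thesis .
qed

end

section \<open>Polynomials as finitely supported functions on monomials\<close>

lemma lin_ext_mult:
  fixes h :: "'a::monoid_add \<Rightarrow> 'b::semiring_0 \<Rightarrow> 'c::semiring_0"
  assumes "additive_family h" and mult: "\<And>k l x y. h (k + l) (x * y) = h k x * h l y"
  shows "lin_ext h (p * q) = lin_ext h p * lin_ext h q"
proof -
  interpret additive_family h by fact
  have "p * q = (\<Sum>k\<in>Poly_Mapping.keys p. Poly_Mapping.single k (Poly_Mapping.lookup p k)) *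
      (\<Sum>l\<in>Poly_Mapping.keys q. Poly_Mapping.single l (Poly_Mapping.lookup q l))"
    using poly_mapping_sum_singles[of p] poly_mapping_sum_singles[of q] by simp
  also have "\<dots> = (\<Sum>k\<in>Poly_Mapping.keys p. \<Sum>l\<in>Poly_Mapping.keys q.
      Poly_Mapping.single (k + l) (Poly_Mapping.lookup p k * Poly_Mapping.lookup q l))"
    by (simp add: sum_product mult_single)
  finally show ?thesis
    unfolding lin_ext_def[of h p] lin_ext_def[of h q] sum_product
    by (simp add: lin_ext_sum[OF assms(1)] mult)
qed

definition eval_poly :: "('v \<Rightarrow> 'k::comm_ring_1) \<Rightarrow> ('v, 'k) mpoly \<Rightarrow> 'k" where
  "eval_poly f = lin_ext (\<lambda>m c. c * (\<Prod>v\<in>#m. f v))"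

lemma additive_eval: "additive_family (\<lambda>m c. c * (\<Prod>v\<in>#m. f v) :: 'k::comm_ring_1)"
  by unfold_locales (simp_all add: algebra_simps)

lemma eval_poly_add: "eval_poly f (p + q) = eval_poly f p + eval_poly f q"
  unfolding eval_poly_def by (rule lin_ext_add[OF additive_eval])

lemma eval_poly_diff: "eval_poly f (p - q) = eval_poly f p - eval_poly f q"
  unfolding eval_poly_def by (rule lin_ext_diff[OF additive_eval])

lemma eval_poly_sum: "eval_poly f (sum p A) = (\<Sum>x\<in>A. eval_poly f (p x))"
  unfolding eval_poly_def by (rule lin_ext_sum[OF additive_eval])

lemma eval_poly_single: "eval_poly f (Poly_Mapping.single m c) = c * (\<Prod>v\<in>#m. f v)"
  unfolding eval_poly_def by (rule additive_family.lin_ext_single[OF additive_eval])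

lemma eval_poly_mult: "eval_poly f (p * q) = eval_poly f p * eval_poly f q"
  unfolding eval_poly_def by (rule lin_ext_mult[OF additive_eval]) (simp add: ac_simps)

lemma eval_poly_pvar [simp]: "eval_poly f (pvar v) = f v"
  by (simp add: pvar_def eval_poly_single)

lemma eval_poly_pconst [simp]: "eval_poly f (pconst c) = c"
  by (simp add: pconst_def eval_poly_single)

lemma pconst_0 [simp]: "pconst 0 = 0" and pconst_1 [simp]: "pconst 1 = 1"
  by (simp_all add: pconst_def flip: zero_multiset_def)

lemma pconst_mult: "pconst (a * b) = pconst a * pconst b"
  by (simp add: pconst_def mult_single)

lemma pconst_add: "pconst (a + b) = pconst a + pconst b"
  by (simp add: pconst_def single_add)

lemma eval_poly_0 [simp]: "eval_poly f 0 = 0"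
  using eval_poly_pconst[of f 0] by simp

lemma single_eq_pconst_prod: "Poly_Mapping.single m c = pconst c * (\<Prod>v\<in>#m. pvar v)"
proof -
  have "(\<Prod>v\<in>#m. pvar v :: ('a, 'b) mpoly) = Poly_Mapping.single m 1"
  proof (induction m)
    case empty
    then show ?case using pconst_1 by (simp add: pconst_def)
  next
    case (add x m)
    then show ?case by (simp add: pvar_def mult_single)
  qed
  then show ?thesis by (simp add: pconst_def mult_single)
qed

lemma rename_lin_ext: "rename \<rho> = lin_ext (\<lambda>m c. Poly_Mapping.single (image_mset \<rho> m) c)"
  by (rule ext) (simp add: rename_def lin_ext_def)

lemma additive_rename: "additive_family (\<lambda>m c. Poly_Mapping.single (image_mset \<rho> m) (c :: 'k::comm_ring_1))"
  by unfold_locales (simp_all add: single_add)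

lemma rename_add: "rename \<rho> (p + q) = rename \<rho> p + rename \<rho> q"
  unfolding rename_lin_ext by (rule lin_ext_add[OF additive_rename])

lemma rename_diff: "rename \<rho> (p - q) = rename \<rho> p - rename \<rho> q"
  unfolding rename_lin_ext by (rule lin_ext_diff[OF additive_rename])

lemma rename_sum: "rename \<rho> (sum p A) = (\<Sum>x\<in>A. rename \<rho> (p x))"
  unfolding rename_lin_ext by (rule lin_ext_sum[OF additive_rename])

lemma rename_single: "rename \<rho> (Poly_Mapping.single m c) = Poly_Mapping.single (image_mset \<rho> m) c"
  unfolding rename_lin_ext by (rule additive_family.lin_ext_single[OF additive_rename])

lemma rename_mult: "rename \<rho> (p * q) = rename \<rho> p * rename \<rho> q"
  unfolding rename_lin_ext by (rule lin_ext_mult[OF additive_rename]) (simp add: mult_single)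

lemma rename_pvar [simp]: "rename \<rho> (pvar v) = pvar (\<rho> v)"
  by (simp add: pvar_def rename_single)

lemma rename_pconst [simp]: "rename \<rho> (pconst c) = pconst c"
  by (simp add: pconst_def rename_single)

lemma rename_0 [simp]: "rename \<rho> 0 = 0" and rename_1 [simp]: "rename \<rho> 1 = 1"
  using rename_pconst[of \<rho> 0] rename_pconst[of \<rho> 1] by simp_all

definition component :: "nat \<Rightarrow> ('v, 'k::comm_ring_1) mpoly \<Rightarrow> ('v, 'k) mpoly" where
  "component d = lin_ext (\<lambda>m c. if size m = d then Poly_Mapping.single m c else 0)"

lemma additive_component:
  "additive_family (\<lambda>m c. if size m = d then Poly_Mapping.single m (c :: 'k::comm_ring_1) else 0)"
  by unfold_locales (simp_all add: single_add)

lemma component_add: "component d (p + q) = component d p + component d q"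
  unfolding component_def by (rule lin_ext_add[OF additive_component])

lemma component_sum: "component d (sum p A) = (\<Sum>x\<in>A. component d (p x))"
  unfolding component_def by (rule lin_ext_sum[OF additive_component])

lemma component_single:
  "component d (Poly_Mapping.single m c) = (if size m = d then Poly_Mapping.single m c else 0)"
  unfolding component_def by (rule additive_family.lin_ext_single[OF additive_component])

lemma component_0 [simp]: "component d 0 = 0"
  unfolding component_def by (rule additive_family.lin_ext_0[OF additive_component])

lemma component_single_mult:
  "component d (Poly_Mapping.single m c * p) =
     (if size m \<le> d then Poly_Mapping.single m c * component (d - size m) p else 0)"
proof -
  have "component d (Poly_Mapping.single m c * p) =
      component d (\<Sum>k\<in>Poly_Mapping.keys p. Poly_Mapping.single (m + k) (c * Poly_Mapping.lookup p k))"
    by (subst poly_mapping_sum_singles[of p]) (simp add: sum_distrib_left mult_single)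
  also have "\<dots> = (\<Sum>k\<in>Poly_Mapping.keys p. if size m \<le> d then Poly_Mapping.single m c *
      (if size k = d - size m then Poly_Mapping.single k (Poly_Mapping.lookup p k) else 0) else 0)"
    unfolding component_sum component_single by (intro sum.cong refl) (auto simp: mult_single)
  also have "\<dots> = (if size m \<le> d then Poly_Mapping.single m c * component (d - size m) p else 0)"
    by (simp add: component_def lin_ext_def sum_distrib_left)
  finally show ?thesis .
qed

lemma homogeneous_component: "homogeneous d p \<Longrightarrow> component e p = (if e = d then p else 0)"
proof -
  assume p: "homogeneous d p"
  have "component e p = (\<Sum>k\<in>Poly_Mapping.keys p. if e = d then Poly_Mapping.single k (Poly_Mapping.lookup p k) else 0)"
    unfolding component_def lin_ext_def using p by (intro sum.cong) (auto simp: homogeneous_def)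
  then show ?thesis using poly_mapping_sum_singles[of p] by simp
qed

lemma homogeneous_sum: "(\<And>x. x \<in> A \<Longrightarrow> homogeneous d (p x)) \<Longrightarrow> homogeneous d (sum p A)"
proof (induction A rule: infinite_finite_induct)
  case (insert x A)
  then show ?case using keys_add[of "p x" "sum p A"] by (auto simp: homogeneous_def)
qed (simp_all add: homogeneous_def)

lemma homogeneous_add: "homogeneous d p \<Longrightarrow> homogeneous d q \<Longrightarrow> homogeneous d (p + q)"
  using keys_add[of p q] by (auto simp: homogeneous_def)

lemma homogeneous_mult: "homogeneous d p \<Longrightarrow> homogeneous e q \<Longrightarrow> homogeneous (d + e) (p * q)"
  using keys_mult[of p q] by (fastforce simp: homogeneous_def)

lemma homogeneous_single: "size m = d \<Longrightarrow> homogeneous d (Poly_Mapping.single m c)"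
  by (simp add: homogeneous_def)

lemma homogeneous_pvar: "homogeneous 1 (pvar v)"
  unfolding pvar_def by (rule homogeneous_single) simp

lemma homogeneous_pconst: "homogeneous 0 (pconst c)"
  unfolding pconst_def by (rule homogeneous_single) simp

lemma homogeneous_0: "homogeneous d 0"
  by (simp add: homogeneous_def)

lemma homogeneous_uminus: "homogeneous d p \<Longrightarrow> homogeneous d (- p)"
  by (auto simp: homogeneous_def in_keys_iff)

lemma homogeneous_diff: "homogeneous d p \<Longrightarrow> homogeneous d q \<Longrightarrow> homogeneous d (p - q)"
  using homogeneous_add[of d p "- q"] homogeneous_uminus[of d q] by simp

lemma homogeneous_component_self: "homogeneous d (component d p)"
  unfolding component_def lin_ext_def
  by (intro homogeneous_sum) (auto intro: homogeneous_single homogeneous_0)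

section \<open>The polynomial ring on a set of variables\<close>

definition polys :: "'v set \<Rightarrow> ('v, 'k::comm_ring_1) mpoly set" where
  "polys V = {p. \<forall>m\<in>Poly_Mapping.keys p. set_mset m \<subseteq> V}"

lemma poly_ring_simps:
  "carrier (poly_ring V) = polys V" "x \<otimes>\<^bsub>poly_ring V\<^esub> y = x * y" "\<one>\<^bsub>poly_ring V\<^esub> = 1"
  "\<zero>\<^bsub>poly_ring V\<^esub> = 0" "x \<oplus>\<^bsub>poly_ring V\<^esub> y = x + y"
  by (simp_all add: poly_ring_def polys_def)

lemma polys_0 [simp, intro]: "0 \<in> polys V"
  by (simp add: polys_def)

lemma polys_single [intro]: "set_mset m \<subseteq> V \<Longrightarrow> Poly_Mapping.single m c \<in> polys V"
  by (simp add: polys_def)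

lemma polys_add [intro]: "p \<in> polys V \<Longrightarrow> q \<in> polys V \<Longrightarrow> p + q \<in> polys V"
  using keys_add[of p q] by (auto simp: polys_def)

lemma polys_uminus [intro]: "p \<in> polys V \<Longrightarrow> - p \<in> polys V"
  by (auto simp: polys_def in_keys_iff)

lemma polys_diff [intro]: "p \<in> polys V \<Longrightarrow> q \<in> polys V \<Longrightarrow> p - q \<in> polys V"
  using polys_add[of p V "- q"] polys_uminus[of q V] by simp

lemma polys_mult [intro]: "p \<in> polys V \<Longrightarrow> q \<in> polys V \<Longrightarrow> p * q \<in> polys V"
  using keys_mult[of p q] by (fastforce simp: polys_def)

lemma polys_pconst [simp, intro]: "pconst c \<in> polys V"
  unfolding pconst_def by (rule polys_single) simp

lemma polys_1 [simp, intro]: "1 \<in> polys V"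
  using polys_pconst[of 1 V] by simp

lemma polys_pvar [intro]: "v \<in> V \<Longrightarrow> pvar v \<in> polys V"
  unfolding pvar_def by (rule polys_single) simp

lemma polys_sum [intro]: "(\<And>x. x \<in> A \<Longrightarrow> p x \<in> polys V) \<Longrightarrow> sum p A \<in> polys V"
  by (induction A rule: infinite_finite_induct) auto

lemma polys_power [intro]: "p \<in> polys V \<Longrightarrow> p ^ k \<in> polys V"
  by (induction k) auto

lemma polys_prod_mset [intro]: "(\<And>x. x \<in># M \<Longrightarrow> p x \<in> polys V) \<Longrightarrow> (\<Prod>x\<in>#M. p x) \<in> polys V"
  by (induction M) auto

lemma polys_component [intro]: "p \<in> polys V \<Longrightarrow> component d p \<in> polys V"
  unfolding component_def lin_ext_def by (intro polys_sum) (auto simp: polys_def)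

lemma polys_rename: "p \<in> polys V \<Longrightarrow> \<rho> ` V \<subseteq> W \<Longrightarrow> rename \<rho> p \<in> polys W"
  unfolding rename_def by (intro polys_sum polys_single) (auto simp: polys_def)

lemma cring_poly_ring: "cring (poly_ring V)"
proof (rule cringI)
  show "abelian_group (poly_ring V)"
  proof (rule abelian_groupI)
    fix x assume "x \<in> carrier (poly_ring V)"
    then show "\<exists>y\<in>carrier (poly_ring V). y \<oplus>\<^bsub>poly_ring V\<^esub> x = \<zero>\<^bsub>poly_ring V\<^esub>"
      unfolding poly_ring_simps by (intro bexI[of _ "- x"]) auto
  qed (auto simp: poly_ring_simps algebra_simps)
  show "Group.comm_monoid (poly_ring V)"
    by (rule comm_monoidI) (auto simp: poly_ring_simps algebra_simps)
qed (simp add: poly_ring_simps algebra_simps)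

text \<open>An ideal of \<open>poly_ring V\<close>, in terms of the operations of the type of polynomials.\<close>

locale poly_ideal =
  fixes V :: "'v set" and I :: "('v, 'k::comm_ring_1) mpoly set"
  assumes ideal: "ideal I (poly_ring V)"
begin

lemma zero [simp, intro]: "0 \<in> I"
  using additive_subgroup.zero_closed[OF ideal.axioms(1)[OF ideal]] by (simp add: poly_ring_simps)

lemma add [intro]: "a \<in> I \<Longrightarrow> b \<in> I \<Longrightarrow> a + b \<in> I"
  using additive_subgroup.a_closed[OF ideal.axioms(1)[OF ideal]] by (simp add: poly_ring_simps)

lemma mult [intro]: "a \<in> I \<Longrightarrow> p \<in> polys V \<Longrightarrow> p * a \<in> I"
  using ideal.I_l_closed[OF ideal] by (simp add: poly_ring_simps)

lemma uminus [intro]: "a \<in> I \<Longrightarrow> - a \<in> I"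
  using mult[of a "- 1"] polys_uminus[OF polys_1, of V] by simp

lemma diff [intro]: "a \<in> I \<Longrightarrow> b \<in> I \<Longrightarrow> a - b \<in> I"
  using add[of a "- b"] uminus[of b] by simp

lemma sum [intro]: "(\<And>x. x \<in> A \<Longrightarrow> g x \<in> I) \<Longrightarrow> Groups_Big.sum g A \<in> I"
  by (induction A rule: infinite_finite_induct) auto

lemma diff_trans: "a - b \<in> I \<Longrightarrow> b \<in> I \<Longrightarrow> a \<in> I"
  using add[of "a - b" b] by simp

end

lemma poly_idealI:
  fixes S :: "('v, 'k::comm_ring_1) mpoly set"
  assumes "S \<subseteq> polys V" "0 \<in> S" "\<And>a b. a \<in> S \<Longrightarrow> b \<in> S \<Longrightarrow> a + b \<in> S"
    and mult: "\<And>p a. p \<in> polys V \<Longrightarrow> a \<in> S \<Longrightarrow> p * a \<in> S"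
  shows "ideal S (poly_ring V)"
proof (rule idealI)
  interpret cring "poly_ring V :: ('v, 'k) mpoly ring" by (rule cring_poly_ring)
  show "ring (poly_ring V :: ('v, 'k) mpoly ring)" by unfold_locales
  show "subgroup S (add_monoid (poly_ring V))"
  proof (rule add.subgroupI)
    fix a assume a: "a \<in> S"
    have "- a \<in> S" using mult[OF polys_uminus[OF polys_1] a] by simp
    moreover have "\<ominus>\<^bsub>poly_ring V\<^esub> a = - a"
      using a assms(1) by (intro minus_equality) (auto simp: poly_ring_simps)
    ultimately show "\<ominus>\<^bsub>poly_ring V\<^esub> a \<in> S" by simp
  qed (use assms in \<open>auto simp: poly_ring_simps\<close>)
  fix a x :: "('v, 'k) mpoly" assume "a \<in> S" "x \<in> carrier (poly_ring V)"
  then have "x * a \<in> S" using mult by (simp add: poly_ring_simps)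
  then show "x \<otimes>\<^bsub>poly_ring V\<^esub> a \<in> S" "a \<otimes>\<^bsub>poly_ring V\<^esub> x \<in> S"
    by (simp_all add: poly_ring_simps mult.commute)
qed

section \<open>Relations in the augmented Chow ring of a uniform matroid\<close>

text \<open>Keeps \<open>{1..n}\<close> in the form in which the ground set occurs in the definitions.\<close>

declare One_nat_def [simp del]

locale chow =
  fixes n r :: nat
  assumes r1: "1 \<le> r" and rn: "r \<le> n"
begin

abbreviation "E \<equiv> {1..n}"
abbreviation "L \<equiv> uniform_flats r n"
abbreviation "V \<equiv> chow_vars E L"
abbreviation "P \<equiv> polys V :: (nat chow_var, rat) mpoly set"
abbreviation "I \<equiv> chow_ideal E L"

definition gens :: "(nat chow_var, rat) mpoly set" where
  "gens = {pvar (X F) * pvar (X G) | F G. F \<in> L - {E} \<and> G \<in> L - {E} \<and> \<not> F \<subseteq> G \<and> \<not> G \<subseteq> F} \<union>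
     {pvar (Y i) * pvar (X F) | i F. i \<in> E \<and> F \<in> L - {E} \<and> i \<notin> F} \<union>
     {pvar (Y i) - (\<Sum>F | F \<in> L - {E} \<and> i \<notin> F. pvar (X F)) | i. i \<in> E}"

lemma chow_poly_ring_eq: "chow_poly_ring E L = poly_ring V"
  by (simp add: chow_poly_ring_def)

lemma finite_L [simp, intro]: "finite L"
  by (rule finite_subset[of _ "Pow E"]) (auto simp: uniform_flats_def)

lemma L_iff: "F \<in> L \<longleftrightarrow> F \<subseteq> E \<and> (card F < r \<or> F = E)"
  using r1 by (auto simp: uniform_flats_def)

lemma E_in_L: "E \<in> L" by (simp add: L_iff)

lemma X_in_V: "F \<in> L - {E} \<Longrightarrow> X F \<in> V" and Y_in_V: "i \<in> E \<Longrightarrow> Y i \<in> V"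
  by (auto simp: chow_vars_def)

lemma gens_polys: "gens \<subseteq> P"
proof
  fix a assume "a \<in> gens"
  then consider F G where "F \<in> L - {E}" "G \<in> L - {E}" "a = pvar (X F) * pvar (X G)"
    | i F where "i \<in> E" "F \<in> L - {E}" "a = pvar (Y i) * pvar (X F)"
    | i where "i \<in> E" "a = pvar (Y i) - (\<Sum>F | F \<in> L - {E} \<and> i \<notin> F. pvar (X F))"
    unfolding gens_def by blast
  then show "a \<in> P"
  proof cases
    case 1
    then show ?thesis by (simp only:) (intro polys_mult polys_pvar X_in_V)
  next
    case 2
    then show ?thesis by (simp only:) (intro polys_mult polys_pvar X_in_V Y_in_V)
  next
    case 3
    show ?thesis unfolding 3(2)
      by (intro polys_diff polys_sum polys_pvar Y_in_V 3(1) X_in_V) blast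
  qed
qed

lemma ideal_I: "ideal I (poly_ring V)"
proof -
  interpret cring "poly_ring V :: (nat chow_var, rat) mpoly ring" by (rule cring_poly_ring)
  have "S \<subseteq> gens \<Longrightarrow> ideal (Idl\<^bsub>poly_ring V\<^esub> S) (poly_ring V)" for S :: "(nat chow_var, rat) mpoly set"
    using gens_polys by (intro genideal_ideal) (auto simp: poly_ring_simps)
  then show ?thesis
    unfolding chow_ideal_def chow_I1_def chow_I2_def chow_J_def chow_poly_ring_eq
    by (intro add_ideals) (auto simp: gens_def)
qed

sublocale poly_ideal "chow_vars {1..n} (uniform_flats r n)" "chow_ideal {1..n} (uniform_flats r n)"
  by (rule poly_ideal.intro[OF ideal_I])

lemma gens_I: "gens \<subseteq> I"
proof -
  interpret cring "poly_ring V :: (nat chow_var, rat) mpoly ring" by (rule cring_poly_ring)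
  have self: "S \<subseteq> Idl\<^bsub>poly_ring V\<^esub> S" "0 \<in> Idl\<^bsub>poly_ring V\<^esub> S" if "S \<subseteq> gens" for S :: "(nat chow_var, rat) mpoly set"
  proof -
    have S: "S \<subseteq> carrier (poly_ring V)" using that gens_polys by (auto simp: poly_ring_simps)
    show "S \<subseteq> Idl\<^bsub>poly_ring V\<^esub> S" by (rule genideal_self[OF S])
    show "0 \<in> Idl\<^bsub>poly_ring V\<^esub> S"
      using additive_subgroup.zero_closed[OF ideal.axioms(1)[OF genideal_ideal[OF S]]]
      by (simp add: poly_ring_simps)
  qed
  have add: "a + b \<in> A <+>\<^bsub>poly_ring V\<^esub> B" if "a \<in> A" "b \<in> B" for a b and A B :: "(nat chow_var, rat) mpoly set"
    using that by (force simp: set_add_def' poly_ring_simps)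
  show ?thesis
  proof
    fix a assume "a \<in> gens"
    let ?S1 = "{pvar (X F) * pvar (X G) | F G. F \<in> L - {E} \<and> G \<in> L - {E} \<and> \<not> F \<subseteq> G \<and> \<not> G \<subseteq> F} :: (nat chow_var, rat) mpoly set"
    let ?S2 = "{pvar (Y i) * pvar (X F) | i F. i \<in> E \<and> F \<in> L - {E} \<and> i \<notin> F} :: (nat chow_var, rat) mpoly set"
    let ?S3 = "{pvar (Y i) - (\<Sum>F | F \<in> L - {E} \<and> i \<notin> F. pvar (X F)) | i. i \<in> E} :: (nat chow_var, rat) mpoly set"
    have S: "?S1 \<subseteq> gens" "?S2 \<subseteq> gens" "?S3 \<subseteq> gens" by (auto simp: gens_def)
    have I: "I = (Idl\<^bsub>poly_ring V\<^esub> ?S1 <+>\<^bsub>poly_ring V\<^esub> Idl\<^bsub>poly_ring V\<^esub> ?S2) <+>\<^bsub>poly_ring V\<^esub> Idl\<^bsub>poly_ring V\<^esub> ?S3"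
      unfolding chow_ideal_def chow_I1_def chow_I2_def chow_J_def chow_poly_ring_eq ..
    have "a \<in> ?S1 \<or> a \<in> ?S2 \<or> a \<in> ?S3" using \<open>a \<in> gens\<close> unfolding gens_def by blast
    then show "a \<in> I"
    proof (elim disjE)
      assume h: "a \<in> ?S1"
      have "a + 0 + 0 \<in> I"
        unfolding I by (rule add[OF add[OF subsetD[OF self(1)[OF S(1)] h] self(2)[OF S(2)]] self(2)[OF S(3)]])
      then show ?thesis by simp
    next
      assume h: "a \<in> ?S2"
      have "0 + a + 0 \<in> I"
        unfolding I by (rule add[OF add[OF self(2)[OF S(1)] subsetD[OF self(1)[OF S(2)] h]] self(2)[OF S(3)]])
      then show ?thesis by simp
    next
      assume h: "a \<in> ?S3"
      have "0 + 0 + a \<in> I"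
        unfolding I by (rule add[OF add[OF self(2)[OF S(1)] self(2)[OF S(2)]] subsetD[OF self(1)[OF S(3)] h]])
      then show ?thesis by simp
    qed
  qed
qed

text \<open>Induction principle for the sum of the three generated ideals.\<close>

lemma I_least:
  assumes "0 \<in> S" "\<And>a b. a \<in> S \<Longrightarrow> b \<in> S \<Longrightarrow> a + b \<in> S"
    "\<And>p a. p \<in> P \<Longrightarrow> a \<in> S \<Longrightarrow> p * a \<in> S" "gens \<subseteq> S"
  shows "I \<subseteq> S"
proof -
  interpret cring "poly_ring V :: (nat chow_var, rat) mpoly ring" by (rule cring_poly_ring)
  have S: "ideal (S \<inter> P) (poly_ring V)"
    using assms by (intro poly_idealI) auto
  have min: "Idl\<^bsub>poly_ring V\<^esub> T \<subseteq> S \<inter> P" if "T \<subseteq> gens" for T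
    using that assms(4) gens_polys by (intro genideal_minimal S) auto
  have add: "A <+>\<^bsub>poly_ring V\<^esub> B \<subseteq> S \<inter> P" if "A \<subseteq> S \<inter> P" "B \<subseteq> S \<inter> P"
    for A B :: "(nat chow_var, rat) mpoly set"
  proof
    fix c assume "c \<in> A <+>\<^bsub>poly_ring V\<^esub> B"
    then obtain a b where "a \<in> A" "b \<in> B" "c = a + b"
      unfolding set_add_def' by (auto simp: poly_ring_simps)
    then show "c \<in> S \<inter> P" using that assms(2) polys_add[of a V b] by blast
  qed
  have "I \<subseteq> S \<inter> P"
    unfolding chow_ideal_def chow_I1_def chow_I2_def chow_J_def chow_poly_ring_eq
    by (intro add min) (unfold gens_def, blast+)
  then show ?thesis by blast
qed

text \<open>The ground set gets the element that makes the sum over all flats vanish. Then \<open>y i\<close> is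
  congruent to \<open>- above {i}\<close> and the \<open>x F\<close> for all flats \<open>F\<close> generate the ring.\<close>

definition x :: "nat set \<Rightarrow> (nat chow_var, rat) mpoly" where
  "x F = (if F = E then - (\<Sum>G\<in>L - {E}. pvar (X G)) else pvar (X F))"

definition y :: "nat \<Rightarrow> (nat chow_var, rat) mpoly" where
  "y i = pvar (Y i)"

definition above :: "nat set \<Rightarrow> (nat chow_var, rat) mpoly" where
  "above S = (\<Sum>G | G \<in> L \<and> S \<subseteq> G. x G)"

lemma x_P [simp, intro]: "F \<in> L \<Longrightarrow> x F \<in> P"
proof -
  assume F: "F \<in> L"
  have "(\<Sum>G\<in>L - {E}. pvar (X G)) \<in> P" by (intro polys_sum polys_pvar X_in_V)
  moreover have "pvar (X F) \<in> P" if "F \<noteq> E" using F that by (intro polys_pvar X_in_V) blast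
  ultimately show ?thesis unfolding x_def by (metis polys_uminus)
qed

lemma y_P [simp, intro]: "i \<in> E \<Longrightarrow> y i \<in> P"
  unfolding y_def by (intro polys_pvar Y_in_V)

lemma above_P [simp, intro]: "above S \<in> P"
  unfolding above_def by (intro polys_sum x_P) blast

lemma sum_x_L: "(\<Sum>G\<in>L. x G) = 0"
proof -
  have "(\<Sum>G\<in>L. x G) = x E + (\<Sum>G\<in>L - {E}. x G)"
    using E_in_L by (intro sum.remove) auto
  also have "(\<Sum>G\<in>L - {E}. x G) = (\<Sum>G\<in>L - {E}. pvar (X G))"
    by (intro sum.cong) (auto simp: x_def)
  finally show ?thesis by (simp add: x_def)
qed

lemma sum_x_split: "(\<Sum>G | G \<in> L \<and> Q G. x G) = - (\<Sum>G | G \<in> L \<and> \<not> Q G. x G)"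
proof -
  have "(\<Sum>G\<in>L. x G) = (\<Sum>G\<in>{G \<in> L. Q G} \<union> {G \<in> L. \<not> Q G}. x G)"
    by (intro sum.cong) auto
  also have "\<dots> = (\<Sum>G | G \<in> L \<and> Q G. x G) + (\<Sum>G | G \<in> L \<and> \<not> Q G. x G)"
    by (intro sum.union_disjoint) auto
  finally show ?thesis using sum_x_L by (simp add: eq_neg_iff_add_eq_0)
qed

lemma above_split:
  assumes "S \<subseteq> T"
  shows "above S = above T + (\<Sum>G | G \<in> L \<and> S \<subseteq> G \<and> \<not> T \<subseteq> G. x G)"
proof -
  have "above S = (\<Sum>G\<in>{G \<in> L. T \<subseteq> G} \<union> {G \<in> L. S \<subseteq> G \<and> \<not> T \<subseteq> G}. x G)"
    unfolding above_def using assms by (intro sum.cong) auto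
  also have "\<dots> = above T + (\<Sum>G | G \<in> L \<and> S \<subseteq> G \<and> \<not> T \<subseteq> G. x G)"
    unfolding above_def by (intro sum.union_disjoint) auto
  finally show ?thesis .
qed

lemma x_x:
  assumes "F \<in> L" "G \<in> L" "\<not> F \<subseteq> G" "\<not> G \<subseteq> F"
  shows "x F * x G \<in> I"
proof -
  have "F \<noteq> E" "G \<noteq> E" using assms by (auto simp: L_iff)
  then have "x F * x G = pvar (X F) * pvar (X G)" "F \<in> L - {E}" "G \<in> L - {E}"
    using assms by (simp_all add: x_def)
  then have "x F * x G \<in> gens" using assms(3,4) unfolding gens_def by blast
  then show ?thesis using gens_I by blast
qed

lemma y_x:
  assumes "i \<in> E" "F \<in> L" "i \<notin> F"
  shows "y i * x F \<in> I"
proof -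
  have "F \<noteq> E" using assms by auto
  then have "y i * x F = pvar (Y i) * pvar (X F)" "F \<in> L - {E}"
    using assms by (simp_all add: x_def y_def)
  then have "y i * x F \<in> gens" using assms unfolding gens_def by blast
  then show ?thesis using gens_I by blast
qed

lemma y_above:
  assumes "i \<in> E"
  shows "y i + above {i} \<in> I"
proof -
  have "pvar (Y i) - (\<Sum>F | F \<in> L - {E} \<and> i \<notin> F. pvar (X F)) \<in> gens"
    unfolding gens_def using assms by blast
  moreover have "(\<Sum>F | F \<in> L - {E} \<and> i \<notin> F. pvar (X F)) = (\<Sum>F | F \<in> L \<and> \<not> {i} \<subseteq> F. x F)"
    using assms by (intro sum.cong) (auto simp: x_def)
  ultimately have "y i - (\<Sum>F | F \<in> L \<and> \<not> {i} \<subseteq> F. x F) \<in> gens" by (simp only: y_def)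
  moreover have "above {i} = - (\<Sum>F | F \<in> L \<and> \<not> {i} \<subseteq> F. x F)"
    unfolding above_def by (rule sum_x_split)
  ultimately show ?thesis using gens_I by auto
qed

lemma x_above_join:
  assumes "G \<in> L" "\<not> S \<subseteq> G"
  shows "x G * above S - x G * above (S \<union> G) \<in> I"
proof -
  have "x G * above S - x G * above (S \<union> G) = (\<Sum>K | K \<in> L \<and> S \<subseteq> K \<and> \<not> S \<union> G \<subseteq> K. x G * x K)"
    by (simp add: above_split[of S "S \<union> G"] distrib_left sum_distrib_left)
  also have "\<dots> \<in> I"
    using assms by (intro sum x_x) auto
  finally show ?thesis .
qed

lemma power_congruence:
  assumes "z * a - z * b \<in> I" "a \<in> P" "b \<in> P"
  shows "z * a ^ k - z * b ^ k \<in> I"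
proof (induction k)
  case (Suc k)
  have "z * a ^ Suc k - z * b ^ Suc k = a * (z * a ^ k - z * b ^ k) + b ^ k * (z * a - z * b)"
    by (simp add: algebra_simps)
  also have "\<dots> \<in> I" using Suc assms by (intro add mult) auto
  finally show ?case .
qed simp

lemma flat_card_ge: "K \<in> L \<Longrightarrow> r \<le> card K \<Longrightarrow> K = E"
  by (auto simp: L_iff)

text \<open>Expanding one factor \<open>above S\<close> at an element \<open>i\<close> of \<open>S\<close> outside of \<open>G\<close> gives \<open>above (insert i G)\<close>
  and terms \<open>x K\<close> with \<open>insert i G \<subseteq> K\<close>. The former is killed by \<open>x G\<close>, since \<open>y i * x G\<close>
  is. In the latter, the rank of \<open>K\<close> exceeds that of \<open>G\<close>, so one power less suffices.\<close>

lemma x_above_power: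
  assumes "G \<in> L" "G \<subset> S" "S \<subseteq> E" "1 \<le> e" "min (card S) r \<le> card G + e"
  shows "x G * above S ^ e \<in> I"
  using assms
proof (induction e arbitrary: G S)
  case (Suc e)
  obtain i where i: "i \<in> S" "i \<notin> G" using Suc.prems(2) by blast
  have iE: "i \<in> E" using i Suc.prems(3) by blast
  have fin: "finite S" "finite G"
    using Suc.prems(2,3) finite_subset[of S E] finite_subset[of G S] by auto
  have "x G * above {i} \<in> I"
  proof -
    have "x G * (y i + above {i}) - y i * x G \<in> I"
      using Suc.prems i iE by (intro diff mult y_above y_x) auto
    then show ?thesis by (simp add: algebra_simps)
  qed
  moreover have "x G * above {i} - x G * above (insert i G) \<in> I"
    using x_above_join[of G "{i}"] Suc.prems i by simp
  ultimately have "x G * above {i} - (x G * above {i} - x G * above (insert i G)) \<in> I"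
    by (rule diff)
  then have A: "x G * above (insert i G) \<in> I" by simp
  define T where "T = {K \<in> L. insert i G \<subseteq> K \<and> \<not> S \<subseteq> K}"
  have split: "above S = above (insert i G) - (\<Sum>K\<in>T. x K)"
    using above_split[of "insert i G" S] i Suc.prems(2) by (auto simp: T_def)
  have K: "x K * above S ^ e \<in> I" if "K \<in> T" for K
  proof -
    have K: "K \<in> L" "insert i G \<subseteq> K" "\<not> S \<subseteq> K" using that by (auto simp: T_def)
    have KE: "K \<subseteq> E" "card K < r" using K Suc.prems(3) by (auto simp: L_iff)
    have finK: "finite K" using KE(1) finite_subset by blast
    have cK: "Suc (card G) \<le> card K"
      using card_mono[OF finK K(2)] i fin by simp
    have cSK: "card (S - K) + Suc (card G) \<le> card S"
    proof -
      have "card (S - K) \<le> card (S - insert i G)" using K(2) fin by (intro card_mono) auto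
      also have "\<dots> = card S - Suc (card G)"
        using i Suc.prems(2) fin by (subst card_Diff_subset) auto
      finally show ?thesis
        using card_mono[OF fin(1), of "insert i G"] i Suc.prems(2) fin by auto
    qed
    have "S - K \<noteq> {}" using K by blast
    then have pos: "0 < card (S - K)" using fin by (simp add: card_gt_0_iff)
    have e: "1 \<le> e"
    proof (rule ccontr)
      assume "\<not> 1 \<le> e"
      then have "min (card S) r \<le> Suc (card G)" using Suc.prems by simp
      then show False using pos cSK cK KE(2) by (auto simp: min_def split: if_splits)
    qed
    have union: "card (S \<union> K) = card K + card (S - K)"
      using card_Un_disjoint[of K "S - K"] finK fin by (simp add: Un_commute)
    have "x K * above (S \<union> K) ^ e \<in> I"
    proof (rule Suc.IH[OF K(1) _ _ e])
      show "K \<subset> S \<union> K" "S \<union> K \<subseteq> E" using K KE Suc.prems(3) by auto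
      show "min (card (S \<union> K)) r \<le> card K + e"
        using Suc.prems(5) cSK cK unfolding union by (auto simp: min_def split: if_splits)
    qed
    moreover have "x K * above S ^ e - x K * above (S \<union> K) ^ e \<in> I"
      by (intro power_congruence x_above_join K above_P)
    ultimately show ?thesis using diff_trans by blast
  qed
  have "x G * above S ^ Suc e = above S ^ e * (x G * above (insert i G)) - (\<Sum>K\<in>T. x G * (x K * above S ^ e))"
  proof -
    have "x G * above S ^ Suc e = (x G * above S ^ e) * (above (insert i G) - (\<Sum>K\<in>T. x K))"
      using split by (metis mult.assoc mult.commute power_Suc)
    also have "\<dots> = above S ^ e * (x G * above (insert i G)) - (x G * above S ^ e) * (\<Sum>K\<in>T. x K)"
      by (simp add: algebra_simps)
    also have "(x G * above S ^ e) * (\<Sum>K\<in>T. x K) = (\<Sum>K\<in>T. x G * (x K * above S ^ e))"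
      unfolding sum_distrib_left by (intro sum.cong) (simp_all add: ac_simps)
    finally show ?thesis .
  qed
  also have "\<dots> \<in> I"
    using Suc.prems(1) by (intro diff mult sum A K polys_power) auto
  finally show ?case .
qed simp

text \<open>The same expansion with a product of elements \<open>y i\<close> in the place of \<open>x G\<close>: each step either
  enlarges \<open>J\<close> or leads to \<open>x_above_power\<close>. It ends when \<open>J\<close> spans \<open>S\<close>, because then every flat
  that does not contain \<open>S\<close> misses an element of \<open>J\<close>.\<close>

lemma y_above_power:
  assumes "J \<subseteq> S" "S \<subseteq> E" "1 \<le> e" "Suc (min (card S) r) \<le> card J + e"
  shows "(\<Prod>i\<in>J. y i) * above S ^ e \<in> I"
  using assms
proof (induction e arbitrary: J)
  case (Suc e)
  have fin: "finite S" "finite J"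
    using Suc.prems(1,2) finite_subset[of S E] finite_subset[of J S] by auto
  have prodP: "(\<Prod>i\<in>J'. y i) \<in> P" if "J' \<subseteq> E" for J'
    using that by (induction J' rule: infinite_finite_induct) auto
  have yJ: "(\<Prod>i\<in>J. y i) * x K \<in> I" if K: "K \<in> L" "\<not> J \<subseteq> K" for K
  proof -
    obtain j where j: "j \<in> J" "j \<notin> K" using K by blast
    have "(\<Prod>i\<in>J. y i) = y j * (\<Prod>i\<in>J - {j}. y i)" using j fin by (intro prod.remove) auto
    then have "(\<Prod>i\<in>J. y i) * x K = (\<Prod>i\<in>J - {j}. y i) * (y j * x K)" by (simp add: ac_simps)
    also have "\<dots> \<in> I" using j K Suc.prems(1,2) by (intro mult y_x prodP) auto
    finally show ?thesis .
  qed
  show ?case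
  proof (cases "J = S \<or> r \<le> card J")
    case True
    have "above S = - (\<Sum>K | K \<in> L \<and> \<not> S \<subseteq> K. x K)"
      unfolding above_def by (rule sum_x_split)
    then have "(\<Prod>i\<in>J. y i) * above S = - (\<Sum>K | K \<in> L \<and> \<not> S \<subseteq> K. (\<Prod>i\<in>J. y i) * x K)"
      by (simp add: sum_distrib_left)
    also have "\<dots> \<in> I"
    proof (intro uminus sum yJ)
      fix K assume K: "K \<in> {K \<in> L. \<not> S \<subseteq> K}"
      then show "K \<in> L" by simp
      show "\<not> J \<subseteq> K"
      proof
        assume sub: "J \<subseteq> K"
        have "finite K" using K finite_subset[of K E] by (auto simp: L_iff)
        then have "r \<le> card K" using True sub K card_mono[of K J] by auto
        then show False using flat_card_ge K Suc.prems(2) by blast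
      qed
    qed
    finally have "above S ^ e * ((\<Prod>i\<in>J. y i) * above S) \<in> I"
      by (rule mult) (intro polys_power above_P)
    then show ?thesis by (simp add: ac_simps)
  next
    case False
    then obtain i where i: "i \<in> S" "i \<notin> J" using Suc.prems(1) by blast
    have iE: "i \<in> E" using i Suc.prems(2) by blast
    have "card J < card S" using False Suc.prems(1) fin by (intro psubset_card_mono) auto
    then have e: "1 \<le> e" using Suc.prems(4) False by (auto simp: min_def split: if_splits)
    define T where "T = {K \<in> L. {i} \<subseteq> K \<and> \<not> S \<subseteq> K}"
    have split: "above S = above {i} - (\<Sum>K\<in>T. x K)"
      using above_split[of "{i}" S] i by (simp add: T_def)
    have K: "(\<Prod>i\<in>J. y i) * (x K * above S ^ e) \<in> I" if "K \<in> T" for K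
    proof (cases "J \<subseteq> K")
      case False
      then have "above S ^ e * ((\<Prod>i\<in>J. y i) * x K) \<in> I"
        using that by (intro mult[OF yJ] polys_power above_P) (auto simp: T_def)
      then show ?thesis by (simp add: ac_simps)
    next
      case True
      have K: "K \<in> L" "insert i J \<subseteq> K" "\<not> S \<subseteq> K" using that True by (auto simp: T_def)
      have KE: "K \<subseteq> E" "card K < r" using K Suc.prems(2) by (auto simp: L_iff)
      have finK: "finite K" using KE(1) finite_subset by blast
      have cK: "Suc (card J) \<le> card K"
        using card_mono[OF finK K(2)] i fin by simp
      have cSK: "card (S - K) + Suc (card J) \<le> card S"
      proof -
        have "card (S - K) \<le> card (S - insert i J)" using K(2) fin by (intro card_mono) auto
        also have "\<dots> = card S - Suc (card J)"
          using i Suc.prems(1) fin by (subst card_Diff_subset) auto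
        finally show ?thesis
          using card_mono[OF fin(1), of "insert i J"] i Suc.prems(1) fin by auto
      qed
      have union: "card (S \<union> K) = card K + card (S - K)"
        using card_Un_disjoint[of K "S - K"] finK fin by (simp add: Un_commute)
      have "x K * above (S \<union> K) ^ e \<in> I"
      proof (rule x_above_power[OF K(1) _ _ e])
        show "K \<subset> S \<union> K" "S \<union> K \<subseteq> E" using K KE Suc.prems(2) by auto
        show "min (card (S \<union> K)) r \<le> card K + e"
          using Suc.prems(4) cSK cK unfolding union by (auto simp: min_def split: if_splits)
      qed
      moreover have "x K * above S ^ e - x K * above (S \<union> K) ^ e \<in> I"
        by (intro power_congruence x_above_join K above_P)
      ultimately have "x K * above S ^ e \<in> I" using diff_trans by blast
      then show ?thesis by (rule mult) (use Suc.prems(1,2) in \<open>intro prodP, blast\<close>)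
    qed
    have "(\<Prod>i\<in>insert i J. y i) * above S ^ e \<in> I"
      using Suc.prems i e fin by (intro Suc.IH) auto
    moreover have "above S ^ e * (\<Prod>i\<in>J. y i) * (y i + above {i}) \<in> I"
      using Suc.prems(1,2) by (intro mult[OF y_above[OF iE]] polys_mult polys_power prodP above_P) blast
    moreover have "(\<Sum>K\<in>T. (\<Prod>i\<in>J. y i) * (x K * above S ^ e)) \<in> I" by (intro sum K)
    ultimately have "above S ^ e * (\<Prod>i\<in>J. y i) * (y i + above {i}) - (\<Prod>i\<in>insert i J. y i) * above S ^ e -
        (\<Sum>K\<in>T. (\<Prod>i\<in>J. y i) * (x K * above S ^ e)) \<in> I"
      by (intro diff)
    moreover have "(\<Prod>i\<in>J. y i) * above S ^ Suc e = above S ^ e * (\<Prod>i\<in>J. y i) * (y i + above {i}) -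
        (\<Prod>i\<in>insert i J. y i) * above S ^ e - (\<Sum>K\<in>T. (\<Prod>i\<in>J. y i) * (x K * above S ^ e))"
    proof -
      have "(\<Prod>i\<in>J. y i) * above S ^ Suc e = (\<Prod>i\<in>J. y i) * above S ^ e * (above {i} - (\<Sum>K\<in>T. x K))"
        using split by (metis mult.assoc mult.commute power_Suc)
      also have "\<dots> = above S ^ e * (\<Prod>i\<in>J. y i) * (y i + above {i}) -
          (y i * (\<Prod>i\<in>J. y i)) * above S ^ e - (\<Prod>i\<in>J. y i) * above S ^ e * (\<Sum>K\<in>T. x K)"
        by (simp add: algebra_simps)
      also have "y i * (\<Prod>i\<in>J. y i) = (\<Prod>i\<in>insert i J. y i)" using i fin by simp
      also have "(\<Prod>i\<in>J. y i) * above S ^ e * (\<Sum>K\<in>T. x K) = (\<Sum>K\<in>T. (\<Prod>i\<in>J. y i) * (x K * above S ^ e))"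
        unfolding sum_distrib_left by (intro sum.cong) (simp_all add: ac_simps)
      finally show ?thesis .
    qed
    ultimately show ?thesis by (simp only:)
  qed
qed simp

lemma above_power:
  assumes "S \<subseteq> E" "Suc (min (card S) r) \<le> e"
  shows "above S ^ e \<in> I"
  using y_above_power[of "{}" S e] assms by simp

end

section \<open>Feichtner--Yuzvinsky monomials span\<close>

context chow
begin

definition xmono :: "nat set multiset \<Rightarrow> (nat chow_var, rat) mpoly" where
  "xmono N = (\<Prod>F\<in>#N. x F)"

text \<open>The number \<open>min (card F) r\<close> is the rank of \<open>F\<close>. These are the exponents of the
  Feichtner--Yuzvinsky basis monomials: the bound is weak at the smallest flat of the chain and
  strict above.\<close>

definition fy :: "nat set multiset \<Rightarrow> bool" where
  "fy N \<longleftrightarrow> set_mset N \<subseteq> L \<and> (\<forall>F\<in>#N. count N F \<le> min (card F) r \<and>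
     (\<forall>G\<in>#N. (F \<subseteq> G \<or> G \<subseteq> F) \<and> (G \<subset> F \<longrightarrow> count N F + card G < min (card F) r)))"

definition FY :: "nat \<Rightarrow> nat set multiset set" where
  "FY d = {N. fy N \<and> size N = d}"

lemma finite_FY [simp, intro]: "finite (FY d)"
proof (rule finite_subset)
  show "FY d \<subseteq> multisets_of_size L d" by (auto simp: FY_def fy_def multisets_of_size_def)
qed (rule finite_multisets_of_size, rule finite_L)

lemma xmono_P [simp, intro]: "set_mset N \<subseteq> L \<Longrightarrow> xmono N \<in> P"
  unfolding xmono_def by (intro polys_prod_mset x_P) blast

lemma xmono_add: "xmono (M + N) = xmono M * xmono N"
  by (simp add: xmono_def)

lemma xmono_add_mset: "xmono (add_mset F N) = x F * xmono N"
  by (simp add: xmono_def)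

lemma xmono_replicate: "xmono (replicate_mset e F) = x F ^ e"
  by (induction e) (simp_all add: xmono_def)

definition spanned :: "nat \<Rightarrow> (nat chow_var, rat) mpoly set" where
  "spanned d = {p. \<exists>c. p - (\<Sum>N\<in>FY d. pconst (c N) * xmono N) \<in> I}"

lemma spannedI: "p - (\<Sum>N\<in>FY d. pconst (c N) * xmono N) \<in> I \<Longrightarrow> p \<in> spanned d"
  unfolding spanned_def by (rule CollectI, rule exI[of _ c])

lemma spanned_I: "p \<in> I \<Longrightarrow> p \<in> spanned d"
  unfolding spanned_def by (rule CollectI, rule exI[of _ "\<lambda>_. 0"]) simp

lemma spanned_add:
  assumes "p \<in> spanned d" "q \<in> spanned d"
  shows "p + q \<in> spanned d"
proof -
  from assms obtain c c' where c: "p - (\<Sum>N\<in>FY d. pconst (c N) * xmono N) \<in> I"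
    "q - (\<Sum>N\<in>FY d. pconst (c' N) * xmono N) \<in> I" unfolding spanned_def by blast
  have "p + q - (\<Sum>N\<in>FY d. pconst (c N + c' N) * xmono N) =
      (p - (\<Sum>N\<in>FY d. pconst (c N) * xmono N)) + (q - (\<Sum>N\<in>FY d. pconst (c' N) * xmono N))"
    by (simp add: pconst_add distrib_right sum.distrib)
  also have "\<dots> \<in> I" using c by (rule add)
  finally show ?thesis by (rule spannedI)
qed

lemma spanned_scale:
  assumes "p \<in> spanned d"
  shows "pconst a * p \<in> spanned d"
proof -
  from assms obtain c where c: "p - (\<Sum>N\<in>FY d. pconst (c N) * xmono N) \<in> I"
    unfolding spanned_def by blast
  have "pconst a * p - (\<Sum>N\<in>FY d. pconst (a * c N) * xmono N) =
      pconst a * (p - (\<Sum>N\<in>FY d. pconst (c N) * xmono N))"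
    by (simp add: pconst_mult right_diff_distrib sum_distrib_left mult.assoc)
  also have "\<dots> \<in> I" using c by (rule mult) simp
  finally show ?thesis by (rule spannedI)
qed

lemma spanned_uminus: "p \<in> spanned d \<Longrightarrow> - p \<in> spanned d"
proof -
  assume "p \<in> spanned d"
  then have "pconst (- 1) * p \<in> spanned d" by (rule spanned_scale)
  moreover have "pconst (- 1) + 1 = (0 :: (nat chow_var, rat) mpoly)"
  proof -
    have "pconst (- 1) + pconst 1 = (pconst (- 1 + 1) :: (nat chow_var, rat) mpoly)"
      by (simp only: pconst_add)
    then show ?thesis by simp
  qed
  then have "pconst (- 1) = (- 1 :: (nat chow_var, rat) mpoly)"
    by (simp only: eq_neg_iff_add_eq_0)
  ultimately show ?thesis by simp
qed

lemma spanned_diff: "p \<in> spanned d \<Longrightarrow> q \<in> spanned d \<Longrightarrow> p - q \<in> spanned d"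
  using spanned_add[of p d "- q"] spanned_uminus[of q d] by simp

lemma spanned_sum: "(\<And>x. x \<in> A \<Longrightarrow> p x \<in> spanned d) \<Longrightarrow> Groups_Big.sum p A \<in> spanned d"
  by (induction A rule: infinite_finite_induct) (auto intro: spanned_add spanned_I)

lemma spanned_FY: "N \<in> FY d \<Longrightarrow> xmono N \<in> spanned d"
proof -
  assume N: "N \<in> FY d"
  have "(\<Sum>M\<in>FY d. pconst (if M = N then 1 else 0) * xmono M) = (\<Sum>M\<in>FY d. if M = N then xmono M else 0)"
    by (intro sum.cong) auto
  also have "\<dots> = xmono N" using N by (simp add: sum.delta)
  finally have "xmono N - (\<Sum>M\<in>FY d. pconst (if M = N then 1 else 0) * xmono M) \<in> I" by simp
  then show ?thesis by (rule spannedI)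
qed

text \<open>The measure that increases in straightening; it is bounded in every fixed degree.\<close>

definition weight :: "nat set multiset \<Rightarrow> nat" where
  "weight N = (\<Sum>F\<in>#N. card F)"

lemma weight_simps [simp]: "weight {#} = 0" "weight (add_mset F N) = card F + weight N"
  "weight (M + N) = weight M + weight N" "weight (replicate_mset e F) = e * card F"
  by (simp_all add: weight_def)

lemma weight_le: "set_mset N \<subseteq> L \<Longrightarrow> weight N \<le> size N * n"
proof (induction N)
  case (add F N)
  have "card F \<le> n" using add.prems card_mono[of E F] by (auto simp: L_iff)
  then show ?case using add by auto
qed simp

text \<open>A monomial that violates the Feichtner--Yuzvinsky conditions contains two incomparable flats, or
  contains a power \<open>x F ^ e\<close> for which one of the two vanishing results for \<open>above F ^ e\<close> applies.\<close>

lemma not_fy_cases: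
  assumes "set_mset N \<subseteq> L" "\<not> fy N"
  obtains F G where "F \<in># N" "G \<in># N" "\<not> F \<subseteq> G" "\<not> G \<subseteq> F"
  | R F e where "N = R + replicate_mset e F" "F \<in> L" "0 < e" "xmono R * above F ^ e \<in> I"
proof -
  from assms obtain F where F: "F \<in># N" and "\<not> (count N F \<le> min (card F) r) \<or>
      (\<exists>G\<in>#N. (\<not> F \<subseteq> G \<and> \<not> G \<subseteq> F) \<or> G \<subset> F \<and> \<not> count N F + card G < min (card F) r)"
    unfolding fy_def by blast
  then consider "\<not> count N F \<le> min (card F) r" | G where "G \<in># N" "\<not> F \<subseteq> G" "\<not> G \<subseteq> F"
    | G where "G \<in># N" "G \<subset> F" "\<not> count N F + card G < min (card F) r" by blast
  then show thesis
  proof cases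
    case 1
    have "F \<in> L" using F assms(1) by blast
    then have FE: "F \<subseteq> E" "F \<in> L" by (simp_all add: L_iff)
    define R where "R = filter_mset (\<lambda>G. G \<noteq> F) N"
    have N: "N = R + replicate_mset (count N F) F"
      using multiset_partition[of N "\<lambda>G. G \<noteq> F"] by (simp add: R_def filter_eq_replicate_mset)
    have R: "set_mset R \<subseteq> L" using assms(1) by (auto simp: R_def)
    have "above F ^ count N F \<in> I" using 1 FE by (intro above_power) auto
    then have "xmono R * above F ^ count N F \<in> I" by (rule mult) (rule xmono_P[OF R])
    then show thesis using N FE F by (intro that(2)[of R "count N F" F]) auto
  next
    case 2
    then show thesis using F that(1) by blast
  next
    case 3
    have "F \<in> L" "G \<in> L" using F 3 assms(1) by blast+
    then have FE: "F \<subseteq> E" "F \<in> L" "G \<in> L" by (simp_all add: L_iff)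
    define R where "R = filter_mset (\<lambda>G. G \<noteq> F) N"
    have N: "N = R + replicate_mset (count N F) F"
      using multiset_partition[of N "\<lambda>G. G \<noteq> F"] by (simp add: R_def filter_eq_replicate_mset)
    have "G \<in># R" using 3 by (auto simp: R_def)
    then obtain R' where R': "R = add_mset G R'" by (meson multi_member_split)
    have "set_mset R \<subseteq> L" using assms(1) by (auto simp: R_def)
    then have "set_mset R' \<subseteq> L" by (simp add: R')
    have "x G * above F ^ count N F \<in> I"
      using 3 F FE by (intro x_above_power) auto
    then have "xmono R' * (x G * above F ^ count N F) \<in> I"
      by (rule mult) (rule xmono_P, fact)
    then have "xmono R * above F ^ count N F \<in> I" by (simp add: R' xmono_add_mset ac_simps)
    then show thesis using N FE F by (intro that(2)[of R "count N F" F]) auto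
  qed
qed

text \<open>Straightening: \<open>x F ^ e\<close> is the only term of \<open>above F ^ e\<close> in which no flat larger than \<open>F\<close>
  occurs. Where the power of \<open>above F\<close> vanishes, it can thus be replaced by monomials of larger
  weight.\<close>

lemma xmono_spanned:
  "set_mset N \<subseteq> L \<Longrightarrow> xmono N \<in> spanned (size N)"
proof (induction "size N * n - weight N" arbitrary: N rule: less_induct)
  case less
  let ?d = "size N"
  have IH: "xmono M \<in> spanned ?d" if "set_mset M \<subseteq> L" "size M = ?d" "weight N < weight M" for M
  proof -
    have "weight M \<le> ?d * n" using weight_le[OF that(1)] that(2) by simp
    then have "size M * n - weight M < ?d * n - weight N" using that by simp
    then show ?thesis using less(1)[of M] that by simp
  qed
  show ?case
  proof (cases "fy N")
    case True
    then show ?thesis by (intro spanned_FY) (simp add: FY_def)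
  next
    case False
    from less(2) False show ?thesis
    proof (cases rule: not_fy_cases)
      case (1 F G)
      then have "F \<noteq> G" by blast
      then have "G \<in># N - {#F#}" using 1 by (simp add: in_diff_count)
      then obtain R where R: "N - {#F#} = add_mset G R" by (meson multi_member_split)
      then have N: "N = add_mset F (add_mset G R)" using 1(1) by (metis insert_DiffM)
      have "x F * x G \<in> I" using 1 less(2) by (intro x_x) auto
      moreover have "set_mset R \<subseteq> L" using less(2) N by simp
      ultimately have "xmono R * (x F * x G) \<in> I" by (rule mult[OF _ xmono_P])
      then show ?thesis by (intro spanned_I) (simp add: N xmono_add_mset ac_simps)
    next
      case (2 R F e)
      have R: "set_mset R \<subseteq> L" using less(2) 2 by simp
      \<comment> \<open>Powers of above F may remain as factors: each expands into flats that contain F.\<close>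
      have high: "xmono M * above F ^ j \<in> spanned ?d"
        if "set_mset M \<subseteq> L" "size M + j = ?d" "weight N < weight M + j * card F" for M j
        using that
      proof (induction j arbitrary: M)
        case 0
        then show ?case using IH by simp
      next
        case (Suc j)
        have "xmono M * above F ^ Suc j = (\<Sum>G | G \<in> L \<and> F \<subseteq> G. xmono (add_mset G M) * above F ^ j)"
          by (simp add: xmono_add_mset above_def[of F] sum_distrib_left sum_distrib_right ac_simps
              del: power_Suc add: power_Suc2)
        also have "\<dots> \<in> spanned ?d"
        proof (intro spanned_sum Suc.IH)
          fix G assume G: "G \<in> {G \<in> L. F \<subseteq> G}"
          have "finite G" using G finite_subset[of G E] by (auto simp: L_iff)
          then have "card F \<le> card G" using G by (intro card_mono) auto
          then show "weight N < weight (add_mset G M) + j * card F" using Suc.prems(3) by simp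
          show "set_mset (add_mset G M) \<subseteq> L" "size (add_mset G M) + j = ?d"
            using G Suc.prems by auto
        qed
        finally show ?case .
      qed
      define T where "T = {G \<in> L. F \<subset> G}"
      have above: "above F - x F = (\<Sum>G\<in>T. x G)"
      proof -
        have "{G \<in> L. F \<subseteq> G} = insert F T" using 2(2) by (auto simp: T_def)
        then show ?thesis unfolding above_def by (simp add: T_def)
      qed
      have "above F ^ e - x F ^ e = (above F - x F) * (\<Sum>i<e. x F ^ (e - Suc i) * above F ^ i)"
        by (rule power_diff_sumr2)
      also have "\<dots> = (\<Sum>G\<in>T. \<Sum>i<e. x G * (x F ^ (e - Suc i) * above F ^ i))"
        unfolding above sum_product ..
      finally have "xmono R * (above F ^ e - x F ^ e) =
          (\<Sum>G\<in>T. \<Sum>i<e. xmono (R + add_mset G (replicate_mset (e - Suc i) F)) * above F ^ i)"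
        by (simp add: sum_distrib_left xmono_add xmono_add_mset xmono_replicate mult.assoc mult.left_commute)
      also have "\<dots> \<in> spanned ?d"
      proof (intro spanned_sum high)
        fix G i assume G: "G \<in> T" and i: "i \<in> {..<e}"
        have "finite G" using G finite_subset[of G E] by (auto simp: L_iff T_def)
        then have lt: "card F < card G" using G by (intro psubset_card_mono) (auto simp: T_def)
        show "set_mset (R + add_mset G (replicate_mset (e - Suc i) F)) \<subseteq> L"
          using R G 2(2) by (auto simp: T_def)
        show "size (R + add_mset G (replicate_mset (e - Suc i) F)) + i = ?d"
          using 2(1) i by simp
        have "e = Suc (e - Suc i + i)" using i by simp
        then have "e * card F = card F + (e - Suc i) * card F + i * card F"
          by (metis add_mult_distrib add.assoc mult_Suc)
        then show "weight N < weight (R + add_mset G (replicate_mset (e - Suc i) F)) + i * card F"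
          using lt 2(1) by simp
      qed
      finally have "xmono R * (above F ^ e - x F ^ e) \<in> spanned ?d" .
      then have "xmono R * above F ^ e - xmono R * (above F ^ e - x F ^ e) \<in> spanned ?d"
        by (rule spanned_diff[OF spanned_I[OF 2(4)]])
      then show ?thesis
        by (simp add: 2(1) xmono_add xmono_replicate right_diff_distrib)
    qed
  qed
qed

text \<open>The variables are eliminated one by one in favour of the \<open>x F\<close>, using \<open>y_above\<close>.\<close>

lemma monomial_spanned:
  assumes "set_mset \<mu> \<subseteq> V" "set_mset N \<subseteq> L"
  shows "(\<Prod>v\<in>#\<mu>. pvar v) * xmono N \<in> spanned (size \<mu> + size N)"
  using assms
proof (induction \<mu> arbitrary: N)
  case empty
  then show ?case using xmono_spanned by simp
next
  case (add v \<mu>)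
  have v: "v \<in> V" and \<mu>: "set_mset \<mu> \<subseteq> V" using add.prems by auto
  have step: "x G * ((\<Prod>v\<in>#\<mu>. pvar v) * xmono N) \<in> spanned (size (add_mset v \<mu>) + size N)"
    if "G \<in> L" for G
    using add.IH[OF \<mu>, of "add_mset G N"] add.prems(2) that
    by (simp add: xmono_add_mset ac_simps)
  from v consider F where "v = X F" "F \<in> L - {E}" | i where "v = Y i" "i \<in> E"
    by (auto simp: chow_vars_def)
  then show ?case
  proof cases
    case 1
    then have "pvar v = x F" by (simp add: x_def)
    then show ?thesis using step[of F] 1 by (simp add: mult.assoc)
  next
    case 2
    let ?q = "(\<Prod>v\<in>#\<mu>. pvar v) * xmono N"
    have q: "?q \<in> P" using \<mu> add.prems(2) by (intro polys_mult polys_prod_mset polys_pvar xmono_P) auto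
    have "?q * (y i + above {i}) \<in> I" using y_above[OF 2(2)] q by (rule mult)
    moreover have "above {i} * ?q \<in> spanned (size (add_mset v \<mu>) + size N)"
      unfolding above_def sum_distrib_right by (intro spanned_sum step) auto
    ultimately have "?q * (y i + above {i}) - above {i} * ?q \<in> spanned (size (add_mset v \<mu>) + size N)"
      by (rule spanned_diff[OF spanned_I])
    moreover have "?q * (y i + above {i}) - above {i} * ?q = pvar v * ?q"
      by (simp add: 2(1) y_def algebra_simps)
    ultimately show ?thesis by (simp add: mult.assoc)
  qed
qed

theorem homogeneous_spanned:
  assumes p: "p \<in> P" "homogeneous d p"
  shows "p \<in> spanned d"
proof -
  have "Poly_Mapping.single m (Poly_Mapping.lookup p m) \<in> spanned d" if "m \<in> Poly_Mapping.keys p" for m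
  proof -
    have "set_mset m \<subseteq> V" "size m = d" using p that by (auto simp: polys_def homogeneous_def)
    then have "(\<Prod>v\<in>#m. pvar v) \<in> spanned d"
      using monomial_spanned[of m "{#}"] by (simp add: xmono_def)
    then show ?thesis unfolding single_eq_pconst_prod by (rule spanned_scale)
  qed
  then have "(\<Sum>m\<in>Poly_Mapping.keys p. Poly_Mapping.single m (Poly_Mapping.lookup p m)) \<in> spanned d"
    by (rule spanned_sum)
  then show ?thesis using poly_mapping_sum_singles[of p] by simp
qed

end

section \<open>Feichtner--Yuzvinsky monomials as level functions\<close>

lemma finite_ex_least:
  fixes f :: "'a \<Rightarrow> nat"
  assumes "finite A" "A \<noteq> {}"
  shows "\<exists>k\<in>A. \<forall>l\<in>A. f k \<le> f l"
proof -
  have "Min (f ` A) \<in> f ` A" using assms by (intro Min_in) auto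
  then obtain k where "k \<in> A" "f k = Min (f ` A)" by (metis imageE)
  then show ?thesis using assms by (intro bexI[of _ k]) auto
qed

text \<open>For the Boolean matroid every subset of the ground set is a flat. A multiset of nonempty sets that
  form a chain is determined by the function \<open>depth\<close>, which counts the members containing a given
  element; its upper level sets give the multiset back.\<close>

locale boolean_chow = chow n n for n
begin

lemma L_eq: "L = Pow E"
proof -
  have "card F < n" if "F \<subseteq> E" "F \<noteq> E" for F
    using that psubset_card_mono[of E F] by auto
  then have "F \<in> L \<longleftrightarrow> F \<subseteq> E" for F unfolding L_iff by blast
  then show ?thesis by blast
qed

definition hist :: "(nat \<Rightarrow> nat) \<Rightarrow> nat multiset" where
  "hist D = image_mset D (mset_set E)"

definition upper :: "(nat \<Rightarrow> nat) \<Rightarrow> nat \<Rightarrow> nat set" where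
  "upper D j = {i \<in> E. j \<le> D i}"

definition Lev :: "(nat \<Rightarrow> nat) \<Rightarrow> nat set multiset" where
  "Lev D = image_mset (upper D) (mset_set {1..top (hist D)})"

definition depth :: "nat set multiset \<Rightarrow> nat \<Rightarrow> nat" where
  "depth N = (\<lambda>i\<in>E. size (filter_mset (\<lambda>F. i \<in> F) N))"

definition level_funs :: "(nat \<Rightarrow> nat) set" where
  "level_funs = {D \<in> E \<rightarrow>\<^sub>E UNIV. fy_levels 1 (hist D)}"

lemma set_hist: "set_mset (hist D) = D ` E"
  by (simp add: hist_def)

lemma le_top: "i \<in> E \<Longrightarrow> D i \<le> top (hist D)"
  by (rule top_ge) (simp add: set_hist)

lemma top_attained: "0 < top (hist D) \<Longrightarrow> \<exists>i\<in>E. D i = top (hist D)"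
  using top_mem[of "hist D"] by (force simp: set_hist)

lemma size_Lev: "size (Lev D) = top (hist D)"
  by (simp add: Lev_def)

lemma count_Lev: "count (Lev D) F = card {j \<in> {1..top (hist D)}. upper D j = F}"
proof -
  have "count (Lev D) F = size (filter_mset (\<lambda>G. G = F) (Lev D))"
    by (simp add: filter_eq_replicate_mset)
  then show ?thesis
    by (simp add: Lev_def filter_mset_image_mset filter_mset_mset_set comp_def)
qed

lemma depth_Lev:
  assumes "D \<in> E \<rightarrow>\<^sub>E UNIV"
  shows "depth (Lev D) = D"
proof
  fix i
  show "depth (Lev D) i = D i"
  proof (cases "i \<in> E")
    case True
    have "size (filter_mset (\<lambda>F. i \<in> F) (Lev D)) = card {j \<in> {1..top (hist D)}. i \<in> upper D j}"
      by (simp add: Lev_def filter_mset_image_mset filter_mset_mset_set comp_def)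
    also have "{j \<in> {1..top (hist D)}. i \<in> upper D j} = {1..D i}"
      using le_top[OF True, of D] True by (auto simp: upper_def)
    finally show ?thesis using True by (simp add: depth_def)
  next
    case False
    then show ?thesis using assms unfolding depth_def by (auto simp: PiE_def extensional_def)
  qed
qed

lemma Lev_depth:
  assumes "\<forall>F\<in>#N. F \<subseteq> E \<and> F \<noteq> {} \<and> (\<forall>G\<in>#N. F \<subseteq> G \<or> G \<subseteq> F)"
  shows "top (hist (depth N)) = size N \<and> Lev (depth N) = N"
  using assms
proof (induction "size N" arbitrary: N)
  case 0
  then have N: "N = {#}" by simp
  have "top (hist (depth N)) \<le> 0"
    by (rule top_le) (auto simp: set_hist depth_def N)
  then show ?case by (simp add: Lev_def N)
next
  case (Suc d)
  then have "set_mset N \<noteq> {}" by auto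
  then obtain F where F: "F \<in># N" "\<And>G. G \<in># N \<Longrightarrow> card F \<le> card G"
    using finite_ex_least[OF finite_set_mset, of N card] by blast
  obtain M where N: "N = add_mset F M" using F(1) by (meson multi_member_split)
  have size: "size M = d" using Suc.hyps(2) N by simp
  have FE: "F \<subseteq> E" "F \<noteq> {}" using Suc.prems F(1) by auto
  have sub: "F \<subseteq> G" if "G \<in># M" for G
  proof -
    have G: "G \<in># N" "G \<subseteq> E" using that N Suc.prems by auto
    then have "F \<subseteq> G \<or> G \<subseteq> F" using Suc.prems F(1) by blast
    moreover have "G \<subseteq> F \<Longrightarrow> G = F"
      using F(2)[OF G(1)] FE(1) finite_subset[of F E] by (metis card_seteq finite_atLeastAtMost)
    ultimately show ?thesis by blast
  qed
  have IH: "top (hist (depth M)) = d" "Lev (depth M) = M"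
    using Suc.hyps(1)[of M] Suc.prems size by (auto simp: N)
  have in_F: "depth M i = d" "depth N i = Suc d" if "i \<in> F" for i
  proof -
    have "filter_mset (\<lambda>G. i \<in> G) M = M"
      using sub that by (auto simp: filter_mset_eq_conv)
    then show "depth M i = d" "depth N i = Suc d"
      using that FE size by (auto simp: depth_def N)
  qed
  have out_F: "depth N i = depth M i" "depth N i \<le> d" if "i \<in> E" "i \<notin> F" for i
    using that size size_filter_mset_lesseq[of "\<lambda>G. i \<in> G" M] by (auto simp: depth_def N)
  have top: "top (hist (depth N)) = Suc d"
  proof (rule antisym)
    show "top (hist (depth N)) \<le> Suc d"
    proof (rule top_le)
      fix v assume "v \<in># hist (depth N)"
      then obtain i where "i \<in> E" "v = depth N i" by (auto simp: set_hist)
      then show "v \<le> Suc d" using in_F(2)[of i] out_F(2)[of i] by (cases "i \<in> F") (simp_all add: le_SucI)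
    qed
    obtain i where "i \<in> F" using FE by blast
    then show "Suc d \<le> top (hist (depth N))" using le_top[of i "depth N"] in_F FE by auto
  qed
  have last: "upper (depth N) (Suc d) = F"
  proof (intro equalityI subsetI)
    fix i assume "i \<in> upper (depth N) (Suc d)"
    then show "i \<in> F" using out_F[of i] by (force simp: upper_def)
  next
    fix i assume "i \<in> F"
    then show "i \<in> upper (depth N) (Suc d)" using in_F[of i] FE by (auto simp: upper_def)
  qed
  have lower: "upper (depth N) j = upper (depth M) j" if "j \<le> d" for j
  proof -
    have "j \<le> depth N i \<longleftrightarrow> j \<le> depth M i" if "i \<in> E" for i
      using in_F[of i] out_F[of i] that \<open>j \<le> d\<close> by (cases "i \<in> F") auto
    then show ?thesis by (auto simp: upper_def)
  qed
  have "Lev (depth N) = add_mset F (image_mset (upper (depth N)) (mset_set {1..d}))"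
  proof -
    have "{1..Suc d} = insert (Suc d) {1..d}" by auto
    then show ?thesis unfolding Lev_def top by (simp add: last)
  qed
  also have "image_mset (upper (depth N)) (mset_set {1..d}) = image_mset (upper (depth M)) (mset_set {1..d})"
    using lower by (intro image_mset_cong) simp
  also have "\<dots> = M" using IH by (simp add: Lev_def)
  finally show ?case using top size by (simp add: N)
qed

lemma below_less: "0 < v \<Longrightarrow> below h v < v"
  unfolding below_def by (subst Max_less_iff) auto

lemma below_ge: "w \<in># h \<Longrightarrow> w < v \<Longrightarrow> w \<le> below h v"
  unfolding below_def by (intro Max_ge) auto

lemma below_mem: "0 < below h v \<Longrightarrow> below h v \<in># h \<and> below h v < v"
  using Max_in[of "insert 0 {w \<in> set_mset h. w < v}"] unfolding below_def by auto

text \<open>The upper level set changes only at values of \<open>D\<close>.\<close>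

lemma upper_eq_iff:
  assumes i: "i \<in> E" and v: "0 < D i" and j: "1 \<le> j"
  shows "upper D j = upper D (D i) \<longleftrightarrow> below (hist D) (D i) < j \<and> j \<le> D i"
proof
  assume eq: "upper D j = upper D (D i)"
  have "i \<in> upper D j" unfolding eq using i by (simp add: upper_def)
  then have "j \<le> D i" by (simp add: upper_def)
  moreover have "below (hist D) (D i) < j"
  proof (rule ccontr)
    assume le: "\<not> below (hist D) (D i) < j"
    then have "below (hist D) (D i) \<in># hist D" "below (hist D) (D i) < D i"
      using below_mem[of "hist D" "D i"] j by auto
    then obtain k where k: "k \<in> E" "D k = below (hist D) (D i)" "D k < D i"
      by (auto simp: set_hist)
    then have "k \<in> upper D j" using le by (simp add: upper_def)
    then show False unfolding eq using k by (simp add: upper_def)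
  qed
  ultimately show "below (hist D) (D i) < j \<and> j \<le> D i" by simp
next
  assume b: "below (hist D) (D i) < j \<and> j \<le> D i"
  have "D i \<le> D k" if "k \<in> E" "j \<le> D k" for k
  proof (rule ccontr)
    assume "\<not> D i \<le> D k"
    then have "D k \<le> below (hist D) (D i)" using that by (intro below_ge) (auto simp: set_hist)
    then show False using b that by simp
  qed
  then show "upper D j = upper D (D i)" using b by (auto simp: upper_def)
qed

lemma count_Lev_upper:
  assumes i: "i \<in> E" and v: "0 < D i"
  shows "count (Lev D) (upper D (D i)) = D i - below (hist D) (D i)"
proof -
  have "{j \<in> {1..top (hist D)}. upper D j = upper D (D i)} = {below (hist D) (D i)<..D i}"
  proof -
    have "(j \<in> {1..top (hist D)} \<and> upper D j = upper D (D i)) \<longleftrightarrow> j \<in> {below (hist D) (D i)<..D i}" for j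
    proof (cases "1 \<le> j")
      case True
      show ?thesis
        unfolding upper_eq_iff[where D = D and i = i, OF assms True]
        using True le_top[OF i, of D] by auto
    qed auto
    then show ?thesis by blast
  qed
  then show ?thesis by (simp add: count_Lev)
qed

lemma in_Lev_iff: "F \<in># Lev D \<longleftrightarrow> (\<exists>i\<in>E. 0 < D i \<and> F = upper D (D i))"
proof
  assume "F \<in># Lev D"
  then obtain j where j: "1 \<le> j" "j \<le> top (hist D)" "F = upper D j" by (auto simp: Lev_def)
  then obtain i0 where i0: "i0 \<in> E" "D i0 = top (hist D)" using top_attained[of D] by auto
  have "F \<noteq> {}" "finite F" using i0 j by (auto simp: upper_def)
  then obtain i where i: "i \<in> F" "\<And>k. k \<in> F \<Longrightarrow> D i \<le> D k"
    using finite_ex_least[of F D] by blast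
  then have iE: "i \<in> E" "j \<le> D i" using j by (auto simp: upper_def)
  moreover have "upper D j = upper D (D i)"
    using i(2) iE unfolding j(3) by (auto simp: upper_def)
  ultimately show "\<exists>i\<in>E. 0 < D i \<and> F = upper D (D i)" using j by (intro bexI[of _ i]) auto
next
  assume "\<exists>i\<in>E. 0 < D i \<and> F = upper D (D i)"
  then obtain i where i: "i \<in> E" "0 < D i" "F = upper D (D i)" by blast
  have "count (Lev D) F > 0"
    using count_Lev_upper[where D = D, OF i(1,2)] below_less[OF i(2), of "hist D"] i(3) by simp
  then show "F \<in># Lev D" by simp
qed

lemma count_hist: "count (hist D) v = card {i \<in> E. D i = v}"
proof -
  have "count (hist D) v = size (filter_mset (\<lambda>w. w = v) (hist D))"
    by (simp add: filter_eq_replicate_mset)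
  then show ?thesis by (simp add: hist_def filter_mset_image_mset filter_mset_mset_set comp_def)
qed

lemma card_upper:
  "card (upper D v) = count (hist D) v + card {i \<in> E. v < D i}"
proof -
  have "upper D v = {i \<in> E. D i = v} \<union> {i \<in> E. v < D i}" by (auto simp: upper_def)
  then show ?thesis by (simp add: count_hist card_Un_disjoint disjoint_iff)
qed

lemma fyD:
  assumes "fy N" "F \<in># N"
  shows "count N F \<le> card F" "G \<in># N \<Longrightarrow> G \<subset> F \<Longrightarrow> count N F + card G < card F"
proof -
  have "count N F \<le> min (card F) n" using assms unfolding fy_def by blast
  then show "count N F \<le> card F" by simp
  assume "G \<in># N" "G \<subset> F"
  then have "count N F + card G < min (card F) n" using assms unfolding fy_def by blast
  then show "count N F + card G < card F" by simp
qed

text \<open>The exponent of \<open>upper D v\<close> is the gap below \<open>v\<close>, and its cardinality exceeds that of the next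
  smaller flat by the multiplicity of \<open>v\<close>.\<close>

lemma fy_Lev_iff: "fy (Lev D) \<longleftrightarrow> fy_levels 1 (hist D)"
proof
  assume fy: "fy (Lev D)"
  show "fy_levels 1 (hist D)"
    unfolding fy_levels_def
  proof (intro ballI impI)
    fix v assume "v \<in># hist D" and v: "0 < v"
    then obtain i where i: "i \<in> E" "v = D i" by (auto simp: set_hist)
    have mem: "upper D v \<in># Lev D" using i v by (auto simp: in_Lev_iff)
    have cnt: "count (Lev D) (upper D v) = v - below (hist D) v"
      using count_Lev_upper[of i D] i v by simp
    show "v - below (hist D) v < count (hist D) v + (if v = top (hist D) then 1 else 0)"
    proof (cases "v = top (hist D)")
      case True
      have A: "{i \<in> E. v < D i} = {}"
      proof -
        have "\<not> v < D k" if "k \<in> E" for k using le_top[OF that, of D] unfolding True by simp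
        then show ?thesis by blast
      qed
      have "card (upper D v) = count (hist D) v" unfolding card_upper[of D v] A by simp
      then have "v - below (hist D) v \<le> count (hist D) v"
        using fyD(1)[OF fy mem] unfolding cnt by simp
      then show ?thesis unfolding if_P[OF True] by simp
    next
      case False
      let ?A = "{i \<in> E. v < D i}"
      have "v < top (hist D)"
        using le_neq_implies_less[OF le_top[OF i(1), of D]] False unfolding i(2) by blast
      then have "0 < top (hist D)" by simp
      then obtain i0 where "i0 \<in> E" "D i0 = top (hist D)"
        using top_attained by blast
      then have "i0 \<in> ?A" using \<open>v < top (hist D)\<close> by simp
      then have "?A \<noteq> {}" by blast
      have "finite ?A" by simp
      with \<open>?A \<noteq> {}\<close> obtain k where k: "k \<in> ?A" "\<And>k'. k' \<in> ?A \<Longrightarrow> D k \<le> D k'"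
        using finite_ex_least[of ?A D] \<open>finite ?A\<close> by blast
      have kE: "k \<in> E" "v < D k" using k(1) by simp_all
      have eq: "upper D (D k) = ?A"
      proof (intro equalityI subsetI)
        fix k' assume "k' \<in> upper D (D k)"
        then show "k' \<in> ?A" using kE(2) by (simp add: upper_def)
      next
        fix k' assume "k' \<in> ?A"
        then show "k' \<in> upper D (D k)" using k(2)[of k'] by (simp add: upper_def)
      qed
      have "upper D (D k) \<in># Lev D" unfolding in_Lev_iff using kE by (intro bexI[of _ k]) simp_all
      moreover have "upper D (D k) \<subset> upper D v"
      proof
        show "upper D (D k) \<subseteq> upper D v" unfolding eq by (auto simp: upper_def)
        have "i \<in> upper D v" "i \<notin> ?A" using i by (simp_all add: upper_def)
        then show "upper D (D k) \<noteq> upper D v" unfolding eq by metis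
      qed
      ultimately have "count (Lev D) (upper D v) + card (upper D (D k)) < card (upper D v)"
        by (rule fyD(2)[OF fy mem])
      then have "v - below (hist D) v < count (hist D) v" unfolding cnt eq card_upper by simp
      then show ?thesis by simp
    qed
  qed
next
  assume lev: "fy_levels 1 (hist D)"
  have bound: "v - below (hist D) v < count (hist D) v + (if v = top (hist D) then 1 else 0)"
    if "i \<in> E" "v = D i" "0 < v" for i v
    using lev that unfolding fy_levels_def by (auto simp: set_hist)
  show "fy (Lev D)"
    unfolding fy_def
  proof (intro conjI ballI impI)
    show "set_mset (Lev D) \<subseteq> L" by (auto simp: L_eq Lev_def upper_def)
    fix F assume "F \<in># Lev D"
    then obtain i where i: "i \<in> E" "0 < D i" "F = upper D (D i)" unfolding in_Lev_iff by blast
    have cnt: "count (Lev D) F = D i - below (hist D) (D i)"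
      using count_Lev_upper[where D = D, OF i(1,2)] i(3) by simp
    have "F \<subseteq> E" unfolding i(3) upper_def by blast
    then have le_n: "card F \<le> n" using card_mono[of E F] by simp
    have card_F: "card F = count (hist D) (D i) + card {k \<in> E. D i < D k}"
      unfolding i(3) by (rule card_upper)
    show "count (Lev D) F \<le> min (card F) n"
    proof -
      have "D i - below (hist D) (D i) \<le> count (hist D) (D i)"
        using bound[OF i(1) refl i(2)] by (cases "D i = top (hist D)") simp_all
      also have "\<dots> \<le> card F" unfolding i(3) card_upper by simp
      finally show ?thesis unfolding cnt using le_n by simp
    qed
    fix G assume "G \<in># Lev D"
    then obtain k where k: "k \<in> E" "0 < D k" "G = upper D (D k)" unfolding in_Lev_iff by blast
    show "F \<subseteq> G \<or> G \<subseteq> F"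
    proof (cases "D i \<le> D k")
      case True
      then have "G \<subseteq> F" unfolding i(3) k(3) upper_def by auto
      then show ?thesis ..
    next
      case False
      then have "F \<subseteq> G" unfolding i(3) k(3) upper_def by auto
      then show ?thesis ..
    qed
    assume GF: "G \<subset> F"
    have lt: "D i < D k"
    proof (rule ccontr)
      assume "\<not> D i < D k"
      then have "F \<subseteq> G" unfolding i(3) k(3) upper_def by auto
      then show False using GF by blast
    qed
    then have "D i \<noteq> top (hist D)" using le_top[OF k(1), of D] by simp
    then have "D i - below (hist D) (D i) < count (hist D) (D i)"
      using bound[OF i(1) refl i(2)] by simp
    moreover have "card G \<le> card {k \<in> E. D i < D k}"
      unfolding k(3) using lt by (intro card_mono) (auto simp: upper_def)
    ultimately have "count (Lev D) F + card G < card F"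
      unfolding cnt card_F by simp
    then show "count (Lev D) F + card G < min (card F) n" using le_n by simp
  qed
qed

lemma fy_nonempty: "fy N \<Longrightarrow> F \<in># N \<Longrightarrow> F \<noteq> {}"
proof
  assume "fy N" "F \<in># N" "F = {}"
  then have "count N F \<le> 0" by (auto simp: fy_def)
  then show False using \<open>F \<in># N\<close> by (simp add: count_eq_zero_iff)
qed

lemma Lev_depth_fy: "fy N \<Longrightarrow> top (hist (depth N)) = size N \<and> Lev (depth N) = N"
proof -
  assume N: "fy N"
  have "F \<subseteq> E" if "F \<in># N" for F using N that unfolding fy_def L_eq by blast
  moreover have "F \<subseteq> G \<or> G \<subseteq> F" if "F \<in># N" "G \<in># N" for F G
    using N that unfolding fy_def by blast
  ultimately show ?thesis using fy_nonempty[OF N] by (intro Lev_depth) blast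
qed

lemma Lev_bij: "bij_betw Lev level_funs {N. fy N}"
proof (rule bij_betw_byWitness[where f' = depth])
  show "\<forall>D\<in>level_funs. depth (Lev D) = D" using depth_Lev by (auto simp: level_funs_def)
  show "\<forall>N\<in>{N. fy N}. Lev (depth N) = N" using Lev_depth_fy by blast
  show "Lev ` level_funs \<subseteq> {N. fy N}" using fy_Lev_iff by (auto simp: level_funs_def)
  show "depth ` {N. fy N} \<subseteq> level_funs"
  proof
    fix D assume "D \<in> depth ` {N. fy N}"
    then obtain N where N: "fy N" "D = depth N" by blast
    then have "fy (Lev D)" using Lev_depth_fy by simp
    then have "fy_levels 1 (hist D)" using fy_Lev_iff by blast
    moreover have "D \<in> E \<rightarrow>\<^sub>E UNIV" unfolding N(2) depth_def by simp
    ultimately show "D \<in> level_funs" by (simp add: level_funs_def)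
  qed
qed

lemma graph_mset:
  assumes "finite A" "image_mset fst M = mset_set A"
  shows "\<exists>D. M = image_mset (\<lambda>i. (i, D i)) (mset_set A)"
  using assms
proof (induction A arbitrary: M)
  case (insert a A)
  then have "image_mset fst M = add_mset a (mset_set A)" by simp
  then obtain M1 p where M: "M = add_mset p M1" "fst p = a" "image_mset fst M1 = mset_set A"
    using msed_map_invR by metis
  then obtain D where "M1 = image_mset (\<lambda>i. (i, D i)) (mset_set A)" using insert.IH by blast
  moreover have "image_mset (\<lambda>i. (i, (D(a := snd p)) i)) (mset_set A) = image_mset (\<lambda>i. (i, D i)) (mset_set A)"
    using insert.hyps by (intro image_mset_cong) auto
  ultimately have "M = image_mset (\<lambda>i. (i, (D(a := snd p)) i)) (mset_set (insert a A))"
    using insert.hyps M(1,2) by (simp add: prod_eq_iff)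
  then show ?case by blast
qed simp

lemma card_level_funs: "card level_funs = card (labelled 1 (mset_set E))"
proof (rule bij_betw_same_card)
  let ?f = "\<lambda>D. image_mset (\<lambda>i. (i, D i)) (mset_set E)"
  have simps: "image_mset fst (?f D) = mset_set E" "image_mset snd (?f D) = hist D" for D :: "nat \<Rightarrow> nat"
    by (simp_all add: multiset.map_comp comp_def hist_def)
  show "bij_betw ?f level_funs (labelled 1 (mset_set E))"
    unfolding bij_betw_def
  proof
    show "inj_on ?f level_funs"
    proof (rule inj_onI)
      fix D D' assume D: "D \<in> level_funs" "D' \<in> level_funs" and eq: "?f D = ?f D'"
      have "set_mset (?f D) = set_mset (?f D')" using eq by simp
      then have "(\<lambda>i. (i, D i)) ` E = (\<lambda>i. (i, D' i)) ` E" by simp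
      then have "D i = D' i" if "i \<in> E" for i using that by blast
      then show "D = D'"
        using D by (intro extensionalityI[of _ E]) (auto simp: level_funs_def PiE_def)
    qed
    show "?f ` level_funs = labelled 1 (mset_set E)"
    proof (intro equalityI subsetI)
      fix M assume "M \<in> ?f ` level_funs"
      then show "M \<in> labelled 1 (mset_set E)" using simps by (auto simp: labelled_def level_funs_def)
    next
      fix M assume M: "M \<in> labelled 1 (mset_set E)"
      then obtain D where D: "M = ?f D" using graph_mset[of E M] by (auto simp: labelled_def)
      have "?f (restrict D E) = ?f D" by (intro image_mset_cong) simp
      moreover have "hist (restrict D E) = hist D" unfolding hist_def by (intro image_mset_cong) simp
      moreover have "fy_levels 1 (hist D)" using M unfolding D by (simp add: labelled_def simps)
      ultimately show "M \<in> ?f ` level_funs"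
        unfolding D by (intro image_eqI[of _ _ "restrict D E"]) (auto simp: level_funs_def)
    qed
  qed
qed

lemma card_fy: "card {N. fy N} = card {xs. distinct xs \<and> set xs \<subseteq> E}"
  using bij_betw_same_card[OF Lev_bij] card_level_funs card_labelled_distinct[of E] by simp

text \<open>\<open>Lev\<close> is equivariant, so fixed monomials correspond to fixed level functions.\<close>

lemma fixed_fy:
  assumes \<sigma>: "\<sigma> permutes E"
  shows "bij_betw Lev {D \<in> level_funs. \<forall>i\<in>E. D (\<sigma> i) = D i} {N. fy N \<and> image_mset (image \<sigma>) N = N}"
proof -
  have in_E: "\<sigma> i \<in> E \<longleftrightarrow> i \<in> E" for i by (rule permutes_in_image[OF \<sigma>])
  have "image_mset (image \<sigma>) (Lev D) = Lev D \<longleftrightarrow> (\<forall>i\<in>E. D (\<sigma> i) = D i)" if D: "D \<in> level_funs" for D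
  proof
    assume fixN: "image_mset (image \<sigma>) (Lev D) = Lev D"
    have "D (\<sigma> i) = D i" if i: "i \<in> E" for i
    proof -
      have mem: "\<sigma> i \<in> \<sigma> ` F \<longleftrightarrow> i \<in> F" for F
        using permutes_inj[OF \<sigma>] by (simp add: inj_image_mem_iff)
      have "depth (Lev D) (\<sigma> i) = size (filter_mset (\<lambda>F. \<sigma> i \<in> F) (image_mset (image \<sigma>) (Lev D)))"
        unfolding fixN using i in_E by (simp add: depth_def)
      also have "\<dots> = depth (Lev D) i"
        using i by (simp add: depth_def filter_mset_image_mset comp_def mem)
      finally show ?thesis using depth_Lev[of D] D by (simp add: level_funs_def)
    qed
    then show "\<forall>i\<in>E. D (\<sigma> i) = D i" by blast
  next
    assume inv: "\<forall>i\<in>E. D (\<sigma> i) = D i"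
    have "\<sigma> ` upper D j = upper D j" for j
    proof (rule card_subset_eq)
      show "finite (upper D j)" by (simp add: upper_def)
      show "\<sigma> ` upper D j \<subseteq> upper D j" using inv in_E by (auto simp: upper_def simp del: atLeastAtMost_iff)
      show "card (\<sigma> ` upper D j) = card (upper D j)"
        using permutes_inj_on[OF \<sigma>] by (rule card_image)
    qed
    then show "image_mset (image \<sigma>) (Lev D) = Lev D"
      unfolding Lev_def by (simp add: multiset.map_comp comp_def)
  qed
  then have "bij_betw Lev {D \<in> level_funs. \<forall>i\<in>E. D (\<sigma> i) = D i}
      {N \<in> {N. fy N}. image_mset (image \<sigma>) N = N}"
    by (intro bij_betw_Collect[OF Lev_bij])
  then show ?thesis by (simp only: mem_Collect_eq)
qed

lemma E_in_Lev_iff: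
  "E \<in># Lev D \<longleftrightarrow> 0 \<notin># hist D"
proof
  assume "E \<in># Lev D"
  then obtain i where i: "i \<in> E" "0 < D i" "E = upper D (D i)" by (auto simp: in_Lev_iff)
  have pos: "0 < D k" if "k \<in> E" for k
  proof -
    have "k \<in> upper D (D i)" using i(3) that by (simp only:)
    then show ?thesis using i(2) by (simp add: upper_def)
  qed
  show "0 \<notin># hist D" unfolding set_hist using pos by (metis imageE less_irrefl)
next
  assume 0: "0 \<notin># hist D"
  have pos: "0 < D k" if "k \<in> E" for k
  proof (rule ccontr)
    assume "\<not> 0 < D k"
    then have "D k = 0" by simp
    then show False using 0 that by (force simp: set_hist)
  qed
  have "E \<noteq> {}" using r1 by simp
  then obtain i where i: "i \<in> E" "\<And>k. k \<in> E \<Longrightarrow> D i \<le> D k"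
    using finite_ex_least[of E D, OF finite_atLeastAtMost] by blast
  then have "E = upper D (D i)" by (auto simp: upper_def)
  then show "E \<in># Lev D" using i pos by (auto simp: in_Lev_iff)
qed

end

lemma single_eq_1_inj: "Poly_Mapping.single xs (1::rat) = Poly_Mapping.single ys 1 \<Longrightarrow> xs = ys"
  by (metis keys_single singleton_inject zero_neq_one)

section \<open>Points separating the monomials\<close>

text \<open>A list of distinct elements describes a flag: its tails are the complements of the flats. The
  value at a flat of the flag is the difference of two neighbouring entries of the list, where \<open>p\<close>
  is the entry preceding the list.\<close>

fun flag_value :: "nat set \<Rightarrow> nat \<Rightarrow> nat list \<Rightarrow> nat set \<Rightarrow> rat" where
  "flag_value E p [] F = 0"
| "flag_value E p (a # xs) F = (if F = E - set (a # xs) then of_nat p - of_nat a else flag_value E a xs F)"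

definition point :: "nat set \<Rightarrow> nat list \<Rightarrow> nat chow_var \<Rightarrow> rat" where
  "point E xs v = (case v of X F \<Rightarrow> flag_value E 0 xs F | Y i \<Rightarrow> if i \<in> set xs then 0 else of_nat i)"

lemma flag_value_support:
  "flag_value E p xs F \<noteq> 0 \<Longrightarrow> \<exists>j<length xs. F = E - set (drop j xs)"
proof (induction xs arbitrary: p)
  case (Cons a xs)
  show ?case
  proof (cases "F = E - set (a # xs)")
    case True
    then show ?thesis by (intro exI[of _ 0]) simp
  next
    case False
    then have "flag_value E a xs F \<noteq> 0" using Cons.prems by simp
    then obtain j where "j < length xs" "F = E - set (drop j xs)" using Cons.IH by blast
    then show ?thesis by (intro exI[of _ "Suc j"]) simp
  qed
qed simp

lemma flag_value_fresh:
  assumes "a \<in> E" "a \<notin> F" "a \<notin> set xs"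
  shows "flag_value E p xs F = 0"
proof (rule ccontr)
  assume "flag_value E p xs F \<noteq> 0"
  then obtain j where "F = E - set (drop j xs)" using flag_value_support by blast
  then show False using assms in_set_dropD by fastforce
qed

lemma flag_value_nonzero:
  assumes "distinct xs" "p \<notin> set xs" "set xs \<subseteq> E" "j < length xs"
  shows "flag_value E p xs (E - set (drop j xs)) \<noteq> 0"
  using assms
proof (induction xs arbitrary: p j)
  case (Cons a xs)
  show ?case
  proof (cases j)
    case 0
    then show ?thesis using Cons.prems by simp
  next
    case (Suc k)
    have "a \<in> E - set (drop k xs)" using Cons.prems in_set_dropD[of a k xs] by auto
    then have "E - set (drop k xs) \<noteq> E - set (a # xs)" by auto
    moreover have "flag_value E a xs (E - set (drop k xs)) \<noteq> 0"
      using Cons.prems Suc by (intro Cons.IH) auto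
    ultimately show ?thesis using Suc by simp
  qed
qed simp

text \<open>If \<open>i\<close> occurs in the list, the flats that miss \<open>i\<close> belong to the entries up to \<open>i\<close>, and the
  differences telescope.\<close>

lemma sum_flag_values:
  assumes "finite E" "distinct xs" "set xs \<subseteq> E" "i \<in> E"
  shows "(\<Sum>F | F \<in> Pow E - {E} \<and> i \<notin> F. flag_value E p xs F) =
    (if i \<in> set xs then of_nat p - of_nat i else 0)"
  using assms(2,3)
proof (induction xs arbitrary: p)
  case (Cons a xs)
  let ?F = "E - set (a # xs)" and ?A = "{F. F \<in> Pow E - {E} \<and> i \<notin> F}"
  have fin: "finite ?A" using assms(1) by (intro finite_subset[of ?A "Pow E"]) auto
  have "flag_value E a xs ?F = 0"
    using Cons.prems by (intro flag_value_fresh[of a]) auto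
  then have "flag_value E p (a # xs) F = (if F = ?F then of_nat p - of_nat a else 0) + flag_value E a xs F" for F
    by simp
  then have "(\<Sum>F\<in>?A. flag_value E p (a # xs) F) =
      (\<Sum>F\<in>?A. if F = ?F then of_nat p - of_nat a else 0) + (\<Sum>F\<in>?A. flag_value E a xs F)"
    by (simp only: sum.distrib)
  also have "(\<Sum>F\<in>?A. if F = ?F then of_nat p - of_nat a else (0::rat)) = (if ?F \<in> ?A then of_nat p - of_nat a else 0)"
    by (rule sum.delta[OF fin])
  also have "?F \<in> ?A \<longleftrightarrow> i \<in> set (a # xs)"
    using Cons.prems assms(4) by auto
  also have "(\<Sum>F\<in>?A. flag_value E a xs F) = (if i \<in> set xs then of_nat a - of_nat i else 0)"
    using Cons.prems by (intro Cons.IH) auto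
  finally show ?case using Cons.prems by auto
qed simp

text \<open>Consecutive tails of a list of distinct elements differ by one element.\<close>

lemma eq_from_drop_sets:
  assumes "length xs = length ys" "distinct xs" "distinct ys" "\<And>j. set (drop j xs) = set (drop j ys)"
  shows "xs = ys"
  using assms
proof (induction xs ys rule: list_induct2)
  case (Cons a xs b ys)
  have "set (drop j xs) = set (drop j ys)" for j using Cons.prems(3)[of "Suc j"] by simp
  then have "xs = ys" using Cons.prems by (intro Cons.IH) auto
  moreover have "insert a (set xs) = insert b (set ys)" using Cons.prems(3)[of 0] by simp
  then have "a = b" using Cons.prems \<open>xs = ys\<close> by (metis distinct.simps(2) insert_ident insertI1 insertE)
  ultimately show ?case by simp
qed simp

lemma (in chow) homogeneous_xmono: "homogeneous (size N) (xmono N)"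
proof (induction N)
  case empty
  then show ?case using homogeneous_pconst[of 1] by (simp add: xmono_def)
next
  case (add F N)
  have "homogeneous 1 (x F)"
    unfolding x_def by (auto intro!: homogeneous_uminus homogeneous_sum homogeneous_pvar)
  from homogeneous_mult[OF this add] show ?case by (simp only: xmono_add_mset size_add_mset plus_1_eq_Suc)
qed

context boolean_chow
begin

definition pts :: "nat list set" where
  "pts = {xs. distinct xs \<and> set xs \<subseteq> E}"

abbreviation ev :: "nat list \<Rightarrow> (nat chow_var, rat) mpoly \<Rightarrow> rat" where
  "ev xs \<equiv> eval_poly (point E xs)"

theorem card_fixed_FY:
  assumes "\<sigma> permutes E"
  shows "card {N \<in> FY d. image_mset (image \<sigma>) N = N} = card (fixed_maps n (\<lambda>h. fy_levels 1 h \<and> top h = d) \<sigma>)"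
    and "card {N \<in> FY d. E \<in># N \<and> image_mset (image \<sigma>) N = N} =
      card (fixed_maps n (\<lambda>h. fy_levels 1 h \<and> top h = d \<and> 0 \<notin># h) \<sigma>)"
proof -
  have bij: "bij_betw Lev {D \<in> {D \<in> level_funs. \<forall>i\<in>E. D (\<sigma> i) = D i}. Q (Lev D)}
      {N \<in> {N. fy N \<and> image_mset (image \<sigma>) N = N}. Q N}" for Q
    by (rule bij_betw_Collect[OF fixed_fy[OF assms]]) (rule refl)
  have 1: "{D \<in> {D \<in> level_funs. \<forall>i\<in>E. D (\<sigma> i) = D i}. size (Lev D) = d} =
      fixed_maps n (\<lambda>h. fy_levels 1 h \<and> top h = d) \<sigma>"
    by (auto simp: fixed_maps_def level_funs_def size_Lev hist_def)
  have 2: "{N \<in> {N. fy N \<and> image_mset (image \<sigma>) N = N}. size N = d} = {N \<in> FY d. image_mset (image \<sigma>) N = N}"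
    by (auto simp: FY_def)
  show "card {N \<in> FY d. image_mset (image \<sigma>) N = N} = card (fixed_maps n (\<lambda>h. fy_levels 1 h \<and> top h = d) \<sigma>)"
    using bij_betw_same_card[OF bij[of "\<lambda>N. size N = d"]] unfolding 1 2 by simp
  have 3: "{D \<in> {D \<in> level_funs. \<forall>i\<in>E. D (\<sigma> i) = D i}. size (Lev D) = d \<and> E \<in># Lev D} =
      fixed_maps n (\<lambda>h. fy_levels 1 h \<and> top h = d \<and> 0 \<notin># h) \<sigma>"
    unfolding E_in_Lev_iff by (auto simp: fixed_maps_def level_funs_def size_Lev hist_def)
  have 4: "{N \<in> {N. fy N \<and> image_mset (image \<sigma>) N = N}. size N = d \<and> E \<in># N} =
      {N \<in> FY d. E \<in># N \<and> image_mset (image \<sigma>) N = N}"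
    by (auto simp: FY_def)
  show "card {N \<in> FY d. E \<in># N \<and> image_mset (image \<sigma>) N = N} =
      card (fixed_maps n (\<lambda>h. fy_levels 1 h \<and> top h = d \<and> 0 \<notin># h) \<sigma>)"
    using bij_betw_same_card[OF bij[of "\<lambda>N. size N = d \<and> E \<in># N"]] unfolding 3 4 by simp
qed

lemma finite_pts [simp, intro]: "finite pts"
proof (rule finite_subset)
  show "pts \<subseteq> {xs. set xs \<subseteq> E \<and> length xs \<le> n}"
  proof
    fix xs assume xs: "xs \<in> pts"
    then have "length xs = card (set xs)" by (simp add: pts_def distinct_card)
    also have "\<dots> \<le> card E" using xs by (intro card_mono) (auto simp: pts_def)
    finally show "xs \<in> {xs. set xs \<subseteq> E \<and> length xs \<le> n}" using xs by (simp add: pts_def)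
  qed
qed (rule finite_lists_length_le, simp)

lemma finite_fy [simp, intro]: "finite {N. fy N}"
proof (rule card_ge_0_finite)
  have "[] \<in> pts" by (simp add: pts_def)
  then have "0 < card pts" by (simp add: card_gt_0_iff) blast
  then show "0 < card {N. fy N}" unfolding card_fy pts_def .
qed

text \<open>On functions on the points, the filtration by degree replaces the grading.\<close>

definition low_rel :: "nat \<Rightarrow> (nat chow_var, rat) mpoly \<Rightarrow> bool" where
  "low_rel d p \<longleftrightarrow> (\<exists>q\<in>P. (\<forall>m\<in>Poly_Mapping.keys q. size m < d) \<and> (\<forall>xs\<in>pts. ev xs p = ev xs q))"

lemma low_relI: "q \<in> P \<Longrightarrow> (\<And>m. m \<in> Poly_Mapping.keys q \<Longrightarrow> size m < d) \<Longrightarrow>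
    (\<And>xs. xs \<in> pts \<Longrightarrow> ev xs p = ev xs q) \<Longrightarrow> low_rel d p"
  unfolding low_rel_def by blast

lemma low_rel_0: "low_rel d 0"
  by (rule low_relI[of 0]) simp_all

lemma low_rel_add: "low_rel d p \<Longrightarrow> low_rel d p' \<Longrightarrow> low_rel d (p + p')"
proof -
  assume "low_rel d p" "low_rel d p'"
  then obtain q q' where q: "q \<in> P" "\<forall>m\<in>Poly_Mapping.keys q. size m < d" "\<forall>xs\<in>pts. ev xs p = ev xs q"
    "q' \<in> P" "\<forall>m\<in>Poly_Mapping.keys q'. size m < d" "\<forall>xs\<in>pts. ev xs p' = ev xs q'"
    unfolding low_rel_def by blast
  show ?thesis
  proof (rule low_relI[of "q + q'"])
    show "q + q' \<in> P" using q by (intro polys_add)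
    show "size m < d" if "m \<in> Poly_Mapping.keys (q + q')" for m
      using that keys_add[of q q'] q(2,5) by blast
    show "ev xs (p + p') = ev xs (q + q')" if "xs \<in> pts" for xs
      using that q(3,6) by (simp add: eval_poly_add)
  qed
qed

lemma low_rel_sum: "(\<And>x. x \<in> A \<Longrightarrow> low_rel d (p x)) \<Longrightarrow> low_rel d (Groups_Big.sum p A)"
  by (induction A rule: infinite_finite_induct) (simp_all add: low_rel_0 low_rel_add)

lemma low_rel_single_mult:
  assumes "low_rel d p" "set_mset k \<subseteq> V"
  shows "low_rel (size k + d) (Poly_Mapping.single k c * p)"
proof -
  obtain q where q: "q \<in> P" "\<forall>m\<in>Poly_Mapping.keys q. size m < d" "\<forall>xs\<in>pts. ev xs p = ev xs q"
    using assms(1) unfolding low_rel_def by blast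
  show ?thesis
  proof (rule low_relI[of "Poly_Mapping.single k c * q"])
    show "Poly_Mapping.single k c * q \<in> P" using q(1) assms(2) by (intro polys_mult polys_single)
    fix m assume "m \<in> Poly_Mapping.keys (Poly_Mapping.single k c * q)"
    then obtain a b where m: "m = a + b" "a \<in> Poly_Mapping.keys (Poly_Mapping.single k c)" "b \<in> Poly_Mapping.keys q"
      using keys_mult[of "Poly_Mapping.single k c" q] by blast
    then have "a = k" by (simp split: if_splits)
    moreover have "size b < d" using q(2) m(3) by blast
    ultimately show "size m < size k + d" using m(1) by simp
  next
    fix xs assume "xs \<in> pts"
    then show "ev xs (Poly_Mapping.single k c * p) = ev xs (Poly_Mapping.single k c * q)"
      using q(3) by (simp add: eval_poly_mult)
  qed
qed

text \<open>The points satisfy the quadratic relations of the ring exactly, and the linear ones up to the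
  constant \<open>i\<close>.\<close>

lemma point_gens:
  assumes xs: "xs \<in> pts"
  shows "F \<in> L - {E} \<Longrightarrow> G \<in> L - {E} \<Longrightarrow> \<not> F \<subseteq> G \<Longrightarrow> \<not> G \<subseteq> F \<Longrightarrow> ev xs (pvar (X F) * pvar (X G)) = 0"
    and "i \<in> E \<Longrightarrow> F \<in> L - {E} \<Longrightarrow> i \<notin> F \<Longrightarrow> ev xs (pvar (Y i) * pvar (X F)) = 0"
    and "i \<in> E \<Longrightarrow> ev xs (pvar (Y i) - (\<Sum>F | F \<in> L - {E} \<and> i \<notin> F. pvar (X F))) = of_nat i"
proof -
  have d: "distinct xs" "set xs \<subseteq> E" using xs by (auto simp: pts_def)
  show "ev xs (pvar (X F) * pvar (X G)) = 0" if FG: "\<not> F \<subseteq> G" "\<not> G \<subseteq> F"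
  proof (rule ccontr)
    assume "ev xs (pvar (X F) * pvar (X G)) \<noteq> 0"
    then have "flag_value E 0 xs F \<noteq> 0" "flag_value E 0 xs G \<noteq> 0"
      by (auto simp: eval_poly_mult point_def)
    then obtain j k where "F = E - set (drop j xs)" "G = E - set (drop k xs)"
      using flag_value_support by metis
    moreover have "set (drop j xs) \<subseteq> set (drop k xs) \<or> set (drop k xs) \<subseteq> set (drop j xs)"
      using set_drop_subset_set_drop[of j k xs] set_drop_subset_set_drop[of k j xs] by (meson le_cases)
    ultimately show False using FG by blast
  qed
  show "ev xs (pvar (Y i) * pvar (X F)) = 0" if i: "i \<in> E" "i \<notin> F"
  proof (cases "i \<in> set xs")
    case False
    then have "flag_value E 0 xs F = 0" using i by (intro flag_value_fresh)
    then show ?thesis by (simp add: eval_poly_mult point_def)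
  qed (simp add: eval_poly_mult point_def)
  show "ev xs (pvar (Y i) - (\<Sum>F | F \<in> L - {E} \<and> i \<notin> F. pvar (X F))) = of_nat i" if i: "i \<in> E"
  proof -
    have "(\<Sum>F | F \<in> L - {E} \<and> i \<notin> F. flag_value E 0 xs F) = (if i \<in> set xs then of_nat 0 - of_nat i else 0)"
      unfolding L_eq by (rule sum_flag_values) (use d i in simp_all)
    then show ?thesis by (simp add: eval_poly_diff eval_poly_sum point_def)
  qed
qed

text \<open>The relations hold on the points up to terms of lower degree, and this property passes from
  the generators to the ideal.\<close>

lemma I_low_rel:
  assumes "p \<in> I"
  shows "low_rel d (component d p)"
proof -
  let ?S = "{p. \<forall>d. low_rel d (component d p)}"
  have "I \<subseteq> ?S"
  proof (rule I_least)
    show "0 \<in> ?S" by (simp add: low_rel_0)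
    show "a + b \<in> ?S" if "a \<in> ?S" "b \<in> ?S" for a b
      using that by (simp add: component_add low_rel_add)
    show "p * a \<in> ?S" if p: "p \<in> P" and a: "a \<in> ?S" for p a
    proof (intro CollectI allI)
      fix d
      have "p * a = (\<Sum>k\<in>Poly_Mapping.keys p. Poly_Mapping.single k (Poly_Mapping.lookup p k) * a)"
        unfolding sum_distrib_right[symmetric] poly_mapping_sum_singles[symmetric] ..
      then have "component d (p * a) = (\<Sum>k\<in>Poly_Mapping.keys p.
          if size k \<le> d then Poly_Mapping.single k (Poly_Mapping.lookup p k) * component (d - size k) a else 0)"
        by (simp only: component_sum component_single_mult)
      also have "low_rel d \<dots>"
      proof (rule low_rel_sum)
        fix k assume k: "k \<in> Poly_Mapping.keys p"
        show "low_rel d (if size k \<le> d then Poly_Mapping.single k (Poly_Mapping.lookup p k) * component (d - size k) a else 0)"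
        proof (cases "size k \<le> d")
          case True
          have "low_rel (d - size k) (component (d - size k) a)" using a by simp
          moreover have "set_mset k \<subseteq> V" using p k by (auto simp: polys_def)
          ultimately have "low_rel (size k + (d - size k)) (Poly_Mapping.single k (Poly_Mapping.lookup p k) * component (d - size k) a)"
            by (rule low_rel_single_mult)
          then show ?thesis using True by simp
        qed (simp add: low_rel_0)
      qed
      finally show "low_rel d (component d (p * a))" .
    qed
    show "gens \<subseteq> ?S"
    proof (intro subsetI CollectI allI)
      fix g d assume "g \<in> gens"
      have hom: "low_rel d (component d g)" if "homogeneous e g" "low_rel e g" for e
        using that by (simp add: homogeneous_component low_rel_0)
      have X2: "homogeneous 2 (pvar v * pvar w :: (nat chow_var, rat) mpoly)" for v w
        using homogeneous_mult[OF homogeneous_pvar homogeneous_pvar, of v w] by simp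
      from \<open>g \<in> gens\<close> consider
        F G where "F \<in> L - {E}" "G \<in> L - {E}" "\<not> F \<subseteq> G" "\<not> G \<subseteq> F" "g = pvar (X F) * pvar (X G)"
        | i F where "i \<in> E" "F \<in> L - {E}" "i \<notin> F" "g = pvar (Y i) * pvar (X F)"
        | i where "i \<in> E" "g = pvar (Y i) - (\<Sum>F | F \<in> L - {E} \<and> i \<notin> F. pvar (X F))"
        unfolding gens_def by blast
      then show "low_rel d (component d g)"
      proof cases
        case 1
        show ?thesis
        proof (rule hom)
          show "homogeneous 2 g" unfolding 1(5) by (rule X2)
          show "low_rel 2 g" using point_gens(1)[OF _ 1(1-4)] unfolding 1(5)
            by (intro low_relI[of 0]) simp_all
        qed
      next
        case 2
        show ?thesis
        proof (rule hom)
          show "homogeneous 2 g" unfolding 2(4) by (rule X2)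
          show "low_rel 2 g" using point_gens(2)[OF _ 2(1-3)] unfolding 2(4)
            by (intro low_relI[of 0]) simp_all
        qed
      next
        case 3
        show ?thesis
        proof (rule hom)
          show "homogeneous 1 g" unfolding 3(2)
            by (intro homogeneous_diff homogeneous_sum homogeneous_pvar)
          show "low_rel 1 g"
          proof (rule low_relI[of "pconst (of_nat i)"])
            show "size m < 1" if "m \<in> Poly_Mapping.keys (pconst (of_nat i) :: (nat chow_var, rat) mpoly)" for m
              using that unfolding pconst_def keys_single by (auto simp only: split: if_splits)
            show "ev xs g = ev xs (pconst (of_nat i))" if "xs \<in> pts" for xs
              unfolding 3(2) point_gens(3)[OF that 3(1)] by simp
          qed simp
        qed
      qed
    qed
  qed
  then show ?thesis using assms by blast
qed

definition low_span :: "nat \<Rightarrow> (nat chow_var, rat) mpoly \<Rightarrow> bool" where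
  "low_span d p \<longleftrightarrow> (\<exists>c. (\<forall>N. d \<le> size N \<longrightarrow> c N = 0) \<and>
     (\<forall>xs\<in>pts. ev xs p = (\<Sum>N | fy N. c N * ev xs (xmono N))))"

lemma low_span_add:
  assumes "low_span d p" "low_span d q"
  shows "low_span d (p + q)"
proof -
  from assms obtain c c' where "\<forall>N. d \<le> size N \<longrightarrow> c N = 0" "\<forall>N. d \<le> size N \<longrightarrow> c' N = 0"
    "\<forall>xs\<in>pts. ev xs p = (\<Sum>N | fy N. c N * ev xs (xmono N))"
    "\<forall>xs\<in>pts. ev xs q = (\<Sum>N | fy N. c' N * ev xs (xmono N))"
    unfolding low_span_def by blast
  then show ?thesis
    unfolding low_span_def
    by (intro exI[of _ "\<lambda>N. c N + c' N"]) (simp add: eval_poly_add distrib_right sum.distrib)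
qed

lemma low_span_mono: "low_span d p \<Longrightarrow> d \<le> e \<Longrightarrow> low_span e p"
  unfolding low_span_def by (meson order_trans)

lemma low_span_FY: "low_span (Suc d) (\<Sum>N\<in>FY d. pconst (c N) * xmono N)"
  unfolding low_span_def
proof (intro exI[of _ "\<lambda>N. if size N = d then c N else 0"] conjI allI ballI)
  fix xs
  have "(\<Sum>N | fy N. (if size N = d then c N else 0) * ev xs (xmono N)) =
      (\<Sum>N\<in>{N \<in> {N. fy N}. size N = d}. c N * ev xs (xmono N))"
    unfolding sum.inter_filter[OF finite_fy] by (intro sum.cong) auto
  also have "{N \<in> {N. fy N}. size N = d} = FY d" by (simp add: FY_def)
  finally show "ev xs (\<Sum>N\<in>FY d. pconst (c N) * xmono N) =
      (\<Sum>N | fy N. (if size N = d then c N else 0) * ev xs (xmono N))"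
    by (simp add: eval_poly_sum eval_poly_mult)
qed simp

lemma low_span_cong: "(\<And>xs. xs \<in> pts \<Longrightarrow> ev xs p = ev xs q) \<Longrightarrow> low_span d q \<Longrightarrow> low_span d p"
  unfolding low_span_def by auto

text \<open>Straightening modulo lower degree, by induction on the degree: the leading form of a polynomial
  is congruent to a combination of Feichtner--Yuzvinsky monomials, and the error agrees on the
  points with a polynomial of lower degree.\<close>

lemma polys_low_span:
  assumes "q \<in> P" "\<And>m. m \<in> Poly_Mapping.keys q \<Longrightarrow> size m < d"
  shows "low_span d q"
  using assms
proof (induction d arbitrary: q)
  case 0
  then have "Poly_Mapping.keys q = {}" by blast
  then have "q = 0" using poly_mapping_sum_singles[of q] by simp
  then show ?case unfolding low_span_def by (intro exI[of _ "\<lambda>_. 0"]) simp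
next
  case (Suc d)
  define h where "h = component d q"
  have hP: "h \<in> P" unfolding h_def using Suc.prems(1) by (rule polys_component)
  have hom: "homogeneous d h" unfolding h_def by (rule homogeneous_component_self)
  have lookup_h: "Poly_Mapping.lookup h m = (if size m = d then Poly_Mapping.lookup q m else 0)" for m
  proof -
    have "Poly_Mapping.lookup h m = (\<Sum>k\<in>Poly_Mapping.keys q. if m = k then (if size k = d then Poly_Mapping.lookup q k else 0) else 0)"
      unfolding h_def component_def lin_ext_def lookup_sum
      by (intro sum.cong) (auto simp: lookup_single when_def)
    then show ?thesis by (auto simp: in_keys_iff)
  qed
  have rest: "low_span d (q - h)"
  proof (rule Suc.IH)
    show "q - h \<in> P" using Suc.prems(1) hP by (rule polys_diff)
    fix m assume m: "m \<in> Poly_Mapping.keys (q - h)"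
    then have "size m \<noteq> d" "m \<in> Poly_Mapping.keys q"
      by (auto simp: in_keys_iff lookup_minus lookup_h split: if_splits)
    then show "size m < d" using Suc.prems(2)[of m] by simp
  qed
  obtain c where c: "h - (\<Sum>N\<in>FY d. pconst (c N) * xmono N) \<in> I"
    using homogeneous_spanned[OF hP hom] unfolding spanned_def by blast
  let ?r = "h - (\<Sum>N\<in>FY d. pconst (c N) * xmono N)"
  have "homogeneous d (pconst (c N) * xmono N)" if "N \<in> FY d" for N
    using homogeneous_mult[OF homogeneous_pconst[of "c N"] homogeneous_xmono[of N]] that by (simp add: FY_def)
  then have "homogeneous d ?r" using hom by (intro homogeneous_diff homogeneous_sum)
  then have "low_rel d ?r" using I_low_rel[OF c, of d] by (simp add: homogeneous_component)
  then obtain q' where q': "q' \<in> P" "\<forall>m\<in>Poly_Mapping.keys q'. size m < d" "\<forall>xs\<in>pts. ev xs ?r = ev xs q'"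
    unfolding low_rel_def by blast
  have "low_span d ?r"
    by (rule low_span_cong[of _ q']) (use q' Suc.IH in auto)
  then have "low_span (Suc d) (?r + (\<Sum>N\<in>FY d. pconst (c N) * xmono N))"
    by (intro low_span_add low_span_FY) (auto intro: low_span_mono)
  moreover have "low_span (Suc d) (q - h)" using rest by (rule low_span_mono) simp
  ultimately have "low_span (Suc d) ((q - h) + (?r + (\<Sum>N\<in>FY d. pconst (c N) * xmono N)))"
    by (rule low_span_add[rotated])
  then show ?case by simp
qed

text \<open>A monomial that vanishes at all points but one: its flats force the whole flag of \<open>xs\<close> to
  occur, and its variables \<open>Y i\<close> exclude all further elements from the list.\<close>

definition indicator_mono :: "nat list \<Rightarrow> nat chow_var multiset" where
  "indicator_mono xs = image_mset (\<lambda>j. X (E - set (drop j xs))) (mset_set {..<length xs}) +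
     image_mset Y (mset_set (E - set xs))"

lemma ev_indicator_mono:
  assumes xs: "xs \<in> pts" and ys: "ys \<in> pts"
  shows "ev ys (Poly_Mapping.single (indicator_mono xs) 1) \<noteq> 0 \<longleftrightarrow> ys = xs"
proof -
  have dx: "distinct xs" "set xs \<subseteq> E" and dy: "distinct ys" "set ys \<subseteq> E"
    using xs ys by (auto simp: pts_def)
  have "ev ys (Poly_Mapping.single (indicator_mono xs) 1) =
      (\<Prod>j<length xs. flag_value E 0 ys (E - set (drop j xs))) * (\<Prod>i\<in>E - set xs. if i \<in> set ys then 0 else of_nat i)"
    by (simp add: eval_poly_single indicator_mono_def multiset.map_comp comp_def point_def prod_unfold_prod_mset)
  then have iff: "ev ys (Poly_Mapping.single (indicator_mono xs) 1) \<noteq> 0 \<longleftrightarrow>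
      (\<forall>j<length xs. flag_value E 0 ys (E - set (drop j xs)) \<noteq> 0) \<and> (\<forall>i\<in>E - set xs. i \<notin> set ys)"
    by (auto split: if_splits)
  show ?thesis
    unfolding iff
  proof
    assume "ys = xs"
    moreover have "0 \<notin> set xs" using dx by auto
    ultimately show "(\<forall>j<length xs. flag_value E 0 ys (E - set (drop j xs)) \<noteq> 0) \<and> (\<forall>i\<in>E - set xs. i \<notin> set ys)"
      using flag_value_nonzero[OF dx(1) _ dx(2)] by blast
  next
    assume A: "(\<forall>j<length xs. flag_value E 0 ys (E - set (drop j xs)) \<noteq> 0) \<and> (\<forall>i\<in>E - set xs. i \<notin> set ys)"
    have sub: "set ys \<subseteq> set xs" using A dy by blast
    have ex: "\<exists>k. set (drop j xs) = set (drop k ys)" if "j < length xs" for j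
    proof -
      have "flag_value E 0 ys (E - set (drop j xs)) \<noteq> 0" using A that by blast
      then obtain k where k: "E - set (drop j xs) = E - set (drop k ys)" using flag_value_support by metis
      have "set (drop j xs) \<subseteq> E" "set (drop k ys) \<subseteq> E" using dx dy set_drop_subset by fast+
      then have "set (drop j xs) = set (drop k ys)" using k by blast
      then show ?thesis by blast
    qed
    have card_drop: "card (set (drop k zs)) = length zs - k" if "distinct zs" for k and zs :: "nat list"
      using distinct_card[of "drop k zs"] that by simp
    have "set xs \<subseteq> set ys"
    proof (cases "xs = []")
      case False
      then obtain k where "set (drop 0 xs) = set (drop k ys)" using ex[of 0] by auto
      then show ?thesis using set_drop_subset[of k ys] by simp
    qed simp
    then have len: "length xs = length ys" using sub dx dy by (metis distinct_card subset_antisym)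
    have "set (drop j xs) = set (drop j ys)" for j
    proof (cases "j < length xs")
      case True
      then obtain k where k: "set (drop j xs) = set (drop k ys)" using ex by blast
      then have "length xs - j = length ys - k" using card_drop[OF dx(1)] card_drop[OF dy(1)] by metis
      then have "k = j" using True len by simp
      then show ?thesis using k by simp
    qed (use len in simp)
    then show "ys = xs" using eq_from_drop_sets[OF len dx(1) dy(1)] by simp
  qed
qed

end

interpretation pm: vector_space "\<lambda>c. Poly_Mapping.map ((*) (c :: rat)) :: ('a \<Rightarrow>\<^sub>0 rat) \<Rightarrow> ('a \<Rightarrow>\<^sub>0 rat)"
  by unfold_locales (rule poly_mapping_eqI, simp add: lookup_map_times lookup_add algebra_simps)+

context boolean_chow
begin

definition ev_vec :: "(nat chow_var, rat) mpoly \<Rightarrow> nat list \<Rightarrow>\<^sub>0 rat" where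
  "ev_vec p = (\<Sum>xs\<in>pts. Poly_Mapping.single xs (ev xs p))"

lemma lookup_ev_vec: "Poly_Mapping.lookup (ev_vec p) ys = (if ys \<in> pts then ev ys p else 0)"
proof -
  have "Poly_Mapping.lookup (ev_vec p) ys = (\<Sum>xs\<in>pts. if ys = xs then ev xs p else 0)"
    unfolding ev_vec_def lookup_sum by (intro sum.cong) (auto simp: lookup_single when_def)
  then show ?thesis by simp
qed

text \<open>A multiple of the indicator of a point is the evaluation of a polynomial, hence of a combination
  of Feichtner--Yuzvinsky monomials.\<close>

lemma unit_in_span:
  assumes xs: "xs \<in> pts"
  shows "Poly_Mapping.single xs 1 \<in> pm.span ((\<lambda>N. ev_vec (xmono N)) ` {N. fy N})"
proof -
  let ?e = "Poly_Mapping.single (indicator_mono xs) 1 :: (nat chow_var, rat) mpoly"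
  let ?T = "(\<lambda>N. ev_vec (xmono N)) ` {N. fy N}"
  have V: "set_mset (indicator_mono xs) \<subseteq> V"
  proof -
    have "E - set (drop j xs) \<in> L - {E}" if "j < length xs" for j
    proof -
      have "set (drop j xs) \<noteq> {}" "set (drop j xs) \<subseteq> E"
        using that xs set_drop_subset[of j xs] by (auto simp: pts_def)
      then have "\<exists>i. i \<in> set (drop j xs)" unfolding ex_in_conv by blast
      then obtain i where i: "i \<in> set (drop j xs)" ..
      then have "i \<in> E" using \<open>set (drop j xs) \<subseteq> E\<close> by (rule subsetD[rotated])
      then have "E - set (drop j xs) \<noteq> E" using i by blast
      then show ?thesis unfolding L_eq by blast
    qed
    then show ?thesis unfolding indicator_mono_def by (auto intro!: X_in_V Y_in_V simp del: atLeastAtMost_iff)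
  qed
  have "low_span (Suc (size (indicator_mono xs))) ?e"
    using V by (intro polys_low_span polys_single) (auto split: if_splits)
  then obtain c where c: "\<And>ys. ys \<in> pts \<Longrightarrow> ev ys ?e = (\<Sum>N | fy N. c N * ev ys (xmono N))"
    unfolding low_span_def by blast
  have "ev_vec ?e = (\<Sum>N | fy N. Poly_Mapping.map ((*) (c N)) (ev_vec (xmono N)))"
    by (rule poly_mapping_eqI) (simp add: lookup_ev_vec lookup_sum lookup_map_times c)
  also have "\<dots> \<in> pm.span ?T"
    by (intro pm.span_sum pm.span_scale pm.span_base) blast
  finally have "Poly_Mapping.map ((*) (inverse (ev xs ?e))) (ev_vec ?e) \<in> pm.span ?T"
    by (rule pm.span_scale)
  moreover have "Poly_Mapping.map ((*) (inverse (ev xs ?e))) (ev_vec ?e) = Poly_Mapping.single xs 1"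
    using ev_indicator_mono[OF xs] xs
    by (intro poly_mapping_eqI) (auto simp: lookup_map_times lookup_ev_vec lookup_single when_def)
  ultimately show ?thesis by simp
qed

lemma units_independent: "pm.independent ((\<lambda>xs. Poly_Mapping.single xs 1) ` pts)"
proof (rule notI)
  assume dep: "pm.dependent ((\<lambda>xs. Poly_Mapping.single xs 1) ` pts)"
  then have "\<exists>t u. finite t \<and> t \<subseteq> (\<lambda>xs. Poly_Mapping.single xs (1::rat)) ` pts \<and>
      (\<Sum>v\<in>t. Poly_Mapping.map ((*) (u v)) v) = 0 \<and> (\<exists>v\<in>t. u v \<noteq> 0)"
    by (simp only: pm.dependent_explicit)
  then obtain t u where t: "finite t" "t \<subseteq> (\<lambda>xs. Poly_Mapping.single xs (1::rat)) ` pts"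
    "(\<Sum>v\<in>t. Poly_Mapping.map ((*) (u v)) v) = 0" "\<exists>v\<in>t. u v \<noteq> 0"
    by (elim exE conjE) (rule that)
  from t(4) obtain v where v1: "v \<in> t" "u v \<noteq> 0" by (rule bexE)
  from subsetD[OF t(2) v1(1)] obtain xs where "v = Poly_Mapping.single xs 1" by (rule imageE)
  note v = v1 this
  have "0 = Poly_Mapping.lookup (\<Sum>w\<in>t. Poly_Mapping.map ((*) (u w)) w) xs" unfolding t(3) by (rule lookup_zero[symmetric])
  also have "\<dots> = (\<Sum>w\<in>t. u w * Poly_Mapping.lookup w xs)"
    by (simp only: lookup_sum lookup_map_times)
  also have "\<dots> = (\<Sum>w\<in>t. if w = v then u w else 0)"
  proof (intro sum.cong refl)
    fix w assume "w \<in> t"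
    from subsetD[OF t(2) this] obtain ys where w: "w = Poly_Mapping.single ys 1" by (rule imageE)
    show "u w * Poly_Mapping.lookup w xs = (if w = v then u w else 0)"
    proof (cases "ys = xs")
      case True
      then show ?thesis unfolding v(3) w by (simp add: lookup_single)
    next
      case False
      have "w \<noteq> v"
      proof
        assume "w = v"
        then have "ys = xs" unfolding v(3) w by (rule single_eq_1_inj)
        then show False using False by contradiction
      qed
      then show ?thesis using False by (simp only: w lookup_single when_def if_False mult_zero_right)
    qed
  qed
  also have "\<dots> = u v" unfolding sum.delta[OF t(1)] using v(1) by (simp only: if_True)
  finally show False using v(2) by (simp only: not_True_eq_False)
qed

text \<open>The evaluations span a space whose dimension is the number of points, and by \<open>card_fy\<close> this is
  the number of monomials; so none of them is a combination of the others.\<close>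

lemma fy_evaluations_independent:
  assumes "\<And>xs. xs \<in> pts \<Longrightarrow> (\<Sum>N | fy N. b N * ev xs (xmono N)) = 0" and "fy N0"
  shows "b N0 = 0"
proof (rule ccontr)
  assume b: "b N0 \<noteq> 0"
  let ?f = "\<lambda>N. ev_vec (xmono N)" and ?A = "{N. fy N} - {N0}"
  let ?T = "?f ` ?A"
  have "?f N0 = (\<Sum>N\<in>?A. Poly_Mapping.map ((*) (- b N / b N0)) (?f N))"
  proof (rule poly_mapping_eqI)
    fix ys
    show "Poly_Mapping.lookup (?f N0) ys = Poly_Mapping.lookup (\<Sum>N\<in>?A. Poly_Mapping.map ((*) (- b N / b N0)) (?f N)) ys"
    proof (cases "ys \<in> pts")
      case True
      have "(\<Sum>N | fy N. b N * ev ys (xmono N)) = b N0 * ev ys (xmono N0) + (\<Sum>N\<in>?A. b N * ev ys (xmono N))"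
        using assms(2) by (intro sum.remove) auto
      then have "b N0 * ev ys (xmono N0) = - (\<Sum>N\<in>?A. b N * ev ys (xmono N))"
        using assms(1)[OF True] by (simp add: eq_neg_iff_add_eq_0)
      then have "ev ys (xmono N0) = - (\<Sum>N\<in>?A. b N * ev ys (xmono N)) / b N0"
        using b by (metis nonzero_mult_div_cancel_left)
      then show ?thesis
        using True by (simp add: lookup_ev_vec lookup_sum lookup_map_times sum_negf sum_divide_distrib)
    qed (simp add: lookup_ev_vec lookup_sum lookup_map_times)
  qed
  also have "\<dots> \<in> pm.span ?T" by (intro pm.span_sum pm.span_scale pm.span_base) blast
  finally have N0: "?f N0 \<in> pm.span ?T" .
  have "?f M \<in> pm.span ?T" if "fy M" for M
  proof (cases "M = N0")
    case False
    then have "?f M \<in> ?T" using that by (intro imageI DiffI CollectI) (simp_all only: singleton_iff not_False_eq_True)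
    then show ?thesis by (rule pm.span_base)
  qed (simp only: N0)
  then have "?f ` {N. fy N} \<subseteq> pm.span ?T" by (intro image_subsetI) (simp only: mem_Collect_eq)
  from pm.span_minimal[OF this pm.subspace_span] have sub: "pm.span (?f ` {N. fy N}) \<subseteq> pm.span ?T" .
  have S: "(\<lambda>xs. Poly_Mapping.single xs (1::rat)) ` pts \<subseteq> pm.span ?T"
    by (intro image_subsetI subsetD[OF sub] unit_in_span)
  have "finite ?T" by (rule finite_imageI[OF finite_Diff[OF finite_fy]])
  from pm.independent_span_bound[OF this units_independent S]
  have "card ((\<lambda>xs. Poly_Mapping.single xs (1::rat)) ` pts) \<le> card ?T" by (rule conjunct2)
  also have "\<dots> \<le> card ?A" by (rule card_image_le[OF finite_Diff[OF finite_fy]])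
  also have "card ?A < card {N. fy N}" by (rule card_Diff1_less[OF finite_fy]) (use assms(2) in blast)
  also have "card {N. fy N} = card pts" unfolding card_fy pts_def ..
  also have "card pts = card ((\<lambda>xs. Poly_Mapping.single xs (1::rat)) ` pts)"
    by (rule card_image[symmetric], rule inj_onI) (erule single_eq_1_inj)
  finally show False by simp
qed

text \<open>A homogeneous relation of degree \<open>d\<close> gives a relation on the points in which the
  monomials of degree \<open>d\<close> keep their coefficients, since the correction terms have lower degree.\<close>

theorem FY_independent:
  assumes "(\<Sum>N\<in>FY d. pconst (c N) * xmono N) \<in> I" "N0 \<in> FY d"
  shows "c N0 = 0"
proof -
  let ?p = "\<Sum>N\<in>FY d. pconst (c N) * xmono N"
  have "homogeneous d (pconst (c N) * xmono N)" if "N \<in> FY d" for N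
    using homogeneous_mult[OF homogeneous_pconst[of "c N"] homogeneous_xmono[of N]] that by (simp add: FY_def)
  then have "homogeneous d ?p" by (rule homogeneous_sum)
  then have "low_rel d ?p" using I_low_rel[OF assms(1), of d] by (simp add: homogeneous_component)
  then obtain q where q: "q \<in> P" "\<forall>m\<in>Poly_Mapping.keys q. size m < d" "\<forall>xs\<in>pts. ev xs ?p = ev xs q"
    unfolding low_rel_def by blast
  then have "low_span d q" by (intro polys_low_span) auto
  then obtain c' where c': "\<forall>N. d \<le> size N \<longrightarrow> c' N = 0" "\<And>xs. xs \<in> pts \<Longrightarrow> ev xs q = (\<Sum>N | fy N. c' N * ev xs (xmono N))"
    unfolding low_span_def by blast
  define b where "b N = (if size N = d then c N else 0) - c' N" for N
  have rel: "(\<Sum>N | fy N. b N * ev xs (xmono N)) = 0" if "xs \<in> pts" for xs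
  proof -
    have "(\<Sum>N | fy N. (if size N = d then c N else 0) * ev xs (xmono N)) =
        (\<Sum>N\<in>{N \<in> {N. fy N}. size N = d}. c N * ev xs (xmono N))"
      unfolding sum.inter_filter[OF finite_fy] by (intro sum.cong) auto
    also have "{N \<in> {N. fy N}. size N = d} = FY d" by (simp add: FY_def)
    also have "(\<Sum>N\<in>FY d. c N * ev xs (xmono N)) = ev xs ?p"
      by (simp add: eval_poly_sum eval_poly_mult)
    also have "\<dots> = (\<Sum>N | fy N. c' N * ev xs (xmono N))" using q(3) c'(2) that by simp
    finally show ?thesis by (simp add: b_def left_diff_distrib sum_subtractf)
  qed
  have N0: "fy N0" "size N0 = d" using assms(2) by (simp_all add: FY_def)
  have "b N0 = 0" using rel N0(1) by (rule fy_evaluations_independent)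
  moreover have "c' N0 = 0" using c'(1) N0(2) by (metis order_refl)
  ultimately show ?thesis using N0(2) by (simp add: b_def)
qed

end

section \<open>From the Boolean matroid to its truncation\<close>

locale truncated_chow =
  fixes n :: nat
  assumes n2: "2 \<le> n"

sublocale truncated_chow \<subseteq> C: chow n "n - 1"
  using n2 by unfold_locales simp_all

sublocale truncated_chow \<subseteq> B: boolean_chow n
  using n2 by unfold_locales simp_all

context truncated_chow
begin

lemma C_L_subset: "C.L \<subseteq> B.L"
  by (auto simp: C.L_iff B.L_eq simp del: atLeastAtMost_iff)

lemma C_V_subset: "C.V \<subseteq> B.V"
  using C_L_subset by (auto simp: chow_vars_def simp del: atLeastAtMost_iff)

lemma C_P_subset: "C.P \<subseteq> B.P"
  using C_V_subset by (auto simp: polys_def)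

text \<open>The flats of the Boolean matroid that are lost in the truncation are the sets with one element
  less than the ground set, and their variables are killed by \<open>x\<close> of the ground set.\<close>

lemma coatom_top:
  assumes "G \<in> B.L" "G \<notin> C.L"
  shows "B.x C.E * pvar (X G) \<in> B.I"
proof -
  have G: "G \<subseteq> C.E" "G \<noteq> C.E" using assms by (auto simp: B.L_eq C.L_iff simp del: atLeastAtMost_iff)
  then have "card G < n" using psubset_card_mono[of C.E G] by auto
  moreover have "\<not> card G < n - 1" using assms G by (auto simp: C.L_iff simp del: atLeastAtMost_iff)
  ultimately have c: "card G = n - 1" by simp
  have "{K \<in> B.L. C.E \<subseteq> K} = {C.E}" by (auto simp: B.L_eq simp del: atLeastAtMost_iff)
  then have "B.above C.E = B.x C.E" by (simp add: B.above_def)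
  moreover have "B.x G * B.above C.E ^ 1 \<in> B.I"
    using assms(1) G c by (intro B.x_above_power) auto
  moreover have "B.x G = pvar (X G)" using G by (simp add: B.x_def)
  ultimately show ?thesis by (simp add: mult.commute)
qed

text \<open>Multiplication by \<open>x\<close> of the ground set maps the relations of the truncation to relations of
  the Boolean matroid: the generators differ by variables of lost flats.\<close>

lemma top_times_I:
  assumes "p \<in> C.I"
  shows "B.x C.E * p \<in> B.I"
proof -
  have "C.I \<subseteq> {p. B.x C.E * p \<in> B.I}"
  proof (rule C.I_least)
    show "a + b \<in> {p. B.x C.E * p \<in> B.I}" if "a \<in> {p. B.x C.E * p \<in> B.I}" "b \<in> {p. B.x C.E * p \<in> B.I}" for a b
      using that by (simp add: distrib_left B.add)
    show "p * a \<in> {p. B.x C.E * p \<in> B.I}" if "p \<in> C.P" "a \<in> {p. B.x C.E * p \<in> B.I}" for p a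
      using that C_P_subset B.mult[of "B.x C.E * a" p] by (auto simp: mult.left_commute)
    show "C.gens \<subseteq> {p. B.x C.E * p \<in> B.I}"
    proof (intro subsetI CollectI)
      fix g assume "g \<in> C.gens"
      then consider "g \<in> B.gens"
        | i where "i \<in> C.E" "g = pvar (Y i) - (\<Sum>F | F \<in> C.L - {C.E} \<and> i \<notin> F. pvar (X F))"
        unfolding C.gens_def B.gens_def using C_L_subset by blast
      then show "B.x C.E * g \<in> B.I"
      proof cases
        case 1
        then show ?thesis using B.gens_I B.E_in_L by (intro B.mult B.x_P) blast+
      next
        case 2
        let ?T = "{F \<in> B.L - C.L. i \<notin> F}"
        have "{F. F \<in> B.L - {C.E} \<and> i \<notin> F} = {F. F \<in> C.L - {C.E} \<and> i \<notin> F} \<union> ?T"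
          using C_L_subset C.E_in_L by blast
        then have "(\<Sum>F | F \<in> B.L - {C.E} \<and> i \<notin> F. pvar (X F) :: (nat chow_var, rat) mpoly) =
            (\<Sum>F | F \<in> C.L - {C.E} \<and> i \<notin> F. pvar (X F)) + (\<Sum>F\<in>?T. pvar (X F))"
          by (simp only:) (intro sum.union_disjoint, auto simp del: atLeastAtMost_iff)
        then have g: "g = (pvar (Y i) - (\<Sum>F | F \<in> B.L - {C.E} \<and> i \<notin> F. pvar (X F))) + (\<Sum>F\<in>?T. pvar (X F))"
          unfolding 2(2) by (simp add: algebra_simps)
        have "pvar (Y i) - (\<Sum>F | F \<in> B.L - {C.E} \<and> i \<notin> F. pvar (X F)) \<in> B.gens"
          unfolding B.gens_def using 2(1) by blast
        then have "B.x C.E * (pvar (Y i) - (\<Sum>F | F \<in> B.L - {C.E} \<and> i \<notin> F. pvar (X F))) \<in> B.I"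
          using B.gens_I B.E_in_L by (intro B.mult B.x_P) blast+
        moreover have "(\<Sum>F\<in>?T. B.x C.E * pvar (X F)) \<in> B.I"
          by (intro B.sum coatom_top) auto
        ultimately show ?thesis unfolding g distrib_left sum_distrib_left by (rule B.add)
      qed
    qed
  qed simp
  then show ?thesis using assms by blast
qed

lemma top_times_x:
  assumes "F \<in> C.L"
  shows "B.x C.E * (C.x F - B.x F) \<in> B.I"
proof (cases "F = C.E")
  case True
  have "B.L - {C.E} = (C.L - {C.E}) \<union> (B.L - C.L)" using C_L_subset C.E_in_L by blast
  then have "(\<Sum>G\<in>B.L - {C.E}. pvar (X G) :: (nat chow_var, rat) mpoly) =
      (\<Sum>G\<in>C.L - {C.E}. pvar (X G)) + (\<Sum>G\<in>B.L - C.L. pvar (X G))"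
    by (simp only:) (intro sum.union_disjoint, auto simp del: atLeastAtMost_iff)
  then have "C.x F - B.x F = (\<Sum>G\<in>B.L - C.L. pvar (X G))"
    unfolding True C.x_def B.x_def by (simp add: algebra_simps)
  then have "B.x C.E * (C.x F - B.x F) = (\<Sum>G\<in>B.L - C.L. B.x C.E * pvar (X G))"
    by (simp add: sum_distrib_left)
  also have "\<dots> \<in> B.I" by (intro B.sum coatom_top) auto
  finally show ?thesis .
qed (simp add: C.x_def B.x_def)

lemma top_times_xmono:
  "set_mset N \<subseteq> C.L \<Longrightarrow> B.x C.E * C.xmono N - B.xmono (add_mset C.E N) \<in> B.I"
proof (induction N)
  case (add F N)
  then have F: "F \<in> C.L" and N: "set_mset N \<subseteq> C.L" by simp_all
  have "B.x C.E * C.xmono (add_mset F N) - B.xmono (add_mset C.E (add_mset F N)) =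
      C.xmono N * (B.x C.E * (C.x F - B.x F)) + B.x F * (B.x C.E * C.xmono N - B.xmono (add_mset C.E N))"
    by (simp add: C.xmono_add_mset B.xmono_add_mset algebra_simps)
  also have "\<dots> \<in> B.I"
    by (rule B.add[OF B.mult[OF top_times_x[OF F] subsetD[OF C_P_subset C.xmono_P[OF N]]]
          B.mult[OF add.IH[OF N] B.x_P[OF subsetD[OF C_L_subset F]]]])
  finally show ?case .
qed (simp add: C.xmono_def B.xmono_def)

text \<open>The factor for the ground set turns the Boolean condition at the top of the chain into the
  condition for rank \<open>n - 1\<close>.\<close>

lemma fy_add_top: "C.fy N \<longleftrightarrow> B.fy (add_mset C.E N)"
proof
  assume fy: "C.fy N"
  then have sub: "set_mset N \<subseteq> C.L" by (simp only: C.fy_def)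
  have cnt: "count N F \<le> min (card F) (n - 1)" if "F \<in># N" for F
    using fy that unfolding C.fy_def by blast
  have cmp: "F \<subseteq> G \<or> G \<subseteq> F" if "F \<in># N" "G \<in># N" for F G
    using fy that unfolding C.fy_def by blast
  have gap: "count N F + card G < min (card F) (n - 1)" if "F \<in># N" "G \<in># N" "G \<subset> F" for F G
    using fy that unfolding C.fy_def by blast
  have subE: "F \<subseteq> C.E" if "F \<in># add_mset C.E N" for F
    using that sub C_L_subset B.L_eq by auto
  have cardE: "card C.E = n" by simp
  show "B.fy (add_mset C.E N)"
    unfolding B.fy_def
  proof (intro conjI ballI impI)
    show "set_mset (add_mset C.E N) \<subseteq> B.L" using sub C_L_subset C.E_in_L by auto
    fix F assume F: "F \<in># add_mset C.E N"
    show "count (add_mset C.E N) F \<le> min (card F) n"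
    proof (cases "F = C.E")
      case True
      have "count N C.E \<le> n - 1" using cnt[of C.E] by (cases "C.E \<in># N") (simp_all add: not_in_iff)
      then show ?thesis using True n2 cardE by simp
    next
      case False
      then have "count N F \<le> card F" "count N F \<le> n - 1" using F cnt[of F] by simp_all
      moreover from this(2) have "count N F \<le> n" by arith
      ultimately show ?thesis using False by simp
    qed
    fix G assume G: "G \<in># add_mset C.E N"
    show "F \<subseteq> G \<or> G \<subseteq> F"
    proof (cases "F = C.E \<or> G = C.E")
      case True
      then show ?thesis using subE[OF F] subE[OF G] by (elim disjE) simp_all
    next
      case False
      then show ?thesis using F G by (intro cmp) simp_all
    qed
    assume GF: "G \<subset> F"
    then have "G \<noteq> C.E" using subE[OF F] by blast
    then have GN: "G \<in># N" using G by simp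
    show "count (add_mset C.E N) F + card G < min (card F) n"
    proof (cases "F = C.E")
      case True
      have "card G < n - 1" using GN sub \<open>G \<noteq> C.E\<close> by (auto simp: C.L_iff)
      then have "count N C.E + card G < n - 1"
        using gap[of C.E G] GN GF True by (cases "C.E \<in># N") (simp_all add: not_in_iff)
      then show ?thesis using True cardE by simp
    next
      case False
      then have "count N F + card G < card F" "count N F + card G < n - 1"
        using F gap[of F G] GN GF by simp_all
      moreover from this(2) have "count N F + card G < n" by arith
      ultimately show ?thesis using False by simp
    qed
  qed
next
  assume fy: "B.fy (add_mset C.E N)"
  let ?M = "add_mset C.E N"
  have cnt: "count ?M F \<le> min (card F) n" if "F \<in># ?M" for F
    using fy that unfolding B.fy_def by blast
  have cmp: "F \<subseteq> G \<or> G \<subseteq> F" if "F \<in># ?M" "G \<in># ?M" for F G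
    using fy that unfolding B.fy_def by blast
  have gap: "count ?M F + card G < min (card F) n" if "F \<in># ?M" "G \<in># ?M" "G \<subset> F" for F G
    using fy that unfolding B.fy_def by blast
  have "set_mset ?M \<subseteq> Pow C.E" using fy by (simp only: B.fy_def B.L_eq)
  then have subE: "F \<subseteq> C.E" if "F \<in># N" for F
    using that by auto
  have cardE: "card C.E = n" by simp
  have small: "card F < n - 1" if "F \<in># N" "F \<noteq> C.E" for F
  proof -
    have "F \<subset> C.E" using subE that by blast
    then have "count ?M C.E + card F < n" using gap[of C.E F] that cardE by simp
    then show ?thesis by simp
  qed
  show "C.fy N"
    unfolding C.fy_def
  proof (intro conjI ballI impI)
    show "set_mset N \<subseteq> C.L"
    proof
      fix F assume "F \<in># N"
      then show "F \<in> C.L" unfolding C.L_iff using subE small by metis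
    qed
    fix F assume F: "F \<in># N"
    show "count N F \<le> min (card F) (n - 1)"
      using cnt[of F] F small[of F] cardE by (cases "F = C.E") simp_all
    fix G assume G: "G \<in># N"
    show "F \<subseteq> G \<or> G \<subseteq> F" using F G by (intro cmp) simp_all
    assume GF: "G \<subset> F"
    then show "count N F + card G < min (card F) (n - 1)"
      using gap[of F G] F G small[of F] cardE by (cases "F = C.E") simp_all
  qed
qed

lemma FY_add_top: "add_mset C.E ` C.FY d = {M \<in> B.FY (Suc d). C.E \<in># M}"
proof (intro equalityI subsetI)
  fix M assume "M \<in> {M \<in> B.FY (Suc d). C.E \<in># M}"
  then obtain N where "M = add_mset C.E N" "B.fy (add_mset C.E N)" "size N = d"
    unfolding B.FY_def by (auto dest: multi_member_split)
  then show "M \<in> add_mset C.E ` C.FY d" by (auto simp: C.FY_def fy_add_top)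
qed (auto simp: C.FY_def B.FY_def fy_add_top)

lemma inj_add_top: "inj_on (add_mset F) A"
  by (rule inj_onI) simp

text \<open>Multiplication by \<open>x\<close> of the ground set sends the monomials of the truncation to distinct
  monomials of the Boolean matroid, which are independent.\<close>

theorem C_FY_independent:
  assumes "(\<Sum>N\<in>C.FY d. pconst (c N) * C.xmono N) \<in> C.I" "N0 \<in> C.FY d"
  shows "c N0 = 0"
proof -
  \<comment> \<open>The relation, multiplied by x of the ground set and written in the monomials of the Boolean matroid.\<close>
  let ?c = "\<lambda>M. if C.E \<in># M then c (M - {#C.E#}) else 0"
  let ?S = "\<Sum>N\<in>C.FY d. pconst (c N) * C.xmono N"
  let ?D = "\<Sum>N\<in>C.FY d. pconst (c N) * (B.x C.E * C.xmono N - B.xmono (add_mset C.E N))"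
  have "?D \<in> B.I"
    by (intro B.sum B.mult top_times_xmono polys_pconst) (auto simp: C.FY_def C.fy_def)
  then have "B.x C.E * ?S - ?D \<in> B.I"
    using top_times_I[OF assms(1)] by (rule B.diff[rotated])
  moreover have "B.x C.E * ?S - ?D = (\<Sum>N\<in>C.FY d. pconst (c N) * B.xmono (add_mset C.E N))"
    by (simp add: sum_distrib_left sum_subtractf[symmetric] algebra_simps)
  moreover have "(\<Sum>N\<in>C.FY d. pconst (c N) * B.xmono (add_mset C.E N)) = (\<Sum>M\<in>add_mset C.E ` C.FY d. pconst (?c M) * B.xmono M)"
    unfolding sum.reindex[OF inj_add_top] by simp
  moreover have "(\<Sum>M\<in>add_mset C.E ` C.FY d. pconst (?c M) * B.xmono M) = (\<Sum>M\<in>B.FY (Suc d). pconst (?c M) * B.xmono M)"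
    unfolding FY_add_top by (rule sum.mono_neutral_left) auto
  ultimately have rel: "(\<Sum>M\<in>B.FY (Suc d). pconst (?c M) * B.xmono M) \<in> B.I" by simp
  have "add_mset C.E N0 \<in> B.FY (Suc d)" using FY_add_top[of d] assms(2) by blast
  from B.FY_independent[OF rel this] show ?thesis by simp
qed

theorem C_card_fixed_FY:
  assumes "\<sigma> permutes C.E"
  shows "card {N \<in> C.FY d. image_mset (image \<sigma>) N = N} =
    card (fixed_maps n (\<lambda>h. fy_levels 1 h \<and> top h = Suc d \<and> 0 \<notin># h) \<sigma>)"
proof -
  have E: "\<sigma> ` C.E = C.E" by (rule permutes_image[OF assms])
  have "add_mset C.E ` {N \<in> C.FY d. image_mset (image \<sigma>) N = N} =
      {M \<in> add_mset C.E ` C.FY d. image_mset (image \<sigma>) M = M}"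
    using E by auto
  also have "\<dots> = {M \<in> B.FY (Suc d). C.E \<in># M \<and> image_mset (image \<sigma>) M = M}"
    unfolding FY_add_top by blast
  finally have "card {N \<in> C.FY d. image_mset (image \<sigma>) N = N} =
      card {M \<in> B.FY (Suc d). C.E \<in># M \<and> image_mset (image \<sigma>) M = M}"
    using card_image[OF inj_add_top] by metis
  then show ?thesis unfolding B.card_fixed_FY(2)[OF assms] .
qed

end

section \<open>The graded character of the augmented Chow ring\<close>

text \<open>The consequences of the linear independence of the Feichtner--Yuzvinsky monomials, which together
  with \<open>homogeneous_spanned\<close> makes them a basis.\<close>

locale chow_basis = chow +
  assumes FY_indep: "(\<Sum>N\<in>FY d. pconst (c N) * xmono N) \<in> I \<Longrightarrow> N0 \<in> FY d \<Longrightarrow> c N0 = 0"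
begin

abbreviation "piece d \<equiv> aug_chow_piece E L d"

definition cls :: "(nat chow_var, rat) mpoly \<Rightarrow> (nat chow_var, rat) mpoly set" where
  "cls p = I +>\<^bsub>poly_ring V\<^esub> p"

lemma in_cls_iff: "q \<in> cls p \<longleftrightarrow> q - p \<in> I"
proof -
  have "cls p = {a + p | a. a \<in> I}"
    unfolding cls_def a_r_coset_def' poly_ring_simps by blast
  moreover have "(\<exists>a. q = a + p \<and> a \<in> I) \<longleftrightarrow> q - p \<in> I"
    by (metis add_diff_cancel_right' diff_add_cancel)
  ultimately show ?thesis by (simp only: mem_Collect_eq)
qed

lemma cls_eq_iff: "cls p = cls q \<longleftrightarrow> p - q \<in> I"
proof
  assume "cls p = cls q"
  moreover have "p \<in> cls p" by (simp add: in_cls_iff)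
  ultimately show "p - q \<in> I" by (simp add: in_cls_iff)
next
  assume pq: "p - q \<in> I"
  have "h - p \<in> I \<longleftrightarrow> h - q \<in> I" for h
    using add[of "h - p" "p - q"] diff[of "h - q" "p - q"] pq by auto
  then show "cls p = cls q" by (intro Set.set_eqI) (simp only: in_cls_iff)
qed

lemma piece_simps:
  "carrier (piece d) = {cls p | p. p \<in> P \<and> homogeneous d p}"
  "\<zero>\<^bsub>piece d\<^esub> = cls 0"
  "p \<in> P \<Longrightarrow> q \<in> P \<Longrightarrow> cls p \<oplus>\<^bsub>piece d\<^esub> cls q = cls (p + q)"
  "p \<in> P \<Longrightarrow> a \<odot>\<^bsub>piece d\<^esub> cls p = cls (pconst a * p)"
proof -
  interpret J: ideal I "poly_ring V" by (rule ideal_I)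
  show "carrier (piece d) = {cls p | p. p \<in> P \<and> homogeneous d p}"
    by (simp add: aug_chow_piece_def chow_poly_ring_eq poly_ring_simps cls_def)
  have "cls 0 = I" by (intro Set.set_eqI) (simp add: in_cls_iff)
  then show "\<zero>\<^bsub>piece d\<^esub> = cls 0"
    by (simp add: aug_chow_piece_def aug_chow_ring_def FactRing_def)
  show "cls p \<oplus>\<^bsub>piece d\<^esub> cls q = cls (p + q)" if "p \<in> P" "q \<in> P"
    using J.a_rcos_sum[of p q] that
    by (simp add: aug_chow_piece_def aug_chow_ring_def FactRing_def chow_poly_ring_eq poly_ring_simps cls_def)
  show "a \<odot>\<^bsub>piece d\<^esub> cls p = cls (pconst a * p)" if "p \<in> P"
    using J.rcoset_mult_add[of "pconst a" p] that
    by (simp add: aug_chow_piece_def aug_chow_ring_def FactRing_def chow_poly_ring_eq poly_ring_simps cls_def)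
qed

definition comb :: "nat \<Rightarrow> (nat set multiset \<Rightarrow> rat) \<Rightarrow> (nat chow_var, rat) mpoly" where
  "comb d c = (\<Sum>N\<in>FY d. pconst (c N) * xmono N)"

lemma FY_D: "N \<in> FY d \<Longrightarrow> set_mset N \<subseteq> L" "N \<in> FY d \<Longrightarrow> size N = d"
  by (simp_all add: FY_def fy_def)

lemma comb_P: "comb d c \<in> P"
  unfolding comb_def by (intro polys_sum polys_mult polys_pconst xmono_P FY_D)

lemma homogeneous_comb: "homogeneous d (comb d c)"
  unfolding comb_def
proof (rule homogeneous_sum)
  fix N assume N: "N \<in> FY d"
  show "homogeneous d (pconst (c N) * xmono N)"
    using homogeneous_mult[OF homogeneous_pconst[of "c N"] homogeneous_xmono[of N]] FY_D(2)[OF N] by simp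
qed

lemma comb_add: "comb d (\<lambda>i. c i + c' i) = comb d c + comb d c'"
  by (simp add: comb_def pconst_add distrib_right sum.distrib)

lemma comb_scale: "comb d (\<lambda>i. a * c i) = pconst a * comb d c"
  by (simp add: comb_def pconst_mult sum_distrib_left mult.assoc)

lemma comb_bij: "bij_betw (\<lambda>c. cls (comb d c)) (supported (FY d)) (carrier (piece d))"
  unfolding bij_betw_def
proof
  show "inj_on (\<lambda>c. cls (comb d c)) (supported (FY d))"
  proof (rule inj_onI)
    fix c c' assume s: "c \<in> supported (FY d)" "c' \<in> supported (FY d)" and eq: "cls (comb d c) = cls (comb d c')"
    have "comb d c = comb d (\<lambda>i. (c i - c' i) + c' i)" by simp
    also have "\<dots> = comb d (\<lambda>i. c i - c' i) + comb d c'" by (rule comb_add)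
    finally have "comb d (\<lambda>i. c i - c' i) = comb d c - comb d c'" by simp
    then have "comb d (\<lambda>i. c i - c' i) \<in> I" using eq by (simp add: cls_eq_iff)
    then have "c i - c' i = 0" if "i \<in> FY d" for i
      using FY_indep[of "\<lambda>i. c i - c' i" d i] that unfolding comb_def by blast
    then have "c i = c' i" for i
      using s by (cases "i \<in> FY d") (auto simp: supported_def)
    then show "c = c'" by (rule ext)
  qed
  show "(\<lambda>c. cls (comb d c)) ` supported (FY d) = carrier (piece d)"
  proof (intro equalityI subsetI)
    fix a assume "a \<in> (\<lambda>c. cls (comb d c)) ` supported (FY d)"
    then show "a \<in> carrier (piece d)"
      unfolding piece_simps using comb_P homogeneous_comb by blast
  next
    fix a assume "a \<in> carrier (piece d)"
    then obtain p where p: "a = cls p" "p \<in> P" "homogeneous d p" unfolding piece_simps by blast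
    then obtain c where c: "p - comb d c \<in> I"
      using homogeneous_spanned[of p d] unfolding spanned_def comb_def by blast
    let ?c = "\<lambda>i. if i \<in> FY d then c i else 0"
    have "comb d ?c = comb d c" unfolding comb_def by (intro sum.cong) simp_all
    then have "a = cls (comb d ?c)" using c unfolding p(1) cls_eq_iff by (simp only:)
    moreover have "?c \<in> supported (FY d)" by (simp add: supported_def)
    ultimately show "a \<in> (\<lambda>c. cls (comb d c)) ` supported (FY d)" by (rule image_eqI)
  qed
qed

definition coord :: "nat \<Rightarrow> (nat chow_var, rat) mpoly set \<Rightarrow> nat set multiset \<Rightarrow> rat" where
  "coord d = inv_into (supported (FY d)) (\<lambda>c. cls (comb d c))"

lemma coord_comb: "c \<in> supported (FY d) \<Longrightarrow> coord d (cls (comb d c)) = c"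
  unfolding coord_def using comb_bij[of d] by (intro inv_into_f_f) (auto simp: bij_betw_def)

lemma pieceE:
  assumes "a \<in> carrier (piece d)"
  obtains c where "c \<in> supported (FY d)" "a = cls (comb d c)"
  using assms comb_bij[of d] unfolding bij_betw_def by blast

lemma piece_coordinates: "rational_coordinates (piece d) (FY d) (coord d)"
proof unfold_locales
  show "finite (FY d)" by (rule finite_FY)
  show "bij_betw (coord d) (carrier (piece d)) (supported (FY d))"
    unfolding coord_def by (rule bij_betw_inv_into[OF comb_bij])
  have mem: "cls (comb d c) \<in> carrier (piece d)" for c
    unfolding piece_simps using comb_P homogeneous_comb by blast
  have zero: "cls 0 = cls (comb d (\<lambda>_. 0))" by (simp add: comb_def)
  show "\<zero>\<^bsub>piece d\<^esub> \<in> carrier (piece d)" unfolding piece_simps(2) zero by (rule mem)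
  have "coord d (cls (comb d (\<lambda>_. 0))) = (\<lambda>_. 0)" by (rule coord_comb) (simp add: supported_def)
  then show "coord d \<zero>\<^bsub>piece d\<^esub> i = 0" for i unfolding piece_simps(2) zero by simp
  show "a \<oplus>\<^bsub>piece d\<^esub> b \<in> carrier (piece d)" if "a \<in> carrier (piece d)" "b \<in> carrier (piece d)" for a b
    using that by (elim pieceE) (simp only: piece_simps(3)[OF comb_P comb_P] comb_add[symmetric] mem)
  show "coord d (a \<oplus>\<^bsub>piece d\<^esub> b) i = coord d a i + coord d b i"
    if "a \<in> carrier (piece d)" "b \<in> carrier (piece d)" for a b i
  proof -
    from that(1) obtain c where c1: "c \<in> supported (FY d)" "a = cls (comb d c)" by (rule pieceE)
    from that(2) obtain c' where c2: "c' \<in> supported (FY d)" "b = cls (comb d c')" by (rule pieceE)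
    note c = c1 c2
    have "coord d (cls (comb d (\<lambda>i. c i + c' i))) = (\<lambda>i. c i + c' i)"
      using c by (intro coord_comb) (simp add: supported_def)
    then show ?thesis
      unfolding c(2,4) piece_simps(3)[OF comb_P comb_P] comb_add[symmetric] coord_comb[OF c(1)] coord_comb[OF c(3)]
      by simp
  qed
  show "z \<odot>\<^bsub>piece d\<^esub> a \<in> carrier (piece d)" if "a \<in> carrier (piece d)" for a z
    using that by (elim pieceE) (simp only: piece_simps(4)[OF comb_P] comb_scale[symmetric] mem)
  show "coord d (z \<odot>\<^bsub>piece d\<^esub> a) i = z * coord d a i" if "a \<in> carrier (piece d)" for a z i
  proof -
    from that obtain c where c: "c \<in> supported (FY d)" "a = cls (comb d c)" by (rule pieceE)
    have "coord d (cls (comb d (\<lambda>i. z * c i))) = (\<lambda>i. z * c i)"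
      using c by (intro coord_comb) (simp add: supported_def)
    then show ?thesis
      unfolding c(2) piece_simps(4)[OF comb_P] comb_scale[symmetric] coord_comb[OF c(1)] by simp
  qed
qed

end

context chow
begin

context
  fixes \<sigma> assumes \<sigma>: "\<sigma> permutes E"
begin

lemma perm_flat: "F \<in> L \<Longrightarrow> \<sigma> ` F \<in> L"
proof -
  assume F: "F \<in> L"
  have "card (\<sigma> ` F) = card F" by (rule card_image[OF permutes_inj_on[OF \<sigma>]])
  moreover have "\<sigma> ` F \<subseteq> E" using F permutes_image[OF \<sigma>] unfolding L_iff by blast
  ultimately show ?thesis using F permutes_image[OF \<sigma>] unfolding L_iff by auto
qed

lemma perm_proper: "\<sigma> ` F = E \<longleftrightarrow> F = E"
  using permutes_image[OF \<sigma>] inj_image_eq_iff[OF permutes_inj[OF \<sigma>], of F E] by simp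

end

lemma inv_image_cancel:
  assumes "\<sigma> permutes E"
  shows "inv_into UNIV \<sigma> ` \<sigma> ` F = F" and "\<sigma> ` inv_into UNIV \<sigma> ` F = F"
  unfolding image_comp permutes_inv_o[OF assms] by simp_all

text \<open>Stated for a condition and its translate, so that sums over the flats that miss \<open>i\<close> can be
  reindexed.\<close>

lemma perm_flats_bij:
  assumes \<sigma>: "\<sigma> permutes E" and QR: "\<And>F. R (\<sigma> ` F) \<longleftrightarrow> Q F"
  shows "bij_betw (image \<sigma>) {F. F \<in> L - {E} \<and> Q F} {F. F \<in> L - {E} \<and> R F}"
proof (rule bij_betw_byWitness[where f' = "image (inv_into UNIV \<sigma>)"])
  note \<sigma>' = permutes_inv[OF \<sigma>]
  show "image \<sigma> ` {F. F \<in> L - {E} \<and> Q F} \<subseteq> {F. F \<in> L - {E} \<and> R F}"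
  proof (intro image_subsetI CollectI conjI DiffI)
    fix F assume F: "F \<in> {F. F \<in> L - {E} \<and> Q F}"
    then show "\<sigma> ` F \<in> L" using perm_flat[OF \<sigma>] by blast
    show "\<sigma> ` F \<notin> {E}" using F perm_proper[OF \<sigma>, of F] by blast
    show "R (\<sigma> ` F)" unfolding QR using F by blast
  qed
  show "image (inv_into UNIV \<sigma>) ` {F. F \<in> L - {E} \<and> R F} \<subseteq> {F. F \<in> L - {E} \<and> Q F}"
  proof (intro image_subsetI CollectI conjI DiffI)
    fix F assume F: "F \<in> {F. F \<in> L - {E} \<and> R F}"
    then show "inv_into UNIV \<sigma> ` F \<in> L" using perm_flat[OF \<sigma>'] by blast
    show "inv_into UNIV \<sigma> ` F \<notin> {E}" using F perm_proper[OF \<sigma>', of F] by blast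
    have "R (\<sigma> ` inv_into UNIV \<sigma> ` F)" unfolding inv_image_cancel(2)[OF \<sigma>] using F by blast
    then show "Q (inv_into UNIV \<sigma> ` F)" by (simp only: QR)
  qed
qed (simp_all only: inv_image_cancel[OF \<sigma>] ball_simps simp_thms)

lemma rename_sum_flats:
  assumes \<sigma>: "\<sigma> permutes E" and QR: "\<And>F. R (\<sigma> ` F) \<longleftrightarrow> Q F"
  shows "rename (chow_var_act \<sigma>) (\<Sum>F | F \<in> L - {E} \<and> Q F. pvar (X F) :: (nat chow_var, rat) mpoly) =
    (\<Sum>F | F \<in> L - {E} \<and> R F. pvar (X F))"
proof -
  have "bij_betw (image \<sigma>) {F. F \<in> L - {E} \<and> Q F} {F. F \<in> L - {E} \<and> R F}"
    by (rule perm_flats_bij[where R = R and Q = Q, OF assms])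
  from sum.reindex_bij_betw[OF this, of "\<lambda>F. pvar (X F)"] show ?thesis
    by (simp only: rename_sum rename_pvar chow_var_act.simps)
qed

lemma rename_x: "\<sigma> permutes E \<Longrightarrow> rename (chow_var_act \<sigma>) (x F) = x (\<sigma> ` F)"
proof -
  assume \<sigma>: "\<sigma> permutes E"
  show ?thesis
  proof (cases "F = E")
    case True
    have "rename (chow_var_act \<sigma>) (x E) = rename (chow_var_act \<sigma>) (0 - (\<Sum>G | G \<in> L - {E} \<and> True. pvar (X G)))"
      by (simp add: x_def Collect_conj_eq[symmetric] set_diff_eq)
    also have "\<dots> = 0 - (\<Sum>G | G \<in> L - {E} \<and> True. pvar (X G))"
      unfolding rename_diff rename_sum_flats[OF \<sigma>, of "\<lambda>_. True" "\<lambda>_. True", OF refl] by simp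
    also have "\<dots> = x E" by (simp add: x_def set_diff_eq)
    finally show ?thesis using True permutes_image[OF \<sigma>] by (simp only:)
  next
    case False
    then show ?thesis using perm_proper[OF \<sigma>] by (simp add: x_def)
  qed
qed

lemma rename_xmono: "\<sigma> permutes E \<Longrightarrow> rename (chow_var_act \<sigma>) (xmono N) = xmono (image_mset (image \<sigma>) N)"
proof (induction N)
  case (add F N)
  then show ?case by (simp add: xmono_add_mset rename_mult rename_x)
qed (simp add: xmono_def)

lemma rename_P: "\<sigma> permutes E \<Longrightarrow> p \<in> P \<Longrightarrow> rename (chow_var_act \<sigma>) p \<in> P"
proof -
  assume \<sigma>: "\<sigma> permutes E" and p: "p \<in> P"
  have "chow_var_act \<sigma> ` V \<subseteq> V"
  proof (rule image_subsetI)
    fix v assume "v \<in> V"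
    then consider F where "v = X F" "F \<in> L - {E}" | i where "v = Y i" "i \<in> E"
      unfolding chow_vars_def by blast
    then show "chow_var_act \<sigma> v \<in> V"
    proof cases
      case 1
      then have "\<sigma> ` F \<in> L - {E}" using perm_flat[OF \<sigma>] perm_proper[OF \<sigma>] by blast
      then show ?thesis unfolding 1 chow_var_act.simps by (rule X_in_V)
    next
      case 2
      then have "\<sigma> i \<in> E" using permutes_in_image[OF \<sigma>] by blast
      then show ?thesis unfolding 2 chow_var_act.simps by (rule Y_in_V)
    qed
  qed
  with p show ?thesis by (rule polys_rename)
qed

lemma rename_I: 
  assumes \<sigma>: "\<sigma> permutes E" and "p \<in> I"
  shows "rename (chow_var_act \<sigma>) p \<in> I"
proof -
  have flat: "\<sigma> ` F \<in> L - {E}" if "F \<in> L - {E}" for F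
    using that perm_flat[OF \<sigma>] perm_proper[OF \<sigma>] by blast
  have in_E: "\<sigma> i \<in> E \<longleftrightarrow> i \<in> E" for i by (rule permutes_in_image[OF \<sigma>])
  note inj = permutes_inj[OF \<sigma>]
  have "I \<subseteq> {p. rename (chow_var_act \<sigma>) p \<in> I}"
  proof (rule I_least)
    show "a + b \<in> {p. rename (chow_var_act \<sigma>) p \<in> I}"
      if "a \<in> {p. rename (chow_var_act \<sigma>) p \<in> I}" "b \<in> {p. rename (chow_var_act \<sigma>) p \<in> I}" for a b
      using that by (simp add: rename_add add)
    show "p * a \<in> {p. rename (chow_var_act \<sigma>) p \<in> I}"
      if "p \<in> P" "a \<in> {p. rename (chow_var_act \<sigma>) p \<in> I}" for p a
      using that rename_P[OF \<sigma>] by (simp add: rename_mult mult)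
    show "gens \<subseteq> {p. rename (chow_var_act \<sigma>) p \<in> I}"
    proof (intro subsetI CollectI)
      fix g assume "g \<in> gens"
      then consider
        F G where "F \<in> L - {E}" "G \<in> L - {E}" "\<not> F \<subseteq> G" "\<not> G \<subseteq> F" "g = pvar (X F) * pvar (X G)"
        | i F where "i \<in> E" "F \<in> L - {E}" "i \<notin> F" "g = pvar (Y i) * pvar (X F)"
        | i where "i \<in> E" "g = pvar (Y i) - (\<Sum>F | F \<in> L - {E} \<and> i \<notin> F. pvar (X F))"
        unfolding gens_def by blast
      then have "rename (chow_var_act \<sigma>) g \<in> gens"
      proof cases
        case 1
        have "\<not> \<sigma> ` F \<subseteq> \<sigma> ` G" "\<not> \<sigma> ` G \<subseteq> \<sigma> ` F"
          using 1(3,4) unfolding inj_image_subset_iff[OF inj] by blast+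
        moreover have "rename (chow_var_act \<sigma>) g = pvar (X (\<sigma> ` F)) * pvar (X (\<sigma> ` G))"
          unfolding 1(5) by (simp add: rename_mult)
        ultimately show ?thesis using flat[OF 1(1)] flat[OF 1(2)] unfolding gens_def by blast
      next
        case 2
        have "\<sigma> i \<notin> \<sigma> ` F" using 2(3) unfolding inj_image_mem_iff[OF inj] .
        moreover have "\<sigma> i \<in> E" using 2(1) in_E by blast
        moreover have "rename (chow_var_act \<sigma>) g = pvar (Y (\<sigma> i)) * pvar (X (\<sigma> ` F))"
          unfolding 2(4) by (simp add: rename_mult)
        ultimately show ?thesis using flat[OF 2(2)] unfolding gens_def by blast
      next
        case 3
        have "\<sigma> i \<in> E" using 3(1) in_E by blast
        moreover have "rename (chow_var_act \<sigma>) g = pvar (Y (\<sigma> i)) - (\<Sum>F | F \<in> L - {E} \<and> \<sigma> i \<notin> F. pvar (X F))"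
          unfolding 3(2) rename_diff
          by (subst rename_sum_flats[OF \<sigma>, where R = "\<lambda>F. \<sigma> i \<notin> F"]) (simp_all add: inj_image_mem_iff[OF inj])
        ultimately show ?thesis unfolding gens_def by blast
      qed
      then show "rename (chow_var_act \<sigma>) g \<in> I" using gens_I by blast
    qed
  qed simp
  then show ?thesis using assms(2) by blast
qed

lemma fy_image:
  assumes \<sigma>: "\<sigma> permutes E" and N: "fy N"
  shows "fy (image_mset (image \<sigma>) N)"
proof -
  note inj = permutes_inj[OF \<sigma>]
  have cnt: "count (image_mset (image \<sigma>) N) (\<sigma> ` F) = count N F" for F
  proof (induction N)
    case (add G N)
    then show ?case using inj_image_eq_iff[OF inj, of G F] by simp
  qed simp
  have card: "card (\<sigma> ` F) = card F" for F by (rule card_image[OF permutes_inj_on[OF \<sigma>]])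
  show ?thesis
    unfolding fy_def set_image_mset
  proof (intro conjI ballI impI)
    show "image \<sigma> ` set_mset N \<subseteq> L" using N perm_flat[OF \<sigma>] unfolding fy_def by blast
    fix F' assume "F' \<in> image \<sigma> ` set_mset N"
    then obtain F where F: "F' = \<sigma> ` F" "F \<in># N" by (rule imageE)
    then show "count (image_mset (image \<sigma>) N) F' \<le> min (card F') r"
      using N unfolding F(1) cnt card fy_def by blast
    fix G' assume "G' \<in> image \<sigma> ` set_mset N"
    then obtain G where G: "G' = \<sigma> ` G" "G \<in># N" by (rule imageE)
    show "F' \<subseteq> G' \<or> G' \<subseteq> F'"
      using N F(2) G(2) unfolding F(1) G(1) inj_image_subset_iff[OF inj] fy_def by blast
    assume "G' \<subset> F'"
    then have "G \<subset> F"
      unfolding F(1) G(1) psubset_eq inj_image_subset_iff[OF inj] inj_image_eq_iff[OF inj] .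
    then show "count (image_mset (image \<sigma>) N) F' + card G' < min (card F') r"
      using N F(2) G(2) unfolding F(1) G(1) cnt card fy_def by blast
  qed
qed

lemma image_mset_inv_cancel:
  assumes "\<sigma> permutes E"
  shows "image_mset (image (inv_into UNIV \<sigma>)) (image_mset (image \<sigma>) N) = N"
    and "image_mset (image \<sigma>) (image_mset (image (inv_into UNIV \<sigma>)) N) = N"
  by (simp_all only: multiset.map_comp comp_def inv_image_cancel[OF assms] multiset.map_ident)

lemma FY_perm_bij:
  assumes \<sigma>: "\<sigma> permutes E"
  shows "bij_betw (image_mset (image \<sigma>)) (FY d) (FY d)"
proof (rule bij_betw_byWitness[where f' = "image_mset (image (inv_into UNIV \<sigma>))"])
  show "image_mset (image \<sigma>) ` FY d \<subseteq> FY d"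
    using fy_image[OF \<sigma>] by (auto simp: FY_def)
  show "image_mset (image (inv_into UNIV \<sigma>)) ` FY d \<subseteq> FY d"
    using fy_image[OF permutes_inv[OF \<sigma>]] by (auto simp: FY_def)
qed (use image_mset_inv_cancel[OF \<sigma>] in blast)+

end

context chow_basis
begin

lemma act_cls:
  assumes \<sigma>: "\<sigma> permutes E"
  shows "aug_chow_act E L \<sigma> (cls p) = cls (rename (chow_var_act \<sigma>) p)"
proof -
  have same: "cls (rename (chow_var_act \<sigma>) q) = cls (rename (chow_var_act \<sigma>) p)" if "q \<in> cls p" for q
  proof -
    have "rename (chow_var_act \<sigma>) (q - p) \<in> I"
      using that unfolding in_cls_iff by (rule rename_I[OF \<sigma>])
    then show ?thesis unfolding cls_eq_iff rename_diff .
  qed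
  have "p \<in> cls p" unfolding in_cls_iff by simp
  then have "cls p \<noteq> {}" by blast
  then have "(\<Union>q\<in>cls p. cls (rename (chow_var_act \<sigma>) q)) = cls (rename (chow_var_act \<sigma>) p)"
    by (rule SUP_eq_const) (rule same)
  then show ?thesis
    unfolding aug_chow_act_def chow_poly_ring_eq cls_def .
qed

text \<open>The group permutes the Feichtner--Yuzvinsky monomials.\<close>

theorem trace_act:
  assumes \<sigma>: "\<sigma> permutes E"
  shows "module_trace (complexify (piece d)) (complexify_map (piece d) (aug_chow_act E L \<sigma>)) =
    of_nat (card {N \<in> FY d. image_mset (image \<sigma>) N = N})"
proof -
  interpret R: rational_coordinates "piece d" "FY d" "coord d" by (rule piece_coordinates)
  note \<sigma>' = permutes_inv[OF \<sigma>]
  let ?p = "image_mset (image \<sigma>)" and ?q = "image_mset (image (inv_into UNIV \<sigma>))"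
  have act_comb: "aug_chow_act E L \<sigma> (cls (comb d c)) = cls (comb d (\<lambda>M. c (?q M)))" for c
  proof -
    have "rename (chow_var_act \<sigma>) (comb d c) = (\<Sum>N\<in>FY d. pconst (c N) * xmono (?p N))"
      unfolding comb_def rename_sum by (simp add: rename_mult rename_xmono[OF \<sigma>])
    also have "\<dots> = (\<Sum>N\<in>FY d. pconst (c (?q (?p N))) * xmono (?p N))"
      by (simp only: image_mset_inv_cancel[OF \<sigma>])
    also have "\<dots> = comb d (\<lambda>M. c (?q M))"
      unfolding comb_def by (rule sum.reindex_bij_betw[OF FY_perm_bij[OF \<sigma>]])
    finally show ?thesis unfolding act_cls[OF \<sigma>] by simp
  qed
  have q_FY: "M \<in> FY d" if "?q M \<in> FY d" for M
  proof -
    have "?p (?q M) \<in> FY d" using bij_betwE[OF FY_perm_bij[OF \<sigma>]] that by (rule bspec)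
    then show ?thesis unfolding image_mset_inv_cancel(2)[OF \<sigma>] .
  qed
  have supp: "(\<lambda>M. c (?q M)) \<in> supported (FY d)" if "c \<in> supported (FY d)" for c :: "_ \<Rightarrow> rat"
    using that q_FY unfolding supported_def by blast
  show ?thesis
  proof (rule R.trace_complexify_permuted[OF _ FY_perm_bij[OF \<sigma>]])
    fix a assume "a \<in> carrier (piece d)"
    then obtain c where c: "c \<in> supported (FY d)" "a = cls (comb d c)" by (elim pieceE)
    show "aug_chow_act E L \<sigma> a \<in> carrier (piece d)"
      unfolding c(2) act_comb piece_simps using comb_P homogeneous_comb by blast
    fix N assume "N \<in> FY d"
    show "coord d (aug_chow_act E L \<sigma> a) (?p N) = coord d a N"
      unfolding c(2) act_comb coord_comb[OF c(1)] coord_comb[OF supp[OF c(1)]]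
      by (simp only: image_mset_inv_cancel[OF \<sigma>])
  qed
qed

lemma nth_aug_chow_frob:
  assumes "\<And>\<sigma>. \<sigma> permutes E \<Longrightarrow> card {N \<in> FY d. image_mset (image \<sigma>) N = N} = card (fixed_maps n Q \<sigma>)"
  shows "fps_nth (aug_chow_frob r n) d = frobenius_ch n (\<lambda>\<sigma>. of_nat (card (fixed_maps n Q \<sigma>)))"
  unfolding aug_chow_frob_def gr_frob_def fps_nth_Abs_fps frobenius_ch_def
  by (intro sum.cong refl) (simp add: trace_act assms)

end

section \<open>The graded Frobenius characteristics\<close>

lemma top_ge_member: "top h = d \<Longrightarrow> v \<in># h \<Longrightarrow> v \<le> d"
  using top_ge by blast

theorem corollary1p9:
  fixes n :: nat
  assumes "n \<ge> 1"
  shows "aug_chow_frob n n = eulerian_Q_tilde n \<and>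
         (n \<ge> 2 \<longrightarrow> aug_chow_frob (n - 1) n = eulerian_Q n)"
proof (intro conjI impI)
  interpret B: boolean_chow n using assms by unfold_locales simp_all
  interpret chow_basis n n by unfold_locales (rule B.FY_independent)
  show "aug_chow_frob n n = eulerian_Q_tilde n"
  proof (rule fps_ext, rule mfps_eqI)
    fix d and m :: "nat multiset"
    have eq: "{M. image_mset fst M = m \<and> fy_levels 1 (image_mset snd M) \<and> height M = d} = {M \<in> labelled 1 m. height M = d}"
      by (simp only: labelled_def mem_Collect_eq conj_assoc)
    have frob: "fps_nth (aug_chow_frob n n) d =
        frobenius_ch n (\<lambda>\<sigma>. of_nat (card (fixed_maps n (\<lambda>h. fy_levels 1 h \<and> top h = d) \<sigma>)))"
      by (rule nth_aug_chow_frob) (rule B.card_fixed_FY(1))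
    have "mfps_nth (fps_nth (aug_chow_frob n n) d) m =
        (if size m = n then of_nat (card {M \<in> labelled 1 m. height M = d}) else 0)"
      unfolding frob eq[symmetric]
    proof (rule nth_frobenius_ch_levels)
      show "v \<le> d" if "fy_levels 1 h \<and> top h = d" "v \<in># h" for h v
        using that top_ge_member by blast
      show "finite {M. image_mset fst M = m \<and> fy_levels 1 (image_mset snd M) \<and> height M = d}"
        unfolding eq by (rule finite_subset[OF _ finite_labelled[of 1 m]]) blast
    qed
    then show "mfps_nth (fps_nth (aug_chow_frob n n) d) m = mfps_nth (fps_nth (eulerian_Q_tilde n) d) m"
      by (simp only: nth_eulerian_Q_tilde_card)
  qed
next
  assume "2 \<le> n"
  then interpret T: truncated_chow n by unfold_locales
  interpret chow_basis n "n - 1" by unfold_locales (rule T.C_FY_independent)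
  show "aug_chow_frob (n - 1) n = eulerian_Q n"
  proof (rule fps_ext, rule mfps_eqI)
    fix d and m :: "nat multiset"
    have eq: "{M. image_mset fst M = m \<and> fy_levels 1 (image_mset snd M) \<and> height M = Suc d \<and> 0 \<notin># image_mset snd M} =
        {M \<in> labelled_pos 1 m. height M = Suc d}"
      unfolding labelled_pos_def labelled_def by blast
    have frob: "fps_nth (aug_chow_frob (n - 1) n) d =
        frobenius_ch n (\<lambda>\<sigma>. of_nat (card (fixed_maps n (\<lambda>h. fy_levels 1 h \<and> top h = Suc d \<and> 0 \<notin># h) \<sigma>)))"
      by (rule nth_aug_chow_frob) (rule T.C_card_fixed_FY)
    have "mfps_nth (fps_nth (aug_chow_frob (n - 1) n) d) m =
        (if size m = n then of_nat (card {M \<in> labelled_pos 1 m. height M = Suc d}) else 0)"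
      unfolding frob eq[symmetric]
    proof (rule nth_frobenius_ch_levels)
      show "v \<le> Suc d" if "fy_levels 1 h \<and> top h = Suc d \<and> 0 \<notin># h" "v \<in># h" for h v
        using that top_ge_member by blast
      show "finite {M. image_mset fst M = m \<and> fy_levels 1 (image_mset snd M) \<and> height M = Suc d \<and> 0 \<notin># image_mset snd M}"
        unfolding eq by (rule finite_subset[OF _ finite_labelled_pos[of 1 m]]) blast
    qed
    then show "mfps_nth (fps_nth (aug_chow_frob (n - 1) n) d) m = mfps_nth (fps_nth (eulerian_Q n) d) m"
      by (simp only: nth_eulerian_Q_card[OF assms])
  qed
qed

end
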